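(* Let $X=\{0,1,\dots,n\}$. If $A$ and $B$ are chosen independently and uniformly at random from $\mathcal{B}(X)$, then for any $\chi\in\{TBR,SPR,rSPR\}$, $$\mathbb{E}[d_\chi(A,B)] = n - \Theta(n^{2/3})$$ as $n\to\infty$.
   Context: For a finite set $X$ with $|X|>1$, a binary leaf-labelled tree with label set $X$ is a finite tree whose vertices are either tree vertices of degree $3$ or leaves of degree $1$, the leaves being in bijection with $X$ (their labels). $\mathcal{B}(X)$ denotes the set of all such trees up to label-preserving graph isomorphism. The leaf labelled $0$ is called the root. A TBR move on $T\in\mathcal{B}(X)$: delete an edge of $T$ and suppress all resulting degree-$2$ vertices, obtaining two binary trees $T_1,T_2$; then join them by a new edge between the midpoint of an edge of $T_1$ and the midpoint of an edge of $T_2$ (if one of them is a single vertex, the new edge is incident to that vertex). An SPR move taking $xy$ from $ab$ to $cd$ can be performed when $xy, ax, xb, cd$ are distinct edges (vertices $a,b,c,d$ need not be distinct) and the path from $c$ to $y$ contains $x$: delete $ax, xb$, add $ab$; then delete $cd$, add $cx, xd$. It is an rSPR move if moreover the path from the leaf $0$ to $y$ passes through $x$. $d_\chi(A,B)$ is the minimum number of $\chi$ moves needed to transform $A$ into $B$. *)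

theory Defs
  imports "HOL-Probability.Probability" "HOL-Library.Landau_Symbols"
begin

record 'v graph =
  verts :: "'v set"
  edges :: "'v set set"

definition simple_graph :: "'v graph \<Rightarrow> bool" where
  "simple_graph G \<longleftrightarrow>
     finite (verts G) \<and> (\<forall>e\<in>edges G. e \<subseteq> verts G \<and> card e = 2)"

definition nbrs :: "'v graph \<Rightarrow> 'v \<Rightarrow> 'v set" where
  "nbrs G v = {u. {u, v} \<in> edges G}"

definition deg :: "'v graph \<Rightarrow> 'v \<Rightarrow> nat" where
  "deg G v = card (nbrs G v)"

definition gpath :: "'v graph \<Rightarrow> 'v list \<Rightarrow> bool" where
  "gpath G p \<longleftrightarrow> p \<noteq> [] \<and> distinct p \<and> set p \<subseteq> verts G \<and>
     (\<forall>i. Suc i < length p \<longrightarrow> {p ! i, p ! Suc i} \<in> edges G)"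

definition path_between :: "'v graph \<Rightarrow> 'v \<Rightarrow> 'v list \<Rightarrow> 'v \<Rightarrow> bool" where
  "path_between G u p v \<longleftrightarrow> gpath G p \<and> hd p = u \<and> last p = v"

definition joined :: "'v graph \<Rightarrow> 'v \<Rightarrow> 'v \<Rightarrow> bool" where
  "joined G u v \<longleftrightarrow> (\<exists>p. path_between G u p v)"

definition graph_cycle :: "'v graph \<Rightarrow> 'v list \<Rightarrow> bool" where
  "graph_cycle G p \<longleftrightarrow> gpath G p \<and> 3 \<le> length p \<and> {last p, hd p} \<in> edges G"

definition tree :: "'v graph \<Rightarrow> bool" where
  "tree G \<longleftrightarrow> simple_graph G \<and> verts G \<noteq> {} \<and>
     (\<forall>u\<in>verts G. \<forall>v\<in>verts G. joined G u v) \<and> (\<nexists>p. graph_cycle G p)"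

definition comps :: "'v graph \<Rightarrow> 'v set set" where
  "comps G = (\<lambda>v. {u \<in> verts G. joined G v u}) ` verts G"

definition induced :: "'v graph \<Rightarrow> 'v set \<Rightarrow> 'v graph" where
  "induced G C = \<lparr>verts = C, edges = {e \<in> edges G. e \<subseteq> C}\<rparr>"

text \<open>A leaf-labelled tree is a graph together with the map sending each label to the
  leaf that carries it; only the values on the label set matter. Taking the vertices in
  \<^typ>\<open>nat\<close> loses no isomorphism class, since the trees are finite.\<close>

type_synonym ltree = "nat graph \<times> (nat \<Rightarrow> nat)"

definition binary_ltree :: "nat set \<Rightarrow> ltree \<Rightarrow> bool" where
  "binary_ltree X = (\<lambda>(G, l). finite X \<and> 1 < card X \<and> tree G \<and>
     (\<forall>v\<in>verts G. deg G v = 3 \<or> deg G v = 1) \<and>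
     bij_betw l X {v \<in> verts G. deg G v = 1})"

definition ltree_iso :: "nat set \<Rightarrow> ltree \<Rightarrow> ltree \<Rightarrow> bool" where
  "ltree_iso X = (\<lambda>(G, l) (G', l'). \<exists>f. bij_betw f (verts G) (verts G') \<and>
     (\<forall>u\<in>verts G. \<forall>v\<in>verts G. {u, v} \<in> edges G \<longleftrightarrow> {f u, f v} \<in> edges G') \<and>
     (\<forall>x\<in>X. f (l x) = l' x))"

definition iso_rel :: "nat set \<Rightarrow> (ltree \<times> ltree) set" where
  "iso_rel X = {(S, T). binary_ltree X S \<and> binary_ltree X T \<and> ltree_iso X S T}"

definition BT :: "nat set \<Rightarrow> ltree set set" where
  "BT X = {T. binary_ltree X T} // iso_rel X"

definition delete_edge :: "'v set \<Rightarrow> 'v graph \<Rightarrow> 'v graph" where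
  "delete_edge e G = G\<lparr>edges := edges G - {e}\<rparr>"

definition add_edge :: "'v set \<Rightarrow> 'v graph \<Rightarrow> 'v graph" where
  "add_edge e G = G\<lparr>edges := insert e (edges G)\<rparr>"

text \<open>Meant for \<^term>\<open>w\<close> of degree 2, so that \<^term>\<open>nbrs G w\<close> is the new edge.\<close>

definition suppress :: "'v \<Rightarrow> 'v graph \<Rightarrow> 'v graph" where
  "suppress w G = \<lparr>verts = verts G - {w},
     edges = insert (nbrs G w) {e \<in> edges G. w \<notin> e}\<rparr>"

inductive suppress_all :: "'v graph \<Rightarrow> 'v graph \<Rightarrow> bool" where
  suppress_done: "\<forall>w\<in>verts G. deg G w \<noteq> 2 \<Longrightarrow> suppress_all G G"
| suppress_step: "w \<in> verts G \<Longrightarrow> deg G w = 2 \<Longrightarrow> suppress_all (suppress w G) H \<Longrightarrow>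
    suppress_all G H"

text \<open>\<^term>\<open>K\<close> is \<^term>\<open>T\<close> with an attachment point \<^term>\<open>p\<close> made available: the only vertex
  of \<^term>\<open>T\<close>, or a new vertex that is the midpoint of an edge of \<^term>\<open>T\<close>.\<close>

inductive attachment :: "'v graph \<Rightarrow> 'v \<Rightarrow> 'v graph \<Rightarrow> bool" where
  attach_single: "verts T = {p} \<Longrightarrow> attachment T p T"
| attach_midpoint: "{c, d} \<in> edges T \<Longrightarrow> p \<notin> verts T \<Longrightarrow>
    attachment T p \<lparr>verts = insert p (verts T),
      edges = (edges T - {{c, d}}) \<union> {{c, p}, {p, d}}\<rparr>"

definition TBR_graph :: "'v graph \<Rightarrow> 'v graph \<Rightarrow> bool" where
  "TBR_graph G G' \<longleftrightarrow> (\<exists>e H C\<^sub>1 C\<^sub>2 p K\<^sub>1 q K\<^sub>2.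
     e \<in> edges G \<and> suppress_all (delete_edge e G) H \<and>
     comps H = {C\<^sub>1, C\<^sub>2} \<and> C\<^sub>1 \<noteq> C\<^sub>2 \<and>
     attachment (induced H C\<^sub>1) p K\<^sub>1 \<and> attachment (induced H C\<^sub>2) q K\<^sub>2 \<and>
     verts K\<^sub>1 \<inter> verts K\<^sub>2 = {} \<and>
     G' = \<lparr>verts = verts K\<^sub>1 \<union> verts K\<^sub>2, edges = insert {p, q} (edges K\<^sub>1 \<union> edges K\<^sub>2)\<rparr>)"

definition SPR_allowed :: "'v graph \<Rightarrow> 'v \<Rightarrow> 'v \<Rightarrow> 'v \<Rightarrow> 'v \<Rightarrow> 'v \<Rightarrow> 'v \<Rightarrow> bool" where
  "SPR_allowed G x y a b c d \<longleftrightarrow>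
     {{x, y}, {a, x}, {x, b}, {c, d}} \<subseteq> edges G \<and>
     distinct [{x, y}, {a, x}, {x, b}, {c, d}] \<and>
     (\<exists>p. path_between G c p y \<and> x \<in> set p)"

text \<open>The operations are performed in the order in which they are listed, the innermost
  first: if the edge cd meets a or b, a deleted edge is added again.\<close>

definition SPR_result :: "'v graph \<Rightarrow> 'v \<Rightarrow> 'v \<Rightarrow> 'v \<Rightarrow> 'v \<Rightarrow> 'v \<Rightarrow> 'v graph" where
  "SPR_result G x a b c d =
     add_edge {x, d} (add_edge {c, x} (delete_edge {c, d}
       (add_edge {a, b} (delete_edge {x, b} (delete_edge {a, x} G)))))"

datatype move_kind = TBR | SPR | rSPR

fun ltree_move :: "move_kind \<Rightarrow> ltree \<Rightarrow> ltree \<Rightarrow> bool" where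
  "ltree_move TBR (G, l) (G', l') \<longleftrightarrow> l' = l \<and> TBR_graph G G'"
| "ltree_move SPR (G, l) (G', l') \<longleftrightarrow> l' = l \<and>
     (\<exists>x y a b c d. SPR_allowed G x y a b c d \<and> G' = SPR_result G x a b c d)"
| "ltree_move rSPR (G, l) (G', l') \<longleftrightarrow> l' = l \<and>
     (\<exists>x y a b c d. SPR_allowed G x y a b c d \<and>
        (\<exists>p. path_between G (l 0) p y \<and> x \<in> set p) \<and> G' = SPR_result G x a b c d)"

definition move_rel :: "move_kind \<Rightarrow> nat set \<Rightarrow> (ltree set \<times> ltree set) set" where
  "move_rel \<kappa> X = {(A, B). A \<in> BT X \<and> B \<in> BT X \<and> (\<exists>S\<in>A. \<exists>T\<in>B. ltree_move \<kappa> S T)}"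

definition move_dist :: "move_kind \<Rightarrow> nat set \<Rightarrow> ltree set \<Rightarrow> ltree set \<Rightarrow> nat" where
  "move_dist \<kappa> X A B = (LEAST k. (A, B) \<in> move_rel \<kappa> X ^^ k)"

end

theory Submission
  imports Defs "HOL-Combinatorics.Permutations"
begin

text \<open>
  Root every tree at the leaf 0 and replace it by its clusters, the sets of labels below its
  edges. Call a set of disjoint pairs of labels compatible with a tree if every cluster separates
  at most one pair, that is, if the paths joining the pairs are disjoint.

  Lower bound. Every even set of labels has exactly one compatible pairing of its elements. A move
  deletes one edge, and the pairing of a set survives if that edge has an even number of elements
  of the set below it. So after k moves the sets whose pairings in both trees agree contain a
  binary vector space of codimension about k, and such a space of dimension d has a member with at
  least d/2 elements. Hence a distance below n - 4m forces m pairs that are compatible with both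
  trees. Since a pairing is determined by the set it covers, a random relabelling has a common
  pairing of m pairs with probability at most (n choose 2m) divided by the number of pairings of
  2m labels, which is tiny once m exceeds a constant times the 2/3 power of n.

  Upper bound. Cut both trees into disjoint subtrees carrying r labels each, where r is a small
  constant times the cube root of n. By the second moment method a random relabelling gives on
  average at least a constant times r squared pairs of labels that lie in a common piece of both
  trees, no two of them sharing a piece. These pairs are compatible with both trees, and s such
  pairs give an agreement forest with n + 1 - s components; attaching its components one by one
  to the component of the root takes at most n - s moves.
\<close>

section \<open>Binary hierarchies\<close>

inductive binary_hierarchy :: "'a set \<Rightarrow> 'a set set \<Rightarrow> bool" where
  hierarchy_single: "binary_hierarchy {x} {{x}}"
| hierarchy_join: "binary_hierarchy A C \<Longrightarrow> binary_hierarchy B D \<Longrightarrow> A \<inter> B = {} \<Longrightarrow> binary_hierarchy (A \<union> B) (insert (A \<union> B) (C \<union> D))"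

lemma hierarchy_top: "binary_hierarchy A C \<Longrightarrow> A \<in> C"
  by (induction rule: binary_hierarchy.induct) auto

lemma hierarchy_subset: "binary_hierarchy A C \<Longrightarrow> c \<in> C \<Longrightarrow> c \<subseteq> A"
  by (induction arbitrary: c rule: binary_hierarchy.induct) auto

lemma hierarchy_nonempty: "binary_hierarchy A C \<Longrightarrow> c \<in> C \<Longrightarrow> c \<noteq> {}"
  by (induction arbitrary: c rule: binary_hierarchy.induct) (auto dest: hierarchy_top)

lemma hierarchy_finite: "binary_hierarchy A C \<Longrightarrow> finite A"
  by (induction rule: binary_hierarchy.induct) auto

lemma hierarchy_finite_family: "binary_hierarchy A C \<Longrightarrow> finite C"
  by (induction rule: binary_hierarchy.induct) auto

lemma hierarchy_singleton: "binary_hierarchy A C \<Longrightarrow> x \<in> A \<Longrightarrow> {x} \<in> C"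
  by (induction rule: binary_hierarchy.induct) auto

lemma hierarchy_laminar: "binary_hierarchy A C \<Longrightarrow> c \<in> C \<Longrightarrow> d \<in> C \<Longrightarrow> c \<subseteq> d \<or> d \<subseteq> c \<or> c \<inter> d = {}"
proof (induction arbitrary: c d rule: binary_hierarchy.induct)
  case (hierarchy_join A C B D)
  have CA: "\<And>x. x \<in> C \<Longrightarrow> x \<subseteq> A" and DB: "\<And>x. x \<in> D \<Longrightarrow> x \<subseteq> B"
    using hierarchy_subset hierarchy_join.hyps by blast+
  consider "c = A \<union> B \<or> d = A \<union> B" | "c \<in> C" "d \<in> C" | "c \<in> D" "d \<in> D"
    | "c \<in> C" "d \<in> D" | "c \<in> D" "d \<in> C" using hierarchy_join.prems by blast
  then show ?case
  proof cases
    case 1 then show ?thesis using hierarchy_join.prems CA DB by blast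
  next
    case 2 then show ?thesis using hierarchy_join.IH(1) by blast
  next
    case 3 then show ?thesis using hierarchy_join.IH(2) by blast
  next
    case 4 then show ?thesis using CA DB hierarchy_join.hyps(3) by blast
  next
    case 5 then show ?thesis using CA DB hierarchy_join.hyps(3) by blast
  qed
qed auto

lemma hierarchy_children:
  "binary_hierarchy A C \<Longrightarrow> c \<in> C \<Longrightarrow>
    (\<exists>x. c = {x}) \<or> (\<exists>c1\<in>C. \<exists>c2\<in>C. c = c1 \<union> c2 \<and> c1 \<inter> c2 = {} \<and> c1 \<noteq> {} \<and> c2 \<noteq> {})"
proof (induction arbitrary: c rule: binary_hierarchy.induct)
  case (hierarchy_join A C B D)
  have AB: "A \<in> C" "B \<in> D" "A \<noteq> {}" "B \<noteq> {}"
    using hierarchy_top hierarchy_nonempty hierarchy_join.hyps by blast+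
  consider "c = A \<union> B" | "c \<in> C" | "c \<in> D" using hierarchy_join.prems by blast
  then show ?case
  proof cases
    case 1 then show ?thesis using AB hierarchy_join.hyps(3) by blast
  next
    case 2
    then show ?thesis using hierarchy_join.IH(1)[OF 2] by blast
  next
    case 3
    then show ?thesis using hierarchy_join.IH(2)[OF 3] by blast
  qed
qed auto

definition splits :: "'a set \<Rightarrow> 'a set \<Rightarrow> bool" where
  "splits c K \<longleftrightarrow> c \<inter> K \<noteq> {} \<and> \<not> K \<subseteq> c"

definition compatible :: "'a set set \<Rightarrow> 'a set set \<Rightarrow> bool" where
  "compatible C \<K> \<longleftrightarrow> (\<forall>c\<in>C. \<forall>K\<in>\<K>. \<forall>K'\<in>\<K>. splits c K \<longrightarrow> splits c K' \<longrightarrow> K = K')"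

definition pairing :: "'a set set \<Rightarrow> bool" where
  "pairing P \<longleftrightarrow> (\<forall>p\<in>P. card p = 2) \<and> disjoint P"

lemma pairing_exists:
  assumes "binary_hierarchy A C" "S \<subseteq> A"
  shows "\<exists>P. pairing P \<and> compatible C P \<and>
    (if even (card S) then \<Union>P = S
     else \<exists>z\<in>S. \<Union>P = S - {z} \<and> (\<forall>c\<in>C. z \<in> c \<longrightarrow> (\<forall>p\<in>P. \<not> splits c p)))"
  using assms
proof (induction arbitrary: S rule: binary_hierarchy.induct)
  case (hierarchy_single x)
  then consider "S = {}" | "S = {x}" by blast
  then show ?case
    by cases (auto intro!: exI[of _ "{}"] simp: pairing_def compatible_def disjoint_def)
next
  case (hierarchy_join A C B D)
  note AB = hierarchy_join.hyps
  have fin: "finite A" "finite B" using hierarchy_finite AB by blast+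
  have CA: "\<And>c. c \<in> C \<Longrightarrow> c \<subseteq> A" and DB: "\<And>c. c \<in> D \<Longrightarrow> c \<subseteq> B"
    using hierarchy_subset AB by blast+
  let ?S1 = "S \<inter> A" and ?S2 = "S \<inter> B"
  have S: "S = ?S1 \<union> ?S2" "?S1 \<inter> ?S2 = {}" using hierarchy_join.prems AB by blast+
  have cardS: "card S = card ?S1 + card ?S2"
    by (subst S(1), rule card_Un_disjoint) (use fin S(2) in auto)
  obtain P1 where P1: "pairing P1" "compatible C P1"
    "if even (card ?S1) then \<Union>P1 = ?S1
     else \<exists>z\<in>?S1. \<Union>P1 = ?S1 - {z} \<and> (\<forall>c\<in>C. z \<in> c \<longrightarrow> (\<forall>p\<in>P1. \<not> splits c p))"
    using hierarchy_join.IH(1)[of ?S1] by blast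
  obtain P2 where P2: "pairing P2" "compatible D P2"
    "if even (card ?S2) then \<Union>P2 = ?S2
     else \<exists>z\<in>?S2. \<Union>P2 = ?S2 - {z} \<and> (\<forall>c\<in>D. z \<in> c \<longrightarrow> (\<forall>p\<in>P2. \<not> splits c p))"
    using hierarchy_join.IH(2)[of ?S2] by blast
  have sub1: "\<Union>P1 \<subseteq> ?S1" using P1(3) by (auto split: if_splits)
  have sub2: "\<Union>P2 \<subseteq> ?S2" using P2(3) by (auto split: if_splits)
  have pr: "pairing (P1 \<union> P2)"
  proof -
    have "p \<inter> q = {}" if "p \<in> P1" "q \<in> P2" for p q using that sub1 sub2 S(2) by blast
    then show ?thesis using P1(1) P2(1) unfolding pairing_def disjoint_def by (metis Int_commute UnE)
  qed
  have nC: "\<not> splits c p" if "c \<in> C" "p \<in> P2" for c p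
    using that CA sub2 AB(3) unfolding splits_def by blast
  have nD: "\<not> splits c p" if "c \<in> D" "p \<in> P1" for c p
    using that DB sub1 AB(3) unfolding splits_def by blast
  have nT: "\<not> splits (A \<union> B) p" if "p \<in> P1 \<union> P2" for p
    using that sub1 sub2 unfolding splits_def by blast
  have cp: "compatible (insert (A \<union> B) (C \<union> D)) (P1 \<union> P2)"
    using P1(2) P2(2) nC nD nT unfolding compatible_def by blast
  show ?case
  proof (cases "even (card ?S1) \<or> even (card ?S2)")
    case True
    then consider "even (card ?S1)" "even (card ?S2)" | "odd (card ?S1)" "even (card ?S2)"
      | "even (card ?S1)" "odd (card ?S2)" by blast
    then show ?thesis
    proof cases
      case 1
      then have "\<Union>(P1 \<union> P2) = S" "even (card S)" using P1(3) P2(3) S(1) cardS by auto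
      then show ?thesis using pr cp by auto
    next
      case 2
      then obtain z where z: "z \<in> ?S1" "\<Union>P1 = ?S1 - {z}"
        "\<forall>c\<in>C. z \<in> c \<longrightarrow> (\<forall>p\<in>P1. \<not> splits c p)" using P1(3) by auto
      have "odd (card S)" using 2 cardS by simp
      moreover have "\<Union>(P1 \<union> P2) = S - {z}" using 2 P2(3) z(1,2) S by auto
      moreover have "\<forall>c\<in>insert (A \<union> B) (C \<union> D). z \<in> c \<longrightarrow> (\<forall>p\<in>P1 \<union> P2. \<not> splits c p)"
      proof (intro ballI impI)
        fix c p assume c: "c \<in> insert (A \<union> B) (C \<union> D)" "z \<in> c" "p \<in> P1 \<union> P2"
        then have "c = A \<union> B \<or> c \<in> C" using DB z(1) AB(3) by blast
        then show "\<not> splits c p" using c z(3) nC nT by blast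
      qed
      ultimately show ?thesis using pr cp z(1) by (intro exI[of _ "P1 \<union> P2"]) auto
    next
      case 3
      then obtain z where z: "z \<in> ?S2" "\<Union>P2 = ?S2 - {z}"
        "\<forall>c\<in>D. z \<in> c \<longrightarrow> (\<forall>p\<in>P2. \<not> splits c p)" using P2(3) by auto
      have "odd (card S)" using 3 cardS by simp
      moreover have "\<Union>(P1 \<union> P2) = S - {z}" using 3 P1(3) z(1,2) S by auto
      moreover have "\<forall>c\<in>insert (A \<union> B) (C \<union> D). z \<in> c \<longrightarrow> (\<forall>p\<in>P1 \<union> P2. \<not> splits c p)"
      proof (intro ballI impI)
        fix c p assume c: "c \<in> insert (A \<union> B) (C \<union> D)" "z \<in> c" "p \<in> P1 \<union> P2"
        then have "c = A \<union> B \<or> c \<in> D" using CA z(1) AB(3) by blast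
        then show "\<not> splits c p" using c z(3) nD nT by blast
      qed
      ultimately show ?thesis using pr cp z(1) by (intro exI[of _ "P1 \<union> P2"]) auto
    qed
  next
    case False
    obtain z1 where z1: "z1 \<in> ?S1" "\<Union>P1 = ?S1 - {z1}"
        "\<forall>c\<in>C. z1 \<in> c \<longrightarrow> (\<forall>p\<in>P1. \<not> splits c p)" using P1(3) False by auto
    obtain z2 where z2: "z2 \<in> ?S2" "\<Union>P2 = ?S2 - {z2}"
        "\<forall>c\<in>D. z2 \<in> c \<longrightarrow> (\<forall>p\<in>P2. \<not> splits c p)" using P2(3) False by auto
    have ne: "z1 \<noteq> z2" using z1(1) z2(1) S(2) by blast
    let ?P = "insert {z1, z2} (P1 \<union> P2)"
    have "z1 \<notin> \<Union>P1" "z1 \<notin> \<Union>P2" "z2 \<notin> \<Union>P1" "z2 \<notin> \<Union>P2"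
      using z1(1,2) z2(1,2) S(2) by blast+
    then have out: "p \<inter> {z1, z2} = {}" if "p \<in> P1 \<union> P2" for p
      using that by blast
    have "pairing ?P"
      using pr ne out unfolding pairing_def disjoint_def by auto
    moreover have "\<not> splits (A \<union> B) {z1, z2}" using z1 z2 unfolding splits_def by blast
    moreover have "\<not> splits c p" if c: "c \<in> C \<union> D" "splits c {z1, z2}" "p \<in> P1 \<union> P2" for c p
    proof (cases "c \<in> C")
      case True
      then have "z1 \<in> c" using CA[OF True] c(2) z2(1) AB(3) unfolding splits_def by blast
      then show ?thesis using True c(3) z1(3) nC by blast
    next
      case False
      then have "c \<in> D" using c(1) by blast
      then have "z2 \<in> c" using DB c(2) z1(1) AB(3) unfolding splits_def by blast
      then show ?thesis using \<open>c \<in> D\<close> c(3) z2(3) nD by blast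
    qed
    ultimately have "compatible (insert (A \<union> B) (C \<union> D)) ?P"
      using cp nT unfolding compatible_def by blast
    moreover have "\<Union>?P = S" using z1 z2 S by auto
    moreover have "even (card S)" using False cardS by simp
    ultimately show ?thesis using \<open>pairing ?P\<close> by (intro exI[of _ ?P]) simp
  qed
qed

lemma pairing_unique_aux:
  assumes "binary_hierarchy A C" "pairing P" "pairing Q" "compatible C P" "compatible C Q" "\<Union>P \<inter> A = \<Union>Q \<inter> A"
    "p \<in> P" "p \<subseteq> A"
  shows "p \<in> Q"
  using assms
proof (induction arbitrary: p P Q rule: binary_hierarchy.induct)
  case (hierarchy_single x)
  then show ?case unfolding pairing_def by (metis card.empty card_insert_disjoint finite.emptyI insert_absorb insert_not_empty numeral_eq_one_iff One_nat_def subset_singletonD zero_neq_numeral semiring_norm(85))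
next
  case (hierarchy_join A C B D)
  note AB = hierarchy_join.hyps
  let ?C = "insert (A \<union> B) (C \<union> D)"
  have cm: "compatible C P" "compatible C Q" "compatible D P" "compatible D Q"
    using hierarchy_join.prems unfolding compatible_def by blast+
  have AC: "A \<in> C" "B \<in> D" using AB hierarchy_top by blast+
  have UA: "\<Union>P \<inter> A = \<Union>Q \<inter> A" and UB: "\<Union>P \<inter> B = \<Union>Q \<inter> B" using hierarchy_join.prems(5) by blast+
  have card2: "\<And>p. p \<in> P \<union> Q \<Longrightarrow> card p = 2" using hierarchy_join.prems unfolding pairing_def by blast
  have dP: "\<And>p q. p \<in> P \<Longrightarrow> q \<in> P \<Longrightarrow> p \<inter> q \<noteq> {} \<Longrightarrow> p = q"
   and dQ: "\<And>p q. p \<in> Q \<Longrightarrow> q \<in> Q \<Longrightarrow> p \<inter> q \<noteq> {} \<Longrightarrow> p = q"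
    using hierarchy_join.prems(1,2) unfolding pairing_def disjoint_def by blast+
  have A: "p \<in> P \<longleftrightarrow> p \<in> Q" if "p \<subseteq> A" for p
    using that hierarchy_join.IH(1) hierarchy_join.prems cm UA by metis
  have B: "p \<in> P \<longleftrightarrow> p \<in> Q" if "p \<subseteq> B" for p
    using that hierarchy_join.IH(2) hierarchy_join.prems cm UB by metis
  show ?case
  proof (cases "p \<subseteq> A \<or> p \<subseteq> B")
    case True
    then show ?thesis using A B hierarchy_join.prems by blast
  next
    case False
    obtain z w where zw: "p = {z, w}" "z \<in> A" "w \<in> B"
      using False card2[of p] hierarchy_join.prems(6,7) unfolding card_2_iff by blast
    obtain p' where p': "p' \<in> Q" "z \<in> p'" using UA zw hierarchy_join.prems(6) by blast
    obtain p'' where p'': "p'' \<in> Q" "w \<in> p''" using UB zw hierarchy_join.prems(6) by blast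
    have nA: "\<not> p' \<subseteq> A"
    proof
      assume "p' \<subseteq> A"
      then have "p' \<in> P" using A p' by blast
      then have "p' = p" using dP hierarchy_join.prems(6) p' zw by blast
      then show False using False \<open>p' \<subseteq> A\<close> by blast
    qed
    have nB: "\<not> p'' \<subseteq> B"
    proof
      assume "p'' \<subseteq> B"
      then have "p'' \<in> P" using B p'' by blast
      then have "p'' = p" using dP hierarchy_join.prems(6) p'' zw by blast
      then show False using False \<open>p'' \<subseteq> B\<close> by blast
    qed
    obtain t where t: "p' = {z, t}" "t \<notin> A" 
      using nA p' card2[of p'] zw unfolding card_2_iff by blast
    obtain s where s: "p'' = {w, s}" "s \<notin> B"
      using nB p'' card2[of p''] zw unfolding card_2_iff by blast
    show ?thesis
    proof (cases "p' = p''")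
      case True
      then have "p' = p" using t s zw AB(3) by (auto simp: doubleton_eq_iff)
      then show ?thesis using p' by simp
    next
      case ne: False
      then have d: "p' \<inter> p'' = {}" using dQ p' p'' by blast
      have "t \<notin> B"
      proof
        assume tB: "t \<in> B"
        then obtain q where q: "q \<in> P" "t \<in> q" using UB t p' by blast
        have "\<not> q \<subseteq> B"
        proof
          assume "q \<subseteq> B"
          then have "q \<in> Q" using B q by blast
          then have "q = p'" using dQ[of q p'] q p' t by blast
          then show False using zw t \<open>q \<subseteq> B\<close> AB(3) by blast
        qed
        then have "splits B q" using q tB unfolding splits_def by blast
        moreover have "splits B p" using zw AB(3) unfolding splits_def by blast
        ultimately have "q = p" using cm(3) AC q hierarchy_join.prems(6) unfolding compatible_def by blast
        then have "t = w" using q tB zw AB(3) by blast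
        then show False using d s t by blast
      qed
      moreover have "s \<notin> A"
      proof
        assume sA: "s \<in> A"
        then obtain q where q: "q \<in> P" "s \<in> q" using UA s p'' by blast
        have "\<not> q \<subseteq> A"
        proof
          assume "q \<subseteq> A"
          then have "q \<in> Q" using A q by blast
          then have "q = p''" using dQ[of q p''] q p'' s by blast
          then show False using zw s \<open>q \<subseteq> A\<close> AB(3) by blast
        qed
        then have "splits A q" using q sA unfolding splits_def by blast
        moreover have "splits A p" using zw AB(3) unfolding splits_def by blast
        ultimately have "q = p" using cm(1) AC q hierarchy_join.prems(6) unfolding compatible_def by blast
        then have "s = z" using q sA zw AB(3) by blast
        then show False using d s t by blast
      qed
      ultimately have "splits (A \<union> B) p'" "splits (A \<union> B) p''"
        using t s zw unfolding splits_def by blast+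
      then show ?thesis using ne p' p'' hierarchy_join.prems(4) unfolding compatible_def by blast
    qed
  qed
qed

lemma pairing_unique:
  assumes "binary_hierarchy A C" "pairing P" "pairing Q" "compatible C P" "compatible C Q" "\<Union>P = \<Union>Q" "\<Union>P \<subseteq> A"
  shows "P = Q"
proof -
  have "p \<in> Q" if "p \<in> P" for p
    using pairing_unique_aux[OF assms(1-5)] assms(6,7) that by blast
  moreover have "p \<in> P" if "p \<in> Q" for p
    using pairing_unique_aux[OF assms(1,3,2,5,4)] assms(6,7) that by blast
  ultimately show ?thesis by blast
qed

lemma pieces_exist_aux:
  assumes "binary_hierarchy A C" "2 \<le> r"
  shows "\<exists>\<P> R. disjoint \<P> \<and> \<Union>\<P> \<subseteq> A \<and> R \<subseteq> A \<and> R \<inter> \<Union>\<P> = {} \<and> card R < r \<and>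
    (\<forall>p\<in>\<P>. r \<le> card p) \<and> compatible C \<P> \<and> (\<forall>c\<in>C. c \<inter> R \<noteq> {} \<longrightarrow> (\<forall>p\<in>\<P>. \<not> splits c p)) \<and>
    card A \<le> 2 * r * card \<P> + card R"
  using assms(1)
proof (induction rule: binary_hierarchy.induct)
  case (hierarchy_single x)
  then show ?case using assms(2)
    by (intro exI[of _ "{}"] exI[of _ "{x}"]) (auto simp: compatible_def disjoint_def)
next
  case (hierarchy_join A C B D)
  note AB = hierarchy_join.hyps
  have fin: "finite A" "finite B" using hierarchy_finite AB by blast+
  have CA: "\<And>c. c \<in> C \<Longrightarrow> c \<subseteq> A" and DB: "\<And>c. c \<in> D \<Longrightarrow> c \<subseteq> B"
    using hierarchy_subset AB by blast+
  obtain P1 R1 where 1: "disjoint P1" "\<Union>P1 \<subseteq> A" "R1 \<subseteq> A" "R1 \<inter> \<Union>P1 = {}" "card R1 < r"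
    "\<forall>p\<in>P1. r \<le> card p" "compatible C P1" "\<forall>c\<in>C. c \<inter> R1 \<noteq> {} \<longrightarrow> (\<forall>p\<in>P1. \<not> splits c p)"
    "card A \<le> 2 * r * card P1 + card R1" using hierarchy_join.IH(1) by (elim exE conjE) (rule that)
  obtain P2 R2 where 2: "disjoint P2" "\<Union>P2 \<subseteq> B" "R2 \<subseteq> B" "R2 \<inter> \<Union>P2 = {}" "card R2 < r"
    "\<forall>p\<in>P2. r \<le> card p" "compatible D P2" "\<forall>c\<in>D. c \<inter> R2 \<noteq> {} \<longrightarrow> (\<forall>p\<in>P2. \<not> splits c p)"
    "card B \<le> 2 * r * card P2 + card R2" using hierarchy_join.IH(2) by (elim exE conjE) (rule that)
  have finP: "finite P1" "finite P2"
    using finite_UnionD[OF finite_subset[OF 1(2) fin(1)]] finite_UnionD[OF finite_subset[OF 2(2) fin(2)]] .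
  have nC: "\<not> splits c p" if "c \<in> C" "p \<in> P2" for c p
    using that CA 2 AB(3) unfolding splits_def by blast
  have nD: "\<not> splits c p" if "c \<in> D" "p \<in> P1" for c p
    using that DB 1 AB(3) unfolding splits_def by blast
  have nT: "\<not> splits (A \<union> B) p" if "p \<in> P1 \<union> P2" for p
    using that 1 2 unfolding splits_def by blast
  have cp: "compatible (insert (A \<union> B) (C \<union> D)) (P1 \<union> P2)"
    using 1(7) 2(7) nC nD nT unfolding compatible_def by blast
  have "p \<inter> q = {}" if "p \<in> P1" "q \<in> P2" for p q using that 1(2) 2(2) AB(3) by blast
  then have dj: "disjoint (P1 \<union> P2)"
    using 1(1) 2(1) unfolding disjoint_def by (metis Int_commute UnE)
  have ne: "p \<noteq> {}" if "p \<in> P1 \<union> P2" for p using that 1(6) 2(6) assms(2) by force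
  have "P1 \<inter> P2 = {}" using ne 1(2) 2(2) AB(3) by blast
  then have cardP: "card (P1 \<union> P2) = card P1 + card P2" using card_Un_disjoint finP by blast
  have cardAB: "card (A \<union> B) = card A + card B" using card_Un_disjoint fin AB(3) by blast
  have cardR: "card (R1 \<union> R2) = card R1 + card R2"
    using card_Un_disjoint[of R1 R2] 1(3) 2(3) AB(3) fin finite_subset by blast
  have le: "card (A \<union> B) \<le> 2 * r * card (P1 \<union> P2) + card (R1 \<union> R2)"
    using 1(9) 2(9) cardP cardAB cardR by (simp add: algebra_simps)
  have RP: "(R1 \<union> R2) \<inter> \<Union>(P1 \<union> P2) = {}" using 1(2-4) 2(2-4) AB(3) by blast
  have meets: "\<not> splits c p" if h: "c \<in> insert (A \<union> B) (C \<union> D)" "c \<inter> (R1 \<union> R2) \<noteq> {}" "p \<in> P1 \<union> P2" for c p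
  proof -
    have "c \<in> C \<Longrightarrow> c \<inter> R2 = {}" using CA[of c] 2(3) AB(3) by blast
    moreover have "c \<in> D \<Longrightarrow> c \<inter> R1 = {}" using DB[of c] 1(3) AB(3) by blast
    ultimately consider "c = A \<union> B" | "c \<in> C" "c \<inter> R1 \<noteq> {}" | "c \<in> D" "c \<inter> R2 \<noteq> {}"
      using h(1,2) by (auto simp: Int_Un_distrib)
    then show ?thesis using h(3) nT nC nD 1(8) 2(8) by cases auto
  qed
  show ?case
  proof (cases "card (R1 \<union> R2) < r")
    case True
    have "\<Union>(P1 \<union> P2) \<subseteq> A \<union> B" "R1 \<union> R2 \<subseteq> A \<union> B" using 1(2,3) 2(2,3) by blast+
    moreover have "\<forall>p\<in>P1 \<union> P2. r \<le> card p" using 1(6) 2(6) by blast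
    moreover have "\<forall>c\<in>insert (A \<union> B) (C \<union> D). c \<inter> (R1 \<union> R2) \<noteq> {} \<longrightarrow> (\<forall>p\<in>P1 \<union> P2. \<not> splits c p)"
      using meets by blast
    ultimately show ?thesis using dj RP True cp le
      by (intro exI[of _ "P1 \<union> P2"] exI[of _ "R1 \<union> R2"] conjI)
  next
    case False
    let ?P = "insert (R1 \<union> R2) (P1 \<union> P2)"
    have RP': "p \<inter> (R1 \<union> R2) = {}" "(R1 \<union> R2) \<inter> p = {}" if "p \<in> P1 \<union> P2" for p
      using RP that by blast+
    have nin: "R1 \<union> R2 \<notin> P1 \<union> P2" using RP'(1)[of "R1 \<union> R2"] ne[of "R1 \<union> R2"] by auto
    have dj': "disjoint ?P" unfolding disjoint_def
    proof (intro ballI impI)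
      fix p q assume pq: "p \<in> ?P" "q \<in> ?P" "p \<noteq> q"
      then consider "p \<in> P1 \<union> P2" "q \<in> P1 \<union> P2" | "p = R1 \<union> R2" "q \<in> P1 \<union> P2"
        | "q = R1 \<union> R2" "p \<in> P1 \<union> P2" by (elim insertE) simp_all
      then show "p \<inter> q = {}"
        using dj pq(3) RP' unfolding disjoint_def by cases metis+
    qed
        have sR: "\<not> splits c p" if "c \<in> insert (A \<union> B) (C \<union> D)" "splits c (R1 \<union> R2)" "p \<in> P1 \<union> P2" for c p
      using meets[OF that(1) _ that(3)] that(2) unfolding splits_def by simp
    moreover have "compatible (insert (A \<union> B) (C \<union> D)) ?P"
      unfolding compatible_def
    proof (intro ballI impI)
      fix c p q assume c: "c \<in> insert (A \<union> B) (C \<union> D)" and pq: "p \<in> ?P" "q \<in> ?P" "splits c p" "splits c q"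
      consider "p = q" | "p \<in> P1 \<union> P2" "q \<in> P1 \<union> P2" | "p = R1 \<union> R2" "q \<in> P1 \<union> P2"
        | "q = R1 \<union> R2" "p \<in> P1 \<union> P2" using pq(1,2) by (elim insertE) simp_all
      then show "p = q"
      proof cases
        case 2 then show ?thesis using cp c pq(3,4) unfolding compatible_def by metis
      qed (use sR[OF c] pq in simp_all)
    qed
    moreover have "card (A \<union> B) \<le> 2 * r * card ?P + card ({} :: 'a set)"
    proof -
      have "card ?P = Suc (card (P1 \<union> P2))" using nin finP by simp
      moreover have "card (R1 \<union> R2) \<le> 2 * r" using cardR 1(5) 2(5) by linarith
      ultimately show ?thesis using le by simp
    qed
    moreover have "\<forall>p\<in>?P. r \<le> card p" using False 1(6) 2(6) by auto
    moreover have "\<Union>?P \<subseteq> A \<union> B" using 1(2,3) 2(2,3) by blast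
    ultimately show ?thesis using assms(2) dj'
      by (intro exI[of _ ?P] exI[of _ "{}"]) simp
  qed
qed

lemma pieces_exist:
  assumes "binary_hierarchy A C" "2 \<le> r"
  shows "\<exists>\<P>. disjoint \<P> \<and> \<Union>\<P> \<subseteq> A \<and> (\<forall>p\<in>\<P>. card p = r) \<and> compatible C \<P> \<and>
    card A \<le> 2 * r * card \<P> + r"
proof -
  obtain \<P> and R :: "'a set" where P: "disjoint \<P>" "\<Union>\<P> \<subseteq> A" "card R < r"
    "\<forall>p\<in>\<P>. r \<le> card p" "compatible C \<P>" "card A \<le> 2 * r * card \<P> + card R"
    using pieces_exist_aux[OF assms] by auto
  have "\<forall>p\<in>\<P>. \<exists>q. q \<subseteq> p \<and> card q = r"
    using P(4) by (meson obtain_subset_with_card_n)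
  then obtain f where f: "\<forall>p\<in>\<P>. f p \<subseteq> p \<and> card (f p) = r" by metis
  have ne: "\<And>p. p \<in> \<P> \<Longrightarrow> f p \<noteq> {}" using f assms(2) by fastforce
  have inj: "inj_on f \<P>"
  proof (rule inj_onI)
    fix p q assume pq: "p \<in> \<P>" "q \<in> \<P>" "f p = f q"
    then have "p \<inter> q \<noteq> {}" using f ne by blast
    then show "p = q" using P(1) pq unfolding disjoint_def by blast
  qed
  have s: "splits c p" if "splits c (f p)" "p \<in> \<P>" for c p
    using that f[rule_format, of p] unfolding splits_def by blast
  have "f p \<inter> f q = {}" if "p \<in> \<P>" "q \<in> \<P>" "f p \<noteq> f q" for p q
  proof -
    have "p \<inter> q = {}" using P(1) that unfolding disjoint_def by metis
    then show ?thesis using f[rule_format, of p] f[rule_format, of q] that by blast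
  qed
  then have "disjoint (f ` \<P>)" unfolding disjoint_def by blast
  moreover have "\<Union>(f ` \<P>) \<subseteq> A" using P(2) f by blast
  moreover have "compatible C (f ` \<P>)" using P(5) s unfolding compatible_def by blast
  moreover have "card A \<le> 2 * r * card (f ` \<P>) + r"
    using P(3,6) card_image[OF inj] by simp
  ultimately show ?thesis using f by (intro exI[of _ "f ` \<P>"]) auto
qed

section \<open>Label sets with a common pairing\<close>

lemma card_sym_diff:
  assumes "finite A" "finite B"
  shows "card (sym_diff A B) + 2 * card (A \<inter> B) = card A + card B"
proof -
  have "card (sym_diff A B) = card (A - B) + card (B - A)"
    by (rule card_Un_disjoint) (use assms in auto)
  moreover have "card A = card (A - B) + card (A \<inter> B)"
    using card_Int_Diff[OF assms(1), of B] by simp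
  moreover have "card B = card (B - A) + card (A \<inter> B)"
    using card_Int_Diff[OF assms(2), of A] by (simp add: Int_commute)
  ultimately show ?thesis by simp
qed

lemma even_card_sym_diff_Int:
  assumes "finite A" "finite B"
  shows "even (card (sym_diff A B \<inter> c)) \<longleftrightarrow> (even (card (A \<inter> c)) \<longleftrightarrow> even (card (B \<inter> c)))"
proof -
  have "sym_diff A B \<inter> c = sym_diff (A \<inter> c) (B \<inter> c)" by blast
  then have "card (sym_diff A B \<inter> c) + 2 * card ((A \<inter> c) \<inter> (B \<inter> c)) = card (A \<inter> c) + card (B \<inter> c)"
    using card_sym_diff[of "A \<inter> c" "B \<inter> c"] assms by simp
  then show ?thesis by presburger
qed

definition binary_space :: "'a set \<Rightarrow> 'a set set \<Rightarrow> bool" where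
  "binary_space L V \<longleftrightarrow> V \<subseteq> Pow L \<and> {} \<in> V \<and> (\<forall>S\<in>V. \<forall>T\<in>V. sym_diff S T \<in> V)"

lemma inj_sym_diff: "inj_on (\<lambda>S. sym_diff S T) A"
proof (rule inj_onI)
  fix S S' assume "sym_diff S T = sym_diff S' T"
  then have "sym_diff (sym_diff S T) T = sym_diff (sym_diff S' T) T" by simp
  moreover have "sym_diff (sym_diff S T) T = S" "sym_diff (sym_diff S' T) T = S'" by blast+
  ultimately show "S = S'" by simp
qed

lemma even_subspace:
  assumes "finite L" "binary_space L V"
  shows "binary_space L {S \<in> V. even (card (S \<inter> c))}"
    and "card V \<le> 2 * card {S \<in> V. even (card (S \<inter> c))}"
proof -
  let ?E = "{S \<in> V. even (card (S \<inter> c))}" and ?O = "{S \<in> V. odd (card (S \<inter> c))}"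
  have fin: "\<And>S. S \<in> V \<Longrightarrow> finite S"
    using assms unfolding binary_space_def by (meson PowD finite_subset subsetD)
  have finV: "finite V" using assms unfolding binary_space_def by (meson finite_Pow_iff finite_subset)
  show "binary_space L ?E"
    unfolding binary_space_def
  proof (intro conjI ballI)
    show "?E \<subseteq> Pow L" "{} \<in> ?E" using assms(2) unfolding binary_space_def by auto
    fix S T assume "S \<in> ?E" "T \<in> ?E"
    then show "sym_diff S T \<in> ?E"
      using assms(2) fin even_card_sym_diff_Int[of S T c] unfolding binary_space_def by simp
  qed
  have "card ?O \<le> card ?E"
  proof (cases "?O = {}")
    case True
    then show ?thesis by (metis card.empty le0)
  next
    case False
    then obtain T where T: "T \<in> V" "odd (card (T \<inter> c))" by blast
    have "(\<lambda>S. sym_diff S T) ` ?O \<subseteq> ?E"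
    proof (rule image_subsetI)
      fix S assume S: "S \<in> ?O"
      then have "sym_diff S T \<in> V" using T assms(2) unfolding binary_space_def by blast
      moreover have "even (card (sym_diff S T \<inter> c))"
        using even_card_sym_diff_Int[of S T c] fin S T by auto
      ultimately show "sym_diff S T \<in> ?E" by blast
    qed
    then show ?thesis
      using card_inj_on_le[OF inj_sym_diff, of T ?O ?E] finV by simp
  qed
  moreover have "card V = card ?E + card ?O"
  proof -
    have "V = ?E \<union> ?O" "?E \<inter> ?O = {}" by auto
    then show ?thesis using card_Un_disjoint[of ?E ?O] finV by auto
  qed
  ultimately show "card V \<le> 2 * card ?E" by simp
qed

lemma large_member:
  assumes "finite L" "binary_space L V" "2 ^ d \<le> card V"
  shows "\<exists>S\<in>V. d \<le> 2 * card S"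
proof (rule ccontr)
  assume "\<not> ?thesis"
  then have small: "\<And>S. S \<in> V \<Longrightarrow> 2 * card S < d" by force
  let ?U = "\<Union>V"
  have finV: "finite V" using assms unfolding binary_space_def by (meson finite_Pow_iff finite_subset)
  have finU: "finite ?U" using assms(1,2) unfolding binary_space_def by (meson Sup_le_iff finite_subset PowD subsetD)
  have "card V \<le> card (Pow ?U)" by (rule card_mono) (use finU in auto)
  then have "(2::nat) ^ d \<le> 2 ^ card ?U" using assms(3) card_Pow[OF finU] by linarith
  then have dU: "d \<le> card ?U" by (rule power_le_imp_le_exp[rotated]) simp
  have half: "2 * card {S \<in> V. x \<in> S} = card V" if x: "x \<in> ?U" for x
  proof -
    obtain T where T: "T \<in> V" "x \<in> T" using x by blast
    let ?A = "{S \<in> V. x \<in> S}" and ?B = "{S \<in> V. x \<notin> S}"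
    have cl: "\<And>S. S \<in> V \<Longrightarrow> sym_diff S T \<in> V" using assms(2) T unfolding binary_space_def by blast
    have "(\<lambda>S. sym_diff S T) ` ?A \<subseteq> ?B" "(\<lambda>S. sym_diff S T) ` ?B \<subseteq> ?A"
      using cl T by auto
    then have "card ?A \<le> card ?B" "card ?B \<le> card ?A"
      using card_inj_on_le[OF inj_sym_diff, of T ?A ?B] card_inj_on_le[OF inj_sym_diff, of T ?B ?A] finV by auto
    moreover have "card V = card ?A + card ?B"
    proof -
      have "V = ?A \<union> ?B" by blast
      then show ?thesis using card_Un_disjoint[of ?A ?B] finV by auto
    qed
    ultimately show ?thesis by simp
  qed
  have "(\<Sum>S\<in>V. card S) = (\<Sum>S\<in>V. \<Sum>x\<in>?U. if x \<in> S then 1 else 0)"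
  proof (rule sum.cong[OF refl])
    fix S assume "S \<in> V"
    then have "?U \<inter> S = S" by blast
    then show "card S = (\<Sum>x\<in>?U. if x \<in> S then 1 else 0)" using finU by (simp add: sum.If_cases)
  qed
  also have "\<dots> = (\<Sum>x\<in>?U. \<Sum>S\<in>V. if x \<in> S then 1 else 0)" by (rule sum.swap)
  also have "\<dots> = (\<Sum>x\<in>?U. card {S \<in> V. x \<in> S})"
    using finV by (simp add: sum.If_cases Int_def)
  finally have "2 * (\<Sum>S\<in>V. card S) = (\<Sum>x\<in>?U. card V)"
    using half by (simp add: sum_distrib_left)
  then have eq: "(\<Sum>S\<in>V. 2 * card S) = card V * card ?U" by (simp add: sum_distrib_left)
  have "V \<noteq> {}" using assms(2) unfolding binary_space_def by blast
  then have "(\<Sum>S\<in>V. 2 * card S) < (\<Sum>S\<in>V. d)" by (intro sum_strict_mono finV small)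
  then show False using eq dU by (simp add: mult_le_mono2 leD)
qed

definition agree :: "'a set \<Rightarrow> nat \<Rightarrow> 'a set set \<Rightarrow> 'a set set \<Rightarrow> bool" where
  "agree L k C D \<longleftrightarrow> (\<exists>V. binary_space L V \<and> 2 ^ card L \<le> card V * 2 ^ (k + 1) \<and>
     (\<forall>S\<in>V. \<exists>P. pairing P \<and> \<Union>P = S \<and> compatible C P \<and> compatible D P))"

lemma splits_pair: "splits c {u, v} \<longleftrightarrow> (u \<in> c \<longleftrightarrow> v \<notin> c)"
  unfolding splits_def by auto

lemma agree_refl:
  assumes "binary_hierarchy L C" shows "agree L 0 C C"
proof -
  have fin: "finite L" using assms hierarchy_finite by blast
  have P: "binary_space L (Pow L)" unfolding binary_space_def by blast
  let ?V = "{S \<in> Pow L. even (card (S \<inter> L))}"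
  have "2 ^ card L \<le> card ?V * 2 ^ (0 + 1)"
    using even_subspace(2)[OF fin P, of L] fin by (simp add: card_Pow mult.commute)
  moreover have "\<exists>P. pairing P \<and> \<Union>P = S \<and> compatible C P \<and> compatible C P" if "S \<in> ?V" for S
  proof -
    have S: "S \<subseteq> L" "even (card S)" using that by (auto simp: Int_absorb2)
    obtain P where "pairing P" "compatible C P" "\<Union>P = S"
      using pairing_exists[OF assms S(1)] S(2) by (elim exE conjE) (simp add: that)
    then show ?thesis by blast
  qed
  ultimately show ?thesis
    using even_subspace(1)[OF fin P, of L] unfolding agree_def by - (rule exI[of _ ?V], intro conjI ballI)
qed

text \<open>A pair separated by the deleted edge meets each side once, so an even number of
  labels on a side, together with compatibility, means that no pair is separated.\<close>

lemma agree_step: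
  assumes fin: "finite L" and ag: "agree L k B C" and e: "e \<in> C"
    and st: "\<forall>d\<in>D. \<exists>c\<in>C. \<forall>u\<in>L. \<forall>v\<in>L.
     (u \<in> e \<longleftrightarrow> v \<in> e) \<longrightarrow> (u \<in> c \<longleftrightarrow> v \<in> c) \<longrightarrow> (u \<in> d \<longleftrightarrow> v \<in> d)"
  shows "agree L (Suc k) B D"
proof -
  obtain V where V: "binary_space L V" "2 ^ card L \<le> card V * 2 ^ (k + 1)"
     "\<forall>S\<in>V. \<exists>P. pairing P \<and> \<Union>P = S \<and> compatible B P \<and> compatible C P"
    using ag unfolding agree_def by blast
  let ?V = "{S \<in> V. even (card (S \<inter> e))}"
  have "card V * 2 ^ (k + 1) \<le> (2 * card ?V) * 2 ^ (k + 1)"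
    using even_subspace(2)[OF fin V(1)] by (rule mult_right_mono) simp
  then have "2 ^ card L \<le> card ?V * 2 ^ (Suc k + 1)" using V(2) by (simp only: power_Suc add_Suc)
  moreover have "\<exists>P. pairing P \<and> \<Union>P = S \<and> compatible B P \<and> compatible D P" if S: "S \<in> ?V" for S
  proof -
    obtain P where P: "pairing P" "\<Union>P = S" "compatible B P" "compatible C P" using V(3) S by blast
    have SL: "S \<subseteq> L" using S V(1) unfolding binary_space_def by blast
    have finS: "finite S" using SL fin finite_subset by blast
    have finP: "finite P" using P(2) finS finite_UnionD by metis
    have c2: "\<And>p. p \<in> P \<Longrightarrow> card p = 2" using P(1) unfolding pairing_def by blast
    have un: "\<not> splits e p" if p: "p \<in> P" for p
    proof
      assume sp: "splits e p"
      have other: "even (card (q \<inter> e))" if q: "q \<in> P - {p}" for q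
      proof -
        have "\<not> splits e q" using q p sp P(4) e unfolding compatible_def by (metis DiffD1 DiffD2 singletonI)
        then have "q \<inter> e = {} \<or> q \<inter> e = q" unfolding splits_def by blast
        then show ?thesis using c2 q by auto
      qed
      obtain u v where uv: "p = {u, v}" "u \<noteq> v" using c2[OF p] by (meson card_2_iff)
      have "card (p \<inter> e) = 1" using sp uv unfolding splits_pair uv(1) by (cases "u \<in> e") auto
      have "card (S \<inter> e) = card (\<Union>q\<in>P. q \<inter> e)" 
        unfolding P(2)[symmetric] Int_Union2 ..
      also have "\<dots> = (\<Sum>q\<in>P. card (q \<inter> e))"
      proof (rule card_UN_disjoint[OF finP])
        show "\<forall>q\<in>P. finite (q \<inter> e)" using c2 by (metis card.infinite finite_Int zero_neq_numeral)
        show "\<forall>i\<in>P. \<forall>j\<in>P. i \<noteq> j \<longrightarrow> i \<inter> e \<inter> (j \<inter> e) = {}"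
          using P(1) unfolding pairing_def disjoint_def by fast
      qed
      also have "\<dots> = card (p \<inter> e) + (\<Sum>q\<in>P - {p}. card (q \<inter> e))" using finP p by (simp add: sum.remove)
      finally have "card (S \<inter> e) = 1 + (\<Sum>q\<in>P - {p}. card (q \<inter> e))" using \<open>card (p \<inter> e) = 1\<close> by simp
      moreover have "even (\<Sum>q\<in>P - {p}. card (q \<inter> e))" using other by (meson dvd_sum)
      ultimately show False using S by simp
    qed
    have "compatible D P" unfolding compatible_def
    proof (intro ballI impI)
      fix d p q assume d: "d \<in> D" and pq: "p \<in> P" "q \<in> P" "splits d p" "splits d q"
      obtain c where c: "c \<in> C" "\<forall>u\<in>L. \<forall>v\<in>L. (u \<in> e \<longleftrightarrow> v \<in> e) \<longrightarrow> (u \<in> c \<longleftrightarrow> v \<in> c) \<longrightarrow> (u \<in> d \<longleftrightarrow> v \<in> d)"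
        using st d by blast
      have "splits c p" if p: "p \<in> P" "splits d p" for p
      proof -
        obtain u v where uv: "p = {u, v}" using c2[OF p(1)] by (meson card_2_iff)
        have "u \<in> L" "v \<in> L" using uv p(1) P(2) SL by auto
        then show ?thesis using c(2) un[OF p(1)] p(2) unfolding uv splits_pair by blast
      qed
      then show "p = q" using pq c(1) P(4) unfolding compatible_def by blast
    qed
    then show ?thesis using P by blast
  qed
  ultimately show ?thesis using even_subspace(1)[OF fin V(1), of e] unfolding agree_def
    by - (rule exI[of _ ?V], intro conjI ballI)
qed

lemma agree_common_pairing:
  assumes "finite L" "agree L k C D" "k + 4 * m + 1 \<le> card L"
  shows "\<exists>P. pairing P \<and> \<Union>P \<subseteq> L \<and> card P = m \<and> compatible C P \<and> compatible D P"
proof -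
  obtain V where V: "binary_space L V" "2 ^ card L \<le> card V * 2 ^ (k + 1)"
     "\<forall>S\<in>V. \<exists>P. pairing P \<and> \<Union>P = S \<and> compatible C P \<and> compatible D P"
    using assms(2) unfolding agree_def by blast
  have "(2::nat) ^ (4 * m) * 2 ^ (k + 1) \<le> 2 ^ card L"
    unfolding power_add[symmetric] using assms(3) by (intro power_increasing) auto
  then have "2 ^ (4 * m) \<le> card V" using V(2) by (meson le_trans mult_le_cancel2 zero_less_numeral zero_less_power)
  then obtain S where S: "S \<in> V" "4 * m \<le> 2 * card S" using large_member[OF assms(1) V(1)] by blast
  obtain P where P: "pairing P" "\<Union>P = S" "compatible C P" "compatible D P" using V(3) S by blast
  have SL: "S \<subseteq> L" using S V(1) unfolding binary_space_def by blast
  have finP: "finite P" using P(2) SL assms(1) finite_UnionD finite_subset by metis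
  have "card (\<Union>P) \<le> (\<Sum>p\<in>P. card p)" by (rule card_Union_le_sum_card)
  then have "card S \<le> 2 * card P" using P(1,2) unfolding pairing_def by simp
  then have "m \<le> card P" using S(2) by simp
  then obtain Q where Q: "Q \<subseteq> P" "card Q = m" by (meson obtain_subset_with_card_n)
  have "pairing Q" using P(1) Q(1) unfolding pairing_def disjoint_def by (meson subsetD)
  moreover have "compatible C Q" "compatible D Q" using P(3,4) Q(1) unfolding compatible_def by (meson subsetD)+
  moreover have "\<Union>Q \<subseteq> L" using Q(1) P(2) SL by blast
  ultimately show ?thesis using Q(2) by blast
qed

section \<open>Rearranging one hierarchy into another\<close>

definition regraft :: "'a set set \<Rightarrow> 'a set \<Rightarrow> 'a set \<Rightarrow> 'a set set" where
  "regraft C Y D = {c \<in> C. c \<subseteq> Y} \<union> {c - Y |c. c \<in> C \<and> \<not> c \<subseteq> Y \<and> \<not> D \<subseteq> c} \<union>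
     {c \<union> Y |c. c \<in> C \<and> D \<subseteq> c} \<union> {D - Y}"

definition anchored :: "'a set \<Rightarrow> 'a set set \<Rightarrow> 'a set set \<Rightarrow> bool" where
  "anchored L0 \<K> C \<longleftrightarrow> compatible C \<K> \<and> (\<forall>c\<in>C. c \<inter> L0 \<noteq> {} \<longrightarrow> (\<forall>K\<in>\<K>. \<not> splits c K))"

definition traces :: "'a set \<Rightarrow> 'a set set \<Rightarrow> 'a set set" where
  "traces M C = (\<lambda>c. c \<inter> M) ` C - {{}}"

definition graft :: "'a set set \<Rightarrow> 'a set \<Rightarrow> 'a set \<Rightarrow> 'a set set" where
  "graft R E K = (Pow K - {{}}) \<union> {F \<in> R. \<not> E \<subset> F} \<union> {F \<union> K |F. F \<in> R \<and> E \<subseteq> F}"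

definition is_hull :: "'a set set \<Rightarrow> 'a set \<Rightarrow> 'a set \<Rightarrow> bool" where
  "is_hull C K Y \<longleftrightarrow> Y \<in> C \<and> K \<subseteq> Y \<and> (\<forall>c\<in>C. K \<subseteq> c \<longrightarrow> Y \<subseteq> c)"

lemma hull_exists_pred:
  assumes "binary_hierarchy L C" "K \<noteq> {}" "c0 \<in> C" "K \<subseteq> c0" "Q c0"
  shows "\<exists>Y\<in>C. K \<subseteq> Y \<and> Q Y \<and> (\<forall>c\<in>C. K \<subseteq> c \<longrightarrow> Q c \<longrightarrow> Y \<subseteq> c)"
proof -
  let ?F = "{c \<in> C. K \<subseteq> c \<and> Q c}"
  have "finite ?F" "?F \<noteq> {}" using assms hierarchy_finite_family[OF assms(1)] by auto
  then obtain Y where Y: "Y \<in> ?F" "\<forall>c\<in>?F. card Y \<le> card c"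
    using ex_is_arg_min_if_finite[of ?F card] unfolding is_arg_min_linorder by blast
  have "Y \<subseteq> c" if c: "c \<in> C" "K \<subseteq> c" "Q c" for c
  proof -
    have "c \<inter> Y \<noteq> {}" using c(2) Y(1) assms(2) by blast
    then consider "Y \<subseteq> c" | "c \<subseteq> Y" using hierarchy_laminar[OF assms(1) c(1), of Y] Y(1) by blast
    then show ?thesis
    proof cases
      case 2
      have "finite Y" using Y(1) hierarchy_subset[OF assms(1)] hierarchy_finite[OF assms(1)] finite_subset by blast
      then show ?thesis using 2 Y(2) c card_seteq by blast
    qed
  qed
  then show ?thesis using Y(1) by blast
qed

lemma hull_exists:
  assumes "binary_hierarchy L C" "K \<noteq> {}" "K \<subseteq> L" shows "\<exists>Y. is_hull C K Y"
  using hull_exists_pred[OF assms(1,2) hierarchy_top[OF assms(1)] assms(3), of "\<lambda>_. True"]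
  unfolding is_hull_def by auto

lemma hull_unsplit:
  assumes C: "binary_hierarchy L C" and an: "anchored L0 \<K> C" and K: "K \<in> \<K>" and dj: "disjoint \<K>"
    and ne: "K \<noteq> {}" "K \<inter> L0 = {}" and Y: "is_hull C K Y"
  shows "Y \<inter> L0 = {}" "K' \<in> \<K> \<Longrightarrow> \<not> splits Y K'"
proof -
  have Y': "Y \<in> C" "K \<subseteq> Y" "\<And>c. c \<in> C \<Longrightarrow> K \<subseteq> c \<Longrightarrow> Y \<subseteq> c" using Y unfolding is_hull_def by auto
  have dK: "K' = K" if "K' \<in> \<K>" "K' \<inter> K \<noteq> {}" for K'
    using that dj K unfolding disjoint_def by metis
  have "Y \<inter> L0 = {} \<and> (\<forall>K'\<in>\<K>. \<not> splits Y K')"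
  proof (cases "\<exists>x. Y = {x}")
    case True
    then have KY: "Y = K" using ne(1) Y'(2) by blast
    have "\<not> splits Y K'" if "K' \<in> \<K>" for K'
      using dK[OF that] unfolding splits_def KY by blast
    then show ?thesis using ne(2) KY by blast
  next
    case False
    then obtain c1 c2 where c: "c1 \<in> C" "c2 \<in> C" "Y = c1 \<union> c2" "c1 \<inter> c2 = {}" "c1 \<noteq> {}" "c2 \<noteq> {}"
      using hierarchy_children[OF C Y'(1)] by blast
    have "\<not> K \<subseteq> c1" using Y'(3)[OF c(1)] c(3,4,6) by blast
    moreover have "\<not> K \<subseteq> c2" using Y'(3)[OF c(2)] c(3,4,5) by blast
    ultimately have sp: "splits c1 K" "splits c2 K" using Y'(2) c(3) unfolding splits_def by blast+
    have 1: "c1 \<inter> L0 = {}" using an sp(1) c(1) K unfolding anchored_def by metis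
    have 2: "c2 \<inter> L0 = {}" using an sp(2) c(2) K unfolding anchored_def by metis
    have "\<not> splits Y K'" if K': "K' \<in> \<K>" for K'
    proof
      assume s: "splits Y K'"
      then have "K' \<noteq> K" using Y'(2) unfolding splits_def by blast
      then have "\<not> splits c1 K'" "\<not> splits c2 K'"
        using an sp c(1,2) K K' unfolding anchored_def compatible_def by metis+
      then show False using s c(3) unfolding splits_def by blast
    qed
    then show ?thesis using 1 2 c(3) by blast
  qed
  then show "Y \<inter> L0 = {}" "K' \<in> \<K> \<Longrightarrow> \<not> splits Y K'" by blast+
qed

lemma trace_graft:
  assumes E: "E \<noteq> {}"
    and el: "\<And>c. c \<in> C \<Longrightarrow> c \<inter> M \<noteq> {} \<Longrightarrow>
      (K \<subseteq> c \<and> E \<subseteq> c \<inter> M) \<or> (K \<inter> c = {} \<and> \<not> E \<subset> c \<inter> M)"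
    and ex1: "\<exists>c\<in>C. c \<inter> M = E \<and> K \<inter> c = {}" and ex2: "\<exists>c\<in>C. c \<inter> M = E \<and> K \<subseteq> c"
    and sub: "\<And>S. S \<subseteq> K \<Longrightarrow> S \<noteq> {} \<Longrightarrow> \<exists>c\<in>C. c \<inter> M = {} \<and> c \<inter> K = S"
  shows "traces (M \<union> K) C = graft (traces M C) E K"
proof
  show "traces (M \<union> K) C \<subseteq> graft (traces M C) E K"
  proof
    fix S assume "S \<in> traces (M \<union> K) C"
    then obtain c where c: "c \<in> C" "S = c \<inter> (M \<union> K)" "S \<noteq> {}" unfolding traces_def by blast
    show "S \<in> graft (traces M C) E K"
    proof (cases "c \<inter> M = {}")
      case True
      then have "S = c \<inter> K" using c(2) by blast
      then have "S \<in> Pow K - {{}}" using c(3) by blast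
      then show ?thesis unfolding graft_def by (intro UnI1)
    next
      case False
      then have t: "c \<inter> M \<in> traces M C" using c(1) unfolding traces_def by blast
      from el[OF c(1) False] show ?thesis
      proof
        assume a: "K \<subseteq> c \<and> E \<subseteq> c \<inter> M"
        then have "S = (c \<inter> M) \<union> K" using c(2) by blast
        then have "S \<in> {F \<union> K |F. F \<in> traces M C \<and> E \<subseteq> F}" using t a by blast
        then show ?thesis unfolding graft_def by (intro UnI2)
      next
        assume a: "K \<inter> c = {} \<and> \<not> E \<subset> c \<inter> M"
        then have "S = c \<inter> M" using c(2) by blast
        then have "S \<in> {F \<in> traces M C. \<not> E \<subset> F}" using t a by simp
        then show ?thesis unfolding graft_def by simp
      qed
    qed
  qed
next
  have tr: "c \<inter> (M \<union> K) \<in> traces (M \<union> K) C" if "c \<in> C" "c \<inter> (M \<union> K) \<noteq> {}" for c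
    using that unfolding traces_def by simp
  show "graft (traces M C) E K \<subseteq> traces (M \<union> K) C"
  proof
    fix S assume "S \<in> graft (traces M C) E K"
    then consider "S \<subseteq> K" "S \<noteq> {}" | "S \<in> traces M C" "\<not> E \<subset> S"
      | F where "S = F \<union> K" "F \<in> traces M C" "E \<subseteq> F" unfolding graft_def by blast
    then show "S \<in> traces (M \<union> K) C"
    proof cases
      case 1
      then obtain c where c: "c \<in> C" "c \<inter> M = {}" "c \<inter> K = S" using sub by blast
      then have "S = c \<inter> (M \<union> K)" by blast
      then show ?thesis using tr[OF c(1)] 1(2) by simp
    next
      case 2
      then obtain c where c: "c \<in> C" "S = c \<inter> M" "S \<noteq> {}" unfolding traces_def by blast
      have "\<exists>c\<in>C. S = c \<inter> M \<and> K \<inter> c = {}"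
      proof (cases "S = E")
        case True
        then show ?thesis using ex1 by blast
      next
        case False
        then have "\<not> E \<subseteq> c \<inter> M" using 2(2) c(2) by blast
        then show ?thesis using el[OF c(1)] c by blast
      qed
      then obtain d where d: "d \<in> C" "S = d \<inter> M" "K \<inter> d = {}" by blast
      then have "S = d \<inter> (M \<union> K)" by blast
      then show ?thesis using tr[OF d(1)] c(3) by simp
    next
      case 3
      then obtain c where c: "c \<in> C" "F = c \<inter> M" "F \<noteq> {}" unfolding traces_def by blast
      have "\<exists>c\<in>C. F = c \<inter> M \<and> K \<subseteq> c"
      proof (cases "F = E")
        case True
        then show ?thesis using ex2 by blast
      next
        case False
        then have "E \<subset> c \<inter> M" using 3(3) c(2) by blast
        then show ?thesis using el[OF c(1)] c by blast
      qed
      then obtain d where d: "d \<in> C" "F = d \<inter> M" "K \<subseteq> d" by blast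
      then have "S = d \<inter> (M \<union> K)" using 3(1) by blast
      then show ?thesis using tr[OF d(1)] 3(1) c(3) by auto
    qed
  qed
qed

lemma small_subset_cluster:
  assumes C: "binary_hierarchy L C" and K: "K \<subseteq> L" "finite K" "card K \<le> 2" and Y: "is_hull C K Y"
    and S: "S \<subseteq> K" "S \<noteq> {}"
  shows "\<exists>c\<in>C. c \<subseteq> Y \<and> c \<inter> K = S"
proof (cases "S = K")
  case True
  then show ?thesis using Y unfolding is_hull_def by blast
next
  case False
  then have "card S < card K" using S K(2) by (metis psubset_card_mono psubsetI)
  then have "card S = 1" using K(3) S K(2)
    by (metis One_nat_def card_gt_0_iff finite_subset less_2_cases less_le_trans not_gr_zero)
  then obtain x where x: "S = {x}" by (meson card_1_singletonE)
  then have "{x} \<in> C" using hierarchy_singleton[OF C] S K(1) by blast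
  moreover have "{x} \<subseteq> Y" "{x} \<inter> K = S" using x S Y unfolding is_hull_def by blast+
  ultimately show ?thesis by blast
qed

lemma anchored_trace_graft:
  assumes B: "binary_hierarchy L B" and an: "anchored L0 \<K> B" and K: "K \<in> \<K>" and dj: "disjoint \<K>"
    and ne: "K \<noteq> {}" "K \<inter> L0 = {}" "K \<subseteq> L" "finite K" "card K \<le> 2" and L0: "L0 \<noteq> {}" "L0 \<subseteq> L"
  shows "\<exists>E\<in>traces L0 B. traces (L0 \<union> K) B = graft (traces L0 B) E K"
proof -
  obtain Y where Y: "is_hull B K Y" using hull_exists[OF B ne(1,3)] by blast
  have YL0: "Y \<inter> L0 = {}" by (rule hull_unsplit(1)[OF B an K dj ne(1,2) Y])
  obtain c where c: "c \<in> B" "K \<subseteq> c" "c \<inter> L0 \<noteq> {}"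
    and cmin: "\<forall>d\<in>B. K \<subseteq> d \<longrightarrow> d \<inter> L0 \<noteq> {} \<longrightarrow> c \<subseteq> d"
    using hull_exists_pred[OF B ne(1) hierarchy_top[OF B] ne(3), of "\<lambda>c. c \<inter> L0 \<noteq> {}"] L0 by blast
  have "\<nexists>x. c = {x}" using c ne(1,2) by blast
  then obtain d1 d2 where d: "d1 \<in> B" "d2 \<in> B" "c = d1 \<union> d2" "d1 \<inter> d2 = {}" "d1 \<noteq> {}" "d2 \<noteq> {}"
    using hierarchy_children[OF B c(1)] by blast
  have unsp: "\<not> splits d K" if "d \<in> B" "d \<inter> L0 \<noteq> {}" for d
    using an that K unfolding anchored_def by blast
  have child: "\<exists>c2\<in>B. c2 \<inter> L0 = c \<inter> L0 \<and> K \<inter> c2 = {}"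
    if d: "d1 \<in> B" "d2 \<in> B" "c = d1 \<union> d2" "d1 \<inter> d2 = {}" "d1 \<noteq> {}" "d2 \<noteq> {}" "d1 \<inter> L0 \<noteq> {}" for d1 d2
  proof -
    have "\<not> K \<subseteq> d1" using cmin d by blast
    then have K1: "K \<inter> d1 = {}" using unsp[OF d(1,7)] unfolding splits_def by blast
    then have "K \<subseteq> d2" using c(2) d(3) by blast
    then have "d2 \<inter> L0 = {}" using cmin d by blast
    then show ?thesis using K1 d by blast
  qed
  have ex1: "\<exists>c2\<in>B. c2 \<inter> L0 = c \<inter> L0 \<and> K \<inter> c2 = {}"
  proof (cases "d1 \<inter> L0 = {}")
    case True
    then have "d2 \<inter> L0 \<noteq> {}" using c(3) d(3) by blast
    then show ?thesis using child[of d2 d1] d by (simp add: Un_commute Int_commute)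
  next
    case False
    then show ?thesis using child[of d1 d2] d by simp
  qed
  have "traces (L0 \<union> K) B = graft (traces L0 B) (c \<inter> L0) K"
  proof (rule trace_graft[OF c(3) _ ex1])
    fix d assume d: "d \<in> B" "d \<inter> L0 \<noteq> {}"
    show "(K \<subseteq> d \<and> c \<inter> L0 \<subseteq> d \<inter> L0) \<or> (K \<inter> d = {} \<and> \<not> c \<inter> L0 \<subset> d \<inter> L0)"
    proof (cases "K \<subseteq> d")
      case True
      then show ?thesis using cmin d by blast
    next
      case False
      then have Kd: "K \<inter> d = {}" using unsp[OF d] unfolding splits_def by blast
      have "\<not> c \<inter> L0 \<subset> d \<inter> L0"
      proof
        assume a: "c \<inter> L0 \<subset> d \<inter> L0"
        then have "c \<inter> d \<noteq> {}" using c(3) by blast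
        then have "c \<subseteq> d \<or> d \<subseteq> c" using hierarchy_laminar[OF B c(1) d(1)] by blast
        then show False using a Kd c(2) ne(1) by blast
      qed
      then show ?thesis using Kd by blast
    qed
  next
    show "\<exists>d\<in>B. d \<inter> L0 = c \<inter> L0 \<and> K \<subseteq> d" using c by blast
    fix S assume "S \<subseteq> K" "S \<noteq> {}"
    then obtain d where "d \<in> B" "d \<subseteq> Y" "d \<inter> K = S"
      using small_subset_cluster[OF B ne(3,4,5) Y] by blast
    then show "\<exists>d\<in>B. d \<inter> L0 = {} \<and> d \<inter> K = S" using YL0 by blast
  qed
  moreover have "c \<inter> L0 \<in> traces L0 B" using c unfolding traces_def by blast
  ultimately show ?thesis by blast
qed

lemma trace_regraft:
  assumes Y: "Y \<inter> L0 = {}" and D: "D \<in> C"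
  shows "traces L0 (regraft C Y D) = traces L0 C"
proof
  show "traces L0 (regraft C Y D) \<subseteq> traces L0 C"
  proof
    fix S assume "S \<in> traces L0 (regraft C Y D)"
    then obtain c where c: "c \<in> regraft C Y D" "S = c \<inter> L0" "S \<noteq> {}" unfolding traces_def by blast
    then have "\<exists>d\<in>C. c \<inter> L0 = d \<inter> L0"
      using Y D unfolding regraft_def by (elim UnE) (blast+)
    then show "S \<in> traces L0 C" using c unfolding traces_def by blast
  qed
  show "traces L0 C \<subseteq> traces L0 (regraft C Y D)"
  proof
    fix S assume "S \<in> traces L0 C"
    then obtain c where c: "c \<in> C" "S = c \<inter> L0" "S \<noteq> {}" unfolding traces_def by blast
    have "\<exists>d\<in>regraft C Y D. d \<inter> L0 = c \<inter> L0"
    proof (cases "D \<subseteq> c")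
      case True
      then have "c \<union> Y \<in> regraft C Y D" using c(1) unfolding regraft_def by blast
      moreover have "(c \<union> Y) \<inter> L0 = c \<inter> L0" using Y by blast
      ultimately show ?thesis by blast
    next
      case False
      have "\<not> c \<subseteq> Y" using c(2,3) Y by blast
      then have "c - Y \<in> regraft C Y D" using c(1) False unfolding regraft_def by blast
      moreover have "(c - Y) \<inter> L0 = c \<inter> L0" using Y by blast
      ultimately show ?thesis by blast
    qed
    then show "S \<in> traces L0 (regraft C Y D)" using c unfolding traces_def by blast
  qed
qed

lemma regraft_trace_graft:
  assumes C: "binary_hierarchy L C" and an: "anchored L0 \<K> C" and K: "K \<in> \<K>" and dj: "disjoint \<K>"
    and ne: "K \<noteq> {}" "K \<inter> L0 = {}" "K \<subseteq> L" "finite K" "card K \<le> 2"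
    and Y: "is_hull C K Y" and D: "D \<in> C" "D \<inter> L0 \<noteq> {}"
  shows "traces (L0 \<union> K) (regraft C Y D) = graft (traces L0 C) (D \<inter> L0) K"
proof -
  have YL0: "Y \<inter> L0 = {}" by (rule hull_unsplit(1)[OF C an K dj ne(1,2) Y])
  have KY: "K \<subseteq> Y" "Y \<in> C" using Y unfolding is_hull_def by auto
  have "traces (L0 \<union> K) (regraft C Y D) = graft (traces L0 (regraft C Y D)) (D \<inter> L0) K"
  proof (rule trace_graft[OF D(2)])
    have "D - Y \<in> regraft C Y D" unfolding regraft_def by blast
    moreover have "(D - Y) \<inter> L0 = D \<inter> L0" "K \<inter> (D - Y) = {}" using YL0 KY by blast+
    ultimately show "\<exists>c\<in>regraft C Y D. c \<inter> L0 = D \<inter> L0 \<and> K \<inter> c = {}" by blast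
    have "D \<union> Y \<in> regraft C Y D" using D(1) unfolding regraft_def by blast
    moreover have "(D \<union> Y) \<inter> L0 = D \<inter> L0" "K \<subseteq> D \<union> Y" using YL0 KY by blast+
    ultimately show "\<exists>c\<in>regraft C Y D. c \<inter> L0 = D \<inter> L0 \<and> K \<subseteq> c" by blast
  next
    fix S assume "S \<subseteq> K" "S \<noteq> {}"
    then obtain c where c: "c \<in> C" "c \<subseteq> Y" "c \<inter> K = S"
      using small_subset_cluster[OF C ne(3,4,5) Y] by blast
    then have "c \<in> regraft C Y D" unfolding regraft_def by blast
    then show "\<exists>c\<in>regraft C Y D. c \<inter> L0 = {} \<and> c \<inter> K = S" using c YL0 by blast
  next
    fix c' assume c': "c' \<in> regraft C Y D" "c' \<inter> L0 \<noteq> {}"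
    then consider "c' \<subseteq> Y" | c where "c' = c - Y" "c \<in> C" "\<not> D \<subseteq> c"
      | c where "c' = c \<union> Y" "c \<in> C" "D \<subseteq> c" | "c' = D - Y" unfolding regraft_def by blast
    then show "(K \<subseteq> c' \<and> D \<inter> L0 \<subseteq> c' \<inter> L0) \<or> (K \<inter> c' = {} \<and> \<not> D \<inter> L0 \<subset> c' \<inter> L0)"
    proof cases
      case 1
      then show ?thesis using c'(2) YL0 by blast
    next
      case 2
      have "c \<subseteq> D \<or> c \<inter> D = {}" using hierarchy_laminar[OF C 2(2) D(1)] 2(3) by blast
      then have "\<not> D \<inter> L0 \<subset> c' \<inter> L0" using 2(1) D(2) by blast
      then show ?thesis using 2(1) KY by blast
    next
      case 3
      then show ?thesis using KY by blast
    next
      case 4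
      then show ?thesis using KY by blast
    qed
  qed
  then show ?thesis using trace_regraft[OF YL0 D(1)] by simp
qed

lemma anchored_regraft:
  assumes C: "binary_hierarchy L C" and an: "anchored L0 \<K> C" and K: "K \<in> \<K>" and dj: "disjoint \<K>"
    and ne: "K \<noteq> {}" "K \<inter> L0 = {}" and KL: "\<And>K. K \<in> \<K> \<Longrightarrow> K \<subseteq> L"
    and Y: "is_hull C K Y" and D: "D \<in> C" "D \<inter> L0 \<noteq> {} \<or> D = L"
  shows "anchored (L0 \<union> K) (\<K> - {K}) (regraft C Y D)"
proof -
  have YL0: "Y \<inter> L0 = {}" by (rule hull_unsplit(1)[OF C an K dj ne Y])
  have KY: "K \<subseteq> Y" "Y \<in> C" and hull: "\<And>c. c \<in> C \<Longrightarrow> K \<subseteq> c \<Longrightarrow> Y \<subseteq> c"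
    using Y unfolding is_hull_def by auto
  have Yun: "K' \<subseteq> Y \<or> K' \<inter> Y = {}" if "K' \<in> \<K>" for K'
    using hull_unsplit(2)[OF C an K dj ne Y that] unfolding splits_def by blast
  have an1: "K1 = K2" if "c \<in> C" "K1 \<in> \<K>" "K2 \<in> \<K>" "splits c K1" "splits c K2" for c K1 K2
    using an that unfolding anchored_def compatible_def by metis
  have an2: "\<not> splits c K'" if "c \<in> C" "c \<inter> L0 \<noteq> {}" "K' \<in> \<K>" for c K'
    using an that unfolding anchored_def by metis
  have src: "\<exists>c\<in>C. (\<forall>K'\<in>\<K>. splits c' K' \<longrightarrow> splits c K') \<and>
      (c' \<inter> (L0 \<union> K) \<noteq> {} \<longrightarrow> c \<inter> L0 \<noteq> {} \<or> c = L \<or> (c \<inter> K \<noteq> {} \<and> c \<subseteq> Y))"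
    if c': "c' \<in> regraft C Y D" for c'
  proof -
    have minus: "splits c K'" if "splits (c - Y) K'" "K' \<in> \<K>" for c K'
      using that(1) Yun[OF that(2)] unfolding splits_def by blast
    have plus: "splits c K'" if "splits (c \<union> Y) K'" "K' \<in> \<K>" for c K'
      using that(1) Yun[OF that(2)] unfolding splits_def by blast
    from c' consider "c' \<in> C" "c' \<subseteq> Y" | c where "c' = c - Y" "c \<in> C"
      | c where "c' = c \<union> Y" "c \<in> C" "D \<subseteq> c" using D(1) unfolding regraft_def by blast
    then show ?thesis
    proof cases
      case 1
      then show ?thesis using YL0 by (intro bexI[of _ c']) blast+
    next
      case 2
      have "c' \<inter> (L0 \<union> K) \<noteq> {} \<longrightarrow> c \<inter> L0 \<noteq> {}" using 2(1) KY(1) by blast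
      then show ?thesis using minus 2 by (intro bexI[of _ c]) simp_all
    next
      case 3
      have "c \<inter> L0 \<noteq> {} \<or> c = L" using D(2) 3(3) hierarchy_subset[OF C 3(2)] by blast
      then show ?thesis using plus 3 by (intro bexI[of _ c]) simp_all
    qed
  qed
  show ?thesis unfolding anchored_def compatible_def
  proof (intro conjI ballI impI)
    fix c' K1 K2 assume a: "c' \<in> regraft C Y D" "K1 \<in> \<K> - {K}" "K2 \<in> \<K> - {K}" "splits c' K1" "splits c' K2"
    obtain c where "c \<in> C" "\<forall>K'\<in>\<K>. splits c' K' \<longrightarrow> splits c K'" using src[OF a(1)] by blast
    then show "K1 = K2" using an1[of c K1 K2] a by simp
  next
    fix c' K' assume a: "c' \<in> regraft C Y D" "c' \<inter> (L0 \<union> K) \<noteq> {}" "K' \<in> \<K> - {K}"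
    obtain c where c: "c \<in> C" "\<forall>K'\<in>\<K>. splits c' K' \<longrightarrow> splits c K'"
      "c \<inter> L0 \<noteq> {} \<or> c = L \<or> (c \<inter> K \<noteq> {} \<and> c \<subseteq> Y)" using src[OF a(1)] a(2) by blast
    have K': "K' \<in> \<K>" "K' \<noteq> K" using a(3) by auto
    have "\<not> splits c K'"
    proof -
      consider "c \<inter> L0 \<noteq> {}" | "c = L" | "c \<inter> K \<noteq> {}" "K \<subseteq> c" "c \<subseteq> Y" | "splits c K"
        using c(3) unfolding splits_def by blast
      then show ?thesis
      proof cases
        case 1
        then show ?thesis using an2 c(1) K' by blast
      next
        case 2
        then show ?thesis using KL K' unfolding splits_def by blast
      next
        case 3
        then have "c = Y" using hull c(1) by blast
        then show ?thesis using Yun[OF K'(1)] unfolding splits_def by blast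
      next
        case 4
        then show ?thesis using an1[OF c(1) K] K' by blast
      qed
    qed
    then show "\<not> splits c' K'" using c(2) K' by blast
  qed
qed

lemma anchored_top_component:
  assumes B: "binary_hierarchy L B" and an: "anchored L0 \<K> B" and K: "K \<in> \<K>"
    and h: "\<And>K. K \<in> \<K> \<Longrightarrow> is_hull B K (h K)"
    and mx: "\<And>K'. K' \<in> \<K> \<Longrightarrow> card (h K') \<le> card (h K)"
  shows "anchored (L0 \<union> K) (\<K> - {K}) B"
proof -
  have "compatible B (\<K> - {K})" using an unfolding anchored_def compatible_def by (meson DiffD1)
  moreover have "\<not> splits c K'" if c: "c \<in> B" "c \<inter> (L0 \<union> K) \<noteq> {}" "K' \<in> \<K> - {K}" for c K'
  proof
    assume s: "splits c K'"
    have K': "K' \<in> \<K>" "K' \<noteq> K" using c(3) by auto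
    have "c \<inter> L0 = {}" using an c(1) K' s unfolding anchored_def by metis
    moreover have "\<not> splits c K" using an c(1) K K' s unfolding anchored_def compatible_def by metis
    ultimately have "K \<subseteq> c" using c(2) unfolding splits_def by blast
    then have hc: "h K \<subseteq> c" using h[OF K] c(1) unfolding is_hull_def by blast
    have h': "h K' \<in> B" "K' \<subseteq> h K'" using h[OF K'(1)] unfolding is_hull_def by auto
    have "\<not> h K' \<subseteq> c" "c \<inter> h K' \<noteq> {}" using h'(2) s unfolding splits_def by blast+
    then have "c \<subset> h K'" using hierarchy_laminar[OF B c(1) h'(1)] by blast
    then have "h K \<subset> h K'" using hc by blast
    moreover have "finite (h K')" using h'(1) hierarchy_subset[OF B] hierarchy_finite[OF B] finite_subset by blast
    ultimately have "card (h K) < card (h K')" using psubset_card_mono by blast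
    then show False using mx[OF K'(1)] by simp
  qed
  ultimately show ?thesis unfolding anchored_def by blast
qed

lemma trace_empty_graft:
  assumes C: "binary_hierarchy L C" and K: "K \<noteq> {}" "K \<subseteq> L" "finite K" "card K \<le> 2"
  shows "traces K C = Pow K - {{}}"
proof -
  obtain Y where Y: "is_hull C K Y" using hull_exists[OF C K(1,2)] by blast
  have "S \<in> traces K C" if S: "S \<in> Pow K - {{}}" for S
  proof -
    obtain c where "c \<in> C" "c \<inter> K = S" using small_subset_cluster[OF C K(2-4) Y, of S] S by blast
    then show ?thesis using S unfolding traces_def by blast
  qed
  moreover have "S \<in> Pow K - {{}}" if "S \<in> traces K C" for S using that unfolding traces_def by blast
  ultimately show ?thesis by blast
qed

text \<open>The components are attached to the part already built in the order in which they
  occur in the target tree, starting from its root.\<close>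

lemma regraft_chain:
  assumes H: "\<And>C. C \<in> \<H> \<Longrightarrow> binary_hierarchy L C"
    and mv: "\<And>C Y D. C \<in> \<H> \<Longrightarrow> Y \<in> C \<Longrightarrow> D \<in> C \<Longrightarrow> \<not> D \<subseteq> Y \<Longrightarrow>
      regraft C Y D \<in> \<H> \<and> (regraft C Y D = C \<or> (C, regraft C Y D) \<in> M)"
    and B: "B \<in> \<H>"
    and "C \<in> \<H>" "finite \<K>" "disjoint \<K>" "\<And>K. K \<in> \<K> \<Longrightarrow> K \<noteq> {} \<and> card K \<le> 2"
      "L0 \<inter> \<Union>\<K> = {}" "L0 \<union> \<Union>\<K> = L" "anchored L0 \<K> C" "anchored L0 \<K> B"
      "traces L0 C = traces L0 B"
  shows "\<exists>k\<le>card \<K>. (C, B) \<in> M ^^ k"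
  using assms(4-)
proof (induction "card \<K>" arbitrary: \<K> C L0)
  case 0
  then have L0: "L0 = L" by simp
  have "traces L C' = C'" if "C' \<in> \<H>" for C'
  proof -
    have "c \<inter> L = c" "c \<noteq> {}" if "c \<in> C'" for c
      using hierarchy_subset[OF H[OF \<open>C' \<in> \<H>\<close>] that] hierarchy_nonempty[OF H[OF \<open>C' \<in> \<H>\<close>] that] by blast+
    then show ?thesis unfolding traces_def by auto
  qed
  then have "C = B" using 0 B L0 by metis
  then show ?case by (intro exI[of _ 0]) simp
next
  case (Suc n)
  note an = Suc.prems(7,8)
  have bhB: "binary_hierarchy L B" and bhC: "binary_hierarchy L C" using H B Suc.prems(1) by auto
  have KL: "\<And>K. K \<in> \<K> \<Longrightarrow> K \<subseteq> L" and L0L: "L0 \<subseteq> L" using Suc.prems(6) by blast+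
  have Kfin: "\<And>K. K \<in> \<K> \<Longrightarrow> finite K" using KL hierarchy_finite[OF bhB] finite_subset by blast
  have KL0: "\<And>K. K \<in> \<K> \<Longrightarrow> K \<inter> L0 = {}" using Suc.prems(5) by blast
  have "\<forall>K\<in>\<K>. \<exists>Y. is_hull B K Y"
  proof
    fix K assume "K \<in> \<K>"
    then show "\<exists>Y. is_hull B K Y" using hull_exists[OF bhB, of K] KL[of K] Suc.prems(4)[of K] by simp
  qed
  then obtain h where h: "\<And>K. K \<in> \<K> \<Longrightarrow> is_hull B K (h K)" by metis
  have "\<K> \<noteq> {}" using Suc.hyps(2) by auto
  then obtain K where K: "K \<in> \<K>" and Kmax: "Max ((\<lambda>K. card (h K)) ` \<K>) = card (h K)"
    by (rule obtains_MAX[OF Suc.prems(2)])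
  have mx: "card (h K') \<le> card (h K)" if "K' \<in> \<K>" for K'
    unfolding Kmax[symmetric] using Suc.prems(2) that by (intro Max_ge) auto
  have K2: "K \<noteq> {}" "card K \<le> 2" using Suc.prems(4)[OF K] by auto
  have anB: "anchored (L0 \<union> K) (\<K> - {K}) B"
    by (rule anchored_top_component[OF bhB an(2) K h mx])
  obtain Y where Y: "is_hull C K Y" using hull_exists[OF bhC K2(1) KL[OF K]] by blast
  have YC: "Y \<in> C" "K \<subseteq> Y" using Y unfolding is_hull_def by auto
  have "\<exists>C'\<in>\<H>. (C' = C \<or> (C, C') \<in> M) \<and> anchored (L0 \<union> K) (\<K> - {K}) C' \<and>
    traces (L0 \<union> K) C' = traces (L0 \<union> K) B"
  proof (cases "L0 = {}")
    case True
    have tr: "traces (L0 \<union> K) C' = Pow K - {{}}" if "C' \<in> \<H>" for C'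
      using trace_empty_graft[OF H[OF that] K2(1) KL[OF K] Kfin[OF K] K2(2)] True by simp
    show ?thesis
    proof (cases "L \<subseteq> Y")
      case False
      have D: "L \<in> C" "L \<inter> L0 \<noteq> {} \<or> L = L" using hierarchy_top[OF bhC] by auto
      have "anchored (L0 \<union> K) (\<K> - {K}) (regraft C Y L)"
        by (rule anchored_regraft[OF bhC an(1) K Suc.prems(3) K2(1) KL0[OF K] KL Y D])
      then show ?thesis using mv[OF Suc.prems(1) YC(1) D(1) False] tr B by metis
    next
      case True2: True
      have YL: "Y = L" using True2 hierarchy_subset[OF bhC YC(1)] by blast
      have "\<not> splits c K'" if c: "c \<in> C" "c \<inter> (L0 \<union> K) \<noteq> {}" "K' \<in> \<K> - {K}" for c K'
      proof (cases "K \<subseteq> c")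
        case True3: True
        then have "L \<subseteq> c" using Y c(1) YL unfolding is_hull_def by blast
        then show ?thesis using KL[of K'] c(3) unfolding splits_def by blast
      next
        case False
        then have "splits c K" using c(2) True unfolding splits_def by blast
        then show ?thesis using an(1) c(1,3) K unfolding anchored_def compatible_def by (metis DiffD1 DiffD2 singletonI)
      qed
      moreover have "compatible C (\<K> - {K})" using an(1) unfolding anchored_def compatible_def by (meson DiffD1)
      ultimately have "anchored (L0 \<union> K) (\<K> - {K}) C" unfolding anchored_def by blast
      then show ?thesis using tr Suc.prems(1) B by metis
    qed
  next
    case False
    obtain E where E: "E \<in> traces L0 B" "traces (L0 \<union> K) B = graft (traces L0 B) E K"
      using anchored_trace_graft[OF bhB an(2) K Suc.prems(3) K2(1) KL0[OF K] KL[OF K] Kfin[OF K] K2(2) False L0L]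
      by blast
    then have "E \<in> traces L0 C" using Suc.prems(9) by simp
    then obtain D where D: "D \<in> C" "D \<inter> L0 = E" "E \<noteq> {}" unfolding traces_def by blast
    have Dne: "D \<inter> L0 \<noteq> {}" "D \<inter> L0 \<noteq> {} \<or> D = L" using D by auto
    have "Y \<inter> L0 = {}" by (rule hull_unsplit(1)[OF bhC an(1) K Suc.prems(3) K2(1) KL0[OF K] Y])
    then have DY: "\<not> D \<subseteq> Y" using D by blast
    have "anchored (L0 \<union> K) (\<K> - {K}) (regraft C Y D)"
      by (rule anchored_regraft[OF bhC an(1) K Suc.prems(3) K2(1) KL0[OF K] KL Y D(1) Dne(2)])
    moreover have "traces (L0 \<union> K) (regraft C Y D) = traces (L0 \<union> K) B"
      using regraft_trace_graft[OF bhC an(1) K Suc.prems(3) K2(1) KL0[OF K] KL[OF K] Kfin[OF K] K2(2) Y D(1) Dne(1)]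
        E(2) D(2) Suc.prems(9) by simp
    ultimately show ?thesis using mv[OF Suc.prems(1) YC(1) D(1) DY] by blast
  qed
  then obtain C' where C': "C' \<in> \<H>" "C' = C \<or> (C, C') \<in> M" "anchored (L0 \<union> K) (\<K> - {K}) C'"
    "traces (L0 \<union> K) C' = traces (L0 \<union> K) B" by blast
  have n: "n = card (\<K> - {K})" using Suc.hyps(2) K by simp
  have dK: "K' \<inter> K = {}" if "K' \<in> \<K> - {K}" for K'
    using that K Suc.prems(3) unfolding disjoint_def by blast
  have "\<exists>k\<le>card (\<K> - {K}). (C', B) \<in> M ^^ k"
  proof (rule Suc.hyps(1)[OF n C'(1) _ _ _ _ _ C'(3) anB C'(4)])
    show "finite (\<K> - {K})" using Suc.prems(2) by simp
    show "disjoint (\<K> - {K})" using Suc.prems(3) unfolding disjoint_def by blast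
    show "\<And>K'. K' \<in> \<K> - {K} \<Longrightarrow> K' \<noteq> {} \<and> card K' \<le> 2" using Suc.prems(4) by blast
    have "L0 \<inter> \<Union>(\<K> - {K}) = {}" using Suc.prems(5) by blast
    moreover have "K \<inter> \<Union>(\<K> - {K}) = {}" using dK by blast
    ultimately show "(L0 \<union> K) \<inter> \<Union>(\<K> - {K}) = {}" by blast
    have "\<Union>\<K> = K \<union> \<Union>(\<K> - {K})" using K by blast
    then show "L0 \<union> K \<union> \<Union>(\<K> - {K}) = L" using Suc.prems(6) by blast
  qed
  then obtain k where k: "k \<le> n" "(C', B) \<in> M ^^ k" using n by blast
  show ?case
  proof (cases "C' = C")
    case True
    then show ?thesis using k Suc.hyps(2) by (intro exI[of _ k]) simp
  next
    case False
    then have "(C, B) \<in> M ^^ Suc k" using C'(2) k(2) relpow_Suc_I2 by metis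
    then show ?thesis using k(1) Suc.hyps(2) by (intro exI[of _ "Suc k"]) simp
  qed
qed

section \<open>Counting permutations\<close>

lemma card_permutes_map_le:
  assumes "finite L" "distinct xs" "set xs \<subseteq> L"
  shows "card {\<sigma>. \<sigma> permutes L \<and> map \<sigma> xs = ys} \<le> fact (card L - length xs)"
proof (cases "{\<sigma>. \<sigma> permutes L \<and> map \<sigma> xs = ys} = {}")
  case True
  show ?thesis unfolding True by simp
next
  case False
  then obtain \<rho> where \<rho>: "\<rho> permutes L" "map \<rho> xs = ys" by blast
  let ?T = "{\<tau>. \<tau> permutes (L - set xs)}"
  have "{\<sigma>. \<sigma> permutes L \<and> map \<sigma> xs = ys} \<subseteq> (\<lambda>\<tau>. \<rho> \<circ> \<tau>) ` ?T"
  proof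
    fix \<sigma> assume "\<sigma> \<in> {\<sigma>. \<sigma> permutes L \<and> map \<sigma> xs = ys}"
    then have \<sigma>: "\<sigma> permutes L" "map \<sigma> xs = ys" by auto
    let ?\<tau> = "inv \<rho> \<circ> \<sigma>"
    have "?\<tau> permutes L" using \<sigma>(1) \<rho>(1) by (simp add: permutes_compose permutes_inv)
    moreover have "?\<tau> x = x" if "x \<in> set xs" for x
    proof -
      have "\<sigma> x = \<rho> x" using \<sigma>(2) \<rho>(2) that by (metis map_eq_conv)
      then show ?thesis using \<rho>(1) by (simp add: permutes_inverses)
    qed
    ultimately have "?\<tau> permutes (L - set xs)" unfolding permutes_def by (metis DiffI)
    moreover have "\<sigma> = \<rho> \<circ> ?\<tau>" using permutes_inverses(1)[OF \<rho>(1)] by (simp add: fun_eq_iff)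
    ultimately show "\<sigma> \<in> (\<lambda>\<tau>. \<rho> \<circ> \<tau>) ` ?T" by blast
  qed
  then have "card {\<sigma>. \<sigma> permutes L \<and> map \<sigma> xs = ys} \<le> card ?T"
    using assms(1) by (intro surj_card_le) (auto intro: finite_permutations)
  also have "\<dots> = fact (card (L - set xs))"
    using assms(1) by (simp add: card_permutations)
  also have "card (L - set xs) = card L - length xs"
    using assms by (simp add: card_Diff_subset distinct_card)
  finally show ?thesis .
qed

lemma card_permutes_map_in_le:
  assumes "finite L" "distinct xs" "set xs \<subseteq> L" "finite T"
  shows "card {\<sigma>. \<sigma> permutes L \<and> map \<sigma> xs \<in> T} \<le> card T * fact (card L - length xs)"
proof -
  have "{\<sigma>. \<sigma> permutes L \<and> map \<sigma> xs \<in> T} = (\<Union>ys\<in>T. {\<sigma>. \<sigma> permutes L \<and> map \<sigma> xs = ys})" by blast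
  then have "card {\<sigma>. \<sigma> permutes L \<and> map \<sigma> xs \<in> T} \<le> (\<Sum>ys\<in>T. card {\<sigma>. \<sigma> permutes L \<and> map \<sigma> xs = ys})"
    using card_UN_le[OF assms(4)] by simp
  also have "\<dots> \<le> (\<Sum>ys\<in>T. fact (card L - length xs))"
    by (intro sum_mono card_permutes_map_le assms)
  finally show ?thesis by simp
qed

lemma card_permutes_pair:
  assumes "finite L" "x \<in> L" "y \<in> L" "x \<noteq> y" "u \<in> L" "v \<in> L" "u \<noteq> v"
  shows "card {\<sigma>. \<sigma> permutes L \<and> \<sigma> x = u \<and> \<sigma> y = v} = fact (card L - 2)"
proof -
  let ?T = "{\<tau>. \<tau> permutes (L - {x, y})}"
  let ?\<alpha> = "Transposition.transpose x u"
  let ?\<rho> = "Transposition.transpose (?\<alpha> y) v \<circ> ?\<alpha>"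
  have "?\<alpha> permutes L" using assms by (simp add: permutes_swap_id)
  moreover have "?\<alpha> y \<in> L" using assms by (metis calculation permutes_in_image)
  ultimately have \<rho>: "?\<rho> permutes L" using assms by (metis permutes_compose permutes_swap_id)
  have "?\<alpha> y \<noteq> u" using assms(4) by (auto simp: Transposition.transpose_def)
  then have \<rho>x: "?\<rho> x = u" using assms(7) by (simp add: Transposition.transpose_def)
  have \<rho>y: "?\<rho> y = v" by simp
  have "{\<sigma>. \<sigma> permutes L \<and> \<sigma> x = u \<and> \<sigma> y = v} = (\<lambda>\<tau>. ?\<rho> \<circ> \<tau>) ` ?T"
  proof
    show "{\<sigma>. \<sigma> permutes L \<and> \<sigma> x = u \<and> \<sigma> y = v} \<subseteq> (\<lambda>\<tau>. ?\<rho> \<circ> \<tau>) ` ?T"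
    proof
      fix \<sigma> assume "\<sigma> \<in> {\<sigma>. \<sigma> permutes L \<and> \<sigma> x = u \<and> \<sigma> y = v}"
      then have \<sigma>: "\<sigma> permutes L" "\<sigma> x = u" "\<sigma> y = v" by auto
      let ?\<tau> = "inv ?\<rho> \<circ> \<sigma>"
      have "?\<tau> permutes L" using \<sigma>(1) \<rho> by (simp add: permutes_compose permutes_inv)
      moreover have "?\<tau> x = x" "?\<tau> y = y"
        using \<sigma> \<rho>x \<rho>y permutes_inverses(2)[OF \<rho>] unfolding o_apply by metis+
      ultimately have "?\<tau> permutes (L - {x, y})" unfolding permutes_def by (metis DiffI insertE singletonD)
      moreover have "\<sigma> = ?\<rho> \<circ> ?\<tau>" using permutes_inverses(1)[OF \<rho>] by (simp add: fun_eq_iff)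
      ultimately show "\<sigma> \<in> (\<lambda>\<tau>. ?\<rho> \<circ> \<tau>) ` ?T" by blast
    qed
    show "(\<lambda>\<tau>. ?\<rho> \<circ> \<tau>) ` ?T \<subseteq> {\<sigma>. \<sigma> permutes L \<and> \<sigma> x = u \<and> \<sigma> y = v}"
    proof
      fix \<sigma> assume "\<sigma> \<in> (\<lambda>\<tau>. ?\<rho> \<circ> \<tau>) ` ?T"
      then obtain \<tau> where \<tau>: "\<tau> permutes (L - {x, y})" "\<sigma> = ?\<rho> \<circ> \<tau>" by blast
      then have "\<tau> permutes L" by (meson Diff_subset permutes_subset)
      then have "\<sigma> permutes L" using \<tau>(2) \<rho> permutes_compose by metis
      moreover have "\<tau> x = x" "\<tau> y = y" using \<tau>(1) by (simp_all add: permutes_def)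
      ultimately show "\<sigma> \<in> {\<sigma>. \<sigma> permutes L \<and> \<sigma> x = u \<and> \<sigma> y = v}"
        using \<tau>(2) \<rho>x \<rho>y by simp
    qed
  qed
  moreover have "inj_on (\<lambda>\<tau>. ?\<rho> \<circ> \<tau>) ?T"
  proof (rule inj_onI)
    fix a b assume "?\<rho> \<circ> a = ?\<rho> \<circ> b"
    then have "inv ?\<rho> \<circ> (?\<rho> \<circ> a) = inv ?\<rho> \<circ> (?\<rho> \<circ> b)" by simp
    then show "a = b" using permutes_inv_o(2)[OF \<rho>] by (simp add: o_assoc del: o_apply)
  qed
  ultimately have "card {\<sigma>. \<sigma> permutes L \<and> \<sigma> x = u \<and> \<sigma> y = v} = card ?T" by (simp add: card_image)
  also have "\<dots> = fact (card (L - {x, y}))" using assms(1) by (simp add: card_permutations)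
  also have "card (L - {x, y}) = card L - 2" using assms by (simp add: card_Diff_subset)
  finally show ?thesis .
qed

definition upair :: "'a \<times> 'a \<Rightarrow> 'a set" where "upair = (\<lambda>(a, b). {a, b})"

lemma pairing_enum:
  assumes "finite P" "pairing P"
  shows "\<exists>ps. length ps = card P \<and> distinct (map upair ps) \<and> set (map upair ps) = P \<and>
    distinct (concat (map (\<lambda>(a, b). [a, b]) ps))"
  using assms
proof (induction rule: finite_induct)
  case empty
  then show ?case by simp
next
  case (insert p P)
  then have P: "pairing P" unfolding pairing_def disjoint_def by auto
  then obtain ps where ps: "length ps = card P" "distinct (map upair ps)" "set (map upair ps) = P"
    "distinct (concat (map (\<lambda>(a, b). [a, b]) ps))" using insert.IH by blast
  have "card p = 2" using insert.prems unfolding pairing_def by simp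
  then obtain a b where ab: "p = {a, b}" "a \<noteq> b" by (meson card_2_iff)
  have out: "p \<inter> q = {}" if "q \<in> P" for q
    using insert.prems insert.hyps that unfolding pairing_def disjoint_def by (metis insertCI)
  have st: "set (concat (map (\<lambda>(a, b). [a, b]) ps)) = \<Union>P"
    unfolding ps(3)[symmetric] by (auto simp: upair_def)
  have "a \<notin> \<Union>P" "b \<notin> \<Union>P" using out ab by blast+
  then have "distinct (concat (map (\<lambda>(a, b). [a, b]) ((a, b) # ps)))"
    using ps(4) ab(2) st by simp
  moreover have "p \<notin> set (map upair ps)" using insert.hyps ps(3) by simp
  ultimately show ?case
    using ps insert.hyps ab by (intro exI[of _ "(a, b) # ps"]) (simp add: upair_def)
qed

lemma card_permutes_pairing_le:
  fixes L :: "nat set"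
  assumes L: "finite L" and P: "pairing P" "finite P" and Q: "pairing Q" "\<Union>Q \<subseteq> L" "card Q = card P" "finite Q"
  shows "card {\<sigma>. \<sigma> permutes L \<and> (`) \<sigma> ` Q = P} \<le> 2 ^ card P * fact (card P) * fact (card L - 2 * card P)"
proof -
  let ?m = "card P"
  let ?fl = "\<lambda>ps :: (nat \<times> nat) list. concat (map (\<lambda>(a, b). [a, b]) ps)"
  obtain ps where ps: "length ps = ?m" "distinct (map upair ps)" "set (map upair ps) = Q" "distinct (?fl ps)"
    using pairing_enum[OF Q(4,1)] Q(3) by metis
  have len: "length (?fl ws) = 2 * length ws" for ws :: "(nat \<times> nat) list"
    by (induction ws) auto
  have sfl: "set (?fl ps) \<subseteq> L"
  proof -
    have "set (?fl ps) = \<Union>(set (map upair ps))" by (auto simp: upair_def)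
    then show ?thesis using ps(3) Q(2) by simp
  qed
  let ?W = "{ws :: (nat \<times> nat) list. length ws = ?m \<and> distinct (map upair ws) \<and> set (map upair ws) \<subseteq> P}"
  let ?g = "\<lambda>ws :: (nat \<times> nat) list. (map upair ws, map (\<lambda>(a, b). a < b) ws)"
  let ?X = "{ds. length ds = ?m \<and> distinct ds \<and> set ds \<subseteq> P} \<times> {bs :: bool list. set bs \<subseteq> UNIV \<and> length bs = ?m}"
  have X: "finite ?X" "card ?X = fact ?m * 2 ^ ?m"
  proof -
    have "finite {ds. length ds = ?m \<and> distinct ds \<and> set ds \<subseteq> P}"
      using finite_lists_length_eq[OF P(2), of ?m] by (rule finite_subset[rotated]) auto
    then show "finite ?X" using finite_lists_length_eq[of "UNIV :: bool set" ?m] by (simp add: conj_commute)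
    have "card {ds. length ds = ?m \<and> distinct ds \<and> set ds \<subseteq> P} = fact ?m"
      using card_lists_distinct_length_eq[OF P(2), of ?m] by (simp add: fact_prod)
    then show "card ?X = fact ?m * 2 ^ ?m"
      using card_lists_length_eq[of "UNIV :: bool set" ?m] by (simp add: card_cartesian_product)
  qed
  have inj: "inj_on ?g ?W"
  proof (rule inj_onI)
    fix v w assume v: "v \<in> ?W" and w: "w \<in> ?W" and eq: "?g v = ?g w"
    show "v = w"
    proof (rule nth_equalityI)
      show "length v = length w" using v w by simp
      fix i assume i: "i < length v"
      obtain a b where ab: "v ! i = (a, b)" by (cases "v ! i")
      obtain c d where cd: "w ! i = (c, d)" by (cases "w ! i")
      have iw: "i < length w" using i v w by simp
      have e1: "upair (v ! i) = upair (w ! i)" using eq i iw by (metis Pair_inject nth_map)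
      have e2: "(a < b) = (c < d)" using eq i iw ab cd
        by (metis (mono_tags, lifting) Pair_inject case_prod_conv nth_map)
      show "v ! i = w ! i" using e1 e2 ab cd by (auto simp: upair_def doubleton_eq_iff)
    qed
  qed
  have sub: "?g ` ?W \<subseteq> ?X" by auto
  have finW: "finite ?W" using inj sub X(1) by (meson finite_imageD finite_subset)
  have cardW: "card ?W \<le> fact ?m * 2 ^ ?m" using card_inj_on_le[OF inj sub X(1)] X(2) by simp
  have "{\<sigma>. \<sigma> permutes L \<and> (`) \<sigma> ` Q = P} \<subseteq> {\<sigma>. \<sigma> permutes L \<and> map \<sigma> (?fl ps) \<in> ?fl ` ?W}"
  proof
    fix \<sigma> assume "\<sigma> \<in> {\<sigma>. \<sigma> permutes L \<and> (`) \<sigma> ` Q = P}"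
    then have \<sigma>: "\<sigma> permutes L" "(`) \<sigma> ` Q = P" by auto
    let ?ws = "map (\<lambda>(a, b). (\<sigma> a, \<sigma> b)) ps"
    have mu: "map upair ?ws = map ((`) \<sigma>) (map upair ps)" by (auto simp: upair_def)
    have "inj ((`) \<sigma>)" using \<sigma>(1) by (meson inj_image_eq_iff injI permutes_inj)
    then have "distinct (map upair ?ws)" unfolding mu
      using ps(2) inj_on_subset[OF _ subset_UNIV] by (subst distinct_map) blast
    moreover have "set (map upair ?ws) = P" unfolding mu using \<sigma>(2) ps(3) by (metis set_map)
    ultimately have "?ws \<in> ?W" using ps(1) by (simp add: image_image)
    moreover have "map \<sigma> (?fl ps) = ?fl ?ws" by (simp add: map_concat o_def case_prod_unfold)
    ultimately show "\<sigma> \<in> {\<sigma>. \<sigma> permutes L \<and> map \<sigma> (?fl ps) \<in> ?fl ` ?W}" using \<sigma>(1) by blast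
  qed
  then have "card {\<sigma>. \<sigma> permutes L \<and> (`) \<sigma> ` Q = P} \<le> card {\<sigma>. \<sigma> permutes L \<and> map \<sigma> (?fl ps) \<in> ?fl ` ?W}"
    using L by (intro card_mono) (auto intro: finite_subset[OF _ finite_permutations[OF L]])
  also have "\<dots> \<le> card (?fl ` ?W) * fact (card L - length (?fl ps))"
    using finW by (intro card_permutes_map_in_le L ps(4) sfl) simp
  also have "\<dots> \<le> (fact ?m * 2 ^ ?m) * fact (card L - 2 * ?m)"
    unfolding len ps(1) using card_image_le[OF finW, of ?fl] cardW by (intro mult_right_mono) auto
  finally show ?thesis by (simp add: mult.commute)
qed

definition same :: "'a set set \<Rightarrow> 'a \<Rightarrow> 'a \<Rightarrow> bool" where
  "same \<P> x y \<longleftrightarrow> (\<exists>p\<in>\<P>. x \<in> p \<and> y \<in> p)"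

definition doubles :: "nat set set \<Rightarrow> nat set set \<Rightarrow> (nat \<Rightarrow> nat) \<Rightarrow> (nat \<times> nat) set" where
  "doubles \<P> \<Q> \<sigma> = {(x, y). x < y \<and> same \<P> x y \<and> same \<Q> (\<sigma> x) (\<sigma> y)}"

definition isolated :: "nat set set \<Rightarrow> nat set set \<Rightarrow> (nat \<Rightarrow> nat) \<Rightarrow> (nat \<times> nat) set" where
  "isolated \<P> \<Q> \<sigma> = {d \<in> doubles \<P> \<Q> \<sigma>. \<forall>e\<in>doubles \<P> \<Q> \<sigma>.
     same \<P> (fst d) (fst e) \<or> same \<Q> (\<sigma> (fst d)) (\<sigma> (fst e)) \<longrightarrow> e = d}"

definition tuples :: "nat \<Rightarrow> 'a set set \<Rightarrow> 'a list set" where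
  "tuples k \<P> = {xs. length xs = k \<and> (\<exists>p\<in>\<P>. set xs \<subseteq> p)}"

definition two_pairs :: "'a set set \<Rightarrow> 'a list set" where
  "two_pairs \<P> = (\<lambda>(xs, ys). xs @ ys) ` (tuples 2 \<P> \<times> tuples 2 \<P>)"

lemma card_tuples_le:
  assumes "finite \<P>" "\<And>p. p \<in> \<P> \<Longrightarrow> finite p \<and> card p = r"
  shows "finite (tuples k \<P>)" "card (tuples k \<P>) \<le> card \<P> * r ^ k"
proof -
  have eq: "tuples k \<P> = (\<Union>p\<in>\<P>. {xs. set xs \<subseteq> p \<and> length xs = k})" unfolding tuples_def by blast
  show "finite (tuples k \<P>)" unfolding eq using assms by (auto intro: finite_lists_length_eq)
  have "card (tuples k \<P>) \<le> (\<Sum>p\<in>\<P>. card {xs. set xs \<subseteq> p \<and> length xs = k})"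
    unfolding eq by (rule card_UN_le[OF assms(1)])
  also have "\<dots> = (\<Sum>p\<in>\<P>. r ^ k)" using assms by (intro sum.cong) (simp_all add: card_lists_length_eq)
  finally show "card (tuples k \<P>) \<le> card \<P> * r ^ k" by simp
qed

lemma card_two_pairs_le:
  assumes "finite \<P>" "\<And>p. p \<in> \<P> \<Longrightarrow> finite p \<and> card p = r"
  shows "finite (two_pairs \<P>)" "card (two_pairs \<P>) \<le> (card \<P> * r ^ 2) ^ 2"
proof -
  have f: "finite (tuples 2 \<P> \<times> tuples 2 \<P>)" using card_tuples_le(1)[OF assms] by simp
  then show "finite (two_pairs \<P>)" unfolding two_pairs_def by simp
  have "card (two_pairs \<P>) \<le> card (tuples 2 \<P> \<times> tuples 2 \<P>)" unfolding two_pairs_def by (rule card_image_le[OF f])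
  also have "\<dots> = card (tuples 2 \<P>) * card (tuples 2 \<P>)" by (rule card_cartesian_product)
  also have "\<dots> \<le> (card \<P> * r ^ 2) * (card \<P> * r ^ 2)" by (intro mult_mono card_tuples_le(2)[OF assms]) auto
  finally show "card (two_pairs \<P>) \<le> (card \<P> * r ^ 2) ^ 2" by (simp add: power2_eq_square)
qed

lemma sum_card_permutes_map_le:
  assumes "finite L" "finite A" "finite T" "\<And>xs. xs \<in> A \<Longrightarrow> distinct xs \<and> set xs \<subseteq> L \<and> length xs = k"
  shows "(\<Sum>\<sigma> | \<sigma> permutes L. card {xs \<in> A. map \<sigma> xs \<in> T}) \<le> card A * card T * fact (card L - k)"
proof -
  have fS: "finite {\<sigma>. \<sigma> permutes L}" by (rule finite_permutations[OF assms(1)])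
  have "(\<Sum>\<sigma> | \<sigma> permutes L. card {xs \<in> A. map \<sigma> xs \<in> T})
      = (\<Sum>\<sigma> | \<sigma> permutes L. \<Sum>xs\<in>A. if map \<sigma> xs \<in> T then 1 else 0)"
    using assms(2) by (simp add: sum.If_cases Int_def)
  also have "\<dots> = (\<Sum>xs\<in>A. \<Sum>\<sigma> | \<sigma> permutes L. if map \<sigma> xs \<in> T then 1 else 0)" by (rule sum.swap)
  also have "\<dots> = (\<Sum>xs\<in>A. card {\<sigma>. \<sigma> permutes L \<and> map \<sigma> xs \<in> T})"
    using fS by (simp add: sum.If_cases Int_def)
  also have "\<dots> \<le> (\<Sum>xs\<in>A. card T * fact (card L - k))"
  proof (rule sum_mono)
    fix xs assume "xs \<in> A"
    then show "card {\<sigma>. \<sigma> permutes L \<and> map \<sigma> xs \<in> T} \<le> card T * fact (card L - k)"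
      using card_permutes_map_in_le[OF assms(1) _ _ assms(3), of xs] assms(4)[of xs] by simp
  qed
  finally show ?thesis by (simp add: mult.assoc)
qed

lemma same_sym: "same \<P> x y \<Longrightarrow> same \<P> y x" unfolding same_def by blast

lemma same_trans: "disjoint \<P> \<Longrightarrow> same \<P> x y \<Longrightarrow> same \<P> y z \<Longrightarrow> same \<P> x z"
  unfolding same_def disjoint_def by (metis IntI empty_iff)

lemma tuples_2: "[x, y] \<in> tuples 2 \<P> \<longleftrightarrow> same \<P> x y"
  unfolding tuples_def same_def by auto

lemma tuples_3:
  assumes "disjoint \<P>" "same \<P> x y" "same \<P> y z" shows "[x, y, z] \<in> tuples 3 \<P>"
  using assms unfolding tuples_def same_def disjoint_def by simp (metis IntI empty_iff)

lemma tuples_4: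
  assumes "disjoint \<P>" "same \<P> x y" "same \<P> x z" "same \<P> z w" shows "[x, y, z, w] \<in> tuples 4 \<P>"
  using assms unfolding tuples_def same_def disjoint_def by simp (metis IntI empty_iff)

lemma two_pairs_4: "same \<P> x y \<Longrightarrow> same \<P> z w \<Longrightarrow> [x, y, z, w] \<in> two_pairs \<P>"
  unfolding two_pairs_def by (rule image_eqI[of _ _ "([x, y], [z, w])"]) (simp_all add: tuples_2)

definition conflicts :: "nat set set \<Rightarrow> nat set set \<Rightarrow> (nat \<Rightarrow> nat) \<Rightarrow> ((nat \<times> nat) \<times> (nat \<times> nat)) set" where
  "conflicts \<P> \<Q> \<sigma> = {(d, e). d \<in> doubles \<P> \<Q> \<sigma> \<and> e \<in> doubles \<P> \<Q> \<sigma> \<and> d \<noteq> e \<and>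
     (same \<P> (fst d) (fst e) \<or> same \<Q> (\<sigma> (fst d)) (\<sigma> (fst e)))}"

lemma card_conflicts_le:
  assumes P: "disjoint \<P>" and Q: "disjoint \<Q>" and fin: "finite (tuples 3 \<P>)" "finite (tuples 4 \<P>)" "finite (two_pairs \<P>)"
  shows "finite (conflicts \<P> \<Q> \<sigma>)"
    "card (conflicts \<P> \<Q> \<sigma>) \<le> card {xs \<in> {xs \<in> tuples 4 \<P>. distinct xs}. map \<sigma> xs \<in> two_pairs \<Q>}
       + card {xs \<in> {xs \<in> two_pairs \<P>. distinct xs}. map \<sigma> xs \<in> tuples 4 \<Q>}
       + 4 * card {xs \<in> {xs \<in> tuples 3 \<P>. distinct xs}. map \<sigma> xs \<in> tuples 3 \<Q>}"
proof -
  let ?A = "{xs \<in> {xs \<in> tuples 4 \<P>. distinct xs}. map \<sigma> xs \<in> two_pairs \<Q>}"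
  let ?B = "{xs \<in> {xs \<in> two_pairs \<P>. distinct xs}. map \<sigma> xs \<in> tuples 4 \<Q>}"
  let ?C = "{xs \<in> {xs \<in> tuples 3 \<P>. distinct xs}. map \<sigma> xs \<in> tuples 3 \<Q>}"
  let ?f = "\<lambda>xs :: nat list. ((xs ! 0, xs ! 1), (xs ! 2, xs ! 3))"
  let ?g1 = "\<lambda>xs :: nat list. ((xs ! 0, xs ! 1), (xs ! 0, xs ! 2))"
  let ?g2 = "\<lambda>xs :: nat list. ((xs ! 0, xs ! 1), (xs ! 2, xs ! 1))"
  let ?g3 = "\<lambda>xs :: nat list. ((xs ! 0, xs ! 1), (xs ! 2, xs ! 0))"
  let ?g4 = "\<lambda>xs :: nat list. ((xs ! 0, xs ! 1), (xs ! 1, xs ! 2))"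
  have finABC: "finite ?A" "finite ?B" "finite ?C" using fin by auto
  have sub: "conflicts \<P> \<Q> \<sigma> \<subseteq> ?f ` ?A \<union> ?f ` ?B \<union> (?g1 ` ?C \<union> ?g2 ` ?C \<union> (?g3 ` ?C \<union> ?g4 ` ?C))"
  proof
    fix t assume t: "t \<in> conflicts \<P> \<Q> \<sigma>"
    obtain x y z w where tt: "t = ((x, y), (z, w))" by (metis prod.collapse)
    have xy: "x < y" "same \<P> x y" "same \<Q> (\<sigma> x) (\<sigma> y)" and zw: "z < w" "same \<P> z w" "same \<Q> (\<sigma> z) (\<sigma> w)"
      and ne: "(x, y) \<noteq> (z, w)" and cf: "same \<P> x z \<or> same \<Q> (\<sigma> x) (\<sigma> z)"
      using t unfolding tt conflicts_def doubles_def by auto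
    note sy = same_sym
    have mem3: "[a, b, c] \<in> ?C" if "distinct [a, b, c]" "same \<P> a b" "same \<P> b c" "same \<Q> (\<sigma> a) (\<sigma> b)" "same \<Q> (\<sigma> b) (\<sigma> c)" for a b c
      using that tuples_3[OF P, of a b c] tuples_3[OF Q, of "\<sigma> a" "\<sigma> b" "\<sigma> c"] by simp
    consider "x = z" "y \<noteq> w" | "y = w" "x \<noteq> z" | "x = w" | "y = z" | "distinct [x, y, z, w]" "same \<P> x z"
      | "distinct [x, y, z, w]" "same \<Q> (\<sigma> x) (\<sigma> z)"
      using ne cf xy(1) zw(1) by fastforce
    then show "t \<in> ?f ` ?A \<union> ?f ` ?B \<union> (?g1 ` ?C \<union> ?g2 ` ?C \<union> (?g3 ` ?C \<union> ?g4 ` ?C))"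
    proof cases
      case 1
      have "same \<P> y w" "same \<Q> (\<sigma> y) (\<sigma> w)"
        using same_trans[OF P sy[OF xy(2)]] same_trans[OF Q sy[OF xy(3)]] zw(2,3) 1(1) by simp_all
      then have "[x, y, w] \<in> ?C" using 1 xy zw(1) by (intro mem3) simp_all
      moreover have "t = ?g1 [x, y, w]" using tt 1 by simp
      ultimately have "t \<in> ?g1 ` ?C" by (rule image_eqI[rotated])
      then show ?thesis by (intro UnI2 UnI1)
    next
      case 2
      have "[x, y, z] \<in> ?C" using 2 xy zw(1) sy[OF zw(2)] sy[OF zw(3)]
        by (intro mem3) simp_all
      moreover have "t = ?g2 [x, y, z]" using tt 2 by simp
      ultimately have "t \<in> ?g2 ` ?C" by (rule image_eqI[rotated])
      then show ?thesis by blast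
    next
      case 3
      have "same \<P> y z" "same \<Q> (\<sigma> y) (\<sigma> z)"
        using same_trans[OF P sy[OF xy(2)]] same_trans[OF Q sy[OF xy(3)]] sy[OF zw(2)] sy[OF zw(3)] 3 by simp_all
      then have "[x, y, z] \<in> ?C" using 3 xy zw(1) by (intro mem3) simp_all
      moreover have "t = ?g3 [x, y, z]" using tt 3 by simp
      ultimately have "t \<in> ?g3 ` ?C" by (rule image_eqI[rotated])
      then show ?thesis by blast
    next
      case 4
      have "[x, y, w] \<in> ?C" using 4 xy zw by (intro mem3) simp_all
      moreover have "t = ?g4 [x, y, w]" using tt 4 by simp
      ultimately have "t \<in> ?g4 ` ?C" by (rule image_eqI[rotated])
      then show ?thesis by blast
    next
      case 5
      have "[x, y, z, w] \<in> ?A"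
        using 5(1) tuples_4[OF P xy(2) 5(2) zw(2)] two_pairs_4[OF xy(3) zw(3)] by simp
      moreover have "t = ?f [x, y, z, w]" using tt by (simp add: numeral_3_eq_3)
      ultimately have "t \<in> ?f ` ?A" by (rule image_eqI[rotated])
      then show ?thesis by (intro UnI1)
    next
      case 6
      have "[x, y, z, w] \<in> ?B"
        using 6 tuples_4[OF Q xy(3) 6(2) zw(3)] two_pairs_4[OF xy(2) zw(2)] by simp
      moreover have "t = ?f [x, y, z, w]" using tt by (simp add: numeral_3_eq_3)
      ultimately have "t \<in> ?f ` ?B" by (rule image_eqI[rotated])
      then show ?thesis by blast
    qed
  qed
  have fU: "finite (?f ` ?A \<union> ?f ` ?B \<union> (?g1 ` ?C \<union> ?g2 ` ?C \<union> (?g3 ` ?C \<union> ?g4 ` ?C)))"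
    using finABC by (intro finite_UnI finite_imageI)
  show "finite (conflicts \<P> \<Q> \<sigma>)" using sub fU finite_subset by blast
  have "card (conflicts \<P> \<Q> \<sigma>) \<le> card (?f ` ?A \<union> ?f ` ?B \<union> (?g1 ` ?C \<union> ?g2 ` ?C \<union> (?g3 ` ?C \<union> ?g4 ` ?C)))"
    by (rule card_mono[OF fU sub])
  also have "\<dots> \<le> card (?f ` ?A) + card (?f ` ?B) + ((card (?g1 ` ?C) + card (?g2 ` ?C)) + (card (?g3 ` ?C) + card (?g4 ` ?C)))"
    by (intro order_trans[OF card_Un_le] add_mono order_refl)
  also have "\<dots> \<le> card ?A + card ?B + ((card ?C + card ?C) + (card ?C + card ?C))"
    by (intro add_mono card_image_le finABC)
  finally show "card (conflicts \<P> \<Q> \<sigma>) \<le> card ?A + card ?B + 4 * card ?C" by simp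
qed

lemma finite_doubles:
  assumes "finite L" "\<Union>\<P> \<subseteq> L" shows "finite (doubles \<P> \<Q> \<sigma>)"
  by (rule finite_subset[of _ "L \<times> L"]) (use assms in \<open>auto simp: doubles_def same_def\<close>)

lemma card_doubles_le:
  assumes "finite L" "\<Union>\<P> \<subseteq> L" "finite (conflicts \<P> \<Q> \<sigma>)"
  shows "card (doubles \<P> \<Q> \<sigma>) \<le> card (isolated \<P> \<Q> \<sigma>) + card (conflicts \<P> \<Q> \<sigma>)"
proof -
  have fD: "finite (doubles \<P> \<Q> \<sigma>)" by (rule finite_doubles[OF assms(1,2)])
  have fG: "finite (isolated \<P> \<Q> \<sigma>)" using fD unfolding isolated_def by simp
  have "doubles \<P> \<Q> \<sigma> \<subseteq> isolated \<P> \<Q> \<sigma> \<union> fst ` conflicts \<P> \<Q> \<sigma>"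
  proof
    fix d assume d: "d \<in> doubles \<P> \<Q> \<sigma>"
    show "d \<in> isolated \<P> \<Q> \<sigma> \<union> fst ` conflicts \<P> \<Q> \<sigma>"
    proof (cases "d \<in> isolated \<P> \<Q> \<sigma>")
      case False
      then obtain e where "e \<in> doubles \<P> \<Q> \<sigma>" "e \<noteq> d"
        "same \<P> (fst d) (fst e) \<or> same \<Q> (\<sigma> (fst d)) (\<sigma> (fst e))" using d unfolding isolated_def by blast
      then have "(d, e) \<in> conflicts \<P> \<Q> \<sigma>" using d unfolding conflicts_def by simp
      then show ?thesis by force
    qed simp
  qed
  then have "card (doubles \<P> \<Q> \<sigma>) \<le> card (isolated \<P> \<Q> \<sigma> \<union> fst ` conflicts \<P> \<Q> \<sigma>)"
    using fG assms(3) by (intro card_mono) auto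
  also have "\<dots> \<le> card (isolated \<P> \<Q> \<sigma>) + card (fst ` conflicts \<P> \<Q> \<sigma>)" by (rule card_Un_le)
  also have "card (fst ` conflicts \<P> \<Q> \<sigma>) \<le> card (conflicts \<P> \<Q> \<sigma>)" by (rule card_image_le[OF assms(3)])
  finally show ?thesis by simp
qed

lemma card_same_pairs:
  assumes "finite \<P>" "disjoint \<P>" "\<And>p. p \<in> \<P> \<Longrightarrow> finite p \<and> card p = r"
  shows "card {(u, v). u \<noteq> v \<and> same \<P> u v} = card \<P> * (r * (r - 1))"
proof -
  let ?f = "\<lambda>p. p \<times> p - (\<lambda>x. (x, x)) ` p"
  have "{(u, v). u \<noteq> v \<and> same \<P> u v} = (\<Union>p\<in>\<P>. ?f p)" unfolding same_def by auto
  moreover have "card (\<Union>p\<in>\<P>. ?f p) = (\<Sum>p\<in>\<P>. card (?f p))"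
  proof (rule card_UN_disjoint[OF assms(1)])
    show "\<forall>p\<in>\<P>. finite (?f p)" using assms(3) by auto
    show "\<forall>i\<in>\<P>. \<forall>j\<in>\<P>. i \<noteq> j \<longrightarrow> ?f i \<inter> ?f j = {}" using assms(2) unfolding disjoint_def by blast
  qed
  moreover have "card (?f p) = r * (r - 1)" if "p \<in> \<P>" for p
  proof -
    have p: "finite p" "card p = r" using assms(3)[OF that] by auto
    have "card (?f p) = card (p \<times> p) - card ((\<lambda>x. (x, x)) ` p)" by (rule card_Diff_subset) (use p in auto)
    also have "card ((\<lambda>x. (x, x)) ` p) = r" using p by (simp add: card_image inj_on_def)
    finally show ?thesis using p by (simp add: card_cartesian_product diff_mult_distrib2)
  qed
  ultimately show ?thesis by simp
qed

lemma card_same_less: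
  fixes \<P> :: "nat set set"
  assumes "finite \<P>" "disjoint \<P>" "\<And>p. p \<in> \<P> \<Longrightarrow> finite p \<and> card p = r"
  shows "2 * card {(u, v). u < v \<and> same \<P> u v} = card \<P> * (r * (r - 1))"
proof -
  let ?A = "{(u, v). u < v \<and> same \<P> u v}" and ?B = "{(u, v). v < u \<and> same \<P> u v}"
  have fin: "finite {(u, v). u \<noteq> v \<and> same \<P> u v}"
    by (rule finite_subset[of _ "\<Union>\<P> \<times> \<Union>\<P>"]) (use assms in \<open>auto simp: same_def\<close>)
  have "?A \<subseteq> {(u, v). u \<noteq> v \<and> same \<P> u v}" "?B \<subseteq> {(u, v). u \<noteq> v \<and> same \<P> u v}" by auto
  then have f: "finite ?A" "finite ?B" using fin by (blast dest: finite_subset)+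
  have "prod.swap ` ?A = ?B"
  proof
    show "prod.swap ` ?A \<subseteq> ?B"
    proof (rule image_subsetI)
      fix t assume "t \<in> ?A"
      then have "fst t < snd t" "same \<P> (snd t) (fst t)" using same_sym[of \<P> "fst t" "snd t"] by (simp_all add: case_prod_beta)
      then show "prod.swap t \<in> ?B" by (simp add: case_prod_beta)
    qed
    show "?B \<subseteq> prod.swap ` ?A"
    proof
      fix t assume "t \<in> ?B"
      then have "snd t < fst t" "same \<P> (snd t) (fst t)" using same_sym[of \<P> "fst t" "snd t"] by (simp_all add: case_prod_beta)
      then have "prod.swap t \<in> ?A" by (simp add: case_prod_beta)
      then show "t \<in> prod.swap ` ?A" by (rule image_eqI[rotated]) simp
    qed
  qed
  then have "card ?B = card ?A" using card_image[OF inj_on_subset[OF inj_swap subset_UNIV], of ?A] by simp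
  moreover have "{(u, v). u \<noteq> v \<and> same \<P> u v} = ?A \<union> ?B" by auto
  moreover have "card (?A \<union> ?B) = card ?A + card ?B" using f by (intro card_Un_disjoint) auto
  ultimately show ?thesis using card_same_pairs[OF assms] by simp
qed

lemma sum_card_doubles:
  assumes L: "finite L" and P: "finite \<P>" "disjoint \<P>" "\<And>p. p \<in> \<P> \<Longrightarrow> finite p \<and> card p = r" "\<Union>\<P> \<subseteq> L"
    and Q: "finite \<Q>" "disjoint \<Q>" "\<And>p. p \<in> \<Q> \<Longrightarrow> finite p \<and> card p = r" "\<Union>\<Q> \<subseteq> L"
  shows "2 * (\<Sum>\<sigma> | \<sigma> permutes L. card (doubles \<P> \<Q> \<sigma>)) =
    card \<P> * (r * (r - 1)) * (card \<Q> * (r * (r - 1))) * fact (card L - 2)"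
proof -
  let ?A = "{(u, v). u < v \<and> same \<P> u v}" and ?D = "{(u, v). u \<noteq> v \<and> same \<Q> u v}"
  have fS: "finite {\<sigma>. \<sigma> permutes L}" by (rule finite_permutations[OF L])
  have fA: "finite ?A" by (rule finite_subset[of _ "L \<times> L"]) (use P(4) L in \<open>auto simp: same_def\<close>)
  have fD: "finite ?D" by (rule finite_subset[of _ "L \<times> L"]) (use Q(4) L in \<open>auto simp: same_def\<close>)
  have "(\<Sum>\<sigma> | \<sigma> permutes L. card (doubles \<P> \<Q> \<sigma>)) =
    (\<Sum>\<sigma> | \<sigma> permutes L. \<Sum>d\<in>?A. if same \<Q> (\<sigma> (fst d)) (\<sigma> (snd d)) then 1 else 0)"
  proof (rule sum.cong[OF refl])
    fix \<sigma>
    have "doubles \<P> \<Q> \<sigma> = ?A \<inter> {d. same \<Q> (\<sigma> (fst d)) (\<sigma> (snd d))}" unfolding doubles_def by auto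
    then show "card (doubles \<P> \<Q> \<sigma>) = (\<Sum>d\<in>?A. if same \<Q> (\<sigma> (fst d)) (\<sigma> (snd d)) then 1 else 0)"
      using fA by (simp add: sum.If_cases)
  qed
  also have "\<dots> = (\<Sum>d\<in>?A. \<Sum>\<sigma> | \<sigma> permutes L. if same \<Q> (\<sigma> (fst d)) (\<sigma> (snd d)) then 1 else 0)"
    by (rule sum.swap)
  also have "\<dots> = (\<Sum>d\<in>?A. card {\<sigma>. \<sigma> permutes L \<and> same \<Q> (\<sigma> (fst d)) (\<sigma> (snd d))})"
    using fS by (simp add: sum.If_cases Int_def)
  also have "\<dots> = (\<Sum>d\<in>?A. card ?D * fact (card L - 2))"
  proof (rule sum.cong[OF refl])
    fix d assume d: "d \<in> ?A"
    obtain x y where xy: "d = (x, y)" by (cases d)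
    have xyL: "x \<in> L" "y \<in> L" "x \<noteq> y" using d xy P(4) unfolding same_def by auto
    let ?F = "\<lambda>e. {\<sigma>. \<sigma> permutes L \<and> \<sigma> x = fst e \<and> \<sigma> y = snd e}"
    have "{\<sigma>. \<sigma> permutes L \<and> same \<Q> (\<sigma> (fst d)) (\<sigma> (snd d))} = (\<Union>e\<in>?D. ?F e)"
    proof
      show "{\<sigma>. \<sigma> permutes L \<and> same \<Q> (\<sigma> (fst d)) (\<sigma> (snd d))} \<subseteq> (\<Union>e\<in>?D. ?F e)"
      proof
        fix \<sigma> assume "\<sigma> \<in> {\<sigma>. \<sigma> permutes L \<and> same \<Q> (\<sigma> (fst d)) (\<sigma> (snd d))}"
        then have \<sigma>: "\<sigma> permutes L" "same \<Q> (\<sigma> x) (\<sigma> y)" using xy by auto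
        have "\<sigma> x \<noteq> \<sigma> y" using xyL(3) permutes_inj[OF \<sigma>(1)] by (simp add: inj_eq)
        then have "(\<sigma> x, \<sigma> y) \<in> ?D" using \<sigma>(2) by simp
        moreover have "\<sigma> \<in> ?F (\<sigma> x, \<sigma> y)" using \<sigma>(1) by simp
        ultimately show "\<sigma> \<in> (\<Union>e\<in>?D. ?F e)" by (rule UN_I)
      qed
      show "(\<Union>e\<in>?D. ?F e) \<subseteq> {\<sigma>. \<sigma> permutes L \<and> same \<Q> (\<sigma> (fst d)) (\<sigma> (snd d))}"
        using xy by auto
    qed
    moreover have "card (\<Union>e\<in>?D. ?F e) = (\<Sum>e\<in>?D. card (?F e))"
    proof (rule card_UN_disjoint[OF fD])
      show "\<forall>e\<in>?D. finite (?F e)" using finite_subset[OF _ fS] by (metis (no_types, lifting) Collect_mono)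
      show "\<forall>i\<in>?D. \<forall>j\<in>?D. i \<noteq> j \<longrightarrow> ?F i \<inter> ?F j = {}" by (auto simp: prod_eq_iff)
    qed
    moreover have "card (?F e) = fact (card L - 2)" if "e \<in> ?D" for e
    proof -
      have "fst e \<noteq> snd e" "fst e \<in> L" "snd e \<in> L" using that Q(4) unfolding same_def by auto
      then show ?thesis using card_permutes_pair[OF L xyL, of "fst e" "snd e"] by simp
    qed
    ultimately show "card {\<sigma>. \<sigma> permutes L \<and> same \<Q> (\<sigma> (fst d)) (\<sigma> (snd d))} = card ?D * fact (card L - 2)"
      by simp
  qed
  finally have "(\<Sum>\<sigma> | \<sigma> permutes L. card (doubles \<P> \<Q> \<sigma>)) = card ?A * (card ?D * fact (card L - 2))" by simp
  then have "2 * (\<Sum>\<sigma> | \<sigma> permutes L. card (doubles \<P> \<Q> \<sigma>)) = (2 * card ?A) * (card ?D * fact (card L - 2))" by simp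
  then show ?thesis using card_same_less[OF P(1-3)] card_same_pairs[OF Q(1-3)] by (simp only: mult.assoc)
qed

lemma sum_card_conflicts_le:
  assumes L: "finite L" and P: "finite \<P>" "disjoint \<P>" "\<And>p. p \<in> \<P> \<Longrightarrow> finite p \<and> card p = r" "\<Union>\<P> \<subseteq> L"
    and Q: "finite \<Q>" "disjoint \<Q>" "\<And>p. p \<in> \<Q> \<Longrightarrow> finite p \<and> card p = r"
  shows "(\<Sum>\<sigma> | \<sigma> permutes L. card (conflicts \<P> \<Q> \<sigma>)) \<le>
    (card \<P> * r ^ 4) * (card \<Q> * r ^ 2) ^ 2 * fact (card L - 4)
    + (card \<P> * r ^ 2) ^ 2 * (card \<Q> * r ^ 4) * fact (card L - 4)
    + 4 * ((card \<P> * r ^ 3) * (card \<Q> * r ^ 3) * fact (card L - 3))"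
proof -
  note tP = card_tuples_le[OF P(1,3)] and tQ = card_tuples_le[OF Q(1,3)]
  note pP = card_two_pairs_le[OF P(1,3)] and pQ = card_two_pairs_le[OF Q(1,3)]
  let ?A = "{xs \<in> tuples 4 \<P>. distinct xs}" and ?B = "{xs \<in> two_pairs \<P>. distinct xs}"
    and ?C = "{xs \<in> tuples 3 \<P>. distinct xs}"
  have tup: "set xs \<subseteq> L" if "xs \<in> tuples k \<P>" for xs k using that P(4) unfolding tuples_def by blast
  have A: "(\<Sum>\<sigma> | \<sigma> permutes L. card {xs \<in> ?A. map \<sigma> xs \<in> two_pairs \<Q>}) \<le> card ?A * card (two_pairs \<Q>) * fact (card L - 4)"
  proof (rule sum_card_permutes_map_le[OF L _ pQ(1)])
    show "finite ?A" using tP(1) by simp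
    show "\<And>xs. xs \<in> ?A \<Longrightarrow> distinct xs \<and> set xs \<subseteq> L \<and> length xs = 4" using tup[of _ 4] unfolding tuples_def by auto
  qed
  have B: "(\<Sum>\<sigma> | \<sigma> permutes L. card {xs \<in> ?B. map \<sigma> xs \<in> tuples 4 \<Q>}) \<le> card ?B * card (tuples 4 \<Q>) * fact (card L - 4)"
  proof (rule sum_card_permutes_map_le[OF L _ tQ(1)])
    show "finite ?B" using pP(1) by simp
    fix xs assume xs: "xs \<in> ?B"
    then obtain ys zs where "xs = ys @ zs" "ys \<in> tuples 2 \<P>" "zs \<in> tuples 2 \<P>" unfolding two_pairs_def by auto
    then show "distinct xs \<and> set xs \<subseteq> L \<and> length xs = 4" using xs tup[of ys 2] tup[of zs 2] unfolding tuples_def by auto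
  qed
  have C: "(\<Sum>\<sigma> | \<sigma> permutes L. card {xs \<in> ?C. map \<sigma> xs \<in> tuples 3 \<Q>}) \<le> card ?C * card (tuples 3 \<Q>) * fact (card L - 3)"
  proof (rule sum_card_permutes_map_le[OF L _ tQ(1)])
    show "finite ?C" using tP(1) by simp
    show "\<And>xs. xs \<in> ?C \<Longrightarrow> distinct xs \<and> set xs \<subseteq> L \<and> length xs = 3" using tup[of _ 3] unfolding tuples_def by auto
  qed
  have cA: "card ?A \<le> card \<P> * r ^ 4" using card_mono[OF tP(1), of ?A 4] tP(2)[of 4] by fastforce
  have cB: "card ?B \<le> (card \<P> * r ^ 2) ^ 2" using card_mono[OF pP(1), of ?B] pP(2) by fastforce
  have cC: "card ?C \<le> card \<P> * r ^ 3" using card_mono[OF tP(1), of ?C 3] tP(2)[of 3] by fastforce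
  have "(\<Sum>\<sigma> | \<sigma> permutes L. card (conflicts \<P> \<Q> \<sigma>)) \<le> (\<Sum>\<sigma> | \<sigma> permutes L.
      card {xs \<in> ?A. map \<sigma> xs \<in> two_pairs \<Q>} + card {xs \<in> ?B. map \<sigma> xs \<in> tuples 4 \<Q>}
      + 4 * card {xs \<in> ?C. map \<sigma> xs \<in> tuples 3 \<Q>})"
    by (intro sum_mono card_conflicts_le(2)[OF P(2) Q(2) tP(1) tP(1) pP(1)])
  also have "\<dots> = (\<Sum>\<sigma> | \<sigma> permutes L. card {xs \<in> ?A. map \<sigma> xs \<in> two_pairs \<Q>})
      + (\<Sum>\<sigma> | \<sigma> permutes L. card {xs \<in> ?B. map \<sigma> xs \<in> tuples 4 \<Q>})
      + 4 * (\<Sum>\<sigma> | \<sigma> permutes L. card {xs \<in> ?C. map \<sigma> xs \<in> tuples 3 \<Q>})"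
    by (simp add: sum.distrib sum_distrib_left)
  also have "\<dots> \<le> (card \<P> * r ^ 4) * (card \<Q> * r ^ 2) ^ 2 * fact (card L - 4)
    + (card \<P> * r ^ 2) ^ 2 * (card \<Q> * r ^ 4) * fact (card L - 4)
    + 4 * ((card \<P> * r ^ 3) * (card \<Q> * r ^ 3) * fact (card L - 3))"
    by (intro add_mono mult_left_mono order_trans[OF A] order_trans[OF B] order_trans[OF C] mult_mono cA cB cC pQ(2) tQ(2)) auto
  finally show ?thesis .
qed

lemma fact_split2: "2 \<le> N \<Longrightarrow> fact N = real N * (real N - 1) * fact (N - 2)"
  by (cases N rule: nat.exhaust; cases "N - 1" rule: nat.exhaust) (auto simp: algebra_simps)

lemma fact_split3: assumes "3 \<le> N" shows "fact N = real N * (real N - 1) * (real N - 2) * fact (N - 3)"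
proof -
  obtain k where "N = k + 3" using assms by (metis add.commute le_Suc_ex)
  then show ?thesis by (simp add: numeral_3_eq_3 algebra_simps)
qed

lemma fact_split4: assumes "4 \<le> N" shows "fact N = real N * (real N - 1) * (real N - 2) * (real N - 3) * fact (N - 4)"
proof -
  obtain k where k: "N = k + 4" using assms by (metis add.commute le_Suc_ex)
  have "k + 4 = Suc (Suc (Suc (Suc k)))" by simp
  then have "fact (k + 4) = (real k + 4) * ((real k + 3) * ((real k + 2) * ((real k + 1) * fact k)))" by (simp only: fact_Suc) (simp add: add.commute)
  then show ?thesis using k by (simp add: add.commute)
qed

lemma cancel_power:
  fixes N r F :: real assumes "N \<noteq> 0"
  shows "N ^ 3 * r ^ 5 * (2 * F / N ^ 4) = 2 * r ^ 2 * F * (r ^ 3 / N)"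
    "N ^ 2 * r ^ 4 * (2 * F / N ^ 3) = 2 * r * F * (r ^ 3 / N)"
proof -
  have "N ^ 4 = N ^ 3 * N" "r ^ 5 = r ^ 2 * r ^ 3" "r ^ 4 = r * r ^ 3" "N ^ 3 = N ^ 2 * N"
    by (simp_all add: eval_nat_numeral)
  then show "N ^ 3 * r ^ 5 * (2 * F / N ^ 4) = 2 * r ^ 2 * F * (r ^ 3 / N)"
    "N ^ 2 * r ^ 4 * (2 * F / N ^ 3) = 2 * r * F * (r ^ 3 / N)"
    using assms by simp_all
qed

lemma sum_card_isolated_ge:
  assumes L: "finite L" and P: "disjoint \<P>" "\<And>p. p \<in> \<P> \<Longrightarrow> card p = r" "\<Union>\<P> \<subseteq> L"
    and Q: "disjoint \<Q>" "\<And>p. p \<in> \<Q> \<Longrightarrow> card p = r" "\<Union>\<Q> \<subseteq> L"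
    and r: "4 \<le> r" "1024 * r ^ 3 \<le> card L" and q: "card L \<le> 4 * (card \<P> * r)" "card L \<le> 4 * (card \<Q> * r)"
  shows "fact (card L) * (real r ^ 2 / 128) \<le> real (\<Sum>\<sigma> | \<sigma> permutes L. card (isolated \<P> \<Q> \<sigma>))"
proof -
  let ?N = "real (card L)" and ?F = "fact (card L) :: real" and ?r = "real r"
  define a where "a = real (card \<P> * r)"
  define b where "b = real (card \<Q> * r)"
  have fp: "finite p \<and> card p = r" if "p \<in> \<P>" for p using P(2)[OF that] r(1) card.infinite by fastforce
  have fq: "finite p \<and> card p = r" if "p \<in> \<Q>" for p using Q(2)[OF that] r(1) card.infinite by fastforce
  have finP: "finite \<P>" using P(3) L finite_UnionD finite_subset by metis
  have finQ: "finite \<Q>" using Q(3) L finite_UnionD finite_subset by metis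
  have "card (\<Union>\<P>) = card \<P> * r" using card_Union_disjoint[of \<P>] P(1) fp by (simp add: disjoint_def pairwise_def disjnt_def)
  then have aN: "a \<le> ?N" unfolding a_def using card_mono[OF L P(3)] by (simp only: of_nat_le_iff)
  have "card (\<Union>\<Q>) = card \<Q> * r" using card_Union_disjoint[of \<Q>] Q(1) fq by (simp add: disjoint_def pairwise_def disjnt_def)
  then have bN: "b \<le> ?N" unfolding b_def using card_mono[OF L Q(3)] by (simp only: of_nat_le_iff)
  have "real (card L) \<le> real (4 * (card \<P> * r))" using q(1) by (simp only: of_nat_le_iff)
  then have a4: "?N / 4 \<le> a" unfolding a_def by simp
  have "real (card L) \<le> real (4 * (card \<Q> * r))" using q(2) by (simp only: of_nat_le_iff)
  then have b4: "?N / 4 \<le> b" unfolding b_def by simp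
  have ab0: "0 \<le> a" "0 \<le> b" unfolding a_def b_def by simp_all
  have r4: "4 \<le> ?r" using r(1) by simp
  have "real (1024 * r ^ 3) \<le> ?N" using r(2) by (simp only: of_nat_le_iff)
  then have r3: "1024 * ?r ^ 3 \<le> ?N" by simp
  have "64 \<le> ?r ^ 3" using power_mono[OF r4, of 3] by simp
  then have Nbig: "65536 \<le> ?N" using r3 by linarith
  have F0: "0 < ?F" by simp
  define D where "D = real (\<Sum>\<sigma> | \<sigma> permutes L. card (doubles \<P> \<Q> \<sigma>))"
  define X where "X = real (\<Sum>\<sigma> | \<sigma> permutes L. card (conflicts \<P> \<Q> \<sigma>))"
  define G where "G = real (\<Sum>\<sigma> | \<sigma> permutes L. card (isolated \<P> \<Q> \<sigma>))"
  have "(\<Sum>\<sigma> | \<sigma> permutes L. card (doubles \<P> \<Q> \<sigma>)) \<le>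
      (\<Sum>\<sigma> | \<sigma> permutes L. card (isolated \<P> \<Q> \<sigma>) + card (conflicts \<P> \<Q> \<sigma>))"
    by (intro sum_mono card_doubles_le[OF L P(3)] card_conflicts_le(1)[OF P(1) Q(1)]
        card_tuples_le(1)[OF finP fp] card_two_pairs_le(1)[OF finP fp])
  then have DGX: "D \<le> G + X" unfolding D_def G_def X_def sum.distrib of_nat_add[symmetric] of_nat_le_iff .
  have f2: "fact (card L - 2) = ?F / (?N * (?N - 1))" using fact_split2[of "card L"] Nbig by simp
  have f3: "fact (card L - 3) = ?F / (?N * (?N - 1) * (?N - 2))" using fact_split3[of "card L"] Nbig by simp
  have f4: "fact (card L - 4) = ?F / (?N * (?N - 1) * (?N - 2) * (?N - 3))" using fact_split4[of "card L"] Nbig by simp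
  have "2 * D = real (card \<P> * (r * (r - 1)) * (card \<Q> * (r * (r - 1))) * fact (card L - 2))"
    unfolding D_def using arg_cong[OF sum_card_doubles[OF L finP P(1) fp P(3) finQ Q(1) fq Q(3)], of real]
    by (simp only: of_nat_mult of_nat_numeral)
  also have "\<dots> = a * b * (?r - 1) ^ 2 * fact (card L - 2)"
    unfolding a_def b_def using r(1) by (simp add: power2_eq_square of_nat_diff)
  finally have D: "2 * D = a * b * (?r - 1) ^ 2 * (?F / (?N * (?N - 1)))" unfolding f2 .
  have "(?N / 4) * (?N / 4) \<le> a * b" using a4 b4 ab0 Nbig by (intro mult_mono) auto
  moreover have "?N * (?N - 1) \<le> ?N * ?N" using Nbig by simp
  ultimately have "?N * (?N - 1) \<le> 16 * (a * b)" by simp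
  then have ab1: "1 / 16 \<le> a * b / (?N * (?N - 1))" using Nbig by (simp add: field_simps)
  have rr: "?r ^ 2 / 2 \<le> (?r - 1) ^ 2"
  proof -
    have "0 \<le> (?r - 4) * ?r + 2" using r4 by simp
    then show ?thesis by (simp add: power2_eq_square algebra_simps)
  qed
  have "(1 / 16) * (?r ^ 2 / 2) * ?F \<le> (a * b / (?N * (?N - 1))) * (?r - 1) ^ 2 * ?F"
    by (intro mult_mono ab1 rr) (use ab0 Nbig in auto)
  also have "\<dots> = 2 * D" unfolding D by simp
  finally have D1: "?r ^ 2 / 64 * ?F \<le> D" by simp
  have "X \<le> real ((card \<P> * r ^ 4) * (card \<Q> * r ^ 2) ^ 2 * fact (card L - 4)
    + (card \<P> * r ^ 2) ^ 2 * (card \<Q> * r ^ 4) * fact (card L - 4)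
    + 4 * ((card \<P> * r ^ 3) * (card \<Q> * r ^ 3) * fact (card L - 3)))"
    unfolding X_def using sum_card_conflicts_le[OF L finP P(1) fp P(3) finQ Q(1) fq] by (simp only: of_nat_le_iff)
  also have "\<dots> = a * b ^ 2 * ?r ^ 5 * fact (card L - 4) + a ^ 2 * b * ?r ^ 5 * fact (card L - 4)
      + 4 * (a * b * ?r ^ 4 * fact (card L - 3))"
    unfolding a_def b_def by (simp add: eval_nat_numeral)
  finally have X1: "X \<le> a * b ^ 2 * ?r ^ 5 * fact (card L - 4) + a ^ 2 * b * ?r ^ 5 * fact (card L - 4)
      + 4 * (a * b * ?r ^ 4 * fact (card L - 3))" .
  have n3: "?N ^ 3 / 2 \<le> ?N * (?N - 1) * (?N - 2)"
  proof -
    have "0 \<le> ?N * (?N * (?N - 6) + 4)" using Nbig by (intro mult_nonneg_nonneg add_nonneg_nonneg) auto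
    then show ?thesis by (simp add: power3_eq_cube algebra_simps)
  qed
  have n4: "?N ^ 4 / 2 \<le> ?N * (?N - 1) * (?N - 2) * (?N - 3)"
  proof -
    have "0 \<le> ?N * (?N * (?N * (?N - 12)) + (22 * ?N - 12))"
      using Nbig by (intro mult_nonneg_nonneg add_nonneg_nonneg) auto
    then show ?thesis by (simp add: power4_eq_xxxx algebra_simps)
  qed
  have f4': "fact (card L - 4) \<le> 2 * ?F / ?N ^ 4"
  proof -
    have "?F / (?N * (?N - 1) * (?N - 2) * (?N - 3)) \<le> ?F / (?N ^ 4 / 2)"
      using n4 Nbig F0 by (intro divide_left_mono mult_pos_pos) auto
    then show ?thesis unfolding f4 by (simp add: mult.commute)
  qed
  have f3': "fact (card L - 3) \<le> 2 * ?F / ?N ^ 3"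
  proof -
    have "?F / (?N * (?N - 1) * (?N - 2)) \<le> ?F / (?N ^ 3 / 2)"
      using n3 Nbig F0 by (intro divide_left_mono mult_pos_pos) auto
    then show ?thesis unfolding f3 by (simp add: mult.commute)
  qed
  have "a * b ^ 2 \<le> ?N * ?N ^ 2" using aN bN ab0 by (intro mult_mono power_mono) auto
  then have t1: "a * b ^ 2 * ?r ^ 5 * fact (card L - 4) \<le> ?N ^ 3 * ?r ^ 5 * (2 * ?F / ?N ^ 4)"
    by (intro mult_mono f4') (auto simp: eval_nat_numeral)
  have "a ^ 2 * b \<le> ?N ^ 2 * ?N" using aN bN ab0 by (intro mult_mono power_mono) auto
  then have t2: "a ^ 2 * b * ?r ^ 5 * fact (card L - 4) \<le> ?N ^ 3 * ?r ^ 5 * (2 * ?F / ?N ^ 4)"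
    by (intro mult_mono f4') (auto simp: eval_nat_numeral)
  have "a * b \<le> ?N * ?N" using aN bN ab0 by (intro mult_mono) auto
  then have t3: "a * b * ?r ^ 4 * fact (card L - 3) \<le> ?N ^ 2 * ?r ^ 4 * (2 * ?F / ?N ^ 3)"
    by (intro mult_mono f3') (auto simp: eval_nat_numeral)
  have u1: "?N ^ 3 * ?r ^ 5 * (2 * ?F / ?N ^ 4) = 2 * ?r ^ 2 * ?F * (?r ^ 3 / ?N)"
    using Nbig by (intro cancel_power(1)) simp
  have u3: "?N ^ 2 * ?r ^ 4 * (2 * ?F / ?N ^ 3) = 2 * ?r * ?F * (?r ^ 3 / ?N)"
    using Nbig by (intro cancel_power(2)) simp
  have "4 * ?r \<le> ?r ^ 2" using r4 by (simp add: power2_eq_square)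
  then have u4: "4 * (2 * ?r * ?F * (?r ^ 3 / ?N)) \<le> 2 * ?r ^ 2 * ?F * (?r ^ 3 / ?N)"
  proof -
    have "(4 * ?r) * (2 * ?F * (?r ^ 3 / ?N)) \<le> ?r ^ 2 * (2 * ?F * (?r ^ 3 / ?N))"
      using \<open>4 * ?r \<le> ?r ^ 2\<close> Nbig by (intro mult_right_mono) auto
    then show ?thesis by (simp add: algebra_simps)
  qed
  have "X \<le> 6 * (?r ^ 2 * ?F * (?r ^ 3 / ?N))"
    using X1 t1 t2 t3 u4 unfolding u1 u3 by linarith
  also have "\<dots> \<le> 6 * (?r ^ 2 * ?F * (1 / 1024))"
    using r3 Nbig by (intro mult_left_mono) (auto simp: field_simps)
  also have "\<dots> \<le> ?r ^ 2 * ?F / 128" by simp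
  finally have "X \<le> ?r ^ 2 * ?F / 128" .
  then have "?F * (?r ^ 2 / 128) \<le> G" using D1 DGX by (simp add: field_simps)
  then show ?thesis unfolding G_def .
qed

lemma isolated_pairs:
  fixes \<sigma> :: "nat \<Rightarrow> nat"
  assumes P: "disjoint \<P>" "\<Union>\<P> \<subseteq> L" "compatible C \<P>" and Q: "disjoint \<Q>" "compatible D \<Q>"
    and L: "finite L"
  defines "K \<equiv> upair ` isolated \<P> \<Q> \<sigma>"
  shows "pairing K" "\<Union>K \<subseteq> L" "compatible C K" "compatible D ((`) \<sigma> ` K)" "card K = card (isolated \<P> \<Q> \<sigma>)" "finite K"
proof -
  have g: "x < y" "same \<P> x y" "same \<Q> (\<sigma> x) (\<sigma> y)" if "(x, y) \<in> isolated \<P> \<Q> \<sigma>" for x y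
    using that unfolding isolated_def doubles_def by auto
  have sep: "(z, w) = (x, y)" if "(x, y) \<in> isolated \<P> \<Q> \<sigma>" "(z, w) \<in> isolated \<P> \<Q> \<sigma>"
     "same \<P> x z \<or> same \<Q> (\<sigma> x) (\<sigma> z)" for x y z w
  proof -
    have "(z, w) \<in> doubles \<P> \<Q> \<sigma>" using that(2) unfolding isolated_def by simp
    moreover have "\<forall>e\<in>doubles \<P> \<Q> \<sigma>. same \<P> x (fst e) \<or> same \<Q> (\<sigma> x) (\<sigma> (fst e)) \<longrightarrow> e = (x, y)"
      using that(1) unfolding isolated_def by simp
    ultimately show ?thesis using that(3) by (metis fst_conv)
  qed
  show "finite K" unfolding K_def isolated_def using finite_doubles[OF L P(2)] by simp
  have inj: "inj_on upair (isolated \<P> \<Q> \<sigma>)"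
  proof (rule inj_onI)
    fix d e assume d: "d \<in> isolated \<P> \<Q> \<sigma>" and e: "e \<in> isolated \<P> \<Q> \<sigma>" and eq: "upair d = upair e"
    obtain x y where xy: "d = (x, y)" by (cases d)
    obtain z w where zw: "e = (z, w)" by (cases e)
    have "x < y" "z < w" using g(1) d e xy zw by simp_all
    moreover have "{x, y} = {z, w}" using eq unfolding xy zw upair_def by simp
    ultimately show "d = e" unfolding xy zw by (auto simp: doubleton_eq_iff)
  qed
  show "card K = card (isolated \<P> \<Q> \<sigma>)" unfolding K_def by (rule card_image[OF inj])
  show "\<Union>K \<subseteq> L" using P(2) g(2) unfolding K_def upair_def same_def by fastforce
  show "pairing K" unfolding pairing_def disjoint_def
  proof (intro conjI ballI impI)
    fix k assume "k \<in> K"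
    then obtain x y where "(x, y) \<in> isolated \<P> \<Q> \<sigma>" "k = {x, y}" unfolding K_def upair_def by auto
    then show "card k = 2" using g(1)[of x y] by auto
  next
    fix k l assume "k \<in> K" "l \<in> K" "k \<noteq> l"
    then obtain x y z w where 1: "(x, y) \<in> isolated \<P> \<Q> \<sigma>" "k = {x, y}" "(z, w) \<in> isolated \<P> \<Q> \<sigma>" "l = {z, w}"
      unfolding K_def upair_def by auto
    then have "\<not> same \<P> x z" using sep \<open>k \<noteq> l\<close> by blast
    have kx: "same \<P> x t" if "t \<in> k" for t using that 1(2) g(2)[OF 1(1)] unfolding same_def by blast
    have lz: "same \<P> z t" if "t \<in> l" for t using that 1(4) g(2)[OF 1(3)] unfolding same_def by blast
    show "k \<inter> l = {}"
      using kx lz same_trans[OF P(1)] same_sym \<open>\<not> same \<P> x z\<close> by (meson disjoint_iff)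
  qed
  show "compatible C K" unfolding compatible_def
  proof (intro ballI impI)
    fix c k l assume c: "c \<in> C" and kl: "k \<in> K" "l \<in> K" "splits c k" "splits c l"
    then obtain x y z w where 1: "(x, y) \<in> isolated \<P> \<Q> \<sigma>" "k = {x, y}" "(z, w) \<in> isolated \<P> \<Q> \<sigma>" "l = {z, w}"
      unfolding K_def upair_def by auto
    obtain p where p: "p \<in> \<P>" "x \<in> p" "y \<in> p" using g(2)[OF 1(1)] unfolding same_def by blast
    obtain q where q: "q \<in> \<P>" "z \<in> q" "w \<in> q" using g(2)[OF 1(3)] unfolding same_def by blast
    have "splits c p" "splits c q" using kl p q 1 unfolding splits_def by auto
    then have "p = q" using P(3) c p(1) q(1) unfolding compatible_def by metis
    then have "same \<P> x z" using p q unfolding same_def by blast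
    then show "k = l" using sep[OF 1(1,3)] 1 by blast
  qed
  show "compatible D ((`) \<sigma> ` K)" unfolding compatible_def
  proof (intro ballI impI)
    fix c k l assume c: "c \<in> D" and kl: "k \<in> (`) \<sigma> ` K" "l \<in> (`) \<sigma> ` K" "splits c k" "splits c l"
    then obtain x y z w where 1: "(x, y) \<in> isolated \<P> \<Q> \<sigma>" "k = {\<sigma> x, \<sigma> y}" "(z, w) \<in> isolated \<P> \<Q> \<sigma>" "l = {\<sigma> z, \<sigma> w}"
      unfolding K_def upair_def by auto
    obtain p where p: "p \<in> \<Q>" "\<sigma> x \<in> p" "\<sigma> y \<in> p" using g(3)[OF 1(1)] unfolding same_def by blast
    obtain q where q: "q \<in> \<Q>" "\<sigma> z \<in> q" "\<sigma> w \<in> q" using g(3)[OF 1(3)] unfolding same_def by blast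
    have "splits c p" "splits c q" using kl p q 1 unfolding splits_def by auto
    then have "p = q" using Q(2) c p(1) q(1) unfolding compatible_def by metis
    then have "same \<Q> (\<sigma> x) (\<sigma> z)" using p q unfolding same_def by blast
    then show "k = l" using sep[OF 1(1,3)] 1 by blast
  qed
qed

section \<open>Rooted trees\<close>

definition adj :: "'v graph \<Rightarrow> ('v \<times> 'v) set" where
  "adj G = {(u, v). {u, v} \<in> edges G}"

definition reach :: "'v graph \<Rightarrow> 'v \<Rightarrow> 'v \<Rightarrow> bool" where
  "reach G u v \<longleftrightarrow> (u, v) \<in> (adj G)\<^sup>*"

lemma reach_refl [simp]: "reach G u u" unfolding reach_def by simp

lemma reach_trans: "reach G u v \<Longrightarrow> reach G v w \<Longrightarrow> reach G u w"
  unfolding reach_def by (rule rtrancl_trans)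

lemma reach_edge: "{u, v} \<in> edges G \<Longrightarrow> reach G u v"
  unfolding reach_def adj_def by (rule r_into_rtrancl) simp

lemma reach_step: "reach G u v \<Longrightarrow> {v, w} \<in> edges G \<Longrightarrow> reach G u w"
  by (rule reach_trans[OF _ reach_edge])

lemma reach_sym: "reach G u v \<Longrightarrow> reach G v u"
proof -
  have "sym (adj G)" unfolding adj_def sym_def by (simp add: insert_commute)
  then show "reach G u v \<Longrightarrow> reach G v u" unfolding reach_def by (metis sym_rtrancl symD)
qed

lemma reach_induct [consumes 1, case_names refl step]:
  assumes "reach G u v" "P u" "\<And>a b. reach G u a \<Longrightarrow> {a, b} \<in> edges G \<Longrightarrow> P a \<Longrightarrow> P b"
  shows "P v"
  using assms(1) unfolding reach_def
proof (induction rule: rtrancl_induct)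
  case base then show ?case by (rule assms(2))
next
  case (step a b)
  then show ?case using assms(3)[of a b] unfolding reach_def adj_def by simp
qed

lemma reach_hom:
  assumes "reach G u v" "\<And>a b. {a, b} \<in> edges G \<Longrightarrow> reach H (f a) (f b)"
  shows "reach H (f u) (f v)"
  using assms(1) by (induction rule: reach_induct) (auto intro: reach_trans assms(2))

lemma reach_mono: "reach G u v \<Longrightarrow> edges G \<subseteq> edges H \<Longrightarrow> reach H u v"
  using reach_hom[of G u v H "\<lambda>x. x"] by (auto intro: reach_edge)

lemma reach_invariant:
  assumes "reach G u v" "\<And>a b. {a, b} \<in> edges G \<Longrightarrow> a \<in> S \<Longrightarrow> b \<in> S" "u \<in> S"
  shows "v \<in> S"
  using assms(1) by (induction rule: reach_induct) (use assms in auto)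

lemma path_reach:
  assumes "gpath G p" "i < length p" shows "reach G (hd p) (p ! i)"
  using assms(2)
proof (induction i)
  case 0
  then show ?case by (simp add: hd_conv_nth)
next
  case (Suc i)
  then have "reach G (hd p) (p ! i)" "{p ! i, p ! Suc i} \<in> edges G" using assms(1) unfolding gpath_def by simp_all
  then show ?case by (rule reach_step)
qed

lemma edge_verts: "simple_graph G \<Longrightarrow> {u, v} \<in> edges G \<Longrightarrow> u \<in> verts G \<and> v \<in> verts G \<and> u \<noteq> v"
  unfolding simple_graph_def by fastforce

lemma joined_iff_reach:
  assumes "simple_graph G"
  shows "joined G u v \<longleftrightarrow> u \<in> verts G \<and> reach G u v"
proof
  assume "joined G u v"
  then obtain p where p: "gpath G p" "hd p = u" "last p = v" unfolding joined_def path_between_def by blast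
  then have "p \<noteq> []" unfolding gpath_def by simp
  then have "reach G u v" using path_reach[OF p(1), of "length p - 1"] p by (simp add: last_conv_nth)
  moreover have "u \<in> verts G" using p \<open>p \<noteq> []\<close> unfolding gpath_def by auto
  ultimately show "u \<in> verts G \<and> reach G u v" by simp
next
  assume a: "u \<in> verts G \<and> reach G u v"
  then have "reach G u v" by simp
  then show "joined G u v"
  proof (induction rule: reach_induct)
    case refl
    then show ?case using a unfolding joined_def path_between_def gpath_def by (intro exI[of _ "[u]"]) simp
  next
    case (step v w)
    then obtain p where p: "gpath G p" "hd p = u" "last p = v" unfolding joined_def path_between_def by blast
    show ?case
    proof (cases "w \<in> set p")
      case True
      then obtain xs ys where xy: "p = xs @ w # ys" by (meson split_list)
      have "gpath G (xs @ [w])" unfolding gpath_def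
      proof (intro conjI allI impI)
        show "distinct (xs @ [w])" "set (xs @ [w]) \<subseteq> verts G" using p(1) xy unfolding gpath_def by auto
        fix i assume "Suc i < length (xs @ [w])"
        then have "p ! i = (xs @ [w]) ! i" "p ! Suc i = (xs @ [w]) ! Suc i" "Suc i < length p"
          using xy by (auto simp: nth_append less_Suc_eq)
        then show "{(xs @ [w]) ! i, (xs @ [w]) ! Suc i} \<in> edges G" using p(1) unfolding gpath_def by metis
      qed simp
      moreover have "hd (xs @ [w]) = u" using p(2) xy by (cases xs) auto
      ultimately show ?thesis unfolding joined_def path_between_def by (intro exI[of _ "xs @ [w]"]) simp
    next
      case False
      have ne: "p \<noteq> []" using p(1) unfolding gpath_def by simp
      have w: "w \<in> verts G" using edge_verts[OF assms step(2)] by simp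
      have "gpath G (p @ [w])" unfolding gpath_def
      proof (intro conjI allI impI)
        show "distinct (p @ [w])" "set (p @ [w]) \<subseteq> verts G" using p(1) False w unfolding gpath_def by auto
        fix i assume i: "Suc i < length (p @ [w])"
        show "{(p @ [w]) ! i, (p @ [w]) ! Suc i} \<in> edges G"
        proof (cases "Suc i < length p")
          case True
          then show ?thesis using p(1) unfolding gpath_def by (simp add: nth_append)
        next
          case False
          then have "i = length p - 1" using i by simp
          then have "(p @ [w]) ! i = v" "(p @ [w]) ! Suc i = w" using p(3) ne by (simp_all add: nth_append last_conv_nth)
          then show ?thesis using step(2) by simp
        qed
      qed simp
      then show ?thesis using p ne unfolding joined_def path_between_def by (intro exI[of _ "p @ [w]"]) simp
    qed
  qed
qed

lemma edges_delete_edge [simp]: "edges (delete_edge e G) = edges G - {e}"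
  and verts_delete_edge [simp]: "verts (delete_edge e G) = verts G"
  and edges_add_edge [simp]: "edges (add_edge e G) = insert e (edges G)"
  and verts_add_edge [simp]: "verts (add_edge e G) = verts G"
  unfolding delete_edge_def add_edge_def by auto

lemma simple_delete_edge: "simple_graph G \<Longrightarrow> simple_graph (delete_edge e G)"
  unfolding simple_graph_def by auto

locale rtree =
  fixes G :: "'v graph" and r :: 'v and par :: "'v \<Rightarrow> 'v" and Dn :: "'v \<Rightarrow> 'v set"
  assumes finV: "finite (verts G)" and root: "r \<in> verts G"
    and edges_eq: "edges G = (\<lambda>v. {v, par v}) ` (verts G - {r})"
    and par_verts: "v \<in> verts G - {r} \<Longrightarrow> par v \<in> verts G"
    and Dn_verts: "v \<in> verts G - {r} \<Longrightarrow> Dn v \<subseteq> verts G"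
    and root_Dn: "v \<in> verts G - {r} \<Longrightarrow> r \<notin> Dn v"
    and self_Dn: "v \<in> verts G - {r} \<Longrightarrow> v \<in> Dn v"
    and par_Dn: "v \<in> verts G - {r} \<Longrightarrow> par v \<notin> Dn v"
    and step_Dn: "v \<in> verts G - {r} \<Longrightarrow> u \<in> verts G - {r} \<Longrightarrow> u \<noteq> v \<Longrightarrow> u \<in> Dn v \<longleftrightarrow> par u \<in> Dn v"
begin

definition ch :: "'v \<Rightarrow> 'v set" where "ch v = {w \<in> verts G - {r}. par w = v}"

lemma par_neq: "v \<in> verts G - {r} \<Longrightarrow> par v \<noteq> v" using self_Dn par_Dn by metis

lemma par_par_neq: "v \<in> verts G - {r} \<Longrightarrow> par v \<noteq> r \<Longrightarrow> par (par v) \<noteq> v"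
  by (metis DiffI par_Dn par_neq par_verts self_Dn singletonD step_Dn)

lemma no_invariant:
  assumes "Z \<subseteq> verts G - {r}" "z \<in> Z" "\<And>w. w \<in> Z \<Longrightarrow> par w \<in> Z"
  shows False
proof -
  have it: "(par ^^ k) w \<in> Z" if "w \<in> Z" for k w using that by (induction k) (auto intro: assms(3))
  have desc: "x \<in> Dn v" if "x \<in> Z" "v \<in> Z" "(par ^^ k) x \<in> Dn v" for x v k
    using that
  proof (induction k arbitrary: x)
    case (Suc k)
    then have "par x \<in> Dn v" using assms(3) by (simp add: funpow_swap1)
    then show ?case using step_Dn[of v x] self_Dn[of v] Suc.prems(1,2) assms(1) by (cases "x = v") auto
  qed simp
  have "finite Z" using assms(1) finV by (meson finite_Diff finite_subset)
  then have "\<not> inj_on (\<lambda>k. (par ^^ k) z) UNIV"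
    using it[OF assms(2)] by (meson finite_imageD finite_subset image_subsetI infinite_UNIV_nat)
  then obtain i j where ij: "i < j" "(par ^^ i) z = (par ^^ j) z" unfolding inj_on_def by (metis linorder_neqE_nat)
  let ?v = "(par ^^ i) z"
  have v: "?v \<in> Z" by (rule it[OF assms(2)])
  obtain m where m: "j = Suc m + i" using ij(1) by (metis add.commute less_imp_Suc_add add_Suc_right)
  then have "(par ^^ Suc m) ?v = ?v" using ij(2) by (simp add: funpow_add)
  then have "(par ^^ m) (par ?v) = ?v" by (simp add: funpow_swap1)
  then have "par ?v \<in> Dn ?v" using desc[of "par ?v" ?v m] v assms(1,3) self_Dn by auto
  then show False using par_Dn v assms(1) by blast
qed

lemma climb_induct [consumes 1, case_names root step]:
  assumes "u \<in> verts G" "Q r" "\<And>u. u \<in> verts G - {r} \<Longrightarrow> Q (par u) \<Longrightarrow> Q u"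
  shows "Q u"
proof (rule ccontr)
  assume n: "\<not> Q u"
  let ?Z = "{u \<in> verts G. \<not> Q u}"
  have "?Z \<subseteq> verts G - {r}" using assms(2) by blast
  then show False by (rule no_invariant[of ?Z u]) (use n assms par_verts in auto)
qed

lemma edge_cases:
  assumes "{a, b} \<in> edges G"
  obtains "a \<in> verts G - {r}" "b = par a" | "b \<in> verts G - {r}" "a = par b"
proof -
  obtain v where v: "v \<in> verts G - {r}" "{a, b} = {v, par v}" using assms unfolding edges_eq by blast
  then consider "a = v" "b = par v" | "b = v" "a = par v" by (auto simp: doubleton_eq_iff)
  then show thesis
  proof cases
    case 1 then show thesis using v(1) that(1) by simp
  next
    case 2 then show thesis using v(1) that(2) by simp
  qed
qed

lemma par_edge: "v \<in> verts G - {r} \<Longrightarrow> {v, par v} \<in> edges G" unfolding edges_eq by blast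

lemma par_edge': "v \<in> verts G - {r} \<Longrightarrow> {par v, v} \<in> edges G" using par_edge by (simp add: insert_commute)

lemma edge_inj: "u \<in> verts G - {r} \<Longrightarrow> v \<in> verts G - {r} \<Longrightarrow> {u, par u} = {v, par v} \<Longrightarrow> u = v"
  using par_par_neq by (auto simp: doubleton_eq_iff)

lemma simple: "simple_graph G"
proof -
  have "{v, par v} \<subseteq> verts G \<and> card {v, par v} = 2" if "v \<in> verts G - {r}" for v
    using par_verts[OF that] par_neq[OF that] that by auto
  then show ?thesis unfolding simple_graph_def edges_eq using finV by auto
qed

lemma reach_root: "u \<in> verts G \<Longrightarrow> reach G u r"
  by (induction rule: climb_induct) (auto intro: reach_trans[OF reach_edge[OF par_edge]])

lemma reach_all: "u \<in> verts G \<Longrightarrow> v \<in> verts G \<Longrightarrow> reach G u v"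
  using reach_root reach_sym reach_trans by metis

lemma cross:
  assumes v: "v \<in> verts G - {r}" and e: "{a, b} \<in> edges G" "{a, b} \<noteq> {v, par v}"
  shows "a \<in> Dn v \<longleftrightarrow> b \<in> Dn v"
  using e(1)
proof (cases rule: edge_cases)
  case 1
  then show ?thesis using step_Dn[OF v 1(1)] e(2) by auto
next
  case 2
  then show ?thesis using step_Dn[OF v 2(1)] e(2) by (auto simp: insert_commute)
qed

lemma reach_delete_iff:
  assumes v: "v \<in> verts G - {r}" and u: "u \<in> verts G"
  shows "reach (delete_edge {v, par v} G) r u \<longleftrightarrow> u \<notin> Dn v"
proof
  let ?H = "delete_edge {v, par v} G"
  assume a: "reach ?H r u"
  have "u \<in> - Dn v"
    by (rule reach_invariant[OF a]) (use cross[OF v] root_Dn[OF v] in auto)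
  then show "u \<notin> Dn v" by simp
next
  let ?H = "delete_edge {v, par v} G"
  have "u \<notin> Dn v \<longrightarrow> reach ?H u r" using u
  proof (induction rule: climb_induct)
    case (step u)
    show ?case
    proof
      assume n: "u \<notin> Dn v"
      then have ne: "u \<noteq> v" using self_Dn[OF v] by blast
      then have "par u \<notin> Dn v" using step_Dn[OF v step(1) ne] n by blast
      then have "reach ?H (par u) r" using step(2) by blast
      moreover have "{u, par u} \<in> edges ?H" using par_edge[OF step(1)] edge_inj[OF step(1) v] ne by auto
      ultimately show "reach ?H u r" using reach_trans[OF reach_edge] by metis
    qed
  qed simp
  then show "u \<notin> Dn v \<Longrightarrow> reach ?H r u" using reach_sym by metis
qed

lemma reach_below:
  assumes v: "v \<in> verts G - {r}" and u: "u \<in> Dn v"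
  shows "reach (delete_edge {v, par v} G) u v"
proof -
  have "u \<in> verts G" using u Dn_verts[OF v] by blast
  then have "u \<in> Dn v \<longrightarrow> reach (delete_edge {v, par v} G) u v"
  proof (induction rule: climb_induct)
    case root
    then show ?case using root_Dn[OF v] by simp
  next
    case (step u)
    show ?case
    proof (cases "u = v")
      case False
      then have "{u, par u} \<in> edges (delete_edge {v, par v} G)"
        using par_edge[OF step(1)] edge_inj[OF step(1) v] by auto
      then show ?thesis using step_Dn[OF v step(1) False] step(2) reach_trans[OF reach_edge] by metis
    qed simp
  qed
  then show ?thesis using u by simp
qed

lemma path_cross:
  assumes v: "v \<in> verts G - {r}" and p: "path_between G a p b" and a: "a \<notin> Dn v" and b: "b \<in> Dn v"
  shows "par v \<in> set p"
proof (rule ccontr)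
  assume n: "par v \<notin> set p"
  have g: "gpath G p" "hd p = a" "last p = b" using p unfolding path_between_def by auto
  have ne: "p \<noteq> []" using g unfolding gpath_def by simp
  have "p ! i \<notin> Dn v" if "i < length p" for i
    using that
  proof (induction i)
    case 0
    then show ?case using a g(2) ne by (simp add: hd_conv_nth)
  next
    case (Suc i)
    have e: "{p ! i, p ! Suc i} \<in> edges G" using g(1) Suc.prems unfolding gpath_def by simp
    have "p ! i \<noteq> par v" "p ! Suc i \<noteq> par v" using n Suc.prems by (metis Suc_lessD nth_mem)+
    then have "{p ! i, p ! Suc i} \<noteq> {v, par v}" by (auto simp: doubleton_eq_iff)
    then show ?case using cross[OF v e] Suc by simp
  qed
  then have "last p \<notin> Dn v" using ne by (simp add: last_conv_nth)
  then show False using b g(3) by simp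
qed

lemma acyclic: "\<nexists>p. graph_cycle G p"
proof
  assume "\<exists>p. graph_cycle G p"
  then obtain p where p: "gpath G p" "3 \<le> length p" "{last p, hd p} \<in> edges G" unfolding graph_cycle_def by blast
  obtain v where v: "v \<in> verts G - {r}" "{last p, hd p} = {v, par v}" using p(3) unfolding edges_eq by blast
  have ne: "p \<noteq> []" using p(2) by auto
  have dist: "distinct p" using p(1) unfolding gpath_def by simp
  have hl: "hd p = p ! 0" "last p = p ! (length p - 1)" using ne by (simp_all add: hd_conv_nth last_conv_nth)
  have same: "(p ! i \<in> Dn v) = (hd p \<in> Dn v)" if "i < length p" for i
    using that
  proof (induction i)
    case 0
    then show ?case by (simp add: hl)
  next
    case (Suc i)
    have e: "{p ! i, p ! Suc i} \<in> edges G" using p(1) Suc.prems unfolding gpath_def by simp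
    have "{p ! i, p ! Suc i} \<noteq> {last p, hd p}"
    proof
      assume "{p ! i, p ! Suc i} = {last p, hd p}"
      then have "(i = length p - 1 \<and> Suc i = 0) \<or> (i = 0 \<and> Suc i = length p - 1)"
        using dist Suc.prems ne by (auto simp: doubleton_eq_iff hl nth_eq_iff_index_eq)
      then show False using p(2) by auto
    qed
    then show ?case using cross[OF v(1) e] v(2) Suc by simp
  qed
  have "(last p \<in> Dn v) = (hd p \<in> Dn v)" unfolding hl(2) by (rule same) (use ne in simp)
  then have "(v \<in> Dn v) = (par v \<in> Dn v)" using v(2) by (auto simp: doubleton_eq_iff)
  then show False using self_Dn[OF v(1)] par_Dn[OF v(1)] by simp
qed

lemma tree: "tree G"
  unfolding tree_def using simple root reach_all acyclic joined_iff_reach[OF simple] by auto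

lemma Dn_trans:
  assumes v: "v \<in> verts G - {r}" and u: "u \<in> verts G - {r}" "u \<in> Dn v" shows "Dn u \<subseteq> Dn v"
proof
  fix x assume x: "x \<in> Dn u"
  then have "x \<in> verts G" using Dn_verts u by blast
  then have "x \<in> Dn u \<longrightarrow> x \<in> Dn v"
  proof (induction rule: climb_induct)
    case root
    then show ?case using root_Dn[OF u(1)] by simp
  next
    case (step x)
    show ?case
    proof (cases "x = u \<or> x = v")
      case True
      then show ?thesis using u(2) self_Dn[OF v] by blast
    next
      case False
      then show ?thesis using step_Dn[OF u(1) step(1)] step_Dn[OF v step(1)] step(2) by blast
    qed
  qed
  then show "x \<in> Dn v" using x by simp
qed

lemma Dn_disjoint:
  assumes v: "v \<in> verts G - {r}" and u: "u \<in> verts G - {r}" and n: "u \<notin> Dn v" "v \<notin> Dn u"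
  shows "Dn u \<inter> Dn v = {}"
proof -
  have "\<not> (x \<in> Dn u \<and> x \<in> Dn v)" if "x \<in> verts G" for x
    using that
  proof (induction rule: climb_induct)
    case root
    then show ?case using root_Dn[OF u] by simp
  next
    case (step x)
    show ?case
    proof (cases "x = u \<or> x = v")
      case True
      then show ?thesis using n by blast
    next
      case False
      then show ?thesis using step_Dn[OF u step(1)] step_Dn[OF v step(1)] step(2) by blast
    qed
  qed
  then show ?thesis using Dn_verts[OF u] by blast
qed

lemma ch_Dn: "w \<in> ch v \<Longrightarrow> v \<noteq> r \<Longrightarrow> w \<in> Dn v"
  unfolding ch_def using step_Dn[of v w] self_Dn[of v] par_verts[of w] by (cases "w = v") auto

lemma Dn_children: assumes v: "v \<in> verts G - {r}" shows "Dn v = insert v (\<Union>w\<in>ch v. Dn w)"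
proof
  show "insert v (\<Union>w\<in>ch v. Dn w) \<subseteq> Dn v"
    using self_Dn[OF v] ch_Dn[of _ v] Dn_trans[OF v] v unfolding ch_def by blast
  have "u \<in> Dn v \<longrightarrow> u \<in> insert v (\<Union>w\<in>ch v. Dn w)" if "u \<in> verts G" for u
    using that
  proof (induction rule: climb_induct)
    case root
    then show ?case using root_Dn[OF v] by simp
  next
    case (step u)
    show ?case
    proof
      assume a: "u \<in> Dn v"
      show "u \<in> insert v (\<Union>w\<in>ch v. Dn w)"
      proof (cases "u = v")
        case False
        then have pu: "par u \<in> Dn v" using step_Dn[OF v step(1)] a by blast
        show ?thesis
        proof (cases "par u = v")
          case True
          then have "u \<in> ch v" "u \<in> Dn u" using step(1) self_Dn[OF step(1)] unfolding ch_def by auto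
          then show ?thesis by blast
        next
          case False
          then obtain w where w: "w \<in> ch v" "par u \<in> Dn w" using step(2) pu by blast
          then have "u \<in> Dn w" using step_Dn[of w u] self_Dn[of w] step(1) unfolding ch_def by (cases "u = w") auto
          then show ?thesis using w by blast
        qed
      qed simp
    qed
  qed
  then show "Dn v \<subseteq> insert v (\<Union>w\<in>ch v. Dn w)" using Dn_verts[OF v] by blast
qed

lemma ch_disjoint:
  assumes "w \<in> ch v" "w' \<in> ch v" "w \<noteq> w'" shows "Dn w \<inter> Dn w' = {}"
proof (rule Dn_disjoint)
  show w: "w' \<in> verts G - {r}" "w \<in> verts G - {r}" using assms unfolding ch_def by auto
  show "w \<notin> Dn w'" using step_Dn[OF w(1) w(2)] par_Dn[OF w(1)] assms unfolding ch_def by auto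
  show "w' \<notin> Dn w" using step_Dn[OF w(2) w(1)] par_Dn[OF w(2)] assms unfolding ch_def by auto
qed

lemma verts_root_child: assumes "ch r = {w}" shows "verts G - {r} = Dn w"
proof -
  have w: "w \<in> verts G - {r}" "par w = r" using assms unfolding ch_def by auto
  have "u = r \<or> u \<in> Dn w" if "u \<in> verts G" for u
    using that
  proof (induction rule: climb_induct)
    case (step u)
    show ?case
    proof (cases "u = w")
      case True then show ?thesis using self_Dn[OF w(1)] by simp
    next
      case False
      have "par u \<noteq> r" using False assms step(1) unfolding ch_def by blast
      then show ?thesis using step(2) step_Dn[OF w(1) step(1) False] by blast
    qed
  qed simp
  then show ?thesis using Dn_verts[OF w(1)] root_Dn[OF w(1)] by blast
qed

lemma nbrs_eq: "v \<in> verts G \<Longrightarrow> nbrs G v = ch v \<union> (if v = r then {} else {par v})"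
proof
  assume v: "v \<in> verts G"
  show "nbrs G v \<subseteq> ch v \<union> (if v = r then {} else {par v})"
  proof
    fix u assume "u \<in> nbrs G v"
    then have "{u, v} \<in> edges G" unfolding nbrs_def by simp
    then show "u \<in> ch v \<union> (if v = r then {} else {par v})"
      by (cases rule: edge_cases) (auto simp: ch_def)
  qed
  show "ch v \<union> (if v = r then {} else {par v}) \<subseteq> nbrs G v"
    using par_edge par_edge'[of v] v unfolding nbrs_def ch_def by auto
qed

lemma deg_eq: assumes v: "v \<in> verts G" shows "deg G v = card (ch v) + (if v = r then 0 else 1)"
proof -
  have f: "finite (ch v)" unfolding ch_def using finV by simp
  have "par v \<notin> ch v" if "v \<noteq> r" unfolding ch_def using par_par_neq[of v] v that by auto
  then show ?thesis unfolding deg_def nbrs_eq[OF v] using f by simp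
qed

end

lemma reach_delete_either:
  assumes "reach G r w" "e = {u, v}"
  shows "reach (delete_edge e G) r w \<or> reach (delete_edge e G) r u \<or> reach (delete_edge e G) r v"
  using assms(1)
proof (induction rule: reach_induct)
  case (step a b)
  show ?case
  proof (cases "{a, b} = e")
    case True
    then have "a = u \<or> a = v" using assms(2) by (auto simp: doubleton_eq_iff)
    then show ?thesis using step.IH by blast
  next
    case False
    then have "{a, b} \<in> edges (delete_edge e G)" using step(2) by simp
    then show ?thesis using step.IH reach_step[of "delete_edge e G" r a b] by blast
  qed
qed simp

lemma tree_bridge:
  assumes "tree G" "{u, v} \<in> edges G"
  shows "\<not> reach (delete_edge {u, v} G) u v"
proof
  assume a: "reach (delete_edge {u, v} G) u v"
  have sg: "simple_graph G" using assms(1) unfolding tree_def by simp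
  have uv: "u \<in> verts G" "v \<in> verts G" "u \<noteq> v" using edge_verts[OF sg assms(2)] by auto
  have "joined (delete_edge {u, v} G) u v" using joined_iff_reach[OF simple_delete_edge[OF sg]] a uv by simp
  then obtain p where p: "gpath (delete_edge {u, v} G) p" "hd p = u" "last p = v"
    unfolding joined_def path_between_def by blast
  have ne: "p \<noteq> []" using p(1) unfolding gpath_def by simp
  have "gpath G p" using p(1) unfolding gpath_def by auto
  moreover have "length p \<noteq> 1" using p(2,3) uv(3) by (cases p) auto
  moreover have "length p \<noteq> 2"
  proof
    assume l: "length p = 2"
    then have "{p ! 0, p ! 1} \<in> edges (delete_edge {u, v} G)" using p(1) unfolding gpath_def by auto
    moreover have "p ! 0 = u" "p ! 1 = v" using p(2,3) ne l by (simp_all add: hd_conv_nth last_conv_nth)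
    ultimately show False by simp
  qed
  moreover have "length p \<noteq> 0" using ne by simp
  ultimately have "gpath G p" "3 \<le> length p" by linarith+
  then have "graph_cycle G p" unfolding graph_cycle_def using p(2,3) assms(2) by (simp add: insert_commute)
  then show False using assms(1) unfolding tree_def by blast
qed

lemma tree_rtree:
  assumes T: "tree G" and r: "r \<in> verts G"
  shows "\<exists>par Dn. rtree G r par Dn"
proof -
  have sg: "simple_graph G" using T unfolding tree_def by simp
  have conn: "reach G r u" if "u \<in> verts G" for u
    using T r that joined_iff_reach[OF sg] unfolding tree_def by blast
  let ?R = "\<lambda>e u. reach (delete_edge e G) r u"
  have one: "?R e u \<or> ?R e v" if "e = {u, v}" "{u, v} \<in> edges G" for e u v
    using reach_delete_either[OF conn that(1), of u] edge_verts[OF sg that(2)] by blast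
  have notboth: "\<not> (?R e u \<and> ?R e v)" if "e = {u, v}" "{u, v} \<in> edges G" for e u v
    using tree_bridge[OF T that(2)] that(1) reach_sym reach_trans by metis
  have ex: "\<exists>u. {u, v} \<in> edges G \<and> ?R {u, v} u" if v: "v \<in> verts G - {r}" for v
  proof -
    have "joined G r v" using v T r unfolding tree_def by blast
    then obtain p where p: "gpath G p" "hd p = r" "last p = v" unfolding joined_def path_between_def by blast
    have ne: "p \<noteq> []" using p(1) unfolding gpath_def by simp
    have "length p \<noteq> 1" using p(2,3) v by (cases p) auto
    then have len: "2 \<le> length p" using ne by (cases p) (auto simp: Suc_le_eq)
    let ?k = "length p - 2" let ?u = "p ! ?k"
    have pv: "p ! Suc ?k = v" using p(3) ne len by (simp add: last_conv_nth numeral_2_eq_2 Suc_diff_Suc)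
    have e: "{?u, v} \<in> edges G"
    proof -
      have "{p ! ?k, p ! Suc ?k} \<in> edges G" using p(1) len unfolding gpath_def by (simp del: One_nat_def)
      then show ?thesis using pv by simp
    qed
    have "?R {?u, v} (p ! i)" if "i \<le> ?k" for i
      using that
    proof (induction i)
      case 0
      then show ?case using p(2) ne by (simp add: hd_conv_nth[symmetric])
    next
      case (Suc i)
      have "distinct p" using p(1) unfolding gpath_def by simp
      then have "p ! i \<noteq> p ! Suc ?k" "p ! Suc i \<noteq> p ! Suc ?k"
        using Suc.prems len by (simp_all add: nth_eq_iff_index_eq)
      then have "{p ! i, p ! Suc i} \<noteq> {?u, v}" using pv by (auto simp: doubleton_eq_iff)
      moreover have "{p ! i, p ! Suc i} \<in> edges G" using p(1) Suc.prems len unfolding gpath_def by simp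
      ultimately have "{p ! i, p ! Suc i} \<in> edges (delete_edge {?u, v} G)" by simp
      moreover have "?R {?u, v} (p ! i)" using Suc by simp
      ultimately show ?case by (rule reach_step[rotated])
    qed
    then show ?thesis using e by blast
  qed
  define par where "par v = (SOME u. {u, v} \<in> edges G \<and> ?R {u, v} u)" for v
  have par: "{par v, v} \<in> edges G" "?R {par v, v} (par v)" if "v \<in> verts G - {r}" for v
    using someI_ex[OF ex[OF that]] unfolding par_def by auto
  have par_uniq: "u = w" if u: "{u, v} \<in> edges G" "?R {u, v} u" and w: "{w, v} \<in> edges G" "?R {w, v} w" for u v w
  proof (rule ccontr)
    assume ne: "u \<noteq> w"
    then have ene: "{u, v} \<noteq> {w, v}" by (auto simp: doubleton_eq_iff)
    have 1: "\<not> ?R {u, v} v" using notboth[OF refl u(1)] u(2) by blast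
    have 2: "\<not> ?R {w, v} v" using notboth[OF refl w(1)] w(2) by blast
    have nw: "\<not> ?R {u, v} w" using 1 reach_step[of "delete_edge {u, v} G" r w v] w(1) ene by auto
    have nu: "\<not> ?R {w, v} u" using 2 reach_step[of "delete_edge {w, v} G" r u v] u(1) ene by auto
    let ?K = "delete_edge {u, v} (delete_edge {w, v} G)"
    have "reach ?K r w \<or> reach ?K r u \<or> reach ?K r v" by (rule reach_delete_either[OF w(2) refl])
    moreover have "reach ?K r x \<Longrightarrow> ?R {u, v} x" "reach ?K r x \<Longrightarrow> ?R {w, v} x" for x
      by (rule reach_mono, auto)+
    ultimately show False using nw nu 2 by blast
  qed
  define Dn where "Dn v = {u \<in> verts G. \<not> ?R {par v, v} u}" for v
  have "rtree G r par Dn"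
  proof
    show "finite (verts G)" "r \<in> verts G" using sg r unfolding simple_graph_def by auto
    show "edges G = (\<lambda>v. {v, par v}) ` (verts G - {r})"
    proof
      show "(\<lambda>v. {v, par v}) ` (verts G - {r}) \<subseteq> edges G" using par(1) by (auto simp: insert_commute)
      show "edges G \<subseteq> (\<lambda>v. {v, par v}) ` (verts G - {r})"
      proof
        fix e assume e: "e \<in> edges G"
        then have "card e = 2" using sg unfolding simple_graph_def by blast
        then obtain a b where ab: "e = {a, b}" by (meson card_2_iff)
        have "\<exists>u v. e = {u, v} \<and> ?R e u \<and> \<not> ?R e v"
          using one[OF ab] notboth[OF ab] e ab by (metis insert_commute)
        then obtain u v where uv: "e = {u, v}" "?R e u" "\<not> ?R e v" by blast
        have v: "v \<in> verts G - {r}" using edge_verts[OF sg, of u v] e uv by auto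
        have "u = par v" by (rule par_uniq[of u v "par v"]) (use e uv par[OF v] in auto)
        then show "e \<in> (\<lambda>v. {v, par v}) ` (verts G - {r})" using uv v by (auto simp: insert_commute)
      qed
    qed
    fix v assume v: "v \<in> verts G - {r}"
    show "par v \<in> verts G" using edge_verts[OF sg par(1)[OF v]] by simp
    show "Dn v \<subseteq> verts G" "r \<notin> Dn v" unfolding Dn_def by auto
    show "v \<in> Dn v" unfolding Dn_def using v notboth[OF refl par(1)[OF v]] par(2)[OF v] by simp
    show "par v \<notin> Dn v" unfolding Dn_def using par(2)[OF v] by simp
    fix u assume u: "u \<in> verts G - {r}" "u \<noteq> v"
    have "{par u, u} \<noteq> {par v, v}"
    proof
      assume eq: "{par u, u} = {par v, v}"
      then have "par u = v" "par v = u" using u(2) by (auto simp: doubleton_eq_iff)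
      then have "?R {u, v} v" "?R {u, v} u" using par(2)[OF u(1)] par(2)[OF v] by (simp_all add: insert_commute)
      then show False using notboth[OF refl, of u v] par(1)[OF v] \<open>par v = u\<close> by simp
    qed
    then have "{par u, u} \<in> edges (delete_edge {par v, v} G)" "{u, par u} \<in> edges (delete_edge {par v, v} G)"
      using par(1)[OF u(1)] by (auto simp: insert_commute)
    then have "?R {par v, v} u \<longleftrightarrow> ?R {par v, v} (par u)" using reach_step[of _ r] by metis
    moreover have "par u \<in> verts G" using edge_verts[OF sg par(1)[OF u(1)]] by simp
    ultimately show "u \<in> Dn v \<longleftrightarrow> par u \<in> Dn v" unfolding Dn_def using u(1) by simp
  qed
  then show ?thesis by blast
qed

section \<open>Clusters of a leaf-labelled tree\<close>

definition clusters :: "nat set \<Rightarrow> ltree \<Rightarrow> nat set set" where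
  "clusters X = (\<lambda>(G, l). (\<lambda>e. {x \<in> X. \<not> joined (delete_edge e G) (l 0) (l x)}) ` edges G)"

locale binary_rtree = rtree G r par Dn for G :: "nat graph" and r par Dn +
  fixes X :: "nat set" and l :: "nat \<Rightarrow> nat"
  assumes bl: "binary_ltree X (G, l)" and X0: "0 \<in> X" and r_def: "r = l 0"
begin

definition lab :: "nat \<Rightarrow> nat set" where "lab v = {x \<in> X. l x \<in> Dn v}"

lemma leaves: "bij_betw l X {v \<in> verts G. deg G v = 1}" using bl unfolding binary_ltree_def by simp

lemma leaf_verts: "x \<in> X \<Longrightarrow> l x \<in> verts G \<and> deg G (l x) = 1"
  using leaves unfolding bij_betw_def by blast

lemma l_inj: "x \<in> X \<Longrightarrow> y \<in> X \<Longrightarrow> l x = l y \<Longrightarrow> x = y"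
  using leaves unfolding bij_betw_def inj_on_def by blast

lemma finite_ch: "finite (ch v)" unfolding ch_def using finV by simp

lemma root_child: obtains w where "ch r = {w}" "w \<in> verts G - {r}" "par w = r"
proof -
  have "deg G r = 1" using leaf_verts[OF X0] r_def by simp
  then have "card (ch r) = 1" using deg_eq[OF root] by simp
  then obtain w where w: "ch r = {w}" by (meson card_1_singletonE)
  then have "w \<in> verts G - {r}" "par w = r" unfolding ch_def by auto
  then show thesis by (rule that[OF w])
qed

lemma card_ch: assumes v: "v \<in> verts G - {r}" shows "card (ch v) = 0 \<or> card (ch v) = 2"
proof -
  have "deg G v = 3 \<or> deg G v = 1" using bl v unfolding binary_ltree_def by auto
  then show ?thesis using deg_eq[of v] v by auto
qed

lemma leaf_iff: assumes v: "v \<in> verts G - {r}" shows "ch v = {} \<longleftrightarrow> (\<exists>x\<in>X. x \<noteq> 0 \<and> l x = v)"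
proof
  assume "ch v = {}"
  then have "v \<in> {v \<in> verts G. deg G v = 1}" using deg_eq[of v] v by auto
  then obtain x where x: "x \<in> X" "l x = v" using leaves unfolding bij_betw_def by (metis imageE)
  then have "x \<noteq> 0" using v r_def by (metis DiffD2 singletonI)
  then show "\<exists>x\<in>X. x \<noteq> 0 \<and> l x = v" using x by blast
next
  assume "\<exists>x\<in>X. x \<noteq> 0 \<and> l x = v"
  then obtain x where x: "x \<in> X" "l x = v" by blast
  then have "deg G v = 1" using leaf_verts[OF x(1)] by simp
  moreover have "v \<in> verts G" "v \<noteq> r" using v by auto
  then have "deg G v = card (ch v) + 1" using deg_eq by presburger
  ultimately have "card (ch v) = 0" by linarith
  then show "ch v = {}" using finite_ch[of v] by simp
qed

lemma leaf_Dn: assumes "x \<in> X" "x \<noteq> 0" shows "l x \<in> verts G - {r}" "ch (l x) = {}" "Dn (l x) = {l x}" "lab (l x) = {x}"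
proof -
  show v: "l x \<in> verts G - {r}" using leaf_verts[OF assms(1)] l_inj[OF assms(1) X0] assms(2) r_def by auto
  show c: "ch (l x) = {}" using leaf_iff[OF v] assms by blast
  then show D: "Dn (l x) = {l x}" using Dn_children[OF v] by simp
  show "lab (l x) = {x}" unfolding lab_def D using assms(1) l_inj by auto
qed

lemma two_children:
  assumes v: "v \<in> verts G - {r}" and "ch v \<noteq> {}"
  obtains w1 w2 where "ch v = {w1, w2}" "w1 \<noteq> w2"
proof -
  have "card (ch v) = 2" using card_ch[OF v] assms(2) finite_ch[of v] by auto
  then show thesis using that by (meson card_2_iff)
qed

lemma lab_children:
  assumes v: "v \<in> verts G - {r}" and c: "ch v = {w1, w2}"
  shows "lab v = lab w1 \<union> lab w2" "w1 \<noteq> w2 \<Longrightarrow> lab w1 \<inter> lab w2 = {}"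
    "w1 \<in> verts G - {r}" "w2 \<in> verts G - {r}"
proof -
  have "Dn v = insert v (Dn w1 \<union> Dn w2)" using Dn_children[OF v] c by simp
  moreover have "l x \<noteq> v" if "x \<in> X" for x
  proof
    assume "l x = v"
    then have "x \<noteq> 0" using v r_def by (metis DiffD2 singletonI)
    then show False using leaf_iff[OF v] that \<open>l x = v\<close> c by blast
  qed
  ultimately show "lab v = lab w1 \<union> lab w2" unfolding lab_def by auto
  show "w1 \<noteq> w2 \<Longrightarrow> lab w1 \<inter> lab w2 = {}" using ch_disjoint[of w1 v w2] c unfolding lab_def by auto
  have "w1 \<in> ch v" "w2 \<in> ch v" using c by auto
  then show "w1 \<in> verts G - {r}" "w2 \<in> verts G - {r}" unfolding ch_def by auto
qed

lemma hierarchy_lab: assumes "v \<in> verts G - {r}" shows "binary_hierarchy (lab v) (lab ` Dn v)"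
  using assms
proof (induction "card (Dn v)" arbitrary: v rule: less_induct)
  case less
  note v = less.prems
  show ?case
  proof (cases "ch v = {}")
    case True
    then obtain x where x: "x \<in> X" "x \<noteq> 0" "l x = v" using leaf_iff[OF v] by blast
    then show ?thesis using leaf_Dn[OF x(1,2)] hierarchy_single[of x] by simp
  next
    case False
    obtain w1 w2 where w: "ch v = {w1, w2}" "w1 \<noteq> w2" by (rule two_children[OF v False])
    note lc = lab_children[OF v w(1)]
    have D: "Dn v = insert v (Dn w1 \<union> Dn w2)" using Dn_children[OF v] w by simp
    have fin: "finite (Dn v)" using Dn_verts[OF v] finV finite_subset by blast
    have "w1 \<in> ch v" "w2 \<in> ch v" using w(1) by simp_all
    then have "par w1 = v" "par w2 = v" unfolding ch_def by simp_all
    then have "v \<notin> Dn w1" "v \<notin> Dn w2" using par_Dn[OF lc(3)] par_Dn[OF lc(4)] by simp_all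
    then have "Dn w1 \<subset> Dn v" "Dn w2 \<subset> Dn v" using D by auto
    then have "card (Dn w1) < card (Dn v)" "card (Dn w2) < card (Dn v)" using psubset_card_mono[OF fin] by blast+
    then have "binary_hierarchy (lab w1) (lab ` Dn w1)" "binary_hierarchy (lab w2) (lab ` Dn w2)"
      using less.hyps[OF _ lc(3)] less.hyps[OF _ lc(4)] by blast+
    then have "binary_hierarchy (lab w1 \<union> lab w2) (insert (lab w1 \<union> lab w2) (lab ` Dn w1 \<union> lab ` Dn w2))"
      using lc(2)[OF w(2)] by (rule hierarchy_join)
    then show ?thesis unfolding D by (simp add: image_Un lc(1))
  qed
qed

lemma clusters_eq: "clusters X (G, l) = lab ` (verts G - {r})"
proof -
  have "{x \<in> X. \<not> joined (delete_edge {v, par v} G) (l 0) (l x)} = lab v" if v: "v \<in> verts G - {r}" for v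
  proof -
    have "joined (delete_edge {v, par v} G) (l 0) (l x) \<longleftrightarrow> l x \<notin> Dn v" if "x \<in> X" for x
      using joined_iff_reach[OF simple_delete_edge[OF simple], of "{v, par v}" r "l x"]
        reach_delete_iff[OF v, of "l x"] leaf_verts[OF that] root r_def by simp
    then show ?thesis unfolding lab_def by blast
  qed
  then have "(\<lambda>v. {x \<in> X. \<not> joined (delete_edge {v, par v} G) (l 0) (l x)}) ` (verts G - {r}) = lab ` (verts G - {r})"
    by (rule image_cong[OF refl])
  moreover have "clusters X (G, l) = (\<lambda>e. {x \<in> X. \<not> joined (delete_edge e G) (l 0) (l x)}) ` edges G"
    unfolding clusters_def by simp
  ultimately show ?thesis unfolding edges_eq image_image by simp
qed

lemma lab_root_child: assumes "ch r = {w}" shows "lab w = X - {0}"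
proof -
  have D: "Dn w = verts G - {r}" using verts_root_child[OF assms] by simp
  have "l x \<in> verts G - {r} \<longleftrightarrow> x \<noteq> 0" if "x \<in> X" for x
    using leaf_Dn(1)[OF that] r_def by (cases "x = 0") simp_all
  then show ?thesis unfolding lab_def D by blast
qed

lemma hierarchy_clusters: "binary_hierarchy (X - {0}) (clusters X (G, l))"
proof -
  obtain w where w: "ch r = {w}" "w \<in> verts G - {r}" "par w = r" by (rule root_child)
  have "binary_hierarchy (lab w) (lab ` Dn w)" by (rule hierarchy_lab[OF w(2)])
  then show ?thesis unfolding clusters_eq lab_root_child[OF w(1)] using verts_root_child[OF w(1)] by simp
qed

lemma lab_nonempty: "v \<in> verts G - {r} \<Longrightarrow> lab v \<noteq> {}"
  using hierarchy_nonempty[OF hierarchy_clusters] unfolding clusters_eq by blast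

lemma lab_mono: "v \<in> verts G - {r} \<Longrightarrow> u \<in> Dn v \<Longrightarrow> lab u \<subseteq> lab v"
proof -
  assume v: "v \<in> verts G - {r}" and u: "u \<in> Dn v"
  have "u \<in> verts G - {r}" using u Dn_verts[OF v] root_Dn[OF v] by blast
  then show ?thesis using Dn_trans[OF v _ u] unfolding lab_def by blast
qed

lemma lab_strict:
  assumes v: "v \<in> verts G - {r}" and u: "u \<in> Dn v" "u \<noteq> v" shows "lab u \<subset> lab v"
proof -
  have "u \<in> (\<Union>w\<in>ch v. Dn w)" using Dn_children[OF v] u by blast
  then obtain w where w: "w \<in> ch v" "u \<in> Dn w" by blast
  then have "ch v \<noteq> {}" by blast
  then obtain w1 w2 where c: "ch v = {w1, w2}" "w1 \<noteq> w2" by (rule two_children[OF v])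
  note lc = lab_children[OF v c(1)]
  have ne: "lab w1 \<noteq> {}" "lab w2 \<noteq> {}" using lab_nonempty lc(3,4) by blast+
  have "lab u \<subseteq> lab w" using lab_mono[OF _ w(2)] w(1) unfolding ch_def by blast
  moreover have "w = w1 \<or> w = w2" using w(1) c(1) by blast
  ultimately show ?thesis using lc(1) lc(2)[OF c(2)] ne by blast
qed

lemma lab_subset_iff:
  assumes v: "v \<in> verts G - {r}" and u: "u \<in> verts G - {r}" shows "lab u \<subseteq> lab v \<longleftrightarrow> u \<in> Dn v"
proof
  assume a: "lab u \<subseteq> lab v"
  show "u \<in> Dn v"
  proof (rule ccontr)
    assume n: "u \<notin> Dn v"
    show False
    proof (cases "v \<in> Dn u")
      case True
      then have "lab v \<subset> lab u" using lab_strict[OF u True] n self_Dn[OF v] by blast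
      then show False using a by blast
    next
      case False
      then have "Dn u \<inter> Dn v = {}" by (rule Dn_disjoint[OF v u n])
      then have "lab u \<inter> lab v = {}" unfolding lab_def by blast
      then show False using a lab_nonempty[OF u] by blast
    qed
  qed
qed (rule lab_mono[OF v])

lemma lab_inj: "inj_on lab (verts G - {r})"
proof (rule inj_onI)
  fix u v assume uv: "u \<in> verts G - {r}" "v \<in> verts G - {r}" "lab u = lab v"
  then have "u \<in> Dn v" using lab_subset_iff[of v u] by simp
  then show "u = v" using lab_strict[of v u] uv by blast
qed

lemma lab_disjoint:
  assumes "v \<in> verts G - {r}" "u \<in> verts G - {r}" "u \<notin> Dn v" "v \<notin> Dn u" shows "lab u \<inter> lab v = {}"
  using Dn_disjoint[OF assms] unfolding lab_def by blast

lemma par_root_iff: assumes v: "v \<in> verts G - {r}" shows "par v = r \<longleftrightarrow> lab v = X - {0}"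
proof -
  obtain w where w: "ch r = {w}" "w \<in> verts G - {r}" "par w = r" by (rule root_child)
  have "par v = r \<longleftrightarrow> v = w" using w v unfolding ch_def by auto
  also have "\<dots> \<longleftrightarrow> lab v = lab w" using lab_inj v w(2) unfolding inj_on_def by blast
  finally show ?thesis using lab_root_child[OF w(1)] by simp
qed

lemma lab_par_least:
  assumes v: "v \<in> verts G - {r}" and p: "par v \<noteq> r"
  shows "lab v \<subset> lab (par v)" and "u \<in> verts G - {r} \<Longrightarrow> lab v \<subset> lab u \<Longrightarrow> lab (par v) \<subseteq> lab u"
proof -
  have pv: "par v \<in> verts G - {r}" using par_verts[OF v] p by blast
  have "v \<in> Dn (par v)" using step_Dn[OF pv v] self_Dn[OF pv] par_neq[OF v] by auto
  then show "lab v \<subset> lab (par v)" using lab_strict[OF pv] par_neq[OF v] by auto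
  assume u: "u \<in> verts G - {r}" "lab v \<subset> lab u"
  then have "v \<in> Dn u" "v \<noteq> u" using lab_subset_iff[OF u(1) v] by auto
  then have "par v \<in> Dn u" using step_Dn[OF u(1) v] by simp
  then show "lab (par v) \<subseteq> lab u" by (rule lab_mono[OF u(1)])
qed

end

lemma binary_ltree_binary_rtree:
  assumes "binary_ltree X (G, l)" "0 \<in> X"
  shows "\<exists>par Dn. binary_rtree G (l 0) par Dn X l"
proof -
  have t: "tree G" "l 0 \<in> verts G" using assms unfolding binary_ltree_def bij_betw_def by auto
  obtain par Dn where "rtree G (l 0) par Dn" using tree_rtree[OF t] by blast
  then show ?thesis using assms unfolding binary_rtree_def binary_rtree_axioms_def by blast
qed

lemma same_clusters_iso:
  assumes "binary_ltree X (G, l)" "binary_ltree X (G', l')" "0 \<in> X" "clusters X (G, l) = clusters X (G', l')"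
  shows "ltree_iso X (G, l) (G', l')"
proof -
  obtain par Dn where "binary_rtree G (l 0) par Dn X l" using binary_ltree_binary_rtree assms by blast
  then interpret A: binary_rtree G "l 0" par Dn X l .
  obtain par' Dn' where "binary_rtree G' (l' 0) par' Dn' X l'" using binary_ltree_binary_rtree assms by blast
  then interpret B: binary_rtree G' "l' 0" par' Dn' X l' .
  let ?V = "verts G - {l 0}" and ?V' = "verts G' - {l' 0}"
  have im: "A.lab ` ?V = B.lab ` ?V'" using assms(4) A.clusters_eq B.clusters_eq by simp
  define g where "g v = inv_into ?V' B.lab (A.lab v)" for v
  have g: "g v \<in> ?V'" "B.lab (g v) = A.lab v" if "v \<in> ?V" for v
  proof -
    have "A.lab v \<in> B.lab ` ?V'" using that im by blast
    then show "g v \<in> ?V'" unfolding g_def by (rule inv_into_into)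
    show "B.lab (g v) = A.lab v" unfolding g_def by (rule f_inv_into_f) fact
  qed
  have guniq: "v' = g v" if "v \<in> ?V" "v' \<in> ?V'" "B.lab v' = A.lab v" for v v'
    using B.lab_inj g[OF that(1)] that unfolding inj_on_def by metis
  have gbij: "bij_betw g ?V ?V'"
  proof (rule bij_betw_imageI)
    show "inj_on g ?V" using A.lab_inj g unfolding inj_on_def by metis
    show "g ` ?V = ?V'"
    proof
      show "?V' \<subseteq> g ` ?V"
      proof
        fix v' assume v': "v' \<in> ?V'"
        then have "B.lab v' \<in> A.lab ` ?V" unfolding im by (rule imageI)
        then obtain v where v: "v \<in> ?V" "B.lab v' = A.lab v" by (elim imageE)
        have "v' = g v" by (rule guniq[OF v(1) v' v(2)])
        then show "v' \<in> g ` ?V" using v(1) by (rule image_eqI)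
      qed
      show "g ` ?V \<subseteq> ?V'" by (rule image_subsetI) (rule g(1))
    qed
  qed
  define f where "f v = (if v = l 0 then l' 0 else g v)" for v
  have fV: "f v = g v" if "v \<in> ?V" for v using that unfolding f_def by simp
  have bij: "bij_betw f (verts G) (verts G')"
  proof -
    have "bij_betw f ?V ?V'" by (rule iffD2[OF bij_betw_cong gbij]) (rule fV)
    moreover have "bij_betw f {l 0} {l' 0}" unfolding f_def by simp
    ultimately have "bij_betw f (?V \<union> {l 0}) (?V' \<union> {l' 0})" by (rule bij_betw_combine) blast
    then show ?thesis using A.root B.root by (simp add: insert_absorb)
  qed
  have fpar: "f (par v) = par' (f v)" if v: "v \<in> ?V" for v
  proof (cases "par v = l 0")
    case True
    then have "B.lab (g v) = X - {0}" using A.par_root_iff[OF v] g[OF v] by simp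
    then have "par' (g v) = l' 0" using B.par_root_iff g[OF v] by blast
    then show ?thesis using True fV[OF v] unfolding f_def by simp
  next
    case False
    then have pv: "par v \<in> ?V" using A.par_verts[OF v] by blast
    have F': "par' (g v) \<noteq> l' 0" using False A.par_root_iff[OF v] B.par_root_iff[OF g(1)[OF v]] g(2)[OF v] by simp
    then have pv': "par' (g v) \<in> ?V'" using B.par_verts g(1)[OF v] by blast
    have "B.lab (par' (g v)) \<in> A.lab ` ?V" unfolding im using pv' by (rule imageI)
    then obtain u where u: "u \<in> ?V" "A.lab u = B.lab (par' (g v))" by (elim imageE) simp
    have "A.lab v \<subset> A.lab u" using B.lab_par_least(1)[OF g(1)[OF v] F'] g(2)[OF v] u(2) by simp
    then have 1: "A.lab (par v) \<subseteq> B.lab (par' (g v))" using A.lab_par_least(2)[OF v False u(1)] u(2) by simp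
    have "B.lab (g v) \<subset> B.lab (g (par v))" using A.lab_par_least(1)[OF v False] g(2)[OF v] g(2)[OF pv] by simp
    then have "B.lab (par' (g v)) \<subseteq> A.lab (par v)"
      using B.lab_par_least(2)[OF g(1)[OF v] F' g(1)[OF pv]] g(2)[OF pv] by simp
    then have "par' (g v) = g (par v)" using 1 by (intro guniq pv pv') blast
    then show ?thesis using fV[OF v] fV[OF pv] by simp
  qed
  have finj: "f u = f v \<Longrightarrow> u = v" if "u \<in> verts G" "v \<in> verts G" for u v
    using bij that unfolding bij_betw_def inj_on_def by blast
  have fne: "f v \<in> ?V' \<longleftrightarrow> v \<in> ?V" if "v \<in> verts G" for v
    using that g(1)[of v] unfolding f_def by (cases "v = l 0") auto
  have edge: "{u, v} \<in> edges G \<longleftrightarrow> {f u, f v} \<in> edges G'" if uv: "u \<in> verts G" "v \<in> verts G" for u v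
  proof
    assume "{u, v} \<in> edges G"
    then show "{f u, f v} \<in> edges G'"
    proof (cases rule: A.edge_cases)
      case 1
      then show ?thesis using fpar[OF 1(1)] B.par_edge[of "f u"] fne[OF uv(1)] by simp
    next
      case 2
      then show ?thesis using fpar[OF 2(1)] B.par_edge'[of "f v"] fne[OF uv(2)] by simp
    qed
  next
    assume "{f u, f v} \<in> edges G'"
    then show "{u, v} \<in> edges G"
    proof (cases rule: B.edge_cases)
      case 1
      then have u: "u \<in> ?V" using fne[OF uv(1)] by blast
      then have "v = par u" using 1 fpar[OF u] finj[OF uv(2)] A.par_verts[OF u] by simp
      then show ?thesis using A.par_edge[OF u] by simp
    next
      case 2
      then have v: "v \<in> ?V" using fne[OF uv(2)] by blast
      then have "u = par v" using 2 fpar[OF v] finj[OF uv(1)] A.par_verts[OF v] by simp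
      then show ?thesis using A.par_edge'[OF v] by simp
    qed
  qed
  have "f (l x) = l' x" if x: "x \<in> X" for x
  proof (cases "x = 0")
    case False
    have "l' x = g (l x)"
      by (rule guniq[OF A.leaf_Dn(1)[OF x False] B.leaf_Dn(1)[OF x False]])
        (simp add: A.leaf_Dn(4)[OF x False] B.leaf_Dn(4)[OF x False])
    then show ?thesis using fV[OF A.leaf_Dn(1)[OF x False]] by simp
  qed (simp add: f_def)
  then show ?thesis unfolding ltree_iso_def using bij edge by auto
qed

lemma iso_clusters_subset:
  assumes S: "binary_ltree X (G, l)" "binary_ltree X (G', l')" "0 \<in> X" and "ltree_iso X (G, l) (G', l')"
  shows "clusters X (G, l) \<subseteq> clusters X (G', l')"
proof
  obtain f where f: "bij_betw f (verts G) (verts G')"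
    "\<And>u v. u \<in> verts G \<Longrightarrow> v \<in> verts G \<Longrightarrow> {u, v} \<in> edges G \<longleftrightarrow> {f u, f v} \<in> edges G'"
    "\<And>x. x \<in> X \<Longrightarrow> f (l x) = l' x" using assms(4) unfolding ltree_iso_def by auto
  have sg: "simple_graph G" "simple_graph G'" using S unfolding binary_ltree_def tree_def by auto
  have lX: "l x \<in> verts G" "l' x \<in> verts G'" if "x \<in> X" for x
    using S that unfolding binary_ltree_def bij_betw_def by auto
  let ?g = "inv_into (verts G) f"
  have gf: "?g (f v) = v" if "v \<in> verts G" for v using f(1) that by (simp add: bij_betw_def)
  have fg: "f (?g v) = v" "?g v \<in> verts G" if "v \<in> verts G'" for v
    using f(1) that by (auto simp: bij_betw_def f_inv_into_f inv_into_into)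
  fix c assume "c \<in> clusters X (G, l)"
  then obtain e where e: "e \<in> edges G" "c = {x \<in> X. \<not> joined (delete_edge e G) (l 0) (l x)}" unfolding clusters_def by auto
  have "card e = 2" using e(1) sg unfolding simple_graph_def by blast
  then obtain a b where ab: "e = {a, b}" by (meson card_2_iff)
  have abV: "a \<in> verts G" "b \<in> verts G" using edge_verts[OF sg(1)] e(1) ab by auto
  let ?e = "{f a, f b}"
  have e': "?e \<in> edges G'" using f(2)[OF abV] e(1) ab by simp
  have to: "reach (delete_edge ?e G') (f u) (f v)" if "reach (delete_edge e G) u v" for u v
    using that
  proof (rule reach_hom)
    fix x y assume xy: "{x, y} \<in> edges (delete_edge e G)"
    then have V: "x \<in> verts G" "y \<in> verts G" using edge_verts[OF sg(1)] by auto
    have "{f x, f y} \<noteq> ?e"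
    proof
      assume "{f x, f y} = ?e"
      then have "{?g (f x), ?g (f y)} = {?g (f a), ?g (f b)}" by (metis image_insert image_empty)
      then show False using gf V abV xy ab by simp
    qed
    then show "reach (delete_edge ?e G') (f x) (f y)" using f(2)[OF V] xy by (intro reach_edge) simp
  qed
  have fro: "reach (delete_edge e G) (?g u) (?g v)" if "reach (delete_edge ?e G') u v" for u v
    using that
  proof (rule reach_hom)
    fix x y assume xy: "{x, y} \<in> edges (delete_edge ?e G')"
    then have V: "x \<in> verts G'" "y \<in> verts G'" using edge_verts[OF sg(2)] by auto
    have "{?g x, ?g y} \<noteq> e"
    proof
      assume "{?g x, ?g y} = e"
      then have "{f (?g x), f (?g y)} = ?e" using ab by (metis image_insert image_empty)
      then show False using fg V xy by simp
    qed
    then show "reach (delete_edge e G) (?g x) (?g y)"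
      using f(2)[OF fg(2)[OF V(1)] fg(2)[OF V(2)]] fg(1)[OF V(1)] fg(1)[OF V(2)] xy by (intro reach_edge) simp
  qed
  have "joined (delete_edge e G) (l 0) (l x) \<longleftrightarrow> joined (delete_edge ?e G') (l' 0) (l' x)" if x: "x \<in> X" for x
  proof -
    have "joined (delete_edge e G) (l 0) (l x) \<longleftrightarrow> reach (delete_edge e G) (l 0) (l x)"
      using joined_iff_reach[OF simple_delete_edge[OF sg(1)]] lX(1)[OF assms(3)] by simp
    also have "\<dots> \<longleftrightarrow> reach (delete_edge ?e G') (l' 0) (l' x)"
    proof
      show "reach (delete_edge e G) (l 0) (l x) \<Longrightarrow> reach (delete_edge ?e G') (l' 0) (l' x)"
        using to[of "l 0" "l x"] f(3)[OF x] f(3)[OF assms(3)] by simp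
      have "?g (l' 0) = l 0" "?g (l' x) = l x"
        using gf[OF lX(1)[OF assms(3)]] gf[OF lX(1)[OF x]] f(3)[OF x] f(3)[OF assms(3)] by simp_all
      then show "reach (delete_edge ?e G') (l' 0) (l' x) \<Longrightarrow> reach (delete_edge e G) (l 0) (l x)"
        using fro[of "l' 0" "l' x"] by simp
    qed
    also have "\<dots> \<longleftrightarrow> joined (delete_edge ?e G') (l' 0) (l' x)"
      using joined_iff_reach[OF simple_delete_edge[OF sg(2)]] lX(2)[OF assms(3)] by simp
    finally show ?thesis .
  qed
  then have "c = {x \<in> X. \<not> joined (delete_edge ?e G') (l' 0) (l' x)}" using e(2) by blast
  then show "c \<in> clusters X (G', l')" using e' unfolding clusters_def by auto
qed

lemma ltree_iso_sym:
  assumes "ltree_iso X (G, l) (G', l')" "l ` X \<subseteq> verts G"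
  shows "ltree_iso X (G', l') (G, l)"
proof -
  obtain f where f: "bij_betw f (verts G) (verts G')"
    "\<And>u v. u \<in> verts G \<Longrightarrow> v \<in> verts G \<Longrightarrow> {u, v} \<in> edges G \<longleftrightarrow> {f u, f v} \<in> edges G'"
    "\<And>x. x \<in> X \<Longrightarrow> f (l x) = l' x" using assms(1) unfolding ltree_iso_def by auto
  let ?g = "inv_into (verts G) f"
  have fg: "f (?g v) = v" "?g v \<in> verts G" if "v \<in> verts G'" for v
    using f(1) that by (auto simp: bij_betw_def f_inv_into_f inv_into_into)
  have "?g (l' x) = l x" if "x \<in> X" for x
  proof -
    have "l x \<in> verts G" using that assms(2) by blast
    then have "?g (f (l x)) = l x" using f(1) by (simp add: bij_betw_def)
    then show ?thesis using f(3)[OF that] by simp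
  qed
  moreover have "{u, v} \<in> edges G' \<longleftrightarrow> {?g u, ?g v} \<in> edges G" if "u \<in> verts G'" "v \<in> verts G'" for u v
    using f(2)[OF fg(2)[OF that(1)] fg(2)[OF that(2)]] fg(1)[OF that(1)] fg(1)[OF that(2)] by simp
  ultimately show ?thesis unfolding ltree_iso_def using bij_betw_inv_into[OF f(1)] by auto
qed

lemma iso_rel_iff:
  assumes "0 \<in> X"
  shows "(S, T) \<in> iso_rel X \<longleftrightarrow> binary_ltree X S \<and> binary_ltree X T \<and> clusters X S = clusters X T"
proof -
  obtain G l where S: "S = (G, l)" by (cases S)
  obtain G' l' where T: "T = (G', l')" by (cases T)
  have "ltree_iso X S T \<longleftrightarrow> clusters X S = clusters X T" if b: "binary_ltree X S" "binary_ltree X T"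
  proof
    assume i: "ltree_iso X S T"
    have "l ` X \<subseteq> verts G" using b(1) unfolding S binary_ltree_def bij_betw_def by auto
    then have "ltree_iso X T S" using ltree_iso_sym i unfolding S T by blast
    then show "clusters X S = clusters X T" using iso_clusters_subset[OF _ _ assms] i b unfolding S T by blast
  next
    assume "clusters X S = clusters X T"
    then show "ltree_iso X S T" using same_clusters_iso[OF _ _ assms] b unfolding S T by blast
  qed
  then show ?thesis unfolding iso_rel_def by blast
qed

section \<open>The subtree transfer move on clusters\<close>

locale spr_config = binary_rtree G r par Dn X l for G r par Dn X l +
  fixes x y a b c d :: nat
  assumes yV: "y \<in> verts G - {r}" and x: "x = par y" and xr: "x \<noteq> r" and a: "a = par x"
    and chx: "ch x = {y, b}" and bney: "b \<noteq> y"
    and dV: "d \<in> verts G - {r}" and dY: "d \<notin> Dn y" and dx: "d \<noteq> x" and db: "d \<noteq> b" and c: "c = par d"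
begin

abbreviation "Z \<equiv> insert x (Dn y)"

lemma xV: "x \<in> verts G - {r}" using par_verts[OF yV] x xr by simp
lemma bV: "b \<in> verts G - {r}" and par_b: "par b = x"
  using chx unfolding ch_def by auto
lemma aV: "a \<in> verts G" using par_verts[OF xV] a by simp
lemma cV: "c \<in> verts G" using par_verts[OF dV] c by simp
lemma ne_xy: "x \<noteq> y" using par_neq[OF yV] x by simp
lemma ne_xb: "x \<noteq> b" using par_neq[OF bV] par_b by simp
lemma ne_ax: "a \<noteq> x" using par_neq[OF xV] a by simp
lemma ne_yd: "y \<noteq> d" using dY self_Dn[OF yV] by auto
lemma ne_cx: "c \<noteq> x"
proof
  assume "c = x"
  then have "d \<in> ch x" using dV c unfolding ch_def by simp
  then show False using chx ne_yd db by simp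
qed
lemma xY: "x \<notin> Dn y" using par_Dn[OF yV] x by simp
lemma aY: "a \<notin> Dn y" using step_Dn[OF yV xV ne_xy] xY a by simp
lemma cY: "c \<notin> Dn y" using step_Dn[OF yV dV ne_yd[symmetric]] dY c by simp
lemma bY: "b \<notin> Dn y"
proof -
  have "Dn b \<inter> Dn y = {}" by (rule ch_disjoint[of b x y]) (use chx bney in simp_all)
  then show ?thesis using self_Dn[OF bV] by blast
qed
lemma aZ: "a \<notin> Z" using aY ne_ax by simp
lemma cZ: "c \<notin> Z" using cY ne_cx by simp
lemma bZ: "b \<notin> Z" using bY ne_xb by simp
lemma dZ: "d \<notin> Z" using dY dx by simp
lemma xDb: "x \<notin> Dn b" using par_Dn[OF bV] par_b by simp
lemma aDb: "a \<notin> Dn b" using step_Dn[OF bV xV ne_xb] xDb a by simp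
lemma ne_ab: "a \<noteq> b" using aDb self_Dn[OF bV] by auto
lemma cDd: "c \<notin> Dn d" using par_Dn[OF dV] c by simp
lemma ZV: "Z \<subseteq> verts G" using Dn_verts[OF yV] xV by blast
lemma rZ: "r \<notin> Z" using root_Dn[OF yV] xr by simp

lemma par_Y: "u \<in> Dn y \<Longrightarrow> par u \<in> Z"
proof (cases "u = y")
  case False
  assume u: "u \<in> Dn y"
  then have "u \<in> verts G - {r}" using Dn_verts[OF yV] root_Dn[OF yV] by blast
  then show ?thesis using step_Dn[OF yV _ False] u by simp
qed (simp add: x)

lemma par_nZ: assumes u: "u \<in> verts G - {r}" "u \<notin> Z" "u \<noteq> b" shows "par u \<notin> Z"
proof -
  have uy: "u \<noteq> y" using u(2) self_Dn[OF yV] by auto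
  have "par u \<noteq> x" using u chx uy unfolding ch_def by blast
  moreover have "par u \<notin> Dn y" using step_Dn[OF yV u(1) uy] u(2) by simp
  ultimately show ?thesis by simp
qed

definition par' where "par' = par(b := a, d := x, x := c)"
definition Dn' where "Dn' v = (if v \<in> Dn y then Dn v else if v = x then Dn d \<union> Z
   else (Dn v - Z) \<union> (if c \<in> Dn v then Z else {}))"

abbreviation "G' \<equiv> SPR_result G x a b c d"

lemma par'_b: "par' b = a" and par'_d: "par' d = x" and par'_x: "par' x = c"
  and par'_other: "u \<noteq> b \<Longrightarrow> u \<noteq> d \<Longrightarrow> u \<noteq> x \<Longrightarrow> par' u = par u"
  unfolding par'_def using dx db ne_xb by auto

lemma par'_Y: "u \<in> Dn y \<Longrightarrow> par' u = par u"
  using bY dY xY by (intro par'_other) auto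

lemma Dn'_Y: "v \<in> Dn y \<Longrightarrow> Dn' v = Dn v" unfolding Dn'_def by simp
lemma Dn'_x: "Dn' x = Dn d \<union> Z" unfolding Dn'_def using xY by simp
lemma Dn'_nZ: "v \<notin> Z \<Longrightarrow> u \<in> Dn' v \<longleftrightarrow> (if u \<in> Z then c \<in> Dn v else u \<in> Dn v)"
  unfolding Dn'_def by auto

lemma verts_G': "verts G' = verts G" unfolding SPR_result_def by simp

lemma ab_ne_cd: "{a, b} \<noteq> {c, d}"
proof
  assume "{a, b} = {c, d}"
  then have eq: "a = d" "b = c" using db by (auto simp: doubleton_eq_iff)
  then have "par a = b" using c by simp
  moreover have "a \<in> verts G - {r}" using dV eq by simp
  ultimately have "a \<in> Dn b" using step_Dn[OF bV, of a] ne_ab self_Dn[OF bV] by simp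
  then show False using aDb by simp
qed

lemma edges_G': "edges G' = (edges G - {{a, x}, {x, b}, {c, d}}) \<union> {{a, b}, {c, x}, {x, d}}"
  unfolding SPR_result_def using ab_ne_cd by auto

lemma edge_x: "{a, x} = {x, par x}" and edge_b: "{x, b} = {b, par b}" and edge_d: "{c, d} = {d, par d}"
  using a par_b c by (auto simp: insert_commute)

lemma edges_minus: "edges G - {{a, x}, {x, b}, {c, d}} = (\<lambda>v. {v, par v}) ` (verts G - {r} - {x, b, d})"
proof
  show "edges G - {{a, x}, {x, b}, {c, d}} \<subseteq> (\<lambda>v. {v, par v}) ` (verts G - {r} - {x, b, d})"
  proof
    fix e assume e: "e \<in> edges G - {{a, x}, {x, b}, {c, d}}"
    then obtain v where v: "v \<in> verts G - {r}" "e = {v, par v}" unfolding edges_eq by blast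
    have "v \<notin> {x, b, d}" using e v(2) unfolding edge_x edge_b edge_d by auto
    then show "e \<in> (\<lambda>v. {v, par v}) ` (verts G - {r} - {x, b, d})" using v by blast
  qed
  show "(\<lambda>v. {v, par v}) ` (verts G - {r} - {x, b, d}) \<subseteq> edges G - {{a, x}, {x, b}, {c, d}}"
  proof (rule image_subsetI)
    fix v assume v: "v \<in> verts G - {r} - {x, b, d}"
    then have "{v, par v} \<in> edges G" using par_edge by blast
    moreover have "{v, par v} \<noteq> {x, par x}" "{v, par v} \<noteq> {b, par b}" "{v, par v} \<noteq> {d, par d}"
      using edge_inj[of v x] edge_inj[of v b] edge_inj[of v d] v xV bV dV by auto
    ultimately show "{v, par v} \<in> edges G - {{a, x}, {x, b}, {c, d}}" unfolding edge_x edge_b edge_d by simp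
  qed
qed

lemma edges_par': "edges G' = (\<lambda>v. {v, par' v}) ` (verts G' - {r})"
proof -
  have 1: "verts G - {r} = (verts G - {r} - {x, b, d}) \<union> {x, b, d}" using xV bV dV by blast
  have "(\<lambda>v. {v, par' v}) ` (verts G - {r} - {x, b, d}) = (\<lambda>v. {v, par v}) ` (verts G - {r} - {x, b, d})"
    by (rule image_cong[OF refl]) (use par'_other in simp)
  moreover have "(\<lambda>v. {v, par' v}) ` {x, b, d} = {{a, b}, {c, x}, {x, d}}"
    using par'_b par'_d par'_x by (auto simp: insert_commute)
  ultimately have "(\<lambda>v. {v, par' v}) ` (verts G - {r}) = edges G'"
    unfolding edges_G' edges_minus by (subst 1) (simp only: image_Un)
  then show ?thesis using verts_G' by simp
qed

lemma rtree': "rtree G' r par' Dn'"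
proof
  show "finite (verts G')" "r \<in> verts G'" using finV root verts_G' by auto
  show "edges G' = (\<lambda>v. {v, par' v}) ` (verts G' - {r})" by (rule edges_par')
  fix v assume "v \<in> verts G' - {r}"
  then have v: "v \<in> verts G - {r}" using verts_G' by simp
  have cases_v: "v \<in> Dn y \<or> v = x \<or> v \<notin> Z" by blast
  show "par' v \<in> verts G'"
  proof -
    consider "v = b" | "v = d" | "v = x" | "v \<noteq> b" "v \<noteq> d" "v \<noteq> x" by blast
    then show ?thesis
      using par'_b par'_d par'_x par'_other[of v] aV xV cV par_verts[OF v] verts_G' by cases simp_all
  qed
  show "Dn' v \<subseteq> verts G'" unfolding Dn'_def verts_G' using Dn_verts[OF v] Dn_verts[OF dV] ZV by auto
  show "r \<notin> Dn' v" unfolding Dn'_def using root_Dn[OF v] root_Dn[OF dV] rZ by auto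
  show "v \<in> Dn' v"
    using cases_v Dn'_Y[of v] Dn'_x Dn'_nZ[of v v] self_Dn[OF v] by auto
  show "par' v \<notin> Dn' v"
  proof -
    consider "v \<in> Dn y" | "v = x" | "v = b" | "v = d" | "v \<notin> Z" "v \<noteq> b" "v \<noteq> d" using cases_v by blast
    then show ?thesis
    proof cases
      case 1
      then show ?thesis using par'_Y Dn'_Y par_Dn[OF v] by simp
    next
      case 2
      then show ?thesis using par'_x Dn'_x cDd cZ by simp
    next
      case 3
      then show ?thesis using par'_b Dn'_nZ[OF bZ, of a] aZ aDb by simp
    next
      case 4
      then show ?thesis using par'_d Dn'_nZ[OF dZ, of x] cDd by simp
    next
      case 5
      have "par' v = par v" using 5 by (intro par'_other) auto
      then show ?thesis using Dn'_nZ[OF 5(1), of "par v"] par_nZ[OF v 5(1,2)] par_Dn[OF v] by simp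
    qed
  qed
  fix u assume "u \<in> verts G' - {r}" and uv: "u \<noteq> v"
  then have u: "u \<in> verts G - {r}" using verts_G' by simp
  have b_chain: "b \<in> Dn w \<longleftrightarrow> a \<in> Dn w" if "w \<in> verts G - {r}" "w \<noteq> b" "w \<noteq> x" for w
    using step_Dn[OF that(1) bV] step_Dn[OF that(1) xV] that(2,3) par_b a by auto
  consider (Y) "u \<in> Dn y" | (x) "u = x" | (b) "u = b" | (d) "u = d" | (o) "u \<notin> Z" "u \<noteq> b" "u \<noteq> d" by blast
  note ucases = this
  show "u \<in> Dn' v \<longleftrightarrow> par' u \<in> Dn' v"
  proof -
    consider (vY) "v \<in> Dn y" | (vx) "v = x" | (vn) "v \<notin> Z" using cases_v by blast
    then show ?thesis
    proof cases
      case vY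
      have sub: "Dn v \<subseteq> Dn y" by (rule Dn_trans[OF yV v vY])
      show ?thesis
      proof (cases "u \<in> Dn y")
        case True
        then show ?thesis using par'_Y Dn'_Y[OF vY] step_Dn[OF v u uv] by simp
      next
        case False
        have "par' u \<notin> Dn y"
          using ucases
        proof cases
          case o
          then show ?thesis using par'_other[of u] par_nZ[OF u] by auto
        qed (use False par'_x par'_b par'_d cY aY xY in simp_all)
        then show ?thesis using Dn'_Y[OF vY] False sub by blast
      qed
    next
      case vx
      show ?thesis
        using ucases
      proof cases
        case Y
        then show ?thesis using par'_Y par_Y vx Dn'_x by auto
      next
        case b
        then show ?thesis using b_chain[OF dV db dx] par'_b bZ aZ vx Dn'_x by auto
      next
        case d
        then show ?thesis using par'_d self_Dn[OF dV] vx Dn'_x by auto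
      next
        case o
        have "par' u = par u" using o by (intro par'_other) auto
        then show ?thesis using step_Dn[OF dV u o(3)] par_nZ[OF u o(1,2)] o(1) vx Dn'_x by auto
      qed (use uv vx in simp)
    next
      case vn
      note D = Dn'_nZ[OF vn]
      have vx: "v \<noteq> x" using vn by simp
      show ?thesis
        using ucases
      proof cases
        case Y
        then show ?thesis using par'_Y par_Y[OF Y] D by simp
      next
        case x
        then show ?thesis using par'_x cZ D by simp
      next
        case b
        then show ?thesis using b_chain[OF v _ vx] uv par'_b bZ aZ D by simp
      next
        case d
        then show ?thesis using step_Dn[OF v dV] uv c par'_d dZ D by simp
      next
        case o
        have "par' u = par u" using o by (intro par'_other) auto
        then show ?thesis using step_Dn[OF v u uv] par_nZ[OF u o(1,2)] o(1) D by simp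
      qed
    qed
  qed
qed

text \<open>The new parent function is the old one precomposed with the 3-cycle
  taking b to x, x to d and d to b, so the numbers of children do not change.\<close>

lemma card_ch': "card {w \<in> verts G' - {r}. par' w = v} = card (ch v)"
proof -
  define \<pi> where "\<pi> = id(b := x, x := d, d := b)"
  have \<pi>: "\<pi> b = x" "\<pi> x = d" "\<pi> d = b" "\<And>u. u \<noteq> b \<Longrightarrow> u \<noteq> x \<Longrightarrow> u \<noteq> d \<Longrightarrow> \<pi> u = u"
    unfolding \<pi>_def using db dx ne_xb by auto
  have par: "par' w = par (\<pi> w)" for w
  proof -
    consider "w = b" | "w = d" | "w = x" | "w \<noteq> b" "w \<noteq> d" "w \<noteq> x" by blast
    then show ?thesis using \<pi> par'_b par'_d par'_x par'_other[of w] a c par_b by cases simp_all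
  qed
  have inj: "inj \<pi>"
  proof (rule injI)
    fix u v assume e: "\<pi> u = \<pi> v"
    consider "u = b" | "u = d" | "u = x" | "u \<noteq> b" "u \<noteq> d" "u \<noteq> x" by blast
    moreover consider "v = b" | "v = d" | "v = x" | "v \<noteq> b" "v \<noteq> d" "v \<noteq> x" by blast
    ultimately show "u = v" using e \<pi>(1-3) \<pi>(4)[of u] \<pi>(4)[of v] db dx ne_xb by metis
  qed
  have mem: "\<pi> w \<in> verts G - {r} \<longleftrightarrow> w \<in> verts G - {r}" for w
  proof -
    consider "w = b" | "w = d" | "w = x" | "w \<noteq> b" "w \<noteq> d" "w \<noteq> x" by blast
    then show ?thesis using \<pi>(1-3) \<pi>(4)[of w] bV dV xV by cases simp_all
  qed
  have "\<pi> ` {w \<in> verts G' - {r}. par' w = v} = ch v"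
  proof
    show "\<pi> ` {w \<in> verts G' - {r}. par' w = v} \<subseteq> ch v"
      unfolding ch_def verts_G' using par mem by auto
    show "ch v \<subseteq> \<pi> ` {w \<in> verts G' - {r}. par' w = v}"
    proof
      fix w assume w: "w \<in> ch v"
      have "\<exists>u. \<pi> u = w"
      proof -
        consider "w = b" | "w = d" | "w = x" | "w \<noteq> b" "w \<noteq> d" "w \<noteq> x" by blast
        then show ?thesis using \<pi>(1-3) \<pi>(4)[of w] by cases blast+
      qed
      then obtain u where u: "\<pi> u = w" by blast
      then have "u \<in> {w \<in> verts G' - {r}. par' w = v}" using w par[of u] mem[of u] unfolding ch_def verts_G' by simp
      then show "w \<in> \<pi> ` {w \<in> verts G' - {r}. par' w = v}" using u by blast
    qed
  qed
  then show ?thesis using card_image[OF inj_on_subset[OF inj subset_UNIV]] by metis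
qed

lemma deg': assumes v: "v \<in> verts G" shows "deg G' v = deg G v"
proof -
  have v': "v \<in> verts G'" using v verts_G' by simp
  show ?thesis using rtree.deg_eq[OF rtree' v'] deg_eq[OF v] card_ch'[of v] unfolding rtree.ch_def[OF rtree'] by simp
qed

lemma binary': "binary_ltree X (G', l)"
proof -
  have "{v \<in> verts G'. deg G' v = 1} = {v \<in> verts G. deg G v = 1}" using deg' verts_G' by auto
  moreover have "\<forall>v\<in>verts G'. deg G' v = 3 \<or> deg G' v = 1"
    using bl deg' verts_G' unfolding binary_ltree_def by simp
  ultimately show ?thesis using bl rtree.tree[OF rtree'] unfolding binary_ltree_def by simp
qed

lemma binary_rtree': "binary_rtree G' r par' Dn' X l"
  using rtree' binary' X0 r_def unfolding binary_rtree_def binary_rtree_axioms_def by simp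

lemma spr_allowed: "SPR_allowed G x y a b c d"
  unfolding SPR_allowed_def
proof (intro conjI)
  have exy: "{x, y} = {y, par y}" using x by (simp add: insert_commute)
  show "{{x, y}, {a, x}, {x, b}, {c, d}} \<subseteq> edges G"
    unfolding exy edge_x edge_b edge_d using par_edge[OF yV] par_edge[OF xV] par_edge[OF bV] par_edge[OF dV] by simp
  show "distinct [{x, y}, {a, x}, {x, b}, {c, d}]"
    unfolding exy edge_x edge_b edge_d
    using edge_inj[OF yV xV] edge_inj[OF yV bV] edge_inj[OF yV dV] edge_inj[OF xV bV] edge_inj[OF xV dV] edge_inj[OF bV dV]
      ne_xy bney ne_yd ne_xb dx db by auto
  have "joined G c y" using joined_iff_reach[OF simple] cV reach_all[OF cV, of y] yV by simp
  then obtain p where p: "path_between G c p y" unfolding joined_def by blast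
  then have "x \<in> set p" using path_cross[OF yV p cY self_Dn[OF yV]] x by simp
  then show "\<exists>p. path_between G c p y \<and> x \<in> set p" using p by blast
qed

lemma root_path: "\<exists>p. path_between G (l 0) p y \<and> x \<in> set p"
proof -
  have "joined G r y" using joined_iff_reach[OF simple] root reach_all[OF root, of y] yV by simp
  then obtain p where p: "path_between G r p y" unfolding joined_def by blast
  then have "x \<in> set p" using path_cross[OF yV p root_Dn[OF yV] self_Dn[OF yV]] x by simp
  then show ?thesis using p r_def by blast
qed

lemma l_ne_x: "t \<in> X \<Longrightarrow> l t \<noteq> x"
proof
  assume t: "t \<in> X" "l t = x"
  then have "t \<noteq> 0" using xr r_def by metis
  then show False using leaf_iff[OF xV] t chx by blast
qed

lemma lab': "{t \<in> X. l t \<in> Dn' v} = (if v \<in> Dn y then lab v else if v = x then lab d \<union> lab y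
   else (lab v - lab y) \<union> (if c \<in> Dn v then lab y else {}))"
  unfolding Dn'_def lab_def using l_ne_x by auto

lemma clusters': "clusters X (G', l) = regraft (clusters X (G, l)) (lab y) (lab d)"
proof -
  interpret B: binary_rtree G' r par' Dn' X l by (rule binary_rtree')
  have eq': "clusters X (G', l) = (\<lambda>v. {t \<in> X. l t \<in> Dn' v}) ` (verts G - {r})"
    unfolding B.clusters_eq B.lab_def verts_G' ..
  let ?V = "verts G - {r}"
  let ?f = "\<lambda>v. {t \<in> X. l t \<in> Dn' v}"
  have cD: "c \<in> Dn v \<longleftrightarrow> d \<in> Dn v" if "v \<in> ?V" "v \<noteq> d" for v using step_Dn[OF that(1) dV] that(2) c by auto
  have labx: "lab x = lab y \<union> lab b" "lab y \<inter> lab b = {}" using lab_children[OF xV chx] bney by auto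
  have inY: "lab v \<subseteq> lab y \<longleftrightarrow> v \<in> Dn y" if "v \<in> ?V" for v by (rule lab_subset_iff[OF yV that])
  have onD: "lab d \<subseteq> lab v \<longleftrightarrow> d \<in> Dn v" if "v \<in> ?V" for v by (rule lab_subset_iff[OF that dV])
  have fY: "?f v = lab v" if "v \<in> Dn y" for v using that lab'[of v] by simp
  have fx: "?f x = lab d \<union> lab y" using lab'[of x] xY by simp
  have fd: "?f d = lab d - lab y" using lab'[of d] dY dx cDd by simp
  have f1: "?f v = lab v \<union> lab y" if "v \<in> ?V" "v \<notin> Z" "v \<noteq> d" "d \<in> Dn v" for v
    using lab'[of v] that cD[OF that(1,3)] by auto
  have f2: "?f v = lab v - lab y" if "v \<in> ?V" "v \<notin> Z" "v \<noteq> d" "d \<notin> Dn v" for v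
    using lab'[of v] that cD[OF that(1,3)] by auto
  have Cm: "lab v \<in> clusters X (G, l)" if "v \<in> ?V" for v unfolding clusters_eq using that by (rule imageI)
  show ?thesis
  proof
    show "clusters X (G', l) \<subseteq> regraft (clusters X (G, l)) (lab y) (lab d)"
    proof
      fix C assume "C \<in> clusters X (G', l)"
      then obtain v where v: "v \<in> ?V" "C = ?f v" unfolding eq' by (elim imageE) simp
      consider "v \<in> Dn y" | "v = x" | "v = d" | "v \<notin> Z" "v \<noteq> d" "d \<in> Dn v" | "v \<notin> Z" "v \<noteq> d" "d \<notin> Dn v" by blast
      then show "C \<in> regraft (clusters X (G, l)) (lab y) (lab d)"
      proof cases
        case 1
        then have "C \<in> {c \<in> clusters X (G, l). c \<subseteq> lab y}" using v fY inY[OF v(1)] Cm[OF v(1)] by simp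
        then show ?thesis unfolding regraft_def by simp
      next
        case 2
        then have "C \<in> {c \<union> lab y |c. c \<in> clusters X (G, l) \<and> lab d \<subseteq> c}" using v fx Cm[OF dV] by blast
        then show ?thesis unfolding regraft_def by simp
      next
        case 3
        then show ?thesis using v fd unfolding regraft_def by simp
      next
        case 4
        then have "C \<in> {c \<union> lab y |c. c \<in> clusters X (G, l) \<and> lab d \<subseteq> c}"
          using v f1[OF v(1) 4] Cm[OF v(1)] onD[OF v(1)] by blast
        then show ?thesis unfolding regraft_def by simp
      next
        case 5
        have "\<not> lab v \<subseteq> lab y" using inY[OF v(1)] 5(1) by simp
        then have "C \<in> {c - lab y |c. c \<in> clusters X (G, l) \<and> \<not> c \<subseteq> lab y \<and> \<not> lab d \<subseteq> c}"
          using v f2[OF v(1) 5] Cm[OF v(1)] onD[OF v(1)] 5(3) by blast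
        then show ?thesis unfolding regraft_def by simp
      qed
    qed
    have im: "?f v \<in> clusters X (G', l)" if "v \<in> ?V" for v unfolding eq' using that by (rule imageI)
    show "regraft (clusters X (G, l)) (lab y) (lab d) \<subseteq> clusters X (G', l)"
    proof
      fix C assume C: "C \<in> regraft (clusters X (G, l)) (lab y) (lab d)"
      then consider "C \<in> clusters X (G, l)" "C \<subseteq> lab y" | v where "v \<in> ?V" "C = lab v - lab y" "\<not> lab v \<subseteq> lab y" "\<not> lab d \<subseteq> lab v"
        | v where "v \<in> ?V" "C = lab v \<union> lab y" "lab d \<subseteq> lab v" | "C = lab d - lab y"
        unfolding regraft_def clusters_eq by blast
      then show "C \<in> clusters X (G', l)"
      proof cases
        case 1
        then obtain v where v: "v \<in> ?V" "C = lab v" unfolding clusters_eq by (elim imageE) simp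
        then show ?thesis using 1(2) inY[OF v(1)] fY im[OF v(1)] by simp
      next
        case 2
        have vd: "v \<noteq> d" using 2(4) by auto
        have vY: "v \<notin> Dn y" "d \<notin> Dn v" using 2 inY[OF 2(1)] onD[OF 2(1)] by auto
        show ?thesis
        proof (cases "v = x")
          case True
          have "d \<notin> Dn b"
          proof
            assume "d \<in> Dn b"
            moreover have "b \<in> Dn x" using ch_Dn[of b x] chx xr by simp
            ultimately show False using Dn_trans[OF xV bV] vY(2) True by blast
          qed
          then have "?f b = lab b - lab y" by (rule f2[OF bV bZ db[symmetric]])
          moreover have "C = lab b - lab y" using 2(2) True labx by blast
          ultimately show ?thesis using im[OF bV] by simp
        next
          case False
          then show ?thesis using f2[OF 2(1) _ vd vY(2)] vY(1) 2(2) im[OF 2(1)] by simp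
        qed
      next
        case 3
        have dv: "d \<in> Dn v" using 3(3) onD[OF 3(1)] by simp
        have vY: "v \<notin> Dn y" using dv dY Dn_trans[OF yV 3(1)] by blast
        consider "v = d" | "v = x" | "v \<noteq> d" "v \<notin> Z" using vY by blast
        then show ?thesis
        proof cases
          case 1
          then show ?thesis using fx im[OF xV] 3(2) by simp
        next
          case 2
          have "d \<in> Dn b" using dv Dn_children[OF xV] chx dx dY 2 by auto
          then have "?f b = lab b \<union> lab y" by (rule f1[OF bV bZ db[symmetric]])
          moreover have "C = lab b \<union> lab y" using 3(2) 2 labx by blast
          ultimately show ?thesis using im[OF bV] by simp
        next
          case sub: 3
          then show ?thesis using f1[OF 3(1) sub(2,1) dv] 3(2) im[OF 3(1)] by simp
        qed
      next
        case 4
        then show ?thesis using fd im[OF dV] by simp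
      qed
    qed
  qed
qed

end

context binary_rtree begin

lemma regraft_trivial:
  assumes y: "y \<in> verts G - {r}" and xr: "par y \<noteq> r" and chx: "ch (par y) = {y, b}" and bney: "b \<noteq> y"
    and d: "d = par y \<or> d = b"
  shows "regraft (clusters X (G, l)) (lab y) (lab d) = clusters X (G, l)"
proof -
  let ?V = "verts G - {r}"
  have xV: "par y \<in> ?V" using par_verts[OF y] xr by simp
  have bV: "b \<in> ?V" and pb: "par b = par y" using chx unfolding ch_def by auto
  have labx: "lab (par y) = lab y \<union> lab b" "lab y \<inter> lab b = {}" using lab_children[OF xV chx] bney by auto
  have dV: "d \<in> ?V" using d xV bV by auto
  have inY: "lab v \<subseteq> lab y \<longleftrightarrow> v \<in> Dn y" if "v \<in> ?V" for v by (rule lab_subset_iff[OF y that])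
  have Cm: "lab v \<in> clusters X (G, l)" if "v \<in> ?V" for v unfolding clusters_eq using that by (rule imageI)
  have Dy: "lab d - lab y = lab b" using d labx by blast
  have yv: "lab y \<subseteq> lab v" if "v \<in> ?V" "lab d \<subseteq> lab v" "v \<noteq> b \<or> d = par y" for v
  proof (cases "d = par y")
    case True
    then show ?thesis using that(2) labx(1) by blast
  next
    case False
    then have "d = b" "v \<noteq> b" using d that(3) by auto
    then have "b \<in> Dn v" using that(2) lab_subset_iff[OF that(1) bV] by simp
    then have "par y \<in> Dn v" using step_Dn[OF that(1) bV] \<open>v \<noteq> b\<close> pb by auto
    then have "lab (par y) \<subseteq> lab v" by (rule lab_mono[OF that(1)])
    then show ?thesis using labx(1) by blast
  qed
  have disj: "lab v \<inter> lab y = {}" if v: "v \<in> ?V" "\<not> lab v \<subseteq> lab y" "\<not> lab d \<subseteq> lab v" for v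
  proof (rule lab_disjoint[OF y v(1)])
    show n: "v \<notin> Dn y" using v(2) inY[OF v(1)] by simp
    show "y \<notin> Dn v"
    proof
      assume yv': "y \<in> Dn v"
      have "y \<noteq> v" using n self_Dn[OF y] by auto
      then have "par y \<in> Dn v" using step_Dn[OF v(1) y] yv' by simp
      then have "lab (par y) \<subseteq> lab v" by (rule lab_mono[OF v(1)])
      then show False using v(3) d labx(1) by blast
    qed
  qed
  show ?thesis
  proof
    show "regraft (clusters X (G, l)) (lab y) (lab d) \<subseteq> clusters X (G, l)"
    proof
      fix C assume C: "C \<in> regraft (clusters X (G, l)) (lab y) (lab d)"
      then consider "C \<in> clusters X (G, l)" | v where "v \<in> ?V" "C = lab v - lab y" "\<not> lab v \<subseteq> lab y" "\<not> lab d \<subseteq> lab v"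
        | v where "v \<in> ?V" "C = lab v \<union> lab y" "lab d \<subseteq> lab v" | "C = lab d - lab y"
        unfolding regraft_def clusters_eq by blast
      then show "C \<in> clusters X (G, l)"
      proof cases
        case 2
        then have "C = lab v" using disj[OF 2(1,3,4)] by blast
        then show ?thesis using Cm[OF 2(1)] by simp
      next
        case 3
        show ?thesis
        proof (cases "v \<noteq> b \<or> d = par y")
          case True
          then have "C = lab v" using yv[OF 3(1,3)] 3(2) by blast
          then show ?thesis using Cm[OF 3(1)] by simp
        next
          case False
          then have "C = lab (par y)" using 3(2) labx(1) by blast
          then show ?thesis using Cm[OF xV] by simp
        qed
      next
        case 4
        then show ?thesis using Dy Cm[OF bV] by simp
      qed
    qed
    show "clusters X (G, l) \<subseteq> regraft (clusters X (G, l)) (lab y) (lab d)"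
    proof
      fix C assume Cc: "C \<in> clusters X (G, l)"
      then obtain v where v: "v \<in> ?V" "C = lab v" unfolding clusters_eq by (elim imageE) simp
      consider "C \<subseteq> lab y" | "\<not> C \<subseteq> lab y" "\<not> lab d \<subseteq> C" | "lab d \<subseteq> C" "v \<noteq> b \<or> d = par y" | "v = b" by blast
      then show "C \<in> regraft (clusters X (G, l)) (lab y) (lab d)"
      proof cases
        case 1
        then show ?thesis using Cc unfolding regraft_def by simp
      next
        case 2
        then have "C = C - lab y" using disj[OF v(1)] v(2) by blast
        then have "C \<in> {c - lab y |c. c \<in> clusters X (G, l) \<and> \<not> c \<subseteq> lab y \<and> \<not> lab d \<subseteq> c}" using Cc 2 by blast
        then show ?thesis unfolding regraft_def by simp
      next
        case 3
        then have "C = C \<union> lab y" using yv[OF v(1)] v(2) by blast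
        then have "C \<in> {c \<union> lab y |c. c \<in> clusters X (G, l) \<and> lab d \<subseteq> c}" using Cc 3 by blast
        then show ?thesis unfolding regraft_def by simp
      next
        case 4
        then have "C = lab d - lab y" using Dy v(2) by simp
        then show ?thesis unfolding regraft_def by simp
      qed
    qed
  qed
qed

lemma regraft_cases:
  assumes Y: "Y \<in> clusters X (G, l)" and D: "D \<in> clusters X (G, l)" and DY: "\<not> D \<subseteq> Y"
  shows "regraft (clusters X (G, l)) Y D = clusters X (G, l) \<or>
    (\<exists>x y a b c d. spr_config G r par Dn X l x y a b c d \<and> Y = lab y \<and> D = lab d)"
proof -
  obtain y where y: "y \<in> verts G - {r}" "Y = lab y" using Y unfolding clusters_eq by (elim imageE) simp
  obtain d where d: "d \<in> verts G - {r}" "D = lab d" using D unfolding clusters_eq by (elim imageE) simp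
  have dY: "d \<notin> Dn y" using DY lab_mono[OF y(1)] y(2) d(2) by blast
  have xr: "par y \<noteq> r"
  proof
    assume "par y = r"
    then have "lab y = X - {0}" using par_root_iff[OF y(1)] by simp
    then show False using DY hierarchy_subset[OF hierarchy_clusters D] y(2) by simp
  qed
  have xV: "par y \<in> verts G - {r}" using par_verts[OF y(1)] xr by simp
  have yx: "y \<in> ch (par y)" using y(1) unfolding ch_def by simp
  then have "ch (par y) \<noteq> {}" by blast
  then obtain w1 w2 where w: "ch (par y) = {w1, w2}" "w1 \<noteq> w2" by (rule two_children[OF xV])
  then obtain b where b: "ch (par y) = {y, b}" "b \<noteq> y" using yx by (metis doubleton_eq_iff insertE singletonD)
  show ?thesis
  proof (cases "d = par y \<or> d = b")
    case True
    then show ?thesis using regraft_trivial[OF y(1) xr b] y(2) d(2) by simp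
  next
    case False
    have "spr_config G r par Dn X l (par y) y (par (par y)) b (par d) d"
      by unfold_locales (use y(1) xr b d(1) dY False in auto)
    then show ?thesis using y(2) d(2) by blast
  qed
qed

end

section \<open>Cuts under the moves\<close>

definition forest :: "'v graph \<Rightarrow> bool" where
  "forest G \<longleftrightarrow> simple_graph G \<and> (\<forall>u v. {u, v} \<in> edges G \<longrightarrow> \<not> reach (delete_edge {u, v} G) u v)"

lemma tree_forest: "tree G \<Longrightarrow> forest G"
  unfolding forest_def by (simp add: tree_bridge) (simp add: tree_def)

lemma reach_delete_edgeI: "{u, v} \<in> edges G \<Longrightarrow> {u, v} \<noteq> e \<Longrightarrow> reach (delete_edge e G) u v"
  by (rule reach_edge) simp

lemma forest_delete_edge: assumes "forest G" shows "forest (delete_edge e G)"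
proof -
  have "\<not> reach (delete_edge {u, v} (delete_edge e G)) u v" if "{u, v} \<in> edges (delete_edge e G)" for u v
  proof
    assume a: "reach (delete_edge {u, v} (delete_edge e G)) u v"
    have "reach (delete_edge {u, v} G) u v" by (rule reach_mono[OF a]) auto
    then show False using assms that unfolding forest_def by simp
  qed
  then show ?thesis using assms simple_delete_edge unfolding forest_def by blast
qed

lemma reach_delete_split:
  assumes "reach G u v"
  shows "reach (delete_edge {s, t} G) u v \<or>
    (reach (delete_edge {s, t} G) u s \<and> reach (delete_edge {s, t} G) t v) \<or>
    (reach (delete_edge {s, t} G) u t \<and> reach (delete_edge {s, t} G) s v)"
  using assms
proof (induction rule: reach_induct)
  case (step a b)
  let ?R = "reach (delete_edge {s, t} G)"
  show ?case
  proof (cases "{a, b} = {s, t}")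
    case True
    then consider "a = s" "b = t" | "a = t" "b = s" by (auto simp: doubleton_eq_iff)
    then show ?thesis using step.IH by cases auto
  next
    case False
    then have "{a, b} \<in> edges (delete_edge {s, t} G)" using step(2) by simp
    then have "\<And>w. ?R w a \<Longrightarrow> ?R w b" by (rule reach_step[rotated])
    then show ?thesis using step.IH by blast
  qed
qed simp

lemma forest_reach_both:
  assumes F: "forest G" and e: "{s, t} \<in> edges G" and 1: "reach (delete_edge e G) u v"
    and 2: "reach (delete_edge {s, t} G) u v"
  shows "reach (delete_edge {s, t} (delete_edge e G)) u v"
proof (rule ccontr)
  let ?K = "delete_edge {s, t} (delete_edge e G)" and ?H = "delete_edge {s, t} G"
  assume n: "\<not> reach ?K u v"
  have mono: "reach ?K w z \<Longrightarrow> reach ?H w z" for w z by (rule reach_mono) auto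
  from reach_delete_split[OF 1, of s t] n
  have "reach ?K u s \<and> reach ?K t v \<or> reach ?K u t \<and> reach ?K s v" by blast
  then have "reach ?H u s \<and> reach ?H t v \<or> reach ?H u t \<and> reach ?H s v" using mono by blast
  then have "reach ?H s t" using 2 reach_sym reach_trans by metis
  then show False using F e unfolding forest_def by blast
qed

lemma finite_nbrs: "simple_graph G \<Longrightarrow> finite (nbrs G v)"
  unfolding nbrs_def by (rule finite_subset[of _ "verts G"]) (auto dest: edge_verts simp: simple_graph_def)

lemma edges_suppress: "edges (suppress w G) = insert (nbrs G w) {e \<in> edges G. w \<notin> e}"
  and verts_suppress: "verts (suppress w G) = verts G - {w}"
  unfolding suppress_def by auto

locale suppressed =
  fixes G :: "'v graph" and w a b :: 'v
  assumes F: "forest G" and nb: "nbrs G w = {a, b}" and ab: "a \<noteq> b"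
begin

lemma sg: "simple_graph G" using F unfolding forest_def by simp
lemma aw: "{a, w} \<in> edges G" and bw: "{b, w} \<in> edges G" using nb unfolding nbrs_def by blast+
lemma wa: "{w, a} \<in> edges G" and wb: "{w, b} \<in> edges G" using aw bw by (simp_all add: insert_commute)
lemma ne: "a \<noteq> w" "b \<noteq> w" using edge_verts[OF sg aw] edge_verts[OF sg bw] by auto

lemma ab_notin: "{a, b} \<notin> edges G"
proof
  assume e: "{a, b} \<in> edges G"
  have n: "{a, w} \<noteq> {a, b}" "{w, b} \<noteq> {a, b}" using ab ne by (auto simp: doubleton_eq_iff)
  have "reach (delete_edge {a, b} G) a w" "reach (delete_edge {a, b} G) w b"
    by (rule reach_delete_edgeI[OF aw n(1)], rule reach_delete_edgeI[OF wb n(2)])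
  then show False using F e reach_trans unfolding forest_def by metis
qed

lemma E: "edges (suppress w G) = insert {a, b} {e \<in> edges G. w \<notin> e}"
  using edges_suppress[of w G] nb by simp

lemma nbr_cases: "{w, t} \<in> edges G \<Longrightarrow> t = a \<or> t = b"
  using nb unfolding nbrs_def by (metis (no_types, lifting) insertE insert_commute mem_Collect_eq singletonD)

lemma simple_suppress: "simple_graph (suppress w G)"
proof -
  have "a \<in> verts G - {w}" "b \<in> verts G - {w}" using edge_verts[OF sg aw] edge_verts[OF sg bw] by auto
  then have "{a, b} \<subseteq> verts G - {w} \<and> card {a, b} = 2" using ab by simp
  then show ?thesis using sg unfolding simple_graph_def E verts_suppress by auto
qed

lemma reach_suppress:
  assumes "reach G u v" "u \<noteq> w" "v \<noteq> w" shows "reach (suppress w G) u v"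
proof -
  let ?f = "\<lambda>t. if t = w then a else t"
  have "reach (suppress w G) (?f u) (?f v)" using assms(1)
  proof (rule reach_hom)
    fix s t assume st: "{s, t} \<in> edges G"
    have b': "reach (suppress w G) a b" "reach (suppress w G) b a" by (auto intro!: reach_edge simp: E insert_commute)
    consider "s = w" "t \<noteq> w" | "t = w" "s \<noteq> w" | "s \<noteq> w" "t \<noteq> w" using edge_verts[OF sg st] by auto
    then show "reach (suppress w G) (?f s) (?f t)"
    proof cases
      case 1
      then show ?thesis using nbr_cases[of t] st b' by auto
    next
      case 2
      then show ?thesis using nbr_cases[of s] st b' by (auto simp: insert_commute)
    next
      case 3
      then show ?thesis using st by (auto intro!: reach_edge simp: E)
    qed
  qed
  then show ?thesis using assms by simp
qed

lemma suppress_cut: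
  assumes f: "f \<in> edges (suppress w G)"
  shows "\<exists>e\<in>edges G. \<forall>u v. u \<noteq> w \<longrightarrow> v \<noteq> w \<longrightarrow> reach (delete_edge e G) u v \<longrightarrow> reach (delete_edge f (suppress w G)) u v"
proof (cases "f = {a, b}")
  case True
  let ?H = "delete_edge f (suppress w G)"
  have "reach ?H u v" if "u \<noteq> w" "v \<noteq> w" "reach (delete_edge {a, w} G) u v" for u v
  proof -
    let ?f = "\<lambda>t. if t = w then b else t"
    have "reach ?H (?f u) (?f v)" using that(3)
    proof (rule reach_hom)
      fix s t assume "{s, t} \<in> edges (delete_edge {a, w} G)"
      then have st: "{s, t} \<in> edges G" "{s, t} \<noteq> {a, w}" by auto
      consider "s = w" "t \<noteq> w" | "t = w" "s \<noteq> w" | "s \<noteq> w" "t \<noteq> w" using edge_verts[OF sg st(1)] by auto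
      then show "reach ?H (?f s) (?f t)"
      proof cases
        case 1
        then have "t = b" using nbr_cases[of t] st by (auto simp: insert_commute)
        then show ?thesis using 1 by simp
      next
        case 2
        then have "s = b" using nbr_cases[of s] st by (auto simp: insert_commute)
        then show ?thesis using 2 by simp
      next
        case 3
        have "{s, t} \<noteq> f" using ab_notin st(1) True by auto
        then have "{s, t} \<in> edges ?H" using st(1) 3 by (simp add: E)
        then show ?thesis using 3 by (simp add: reach_edge)
      qed
    qed
    then show ?thesis using that by simp
  qed
  then show ?thesis using aw by blast
next
  case False
  then have fG: "f \<in> edges G" "w \<notin> f" using f unfolding E by auto
  let ?H = "delete_edge f (suppress w G)"
  have "reach ?H u v" if "u \<noteq> w" "v \<noteq> w" "reach (delete_edge f G) u v" for u v
  proof -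
    let ?f = "\<lambda>t. if t = w then a else t"
    have ab': "{a, b} \<in> edges ?H" "{b, a} \<in> edges ?H" using False by (auto simp: E insert_commute)
    have "reach ?H (?f u) (?f v)" using that(3)
    proof (rule reach_hom)
      fix s t assume "{s, t} \<in> edges (delete_edge f G)"
      then have st: "{s, t} \<in> edges G" "{s, t} \<noteq> f" by auto
      consider "s = w" "t \<noteq> w" | "t = w" "s \<noteq> w" | "s \<noteq> w" "t \<noteq> w" using edge_verts[OF sg st(1)] by auto
      then show "reach ?H (?f s) (?f t)"
      proof cases
        case 1
        then show ?thesis using nbr_cases[of t] st(1) reach_edge[OF ab'(1)] by auto
      next
        case 2
        then show ?thesis using nbr_cases[of s] st(1) reach_edge[OF ab'(2)] by (auto simp: insert_commute)
      next
        case 3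
        then have "{s, t} \<in> edges ?H" using st by (simp add: E)
        then show ?thesis using 3 by (simp add: reach_edge)
      qed
    qed
    then show ?thesis using that by simp
  qed
  then show ?thesis using fG(1) by blast
qed

lemma forest_suppress: "forest (suppress w G)"
proof -
  have "\<not> reach (delete_edge {u, v} (suppress w G)) u v" if uv: "{u, v} \<in> edges (suppress w G)" for u v
  proof
    assume r: "reach (delete_edge {u, v} (suppress w G)) u v"
    show False
    proof (cases "{u, v} = {a, b}")
      case True
      have "reach (delete_edge {a, w} G) u v"
        by (rule reach_mono[OF r]) (use True in \<open>auto simp: E\<close>)
      then have "reach (delete_edge {a, w} G) a b" using True reach_sym by (auto simp: doubleton_eq_iff)
      moreover have "{b, w} \<in> edges (delete_edge {a, w} G)" using bw ab by (auto simp: doubleton_eq_iff)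
      ultimately have "reach (delete_edge {a, w} G) a w" by (rule reach_step)
      then show False using F aw unfolding forest_def by blast
    next
      case False
      then have uvG: "{u, v} \<in> edges G" "w \<notin> {u, v}" using uv unfolding E by auto
      have "reach (delete_edge {u, v} G) u v"
      proof (rule reach_hom[OF r, where f = "\<lambda>t. t"])
        fix s t assume st: "{s, t} \<in> edges (delete_edge {u, v} (suppress w G))"
        show "reach (delete_edge {u, v} G) s t"
        proof (cases "{s, t} = {a, b}")
          case True
          have n: "{a, w} \<noteq> {u, v}" "{w, b} \<noteq> {u, v}" using uvG(2) by auto
          have "reach (delete_edge {u, v} G) a w" "reach (delete_edge {u, v} G) w b"
            by (rule reach_delete_edgeI[OF aw n(1)], rule reach_delete_edgeI[OF wb n(2)])
          then have "reach (delete_edge {u, v} G) a b" by (rule reach_trans)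
          then show ?thesis using True reach_sym by (auto simp: doubleton_eq_iff)
        next
          case False
          then have "{s, t} \<in> edges (delete_edge {u, v} G)" using st by (auto simp: E)
          then show ?thesis by (rule reach_edge)
        qed
      qed
      then show False using F uvG(1) unfolding forest_def by blast
    qed
  qed
  then show ?thesis using simple_suppress unfolding forest_def by blast
qed

lemma nbrs_suppress_other: assumes "u \<noteq> w" "u \<noteq> a" "u \<noteq> b" shows "nbrs (suppress w G) u = nbrs G u"
proof -
  have "{t, u} \<in> edges (suppress w G) \<longleftrightarrow> {t, u} \<in> edges G" for t
    using assms nbr_cases[of u] unfolding E by (auto simp: doubleton_eq_iff)
  then show ?thesis unfolding nbrs_def by simp
qed

lemma nbrs_suppress_end:
  assumes "(u, u') = (a, b) \<or> (u, u') = (b, a)"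
  shows "nbrs (suppress w G) u = insert u' (nbrs G u - {w})" "u' \<notin> nbrs G u" "w \<in> nbrs G u"
proof -
  have uw: "u \<noteq> w" using assms ne by auto
  have e: "{a, b} = {u', u}" "u' \<noteq> u" using assms ab by (auto simp: insert_commute)
  have "{t, u} \<in> edges (suppress w G) \<longleftrightarrow> t = u' \<or> ({t, u} \<in> edges G \<and> t \<noteq> w)" for t
    unfolding E using uw e(2) by (auto simp: e(1) doubleton_eq_iff)
  then show "nbrs (suppress w G) u = insert u' (nbrs G u - {w})" unfolding nbrs_def by auto
  show "u' \<notin> nbrs G u" using ab_notin e(1) unfolding nbrs_def by simp
  show "w \<in> nbrs G u" using assms wa wb unfolding nbrs_def by auto
qed

lemma deg_suppress: assumes "u \<noteq> w" shows "deg (suppress w G) u = deg G u"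
proof -
  have f: "finite (nbrs G u)" by (rule finite_nbrs[OF sg])
  consider "u \<noteq> a" "u \<noteq> b" | u' where "(u, u') = (a, b) \<or> (u, u') = (b, a)" by blast
  then show ?thesis
  proof cases
    case 1
    then show ?thesis unfolding deg_def using nbrs_suppress_other[OF assms] by simp
  next
    case 2
    have "card (insert u' (nbrs G u - {w})) = card (nbrs G u)"
      using nbrs_suppress_end(2)[OF 2] f card_Suc_Diff1[OF f nbrs_suppress_end(3)[OF 2]]
      by (subst card_insert_disjoint) auto
    then show ?thesis unfolding deg_def nbrs_suppress_end(1)[OF 2] .
  qed
qed

end

lemma suppressed_of_deg2:
  assumes "forest G" "deg G w = 2" obtains a b where "suppressed G w a b"
proof -
  obtain a b where "nbrs G w = {a, b}" "a \<noteq> b" using assms(2) unfolding deg_def by (meson card_2_iff)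
  then show thesis using that assms(1) unfolding suppressed_def by blast
qed

lemma suppress_all_cut:
  assumes "suppress_all G H" "forest G" "\<And>u. u \<in> S \<Longrightarrow> u \<in> verts G \<and> deg G u \<le> 1"
  shows "forest H \<and> S \<subseteq> verts H \<and> (\<forall>u\<in>S. \<forall>v\<in>S. reach G u v \<longrightarrow> reach H u v) \<and>
    (\<forall>f\<in>edges H. \<exists>e\<in>edges G. \<forall>u\<in>S. \<forall>v\<in>S. reach (delete_edge e G) u v \<longrightarrow> reach (delete_edge f H) u v)"
  using assms
proof (induction rule: suppress_all.induct)
  case (suppress_done G)
  then show ?case by blast
next
  case (suppress_step w G H)
  obtain a b where "suppressed G w a b" 
    by (rule suppressed_of_deg2[OF suppress_step.prems(1) suppress_step.hyps(2)])
  then interpret suppressed G w a b .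
  have nw: "u \<noteq> w" if "u \<in> S" for u using suppress_step.prems(2)[OF that] suppress_step.hyps(2) by auto
  have dS: "u \<in> verts (suppress w G) \<and> deg (suppress w G) u \<le> 1" if "u \<in> S" for u
    using suppress_step.prems(2)[OF that] deg_suppress[OF nw[OF that]] nw[OF that] unfolding verts_suppress by simp
  have IH: "forest H \<and> S \<subseteq> verts H \<and> (\<forall>u\<in>S. \<forall>v\<in>S. reach (suppress w G) u v \<longrightarrow> reach H u v) \<and>
    (\<forall>f\<in>edges H. \<exists>e\<in>edges (suppress w G). \<forall>u\<in>S. \<forall>v\<in>S.
      reach (delete_edge e (suppress w G)) u v \<longrightarrow> reach (delete_edge f H) u v)"
    by (rule suppress_step.IH[OF forest_suppress]) (rule dS)
  have "\<exists>e\<in>edges G. \<forall>u\<in>S. \<forall>v\<in>S. reach (delete_edge e G) u v \<longrightarrow> reach (delete_edge f H) u v" if f: "f \<in> edges H" for f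
  proof -
    obtain g where g: "g \<in> edges (suppress w G)"
      "\<forall>u\<in>S. \<forall>v\<in>S. reach (delete_edge g (suppress w G)) u v \<longrightarrow> reach (delete_edge f H) u v" using IH f by blast
    obtain e where e: "e \<in> edges G"
      "\<forall>u v. u \<noteq> w \<longrightarrow> v \<noteq> w \<longrightarrow> reach (delete_edge e G) u v \<longrightarrow> reach (delete_edge g (suppress w G)) u v"
      using suppress_cut[OF g(1)] by blast
    show ?thesis using e g(2) nw by (intro bexI[OF _ e(1)]) blast
  qed
  moreover have "\<forall>u\<in>S. \<forall>v\<in>S. reach G u v \<longrightarrow> reach H u v" using IH reach_suppress nw by blast
  ultimately show ?case using IH by blast
qed

lemma attachment_cut_aux:
  assumes "attachment T p K" and sg: "simple_graph T"
  shows "p \<in> verts K \<and> simple_graph K \<and> (\<forall>u v. reach T u v \<longrightarrow> reach K u v) \<and>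
    (\<forall>f\<in>edges K. \<exists>g\<in>edges T. \<forall>u v. reach (delete_edge g T) u v \<longrightarrow> reach (delete_edge f K) u v)"
  using assms(1)
proof cases
  case attach_single
  then show ?thesis using sg by auto
next
  case (attach_midpoint c d)
  note K = attach_midpoint(1) and cdT = attach_midpoint(2) and pnT = attach_midpoint(3)
  have vK: "verts K = insert p (verts T)" and eK: "edges K = edges T - {{c, d}} \<union> {{c, p}, {p, d}}" using K by auto
  have cd: "c \<in> verts T" "d \<in> verts T" "c \<noteq> d" using edge_verts[OF sg cdT] by auto
  have pT: "p \<notin> e" if "e \<in> edges T" for e using that pnT sg unfolding simple_graph_def by blast
  have cp: "c \<noteq> p" "d \<noteq> p" using cd pnT by auto
  have simp: "simple_graph K" using cd cp sg unfolding simple_graph_def vK eK by auto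
  have through: "reach (delete_edge f K) s t" if "{s, t} \<in> edges T" "{s, t} \<noteq> f" "p \<notin> f" for s t f
  proof (cases "{s, t} = {c, d}")
    case True
    have "{c, p} \<noteq> f" "{p, d} \<noteq> f" using that(3) by auto
    then have "reach (delete_edge f K) c p" "reach (delete_edge f K) p d"
      by (auto intro!: reach_delete_edgeI simp: eK)
    then have "reach (delete_edge f K) c d" by (rule reach_trans)
    then show ?thesis using True reach_sym by (auto simp: doubleton_eq_iff)
  next
    case False
    then show ?thesis using that by (intro reach_delete_edgeI) (simp_all add: eK)
  qed
  have hom: "reach K u v" if "reach T u v" for u v
    using that
  proof (rule reach_hom[where f = "\<lambda>t. t"])
    fix s t assume "{s, t} \<in> edges T"
    then have "reach (delete_edge {} K) s t" using through[of s t "{}"] by simp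
    then show "reach K s t" by (rule reach_mono) auto
  qed
  have "\<exists>g\<in>edges T. \<forall>u v. reach (delete_edge g T) u v \<longrightarrow> reach (delete_edge f K) u v" if f: "f \<in> edges K" for f
  proof (cases "p \<in> f")
    case True
    have "edges (delete_edge {c, d} T) \<subseteq> edges (delete_edge f K)" using True pT by (auto simp: eK)
    then have "reach (delete_edge f K) u v" if "reach (delete_edge {c, d} T) u v" for u v
      using reach_mono that by metis
    then show ?thesis using cdT by blast
  next
    case False
    then have fT: "f \<in> edges T" using f unfolding eK by auto
    have "reach (delete_edge f K) u v" if "reach (delete_edge f T) u v" for u v
      using that
    proof (rule reach_hom[where f = "\<lambda>t. t"])
      fix s t assume "{s, t} \<in> edges (delete_edge f T)"
      then show "reach (delete_edge f K) s t" using through[of s t f] False by simp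
    qed
    then show ?thesis using fT by blast
  qed
  then show ?thesis using vK simp hom by simp
qed

lemma attachment_cut:
  assumes "attachment T p K" and "simple_graph T"
  shows "p \<in> verts K" "simple_graph K" "reach T u v \<Longrightarrow> reach K u v"
    "f \<in> edges K \<Longrightarrow> \<exists>g\<in>edges T. \<forall>u v. reach (delete_edge g T) u v \<longrightarrow> reach (delete_edge f K) u v"
  using attachment_cut_aux[OF assms] by blast+

lemma simple_induced: "simple_graph H \<Longrightarrow> C \<subseteq> verts H \<Longrightarrow> simple_graph (induced H C)"
  unfolding simple_graph_def induced_def by (auto intro: finite_subset)

lemma reach_induced:
  assumes "reach (delete_edge f H) u v" "u \<in> C" "\<forall>a b. {a, b} \<in> edges H \<longrightarrow> a \<in> C \<longrightarrow> b \<in> C"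
  shows "reach (delete_edge f (induced H C)) u v"
proof -
  have "v \<in> C \<and> reach (delete_edge f (induced H C)) u v"
    using assms(1)
  proof (induction rule: reach_induct)
    case (step a b)
    then have e: "{a, b} \<in> edges H" "{a, b} \<noteq> f" "a \<in> C" by auto
    then have "b \<in> C" using assms(3) by blast
    then have "{a, b} \<in> edges (delete_edge f (induced H C))" using e unfolding induced_def by simp
    then show ?case using step.IH reach_step \<open>b \<in> C\<close> by metis
  qed (use assms(2) in simp)
  then show ?thesis by simp
qed

lemma delete_absent: "f \<notin> edges H \<Longrightarrow> delete_edge f H = H"
  unfolding delete_edge_def by simp

lemma TBR_cut:
  assumes T: "tree G" and S: "\<And>u. u \<in> S \<Longrightarrow> u \<in> verts G \<and> deg G u = 1" and M: "TBR_graph G G'"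
  shows "\<exists>e\<in>edges G. \<forall>f\<in>edges G'. \<exists>e0\<in>edges G. \<forall>u\<in>S. \<forall>v\<in>S.
    reach (delete_edge e G) u v \<longrightarrow> reach (delete_edge e0 G) u v \<longrightarrow> reach (delete_edge f G') u v"
proof -
  obtain e H C1 C2 p K1 q K2 where e: "e \<in> edges G" and sup: "suppress_all (delete_edge e G) H"
    and cm: "comps H = {C1, C2}" and at1: "attachment (induced H C1) p K1" and at2: "attachment (induced H C2) q K2"
    and dj: "verts K1 \<inter> verts K2 = {}"
    and G': "G' = \<lparr>verts = verts K1 \<union> verts K2, edges = insert {p, q} (edges K1 \<union> edges K2)\<rparr>"
    using M unfolding TBR_graph_def by (elim exE conjE)
  have F: "forest G" by (rule tree_forest[OF T])
  have sgG: "simple_graph G" using F unfolding forest_def by simp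
  have degS: "u \<in> verts (delete_edge e G) \<and> deg (delete_edge e G) u \<le> 1" if "u \<in> S" for u
  proof -
    have "nbrs (delete_edge e G) u \<subseteq> nbrs G u" unfolding nbrs_def by auto
    then have "deg (delete_edge e G) u \<le> deg G u" unfolding deg_def by (rule card_mono[OF finite_nbrs[OF sgG]])
    then show ?thesis using S[OF that] by simp
  qed
  have all0: "forest H \<and> S \<subseteq> verts H \<and> (\<forall>u\<in>S. \<forall>v\<in>S. reach (delete_edge e G) u v \<longrightarrow> reach H u v) \<and>
    (\<forall>f\<in>edges H. \<exists>e0\<in>edges (delete_edge e G). \<forall>u\<in>S. \<forall>v\<in>S.
      reach (delete_edge e0 (delete_edge e G)) u v \<longrightarrow> reach (delete_edge f H) u v)"
    by (rule suppress_all_cut[OF sup forest_delete_edge[OF F]]) (rule degS)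
  have all: "forest H" "S \<subseteq> verts H" "\<And>u v. u \<in> S \<Longrightarrow> v \<in> S \<Longrightarrow> reach (delete_edge e G) u v \<Longrightarrow> reach H u v"
    "\<And>f. f \<in> edges H \<Longrightarrow> \<exists>e0\<in>edges (delete_edge e G). \<forall>u\<in>S. \<forall>v\<in>S. reach (delete_edge e0 (delete_edge e G)) u v \<longrightarrow> reach (delete_edge f H) u v"
    using all0 by blast+
  have sgH: "simple_graph H" using all(1) unfolding forest_def by simp
  have comp: "C \<subseteq> verts H" "\<forall>a b. {a, b} \<in> edges H \<longrightarrow> a \<in> C \<longrightarrow> b \<in> C" if CH: "C \<in> comps H" for C
  proof -
    obtain v where v: "v \<in> verts H" "C = {u \<in> verts H. joined H v u}" using CH unfolding comps_def by blast
    then show "C \<subseteq> verts H" by blast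
    have "b \<in> C" if "{a, b} \<in> edges H" "a \<in> C" for a b
      using that v joined_iff_reach[OF sgH] reach_step[of H v a b] edge_verts[OF sgH, of a b] by simp
    then show "\<forall>a b. {a, b} \<in> edges H \<longrightarrow> a \<in> C \<longrightarrow> b \<in> C" by blast
  qed
  have C: "C1 \<in> comps H" "C2 \<in> comps H" using cm by auto
  have cover: "u \<in> C1 \<or> u \<in> C2" if "u \<in> verts H" for u
  proof -
    have "{w \<in> verts H. joined H u w} \<in> comps H" unfolding comps_def using that by blast
    moreover have "u \<in> {w \<in> verts H. joined H u w}" using that joined_iff_reach[OF sgH] by simp
    ultimately show ?thesis using cm by auto
  qed
  note I1 = simple_induced[OF sgH comp(1)[OF C(1)]] and I2 = simple_induced[OF sgH comp(1)[OF C(2)]]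
  note A1 = attachment_cut[OF at1 I1] and A2 = attachment_cut[OF at2 I2]
  have sub: "z \<subseteq> verts K \<and> z \<noteq> {}" if "simple_graph K" "z \<in> edges K" for K :: "'a graph" and z
    using that unfolding simple_graph_def by fastforce
  have edgesG': "edges G' = insert {p, q} (edges K1 \<union> edges K2)" using G' by simp
  have whole: "reach (induced H C) u v" if "C \<in> comps H" "u \<in> C" "reach H u v" for C u v
  proof -
    have e: "{} \<notin> edges H" "{} \<notin> edges (induced H C)" using sub[OF sgH, of "{}"] unfolding induced_def by auto
    have "reach (delete_edge {} (induced H C)) u v"
      by (rule reach_induced[OF _ that(2) comp(2)[OF that(1)]]) (simp add: delete_absent[OF e(1)] that(3))
    then show ?thesis using delete_absent[OF e(2)] by simp
  qed
  have pq: "{p, q} \<notin> edges K1" "{p, q} \<notin> edges K2"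
    using sub[OF A1(2), of "{p, q}"] sub[OF A2(2), of "{p, q}"] A1(1) A2(1) dj by auto
  have one_side: "\<exists>e0\<in>edges G. \<forall>u\<in>S. \<forall>v\<in>S.
      reach (delete_edge e G) u v \<longrightarrow> reach (delete_edge e0 G) u v \<longrightarrow> reach (delete_edge f G') u v"
    if f: "f \<in> edges K" and Cs: "C \<in> comps H" "D \<in> comps H" "\<And>u. u \<in> verts H \<Longrightarrow> u \<in> C \<or> u \<in> D"
      and K: "\<And>f. f \<in> edges K \<Longrightarrow> \<exists>g\<in>edges (induced H C). \<forall>u v. reach (delete_edge g (induced H C)) u v \<longrightarrow> reach (delete_edge f K) u v"
      and J: "\<And>u v. reach (induced H D) u v \<Longrightarrow> reach J u v"
      and KJ: "edges K \<subseteq> edges G'" "edges J \<subseteq> edges G'" "f \<notin> edges J" for f C D K J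
  proof -
    obtain g where g: "g \<in> edges (induced H C)"
      "\<forall>u v. reach (delete_edge g (induced H C)) u v \<longrightarrow> reach (delete_edge f K) u v" using K[OF f] by blast
    have gH: "g \<in> edges H" using g(1) unfolding induced_def by simp
    obtain e0 where e0: "e0 \<in> edges (delete_edge e G)"
      "\<forall>u\<in>S. \<forall>v\<in>S. reach (delete_edge e0 (delete_edge e G)) u v \<longrightarrow> reach (delete_edge g H) u v" using all(4)[OF gH] by blast
    have e0G: "e0 \<in> edges G" using e0(1) by simp
    then have "card e0 = 2" using sgG unfolding simple_graph_def by blast
    then obtain s t where st: "e0 = {s, t}" by (meson card_2_iff)
    have "reach (delete_edge f G') u v" if u: "u \<in> S" and v: "v \<in> S" and
      r: "reach (delete_edge e G) u v" "reach (delete_edge e0 G) u v" for u v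
    proof -
      have "reach (delete_edge e0 (delete_edge e G)) u v"
        unfolding st by (rule forest_reach_both[OF F _ r(1)]) (use e0G r(2) st in auto)
      then have rg: "reach (delete_edge g H) u v" using e0(2) u v by blast
      have rH: "reach H u v" by (rule all(3)[OF u v r(1)])
      show ?thesis
      proof (cases "u \<in> C")
        case True
        then have "reach (delete_edge g (induced H C)) u v"
          by (intro reach_induced[OF rg] comp(2)[OF Cs(1)])
        then have "reach (delete_edge f K) u v" using g(2) by blast
        then show ?thesis by (rule reach_mono) (use KJ in auto)
      next
        case False
        then have "u \<in> D" using Cs(3)[of u] u all(2) by blast
        then have "reach J u v" using J whole[OF Cs(2) _ rH] by blast
        then show ?thesis by (rule reach_mono) (use KJ in auto)
      qed
    qed
    then show ?thesis using e0G by blast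
  qed
  have "\<exists>e0\<in>edges G. \<forall>u\<in>S. \<forall>v\<in>S.
    reach (delete_edge e G) u v \<longrightarrow> reach (delete_edge e0 G) u v \<longrightarrow> reach (delete_edge f G') u v" if f: "f \<in> edges G'" for f
  proof -
    consider "f = {p, q}" | "f \<in> edges K1" | "f \<in> edges K2" using f edgesG' by auto
    then show ?thesis
    proof cases
      case 1
      have "reach (delete_edge f G') u v" if u: "u \<in> S" and v: "v \<in> S" and r: "reach (delete_edge e G) u v" for u v
      proof -
        have rH: "reach H u v" by (rule all(3)[OF u v r])
        have "u \<in> C1 \<or> u \<in> C2" using cover u all(2) by blast
        then have "reach K1 u v \<or> reach K2 u v" using A1(3) A2(3) whole[OF C(1) _ rH] whole[OF C(2) _ rH] by blast
        then show ?thesis using reach_mono[of K1 u v "delete_edge f G'"] reach_mono[of K2 u v "delete_edge f G'"] pq 1 edgesG' by auto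
      qed
      then show ?thesis using e by blast
    next
      case 2
      have "f \<notin> edges K2" using 2 sub[OF A1(2)] sub[OF A2(2)] dj by blast
      then show ?thesis by (intro one_side[OF 2 C cover A1(4) A2(3)]) (auto simp: edgesG')
    next
      case 3
      have "f \<notin> edges K1" using 3 sub[OF A1(2)] sub[OF A2(2)] dj by blast
      then show ?thesis by (intro one_side[OF 3 C(2,1) _ A2(4) A1(3)]) (use cover in \<open>auto simp: edgesG'\<close>)
    qed
  qed
  then show ?thesis using e by blast
qed

lemma SPR_cut:
  assumes T: "tree G" and D: "\<forall>v\<in>verts G. deg G v = 3 \<or> deg G v = 1"
    and S: "\<And>u. u \<in> S \<Longrightarrow> u \<in> verts G \<and> deg G u = 1" and M: "SPR_allowed G x y a b c d"
  shows "\<exists>e\<in>edges G. \<forall>f\<in>edges (SPR_result G x a b c d). \<exists>e0\<in>edges G. \<forall>u\<in>S. \<forall>v\<in>S.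
    reach (delete_edge e G) u v \<longrightarrow> reach (delete_edge e0 G) u v \<longrightarrow> reach (delete_edge f (SPR_result G x a b c d)) u v"
proof -
  let ?G' = "SPR_result G x a b c d"
  have F: "forest G" by (rule tree_forest[OF T])
  have sg: "simple_graph G" using F unfolding forest_def by simp
  have E: "{x, y} \<in> edges G" "{a, x} \<in> edges G" "{x, b} \<in> edges G" "{c, d} \<in> edges G"
    and dist: "{x, y} \<noteq> {a, x}" "{x, y} \<noteq> {x, b}" "{a, x} \<noteq> {x, b}" "{x, y} \<noteq> {c, d}" "{a, x} \<noteq> {c, d}" "{x, b} \<noteq> {c, d}"
    using M unfolding SPR_allowed_def
    by (simp_all only: distinct.simps list.set insert_iff insert_subset de_Morgan_disj simp_thms)
  have ne: "y \<noteq> a" "y \<noteq> b" "a \<noteq> b" using dist by (auto simp: doubleton_eq_iff)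
  have nx: "a \<noteq> x" "b \<noteq> x" "y \<noteq> x" using edge_verts[OF sg E(1)] edge_verts[OF sg E(2)] edge_verts[OF sg E(3)] by auto
  have nbx: "{y, a, b} \<subseteq> nbrs G x" using E unfolding nbrs_def by (auto simp: insert_commute)
  then have "3 \<le> deg G x" unfolding deg_def using card_mono[OF finite_nbrs[OF sg] nbx] ne by simp
  then have deg3: "deg G x = 3" using D edge_verts[OF sg E(1)] by force
  then have "{y, a, b} = nbrs G x"
    using card_subset_eq[OF finite_nbrs[OF sg] nbx] ne unfolding deg_def by simp
  then have xe: "t = y \<or> t = a \<or> t = b" if "{x, t} \<in> edges G" for t
    using that unfolding nbrs_def by (auto simp: insert_commute)
  have cx: "c \<noteq> x" "d \<noteq> x"
  proof
    assume "c = x"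
    then have "d = y \<or> d = a \<or> d = b" using xe[of d] E(4) by simp
    then show False using dist(4-6) \<open>c = x\<close> by (auto simp: insert_commute)
  next
    show "d \<noteq> x"
    proof
      assume "d = x"
      then have "c = y \<or> c = a \<or> c = b" using xe[of c] E(4) by (simp add: insert_commute)
      then show False using dist(4-6) \<open>d = x\<close> by (auto simp: insert_commute)
    qed
  qed
  have Sx: "u \<noteq> x" if "u \<in> S" for u using S[OF that] deg3 by auto
  have abE: "{a, b} \<notin> edges G"
  proof
    assume e: "{a, b} \<in> edges G"
    have n: "{a, x} \<noteq> {a, b}" "{x, b} \<noteq> {a, b}" using nx by (auto simp: doubleton_eq_iff)
    have "reach (delete_edge {a, b} G) a x" "reach (delete_edge {a, b} G) x b"
      by (rule reach_delete_edgeI[OF E(2) n(1)], rule reach_delete_edgeI[OF E(3) n(2)])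
    then show False using F e reach_trans unfolding forest_def by metis
  qed
  have abcd: "{a, b} \<noteq> {c, d}" using abE E(4) by auto
  have E': "edges ?G' = (edges G - {{a, x}, {x, b}, {c, d}}) \<union> {{a, b}, {c, x}, {x, d}}"
    unfolding SPR_result_def using abcd by auto
  text \<open>It suffices to say where the edges of the cut graph go when x is identified with z.\<close>
  have hom: "\<forall>u\<in>S. \<forall>v\<in>S. reach (delete_edge {x, y} G) u v \<longrightarrow> reach (delete_edge e0 G) u v \<longrightarrow> reach (delete_edge f ?G') u v"
    if e0: "e0 \<in> edges G"
      and xa: "{a, x} \<noteq> e0 \<Longrightarrow> reach (delete_edge f ?G') z a" and xb: "{x, b} \<noteq> e0 \<Longrightarrow> reach (delete_edge f ?G') z b"
      and cd: "{c, d} \<noteq> e0 \<Longrightarrow> reach (delete_edge f ?G') c d"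
      and fe: "f \<in> edges G \<Longrightarrow> x \<notin> f \<Longrightarrow> f = e0" for e0 f z
  proof (intro ballI impI)
    fix u v assume u: "u \<in> S" and v: "v \<in> S" and r: "reach (delete_edge {x, y} G) u v" "reach (delete_edge e0 G) u v"
    have "card e0 = 2" using e0 sg unfolding simple_graph_def by blast
    then obtain s t where st: "e0 = {s, t}" by (meson card_2_iff)
    let ?K = "delete_edge e0 (delete_edge {x, y} G)"
    have "reach ?K u v" unfolding st by (rule forest_reach_both[OF F _ r(1)]) (use e0 r(2) st in auto)
    let ?f = "\<lambda>t. if t = x then z else t"
    have "reach (delete_edge f ?G') (?f u) (?f v)" using \<open>reach ?K u v\<close>
    proof (rule reach_hom)
      fix s t assume "{s, t} \<in> edges ?K"
      then have st: "{s, t} \<in> edges G" "{s, t} \<noteq> e0" "{s, t} \<noteq> {x, y}" by auto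
      have xcase: "reach (delete_edge f ?G') z w" if w: "{x, w} \<in> edges G" "{x, w} \<noteq> e0" "{x, w} \<noteq> {x, y}" for w
        using xe[OF w(1)] w xa xb by (auto simp: insert_commute)
      consider "s = x" "t \<noteq> x" | "t = x" "s \<noteq> x" | "s \<noteq> x" "t \<noteq> x" "{s, t} = {c, d}" | "s \<noteq> x" "t \<noteq> x" "{s, t} \<noteq> {c, d}"
        using edge_verts[OF sg st(1)] by auto
      then show "reach (delete_edge f ?G') (?f s) (?f t)"
      proof cases
        case 1
        then show ?thesis using xcase[of t] st by simp
      next
        case 2
        then have "reach (delete_edge f ?G') z s" using xcase[of s] st by (simp add: insert_commute)
        then show ?thesis using 2 reach_sym by simp
      next
        case 3
        then have "reach (delete_edge f ?G') c d" using cd st(2) by simp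
        then show ?thesis using 3 reach_sym by (auto simp: doubleton_eq_iff)
      next
        case 4
        have "{s, t} \<in> edges ?G'" unfolding E' using st(1) 4 by (auto simp: doubleton_eq_iff)
        moreover have "{s, t} \<noteq> f" using fe st(1,2) 4 by auto
        ultimately show ?thesis using 4 by (auto intro: reach_edge)
      qed
    qed
    then show "reach (delete_edge f ?G') u v" using Sx[OF u] Sx[OF v] by simp
  qed
  have ab': "{a, b} \<in> edges ?G'" "{c, x} \<in> edges ?G'" "{x, d} \<in> edges ?G'" unfolding E' by auto
  have "\<exists>e0\<in>edges G. \<forall>u\<in>S. \<forall>v\<in>S.
    reach (delete_edge {x, y} G) u v \<longrightarrow> reach (delete_edge e0 G) u v \<longrightarrow> reach (delete_edge f ?G') u v"
    if f: "f \<in> edges ?G'" for f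
  proof -
    have throughx: "reach (delete_edge f ?G') c d" if "f \<noteq> {c, x}" "f \<noteq> {x, d}"
    proof (rule reach_trans[of _ c x d])
      show "reach (delete_edge f ?G') c x" "reach (delete_edge f ?G') x d"
        using that ab' by (auto intro!: reach_edge)
    qed
    have throughab: "reach (delete_edge f ?G') a b" if "f \<noteq> {a, b}"
      using that ab' by (auto intro!: reach_edge)
    consider "f = {a, b}" | "x \<in> f" | "f \<in> edges G" "x \<notin> f" "f \<noteq> {a, b}" using f unfolding E' by auto
    then show ?thesis
    proof cases
      case 1
      have "x \<notin> f" using 1 nx by auto
      then have "f \<noteq> {c, x}" "f \<noteq> {x, d}" by auto
      then have tx: "reach (delete_edge f ?G') c d" by (rule throughx)
      have nf: "f \<notin> edges G" using abE 1 by simp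
      show ?thesis
        by (intro bexI[OF _ E(2)] hom[of "{a, x}" f b]) (use E(2) nf tx in simp_all)
    next
      case 2
      have "f \<noteq> {a, b}" using 2 nx by auto
      then have tab: "reach (delete_edge f ?G') a b" by (rule throughab)
      show ?thesis
        by (intro bexI[OF _ E(4)] hom[of "{c, d}" f a]) (use E(4) 2 tab in simp_all)
    next
      case 3
      have "f \<noteq> {c, x}" "f \<noteq> {x, d}" using 3(2) by auto
      then have tx: "reach (delete_edge f ?G') c d" by (rule throughx)
      have tab: "reach (delete_edge f ?G') a b" by (rule throughab[OF 3(3)])
      show ?thesis
        by (intro bexI[OF _ 3(1)] hom[of f f a]) (use 3 tx tab in simp_all)
    qed
  qed
  then show ?thesis using E(1) by blast
qed

lemma clusters_separation:
  assumes b: "binary_ltree X (G, l)" and X0: "0 \<in> X" and g: "g \<in> edges G"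
    and u: "u \<in> X" and v: "v \<in> X" and c: "c = {x \<in> X. \<not> joined (delete_edge g G) (l 0) (l x)}"
  shows "reach (delete_edge g G) (l u) (l v) \<longleftrightarrow> (u \<in> c \<longleftrightarrow> v \<in> c)"
proof -
  obtain par Dn where "binary_rtree G (l 0) par Dn X l" using binary_ltree_binary_rtree[OF b X0] by blast
  then interpret binary_rtree G "l 0" par Dn X l .
  obtain p where p: "p \<in> verts G - {l 0}" "g = {p, par p}" using g unfolding edges_eq by blast
  have uV: "l u \<in> verts G" "l v \<in> verts G" using leaf_verts u v by blast+
  let ?R = "reach (delete_edge g G)"
  have c': "w \<in> c \<longleftrightarrow> l w \<in> Dn p" if "w \<in> X" for w
    using that reach_delete_iff[OF p(1), of "l w"] leaf_verts[OF that] p(2) root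
      joined_iff_reach[OF simple_delete_edge[OF simple], of g "l 0" "l w"] unfolding c by simp
  have r: "?R (l 0) w \<longleftrightarrow> w \<notin> Dn p" if "w \<in> verts G" for w using reach_delete_iff[OF p(1) that] p(2) by simp
  have below: "?R w p" if "w \<in> Dn p" for w using reach_below[OF p(1) that] p(2) by simp
  show ?thesis
  proof
    assume "?R (l u) (l v)"
    then have "?R (l 0) (l u) \<longleftrightarrow> ?R (l 0) (l v)" using reach_trans reach_sym by metis
    then show "u \<in> c \<longleftrightarrow> v \<in> c" using r[OF uV(1)] r[OF uV(2)] c'[OF u] c'[OF v] by simp
  next
    assume a: "u \<in> c \<longleftrightarrow> v \<in> c"
    show "?R (l u) (l v)"
    proof (cases "u \<in> c")
      case True
      then show ?thesis using a below c'[OF u] c'[OF v] reach_trans reach_sym by metis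
    next
      case False
      then show ?thesis using a r[OF uV(1)] r[OF uV(2)] c'[OF u] c'[OF v] reach_trans reach_sym by metis
    qed
  qed
qed

lemma move_cut:
  assumes S: "binary_ltree X S" and T: "binary_ltree X T" and X0: "0 \<in> X" and m: "ltree_move \<kappa> S T"
  shows "\<exists>e\<in>clusters X S. \<forall>d\<in>clusters X T. \<exists>c\<in>clusters X S. \<forall>u\<in>X. \<forall>v\<in>X.
     (u \<in> e \<longleftrightarrow> v \<in> e) \<longrightarrow> (u \<in> c \<longleftrightarrow> v \<in> c) \<longrightarrow> (u \<in> d \<longleftrightarrow> v \<in> d)"
proof -
  obtain G l where SG: "S = (G, l)" by (cases S)
  obtain G' l' where TG: "T = (G', l')" by (cases T)
  have l': "l' = l" using m unfolding SG TG by (cases \<kappa>) auto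
  have bG: "binary_ltree X (G, l)" and bG': "binary_ltree X (G', l)" using S T SG TG l' by auto
  have tG: "tree G" "\<forall>v\<in>verts G. deg G v = 3 \<or> deg G v = 1" using bG unfolding binary_ltree_def by auto
  have lv: "u \<in> verts G \<and> deg G u = 1" if "u \<in> l ` X" for u
    using bG that unfolding binary_ltree_def bij_betw_def by auto
  have "\<exists>e\<in>edges G. \<forall>f\<in>edges G'. \<exists>e0\<in>edges G. \<forall>u\<in>l ` X. \<forall>v\<in>l ` X.
    reach (delete_edge e G) u v \<longrightarrow> reach (delete_edge e0 G) u v \<longrightarrow> reach (delete_edge f G') u v"
  proof (cases \<kappa>)
    case TBR
    then have h: "TBR_graph G G'" using m unfolding SG TG by simp
    show ?thesis by (rule TBR_cut[OF tG(1) _ h]) (rule lv)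
  next
    case SPR
    then obtain x y a b c d where h: "SPR_allowed G x y a b c d" "G' = SPR_result G x a b c d"
      using m unfolding SG TG by auto
    show ?thesis unfolding h(2) by (rule SPR_cut[OF tG _ h(1)]) (rule lv)
  next
    case rSPR
    then obtain x y a b c d where h: "SPR_allowed G x y a b c d" "G' = SPR_result G x a b c d"
      using m unfolding SG TG by auto
    show ?thesis unfolding h(2) by (rule SPR_cut[OF tG _ h(1)]) (rule lv)
  qed
  then obtain e where e: "e \<in> edges G" "\<forall>f\<in>edges G'. \<exists>e0\<in>edges G. \<forall>u\<in>l ` X. \<forall>v\<in>l ` X.
    reach (delete_edge e G) u v \<longrightarrow> reach (delete_edge e0 G) u v \<longrightarrow> reach (delete_edge f G') u v"
    by (elim bexE)
  let ?c = "\<lambda>g. {x \<in> X. \<not> joined (delete_edge g G) (l 0) (l x)}"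
  let ?c' = "\<lambda>g. {x \<in> X. \<not> joined (delete_edge g G') (l 0) (l x)}"
  have cl: "clusters X S = ?c ` edges G" "clusters X T = ?c' ` edges G'" unfolding clusters_def SG TG l' by simp_all
  show ?thesis
  proof (rule bexI[of _ "?c e"], rule ballI)
    show "?c e \<in> clusters X S" unfolding cl using e(1) by blast
    fix d assume "d \<in> clusters X T"
    then obtain f where f: "f \<in> edges G'" "d = ?c' f" unfolding cl by blast
    obtain e0 where e0: "e0 \<in> edges G" "\<forall>u\<in>l ` X. \<forall>v\<in>l ` X.
      reach (delete_edge e G) u v \<longrightarrow> reach (delete_edge e0 G) u v \<longrightarrow> reach (delete_edge f G') u v"
      using bspec[OF e(2) f(1)] by (elim bexE)
    show "\<exists>c\<in>clusters X S. \<forall>u\<in>X. \<forall>v\<in>X. (u \<in> ?c e \<longleftrightarrow> v \<in> ?c e) \<longrightarrow> (u \<in> c \<longleftrightarrow> v \<in> c) \<longrightarrow> (u \<in> d \<longleftrightarrow> v \<in> d)"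
    proof (rule bexI[of _ "?c e0"], intro ballI impI)
      show "?c e0 \<in> clusters X S" unfolding cl using e0(1) by blast
      fix u v assume u: "u \<in> X" and v: "v \<in> X" and 1: "u \<in> ?c e \<longleftrightarrow> v \<in> ?c e" and 2: "u \<in> ?c e0 \<longleftrightarrow> v \<in> ?c e0"
      have "reach (delete_edge e G) (l u) (l v)" using clusters_separation[OF bG X0 e(1) u v refl] 1 by simp
      moreover have "reach (delete_edge e0 G) (l u) (l v)" using clusters_separation[OF bG X0 e0(1) u v refl] 2 by simp
      ultimately have "reach (delete_edge f G') (l u) (l v)"
        using e0(2)[rule_format, of "l u" "l v"] u v by simp
      then show "u \<in> d \<longleftrightarrow> v \<in> d" using clusters_separation[OF bG' X0 f(1) u v f(2)] by simp
    qed
  qed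
qed

section \<open>Every transfer is a TBR move\<close>

context spr_config begin

lemma nbrs_x: "nbrs G x = {y, b, a}" using nbrs_eq[of x] xV chx a xr by auto

lemma edge_class:
  assumes e: "e \<in> edges G"
  shows "e = {x, y} \<or> e = {a, x} \<or> e = {x, b} \<or> e \<subseteq> verts G - Z \<or> e \<subseteq> Dn y"
proof -
  obtain v where v: "v \<in> verts G - {r}" "e = {v, par v}" using e unfolding edges_eq by blast
  consider "v = y" | "v \<in> Dn y" "v \<noteq> y" | "v = x" | "v = b" | "v \<notin> Z" "v \<noteq> b" by blast
  then show ?thesis
  proof cases
    case 1
    then show ?thesis using v(2) x by (simp add: insert_commute)
  next
    case 2
    then show ?thesis using v(2) step_Dn[OF yV v(1)] by simp
  next
    case 3
    then show ?thesis using v(2) edge_x by simp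
  next
    case 4
    then show ?thesis using v(2) edge_b by simp
  next
    case 5
    have "{v, par v} \<subseteq> verts G - Z" using 5 v(1) par_nZ[OF v(1) 5] par_verts[OF v(1)] by simp
    then show ?thesis using v(2) by simp
  qed
qed

lemma edges_no_x: "{e \<in> edges G. x \<notin> e} = {e \<in> edges G. e \<subseteq> verts G - Z} \<union> {e \<in> edges G. e \<subseteq> Dn y}"
proof
  show "{e \<in> edges G. x \<notin> e} \<subseteq> {e \<in> edges G. e \<subseteq> verts G - Z} \<union> {e \<in> edges G. e \<subseteq> Dn y}"
  proof
    fix e assume "e \<in> {e \<in> edges G. x \<notin> e}"
    then have e: "e \<in> edges G" "x \<notin> e" by auto
    then have "e \<noteq> {x, y}" "e \<noteq> {a, x}" "e \<noteq> {x, b}" by auto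
    then show "e \<in> {e \<in> edges G. e \<subseteq> verts G - Z} \<union> {e \<in> edges G. e \<subseteq> Dn y}" using edge_class[OF e(1)] e(1) by simp
  qed
  show "{e \<in> edges G. e \<subseteq> verts G - Z} \<union> {e \<in> edges G. e \<subseteq> Dn y} \<subseteq> {e \<in> edges G. x \<notin> e}"
    using xY by auto
qed

abbreviation "K \<equiv> delete_edge {x, y} G"

lemma xy_par: "{x, y} = {y, par y}" using x by (simp add: insert_commute)

lemma edge_ne_xy: "{x, y} \<noteq> {a, x}" "{x, y} \<noteq> {x, b}" "{x, y} \<noteq> {c, d}"
  unfolding xy_par edge_x edge_b edge_d
  using edge_inj[OF yV xV] edge_inj[OF yV bV] edge_inj[OF yV dV] ne_xy bney ne_yd by auto

lemma reach_K: "u \<in> verts G \<Longrightarrow> v \<in> verts G \<Longrightarrow> (u \<in> Dn y \<longleftrightarrow> v \<in> Dn y) \<Longrightarrow> reach K u v"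
proof (cases "u \<in> Dn y")
  case True
  assume "u \<in> Dn y \<longleftrightarrow> v \<in> Dn y"
  then have "reach K u y" "reach K v y" using True reach_below[OF yV] unfolding xy_par by auto
  then show ?thesis using reach_sym reach_trans by metis
next
  case False
  assume "u \<in> verts G" "v \<in> verts G" "u \<in> Dn y \<longleftrightarrow> v \<in> Dn y"
  then have "reach K r u" "reach K r v" using False reach_delete_iff[OF yV] unfolding xy_par by auto
  then show ?thesis using reach_sym reach_trans by metis
qed

lemma forest_K: "forest K" by (rule forest_delete_edge[OF tree_forest[OF tree]])

lemma nbrs_K_x: "nbrs K x = {b, a}"
proof -
  have "nbrs K x = nbrs G x - {y}" unfolding nbrs_def using ne_xy by (auto simp: doubleton_eq_iff)
  then show ?thesis using nbrs_x bney aY self_Dn[OF yV] by auto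
qed

lemma nbrs_K_y: "nbrs K y = ch y"
proof -
  have "nbrs K y = nbrs G y - {x}" unfolding nbrs_def using ne_xy by (auto simp: doubleton_eq_iff)
  moreover have "nbrs G y = ch y \<union> {x}" using nbrs_eq[of y] yV x by auto
  moreover have "x \<notin> ch y" using ch_Dn[of x y] xY yV by auto
  ultimately show ?thesis by auto
qed

lemma nbrs_K_other: "v \<noteq> x \<Longrightarrow> v \<noteq> y \<Longrightarrow> nbrs K v = nbrs G v"
  unfolding nbrs_def by (auto simp: doubleton_eq_iff)

lemma suppressed_x: "suppressed K x b a"
  unfolding suppressed_def using forest_K nbrs_K_x ne_ab by auto

lemma edges_suppress_x: "edges (suppress x K) = insert {a, b} ({e \<in> edges G. e \<subseteq> verts G - Z} \<union> {e \<in> edges G. e \<subseteq> Dn y})"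
proof -
  have "{e \<in> edges K. x \<notin> e} = {e \<in> edges G. x \<notin> e}" by auto
  then show ?thesis using suppressed.E[OF suppressed_x] edges_no_x by (simp add: insert_commute)
qed

lemma deg_not_2: "v \<in> verts G \<Longrightarrow> deg G v \<noteq> 2"
  using bl unfolding binary_ltree_def by auto

lemma TBR_assemble:
  assumes sup: "suppress_all K H" and sgH: "simple_graph H" and vH: "verts H = (verts G - Z) \<union> Cy"
    and Cy: "Cy \<subseteq> Dn y" "Cy \<noteq> {}"
    and eH: "edges H = insert {a, b} ({e \<in> edges G. e \<subseteq> verts G - Z} \<union> Fy)" and Fy: "\<And>e. e \<in> Fy \<Longrightarrow> e \<subseteq> Cy"
    and rH: "\<And>u v. u \<in> verts H \<Longrightarrow> v \<in> verts H \<Longrightarrow> reach K u v \<Longrightarrow> reach H u v"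
    and at: "attachment (induced H Cy) y Ky" and Ky: "verts Ky = Dn y" "edges Ky = {e \<in> edges G. e \<subseteq> Dn y}"
  shows "TBR_graph G G'"
proof -
  let ?C1 = "verts G - Z"
  have abC: "{a, b} \<subseteq> ?C1" using aV bV aZ bZ by simp
  have cdC: "{c, d} \<subseteq> ?C1" using cV dV cZ dZ by simp
  have cdE: "{c, d} \<in> edges G" unfolding edge_d by (rule par_edge[OF dV])
  have dj: "?C1 \<inter> Cy = {}" using Cy(1) by blast
  have r1: "r \<in> ?C1" using root rZ by simp
  have closed: "t \<in> ?C1 \<longleftrightarrow> s \<in> ?C1" if "{s, t} \<in> edges H" for s t
  proof -
    have "{s, t} = {a, b} \<or> ({s, t} \<in> edges G \<and> {s, t} \<subseteq> ?C1) \<or> {s, t} \<in> Fy"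
      using that unfolding eH by (simp only: insert_iff Un_iff mem_Collect_eq)
    then have "{s, t} \<subseteq> ?C1 \<or> {s, t} \<subseteq> Cy" using abC Fy by metis
    then show ?thesis using dj by blast
  qed
  have sub: "u \<in> verts G" if "u \<in> verts H" for u using that vH Cy(1) Dn_verts[OF yV] by auto
  have inDn: "u \<in> Dn y \<longleftrightarrow> u \<notin> ?C1" if "u \<in> verts H" for u using that vH Cy(1) by auto
  have join: "joined H u v \<longleftrightarrow> (u \<in> ?C1 \<longleftrightarrow> v \<in> ?C1)" if u: "u \<in> verts H" and v: "v \<in> verts H" for u v
  proof
    assume "joined H u v"
    then have "reach H u v" using joined_iff_reach[OF sgH] by simp
    then show "u \<in> ?C1 \<longleftrightarrow> v \<in> ?C1"
    proof (induction rule: reach_induct)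
      case (step s t)
      then show ?case using closed[of s t] by simp
    qed simp
  next
    assume "u \<in> ?C1 \<longleftrightarrow> v \<in> ?C1"
    then have "u \<in> Dn y \<longleftrightarrow> v \<in> Dn y" unfolding inDn[OF u] inDn[OF v] by (rule arg_cong)
    then have "reach K u v" by (rule reach_K[OF sub[OF u] sub[OF v]])
    then show "joined H u v" using rH[OF u v] joined_iff_reach[OF sgH] u by simp
  qed
  have compset: "{u \<in> verts H. joined H v u} = (if v \<in> ?C1 then ?C1 else Cy)" if "v \<in> verts H" for v
  proof (cases "v \<in> ?C1")
    case True
    then have "{u \<in> verts H. joined H v u} = {u \<in> verts H. u \<in> ?C1}" using join[OF that] by auto
    then show ?thesis using vH True by auto
  next
    case False
    then have "{u \<in> verts H. joined H v u} = {u \<in> verts H. u \<notin> ?C1}" using join[OF that] by auto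
    then show ?thesis using vH False dj by auto
  qed
  obtain z where z: "z \<in> Cy" using Cy(2) by blast
  have comps: "comps H = {?C1, Cy}"
  proof
    show "comps H \<subseteq> {?C1, Cy}" unfolding comps_def using compset by auto
    have "?C1 = {u \<in> verts H. joined H r u}" using compset[of r] r1 vH by simp
    moreover have "Cy = {u \<in> verts H. joined H z u}" using compset[of z] z vH dj by auto
    moreover have "r \<in> verts H" "z \<in> verts H" using r1 z vH by auto
    ultimately show "{?C1, Cy} \<subseteq> comps H" unfolding comps_def by blast
  qed
  have ne: "?C1 \<noteq> Cy" using r1 dj by blast
  have eI: "edges (induced H ?C1) = insert {a, b} {e \<in> edges G. e \<subseteq> ?C1}"
  proof -
    have "\<not> e \<subseteq> ?C1" if "e \<in> Fy" for e
    proof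
      assume "e \<subseteq> ?C1"
      then have "e = {}" using Fy[OF that] dj by blast
      moreover have "card e = 2" using that sgH eH unfolding simple_graph_def by blast
      ultimately show False by simp
    qed
    then show ?thesis unfolding induced_def eH using abC by auto
  qed
  let ?K1 = "\<lparr>verts = insert x ?C1, edges = (edges (induced H ?C1) - {{c, d}}) \<union> {{c, x}, {x, d}}\<rparr>"
  have "attachment (induced H ?C1) x \<lparr>verts = insert x (verts (induced H ?C1)),
      edges = (edges (induced H ?C1) - {{c, d}}) \<union> {{c, x}, {x, d}}\<rparr>"
    by (rule attach_midpoint) (use cdC cdE eI in \<open>auto simp: induced_def\<close>)
  then have at1: "attachment (induced H ?C1) x ?K1" unfolding induced_def by simp
  have vdj: "verts ?K1 \<inter> verts Ky = {}" using Ky(1) xY by auto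
  have vG: "verts G' = verts ?K1 \<union> verts Ky" using verts_G' Ky(1) ZV xV by auto
  have E1: "e \<in> edges ?K1 \<longleftrightarrow> (e = {a, b} \<or> (e \<in> edges G \<and> e \<subseteq> ?C1)) \<and> e \<noteq> {c, d} \<or> e = {c, x} \<or> e = {x, d}" for e
    using eI by auto
  have xyE: "{x, y} \<in> edges G" unfolding xy_par by (rule par_edge[OF yV])
  have old: "e \<in> edges G \<and> e \<noteq> {a, x} \<and> e \<noteq> {x, b} \<and> e \<noteq> {c, d} \<longleftrightarrow>
      e = {x, y} \<or> (e \<in> edges G \<and> e \<subseteq> ?C1 \<and> e \<noteq> {c, d}) \<or> (e \<in> edges G \<and> e \<subseteq> Dn y)" for e
  proof
    assume "e \<in> edges G \<and> e \<noteq> {a, x} \<and> e \<noteq> {x, b} \<and> e \<noteq> {c, d}"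
    then show "e = {x, y} \<or> (e \<in> edges G \<and> e \<subseteq> ?C1 \<and> e \<noteq> {c, d}) \<or> (e \<in> edges G \<and> e \<subseteq> Dn y)"
      using edge_class[of e] by blast
  next
    assume "e = {x, y} \<or> (e \<in> edges G \<and> e \<subseteq> ?C1 \<and> e \<noteq> {c, d}) \<or> (e \<in> edges G \<and> e \<subseteq> Dn y)"
    then show "e \<in> edges G \<and> e \<noteq> {a, x} \<and> e \<noteq> {x, b} \<and> e \<noteq> {c, d}"
    proof (elim disjE)
      assume "e = {x, y}"
      then show ?thesis using xyE edge_ne_xy by simp
    next
      assume h: "e \<in> edges G \<and> e \<subseteq> ?C1 \<and> e \<noteq> {c, d}"
      then have "x \<notin> e" by auto
      then have "e \<noteq> {a, x}" "e \<noteq> {x, b}" by auto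
      then show ?thesis using h by simp
    next
      assume h: "e \<in> edges G \<and> e \<subseteq> Dn y"
      then have "x \<notin> e" "c \<notin> e" using xY cY by auto
      then have "e \<noteq> {a, x}" "e \<noteq> {x, b}" "e \<noteq> {c, d}" by auto
      then show ?thesis using h by simp
    qed
  qed
  have "e \<in> edges G' \<longleftrightarrow> e \<in> insert {x, y} (edges ?K1 \<union> edges Ky)" for e
  proof -
    have "e \<in> edges G' \<longleftrightarrow> (e \<in> edges G \<and> e \<noteq> {a, x} \<and> e \<noteq> {x, b} \<and> e \<noteq> {c, d}) \<or> e = {a, b} \<or> e = {c, x} \<or> e = {x, d}"
      unfolding edges_G' by (simp only: insert_iff Un_iff Diff_iff empty_iff simp_thms de_Morgan_disj)
    also have "\<dots> \<longleftrightarrow> e = {x, y} \<or> e \<in> edges ?K1 \<or> e \<in> edges Ky"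
      unfolding old E1 Ky(2) using ab_ne_cd by (simp only: mem_Collect_eq) metis
    finally show ?thesis by simp
  qed
  then have eG: "edges G' = insert {x, y} (edges ?K1 \<union> edges Ky)" by (rule set_eqI)
  have "G' = \<lparr>verts = verts ?K1 \<union> verts Ky, edges = insert {x, y} (edges ?K1 \<union> edges Ky)\<rparr>"
    by (rule graph.equality, simp only: vG graph.simps, simp only: eG graph.simps, simp)
  then show ?thesis unfolding TBR_graph_def
    by (intro exI[of _ "{x, y}"] exI[of _ H] exI[of _ ?C1] exI[of _ Cy] exI[of _ x] exI[of _ ?K1] exI[of _ y] exI[of _ Ky] conjI
        xyE sup comps ne at1 at vdj)
qed

lemma TBR_move: "TBR_graph G G'"
proof -
  interpret sx: suppressed K x b a by (rule suppressed_x)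
  let ?H1 = "suppress x K"
  have vH1: "verts ?H1 = (verts G - Z) \<union> Dn y" unfolding verts_suppress using xY ZV by auto
  have degx: "deg K x = 2" unfolding deg_def nbrs_K_x using ne_ab by simp
  have xK: "x \<in> verts K" using xV by simp
  have degH1: "deg ?H1 v \<noteq> 2" if "v \<in> verts ?H1" "v \<noteq> y" for v
  proof -
    have "v \<noteq> x" "v \<in> verts G" using that unfolding verts_suppress by auto
    then show ?thesis using sx.deg_suppress[of v] nbrs_K_other[of v] that(2) deg_not_2[of v] unfolding deg_def by simp
  qed
  have reach1: "reach ?H1 u v" if "u \<in> verts ?H1" "v \<in> verts ?H1" "reach K u v" for u v
    using sx.reach_suppress[OF that(3)] that(1,2) unfolding verts_suppress by simp
  show ?thesis
  proof (cases "ch y = {}")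
    case True
    have Dy: "Dn y = {y}" using Dn_children[OF yV] True by simp
    have degy: "deg ?H1 y = 0" using sx.deg_suppress[of y] ne_xy nbrs_K_y True unfolding deg_def by simp
    have noE: "{e \<in> edges G. e \<subseteq> Dn y} = {}"
    proof -
      have "card e \<noteq> 2" if "e \<subseteq> {y}" for e using that card_mono[of "{y}" e] by simp
      then show ?thesis using simple unfolding Dy simple_graph_def by blast
    qed
    show ?thesis
    proof (rule TBR_assemble[where H = ?H1 and Cy = "Dn y" and Fy = "{}"])
      have "suppress_all ?H1 ?H1" by (rule suppress_done) (use degH1 degy in force)
      then show "suppress_all K ?H1" by (rule suppress_step[OF xK degx])
      show "simple_graph ?H1" by (rule sx.simple_suppress)
      show "verts ?H1 = (verts G - Z) \<union> Dn y" by (rule vH1)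
      show "Dn y \<noteq> {}" using Dy by simp
      show "edges ?H1 = insert {a, b} ({e \<in> edges G. e \<subseteq> verts G - Z} \<union> {})" using edges_suppress_x noE by simp
      show "attachment (induced ?H1 (Dn y)) y (induced ?H1 (Dn y))" by (rule attach_single) (simp add: induced_def Dy)
      show "verts (induced ?H1 (Dn y)) = Dn y" by (simp add: induced_def)
      have "\<not> e \<subseteq> Dn y" if "e \<in> edges ?H1" for e
      proof
        assume "e \<subseteq> Dn y"
        then have "card e \<le> 1" using card_mono[of "{y}" e] Dy by simp
        moreover have "card e = 2" using that sx.simple_suppress unfolding simple_graph_def by blast
        ultimately show False by simp
      qed
      then show "edges (induced ?H1 (Dn y)) = {e \<in> edges G. e \<subseteq> Dn y}" unfolding noE by (auto simp: induced_def)
    qed (use reach1 in auto)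
  next
    case False
    obtain y1 y2 where ch: "ch y = {y1, y2}" "y1 \<noteq> y2" by (rule two_children[OF yV False])
    have yc: "y1 \<in> ch y" "y2 \<in> ch y" using ch by auto
    have yD: "y1 \<in> Dn y" "y2 \<in> Dn y" using ch_Dn yc yV by auto
    have "y1 \<in> verts G - {r}" "y2 \<in> verts G - {r}" "par y1 = y" "par y2 = y" using yc unfolding ch_def by auto
    then have yn: "y1 \<noteq> y" "y2 \<noteq> y" using par_neq[of y1] par_neq[of y2] by metis+
    have "y \<noteq> a" "y \<noteq> b" using aY self_Dn[OF yV] bney by auto
    then have "nbrs ?H1 y = {y1, y2}" using sx.nbrs_suppress_other[of y] ne_xy nbrs_K_y ch(1) by simp
    then have sup2: "suppressed ?H1 y y1 y2" unfolding suppressed_def using sx.forest_suppress ch(2) by simp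
    interpret sy: suppressed ?H1 y y1 y2 by (rule sup2)
    let ?H2 = "suppress y ?H1"
    let ?C2 = "Dn y - {y}"
    let ?E2 = "{e \<in> edges G. e \<subseteq> Dn y \<and> y \<notin> e}"
    have eH2: "edges ?H2 = insert {a, b} ({e \<in> edges G. e \<subseteq> verts G - Z} \<union> insert {y1, y2} ?E2)"
    proof -
      have "y \<notin> {a, b}" using \<open>y \<noteq> a\<close> \<open>y \<noteq> b\<close> by simp
      moreover have "y \<notin> e" if "e \<subseteq> verts G - Z" for e using that self_Dn[OF yV] by auto
      ultimately have "{e \<in> edges ?H1. y \<notin> e} = insert {a, b} ({e \<in> edges G. e \<subseteq> verts G - Z} \<union> ?E2)"
        unfolding edges_suppress_x by auto
      then show ?thesis using sy.E by auto
    qed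
    have y12: "{y1, y2} \<notin> edges G"
    proof
      assume "{y1, y2} \<in> edges G"
      then have "{y1, y2} \<in> edges ?H1" unfolding edges_suppress_x using yD by auto
      then show False using sy.ab_notin by simp
    qed
    show ?thesis
    proof (rule TBR_assemble[where H = ?H2 and Cy = ?C2 and Fy = "insert {y1, y2} ?E2"])
      have d2: "deg ?H1 y = 2" using \<open>nbrs ?H1 y = {y1, y2}\<close> ch(2) unfolding deg_def by simp
      have "deg ?H2 v \<noteq> 2" if "v \<in> verts ?H2" for v
        using that degH1[of v] sy.deg_suppress[of v] unfolding verts_suppress[of y] by auto
      then have "suppress_all ?H2 ?H2" by (intro suppress_done) blast
      then have "suppress_all ?H1 ?H2" by (rule suppress_step[rotated 2]) (use d2 vH1 self_Dn[OF yV] in auto)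
      then show "suppress_all K ?H2" by (rule suppress_step[OF xK degx])
      show "simple_graph ?H2" by (rule sy.simple_suppress)
      show "verts ?H2 = (verts G - Z) \<union> ?C2" unfolding verts_suppress[of y] vH1 using self_Dn[OF yV] by auto
      show "?C2 \<subseteq> Dn y" by auto
      show "?C2 \<noteq> {}" using yD yn by auto
      show "edges ?H2 = insert {a, b} ({e \<in> edges G. e \<subseteq> verts G - Z} \<union> insert {y1, y2} ?E2)" by (rule eH2)
      show "e \<subseteq> ?C2" if "e \<in> insert {y1, y2} ?E2" for e using that yD yn by auto
      show "reach ?H2 u v" if h: "u \<in> verts ?H2" "v \<in> verts ?H2" "reach K u v" for u v
      proof -
        have uv: "u \<in> verts ?H1" "v \<in> verts ?H1" "u \<noteq> y" "v \<noteq> y" using h(1,2) unfolding verts_suppress[of y] by auto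
        show ?thesis by (rule sy.reach_suppress[OF reach1[OF uv(1,2) h(3)] uv(3,4)])
      qed
      let ?T = "induced ?H2 ?C2"
      let ?K2 = "\<lparr>verts = insert y (verts ?T), edges = (edges ?T - {{y1, y2}}) \<union> {{y1, y}, {y, y2}}\<rparr>"
      have eT: "edges ?T = insert {y1, y2} ?E2"
      proof -
        have "a \<notin> ?C2" using aY by simp
        then have n1: "\<not> {a, b} \<subseteq> ?C2" by simp
        have n2: "\<not> e \<subseteq> ?C2" if "e \<in> edges G" "e \<subseteq> verts G - Z" for e
        proof
          assume "e \<subseteq> ?C2"
          then have "e = {}" using that(2) by auto
          moreover have "card e = 2" using that(1) simple unfolding simple_graph_def by blast
          ultimately show False by simp
        qed
        have n3: "{y1, y2} \<subseteq> ?C2" using yD yn by simp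
        have n4: "e \<subseteq> ?C2" if "e \<in> ?E2" for e using that by auto
        have "e \<in> edges ?T \<longleftrightarrow> e \<in> insert {y1, y2} ?E2" for e
        proof -
          have "e \<in> edges ?T \<longleftrightarrow> e \<in> edges ?H2 \<and> e \<subseteq> ?C2" by (simp add: induced_def)
          also have "\<dots> \<longleftrightarrow> (e = {a, b} \<or> (e \<in> edges G \<and> e \<subseteq> verts G - Z) \<or> e \<in> insert {y1, y2} ?E2) \<and> e \<subseteq> ?C2"
            unfolding eH2 by (simp only: insert_iff Un_iff mem_Collect_eq)
          also have "\<dots> \<longleftrightarrow> e \<in> insert {y1, y2} ?E2"
          proof
            assume h: "(e = {a, b} \<or> (e \<in> edges G \<and> e \<subseteq> verts G - Z) \<or> e \<in> insert {y1, y2} ?E2) \<and> e \<subseteq> ?C2"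
            have "e \<noteq> {a, b}" using h n1 by metis
            moreover have "\<not> (e \<in> edges G \<and> e \<subseteq> verts G - Z)" using h n2 by metis
            ultimately show "e \<in> insert {y1, y2} ?E2" using h by metis
          next
            assume h: "e \<in> insert {y1, y2} ?E2"
            then have "e \<subseteq> ?C2" using n3 n4 by (elim insertE) simp_all
            then show "(e = {a, b} \<or> (e \<in> edges G \<and> e \<subseteq> verts G - Z) \<or> e \<in> insert {y1, y2} ?E2) \<and> e \<subseteq> ?C2"
              using h by simp
          qed
          finally show ?thesis .
        qed
        then show ?thesis by (rule set_eqI)
      qed
      show "attachment ?T y ?K2" by (rule attach_midpoint) (use eT in \<open>auto simp: induced_def\<close>)
      show "verts ?K2 = Dn y" using self_Dn[OF yV] by (auto simp: induced_def)
      have "?E2 - {{y1, y2}} = ?E2" using y12 by auto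
      then have eK: "edges ?K2 = ?E2 \<union> {{y1, y}, {y, y2}}" unfolding eT by auto
      have py: "{y1, y} \<in> edges G" "{y, y2} \<in> edges G" "{y2, y} \<in> edges G"
        using par_edge[of y1] par_edge[of y2] yc unfolding ch_def by (auto simp: insert_commute)
      show "edges ?K2 = {e \<in> edges G. e \<subseteq> Dn y}"
      proof
        show "edges ?K2 \<subseteq> {e \<in> edges G. e \<subseteq> Dn y}" unfolding eK using py yD self_Dn[OF yV] by auto
        show "{e \<in> edges G. e \<subseteq> Dn y} \<subseteq> edges ?K2"
        proof
          fix e assume "e \<in> {e \<in> edges G. e \<subseteq> Dn y}"
          then have e: "e \<in> edges G" "e \<subseteq> Dn y" by auto
          show "e \<in> edges ?K2"
          proof (cases "y \<in> e")
            case False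
            then show ?thesis unfolding eK using e by simp
          next
            case True
            have "card e = 2" using e(1) simple unfolding simple_graph_def by blast
            then obtain t where t: "e = {t, y}" using True by (metis card_2_iff insertE insert_commute singletonD)
            then have "t \<in> nbrs G y" using e(1) unfolding nbrs_def by simp
            then have "t \<in> ch y \<or> t = x" using nbrs_eq[of y] yV x by auto
            then have "t = y1 \<or> t = y2" using ch(1) e(2) t xY by auto
            then show ?thesis unfolding eK t by (auto simp: insert_commute)
          qed
        qed
      qed
    qed
  qed
qed

lemma config_move: "ltree_move \<kappa> (G, l) (G', l)"
proof (cases \<kappa>)
  case TBR
  then show ?thesis using TBR_move by simp
next
  case SPR
  have "\<exists>x' y a' b' c' d'. SPR_allowed G x' y a' b' c' d' \<and> G' = SPR_result G x' a' b' c' d'"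
    by (rule exI[of _ x], rule exI[of _ y], rule exI[of _ a], rule exI[of _ b], rule exI[of _ c], rule exI[of _ d])
      (simp only: spr_allowed simp_thms)
  then show ?thesis using SPR by simp
next
  case rSPR
  have "\<exists>x' y a' b' c' d'. SPR_allowed G x' y a' b' c' d' \<and>
      (\<exists>p. path_between G (l 0) p y \<and> x' \<in> set p) \<and> G' = SPR_result G x' a' b' c' d'"
    by (rule exI[of _ x], rule exI[of _ y], rule exI[of _ a], rule exI[of _ b], rule exI[of _ c], rule exI[of _ d])
      (simp only: spr_allowed root_path simp_thms)
  then show ?thesis using rSPR by simp
qed

end

lemma caterpillar:
  assumes n: "2 \<le> n"
  shows "\<exists>T. binary_ltree {0..n} T"
proof -
  define par where "par v = (if v < n then n + v else if v = n then 2 * n - 1 else if v = n + 1 then 0 else v - 1)" for v :: nat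
  define Dn where "Dn v = (if v \<le> n then {v} else {u. v \<le> u \<and> u < 2 * n \<or> v - n \<le> u \<and> u \<le> n})" for v :: nat
  define G where "G = \<lparr>verts = {0..<2 * n}, edges = (\<lambda>v. {v, par v}) ` ({0..<2 * n} - {0})\<rparr>"
  have vG: "verts G = {0..<2 * n}" unfolding G_def by simp
  have "rtree G 0 par Dn"
  proof
    show "finite (verts G)" "0 \<in> verts G" using n by (auto simp: vG)
    show "edges G = (\<lambda>v. {v, par v}) ` (verts G - {0})" by (simp add: G_def)
    fix v assume "v \<in> verts G - {0}"
    then have v: "0 < v" "v < 2 * n" by (auto simp: vG)
    show "par v \<in> verts G" using v n by (auto simp: vG par_def)
    show "Dn v \<subseteq> verts G" using v n by (auto simp: vG Dn_def)
    show "0 \<notin> Dn v" using v n by (auto simp: Dn_def)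
    show "v \<in> Dn v" using v by (auto simp: Dn_def)
    show "par v \<notin> Dn v" using v n by (auto simp: par_def Dn_def)
    fix u assume "u \<in> verts G - {0}" and uv: "u \<noteq> v"
    then have u: "0 < u" "u < 2 * n" by (auto simp: vG)
    show "u \<in> Dn v \<longleftrightarrow> par u \<in> Dn v" using u v uv n by (auto simp: par_def Dn_def split: if_splits)
  qed
  then interpret rtree G 0 par Dn .
  have chl: "ch v = {}" if "0 < v" "v \<le> n" for v
    using that n by (auto simp: ch_def vG par_def split: if_splits)
  have ch0: "ch 0 = {n + 1}" using n by (auto simp: ch_def vG par_def split: if_splits)
  have chi: "ch v = {v - n, if v = 2 * n - 1 then n else v + 1}" if "n < v" "v < 2 * n" for v
    using that n by (auto simp: ch_def vG par_def split: if_splits)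
  have deg1: "deg G v = 1" if "v \<le> n" for v
    using that deg_eq[of v] chl[of v] ch0 n by (cases "v = 0") (auto simp: vG)
  have deg3: "deg G v = 3" if "n < v" "v < 2 * n" for v
  proof -
    have "v - n \<noteq> (if v = 2 * n - 1 then n else v + 1)" using that n by auto
    then have "card (ch v) = 2" unfolding chi[OF that] by simp
    then show ?thesis using deg_eq[of v] that by (simp add: vG)
  qed
  have "{v \<in> verts G. deg G v = 1} = {0..n}"
  proof
    show "{v \<in> verts G. deg G v = 1} \<subseteq> {0..n}"
    proof
      fix v assume v: "v \<in> {v \<in> verts G. deg G v = 1}"
      show "v \<in> {0..n}"
      proof (rule ccontr)
        assume "v \<notin> {0..n}"
        then have "deg G v = 3" using v by (intro deg3) (auto simp: vG)
        then show False using v by simp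
      qed
    qed
    show "{0..n} \<subseteq> {v \<in> verts G. deg G v = 1}" using deg1 n by (auto simp: vG)
  qed
  then have "bij_betw id {0..n} {v \<in> verts G. deg G v = 1}" by simp
  moreover have "\<forall>v\<in>verts G. deg G v = 3 \<or> deg G v = 1" using deg1 deg3 by (metis atLeastLessThan_iff leI vG)
  ultimately have "binary_ltree {0..n} (G, id)" unfolding binary_ltree_def using tree n by simp
  then show ?thesis by blast
qed

section \<open>Distances and relabellings\<close>

definition class_clusters :: "nat \<Rightarrow> ltree set \<Rightarrow> nat set set" where
  "class_clusters n A = clusters {0..n} (SOME T. T \<in> A)"

lemma X_minus_root: "{0..n :: nat} - {0} = {1..n}" by auto

lemma iso_class:
  assumes "binary_ltree {0..n} S"
  shows "iso_rel {0..n} `` {S} = {T. binary_ltree {0..n} T \<and> clusters {0..n} T = clusters {0..n} S}"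
  using iso_rel_iff[of "{0..n}" S] assms by auto

lemma BT_cl:
  assumes "A \<in> BT {0..n}"
  shows "A = {T. binary_ltree {0..n} T \<and> clusters {0..n} T = class_clusters n A}" "\<exists>T. T \<in> A"
proof -
  obtain S where S: "binary_ltree {0..n} S" "A = iso_rel {0..n} `` {S}"
    using assms unfolding BT_def quotient_def by auto
  have A: "A = {T. binary_ltree {0..n} T \<and> clusters {0..n} T = clusters {0..n} S}" using S iso_class by simp
  then have SA: "S \<in> A" using S(1) by simp
  then have "(SOME T. T \<in> A) \<in> A" by (rule someI)
  then have "class_clusters n A = clusters {0..n} S" unfolding class_clusters_def using A by blast
  then show "A = {T. binary_ltree {0..n} T \<and> clusters {0..n} T = class_clusters n A}" using A by simp
  show "\<exists>T. T \<in> A" using SA by blast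
qed

lemma BT_member:
  assumes "A \<in> BT {0..n}" "T \<in> A" shows "binary_ltree {0..n} T" "clusters {0..n} T = class_clusters n A"
proof -
  have "T \<in> {T. binary_ltree {0..n} T \<and> clusters {0..n} T = class_clusters n A}" using BT_cl(1)[OF assms(1)] assms(2) by simp
  then show "binary_ltree {0..n} T" "clusters {0..n} T = class_clusters n A" by simp_all
qed

lemma BT_of_tree:
  assumes "binary_ltree {0..n} S" shows "\<exists>A\<in>BT {0..n}. S \<in> A \<and> class_clusters n A = clusters {0..n} S"
proof -
  let ?A = "iso_rel {0..n} `` {S}"
  have "?A \<in> BT {0..n}" unfolding BT_def using assms by (auto intro: quotientI)
  moreover have "S \<in> ?A" using iso_class[OF assms] assms by simp
  ultimately show ?thesis using BT_member(2) by metis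
qed

lemma class_clusters_inj: "inj_on (class_clusters n) (BT {0..n})"
proof (rule inj_onI)
  fix A B assume "A \<in> BT {0..n}" "B \<in> BT {0..n}" "class_clusters n A = class_clusters n B"
  then show "A = B" using BT_cl(1)[of A n] BT_cl(1)[of B n] by simp
qed

lemma hierarchy_clusters_tree:
  assumes "binary_ltree {0..n} T" shows "binary_hierarchy {1..n} (clusters {0..n} T)"
proof -
  obtain G l where T: "T = (G, l)" by (cases T)
  obtain par Dn where "binary_rtree G (l 0) par Dn {0..n} l" using binary_ltree_binary_rtree[of "{0..n}" G l] assms T by auto
  then show ?thesis using binary_rtree.hierarchy_clusters X_minus_root T by metis
qed

lemma hierarchy_cl: assumes "A \<in> BT {0..n}" shows "binary_hierarchy {1..n} (class_clusters n A)"
  using BT_cl(2)[OF assms] BT_member[OF assms] hierarchy_clusters_tree by metis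

lemma finite_BT: "finite (BT {0..n})"
proof (rule inj_on_finite[OF class_clusters_inj])
  show "class_clusters n ` BT {0..n} \<subseteq> Pow (Pow {1..n})" using hierarchy_subset[OF hierarchy_cl] by blast
qed simp

lemma BT_nonempty: "2 \<le> n \<Longrightarrow> BT {0..n} \<noteq> {}"
  using caterpillar BT_of_tree by blast

lemma agree_moves:
  assumes "A \<in> BT {0..n}" "(A, B) \<in> move_rel \<kappa> {0..n} ^^ k"
  shows "B \<in> BT {0..n} \<and> agree {1..n} k (class_clusters n A) (class_clusters n B)"
  using assms(2)
proof (induction k arbitrary: B)
  case 0
  then show ?case using assms(1) agree_refl[OF hierarchy_cl[OF assms(1)]] by simp
next
  case (Suc k)
  then obtain C where C: "(A, C) \<in> move_rel \<kappa> {0..n} ^^ k" "(C, B) \<in> move_rel \<kappa> {0..n}" by auto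
  then have IH: "C \<in> BT {0..n}" "agree {1..n} k (class_clusters n A) (class_clusters n C)" using Suc.IH by auto
  obtain S T where ST: "S \<in> C" "T \<in> B" "ltree_move \<kappa> S T" "B \<in> BT {0..n}" using C(2) unfolding move_rel_def by auto
  have "\<exists>e\<in>clusters {0..n} S. \<forall>d\<in>clusters {0..n} T. \<exists>c\<in>clusters {0..n} S. \<forall>u\<in>{0..n}. \<forall>v\<in>{0..n}.
     (u \<in> e \<longleftrightarrow> v \<in> e) \<longrightarrow> (u \<in> c \<longleftrightarrow> v \<in> c) \<longrightarrow> (u \<in> d \<longleftrightarrow> v \<in> d)"
    by (rule move_cut[OF BT_member(1)[OF IH(1) ST(1)] BT_member(1)[OF ST(4,2)] _ ST(3)]) simp
  then obtain e where e: "e \<in> class_clusters n C" "\<forall>d\<in>class_clusters n B. \<exists>c\<in>class_clusters n C. \<forall>u\<in>{0..n}. \<forall>v\<in>{0..n}.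
     (u \<in> e \<longleftrightarrow> v \<in> e) \<longrightarrow> (u \<in> c \<longleftrightarrow> v \<in> c) \<longrightarrow> (u \<in> d \<longleftrightarrow> v \<in> d)"
    unfolding BT_member(2)[OF IH(1) ST(1)] BT_member(2)[OF ST(4,2)] by (elim bexE)
  have "\<forall>d\<in>class_clusters n B. \<exists>c\<in>class_clusters n C. \<forall>u\<in>{1..n}. \<forall>v\<in>{1..n}.
     (u \<in> e \<longleftrightarrow> v \<in> e) \<longrightarrow> (u \<in> c \<longleftrightarrow> v \<in> c) \<longrightarrow> (u \<in> d \<longleftrightarrow> v \<in> d)"
  proof
    fix d assume "d \<in> class_clusters n B"
    then obtain c where "c \<in> class_clusters n C" "\<forall>u\<in>{0..n}. \<forall>v\<in>{0..n}.
     (u \<in> e \<longleftrightarrow> v \<in> e) \<longrightarrow> (u \<in> c \<longleftrightarrow> v \<in> c) \<longrightarrow> (u \<in> d \<longleftrightarrow> v \<in> d)" using bspec[OF e(2)] by metis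
    then show "\<exists>c\<in>class_clusters n C. \<forall>u\<in>{1..n}. \<forall>v\<in>{1..n}.
     (u \<in> e \<longleftrightarrow> v \<in> e) \<longrightarrow> (u \<in> c \<longleftrightarrow> v \<in> c) \<longrightarrow> (u \<in> d \<longleftrightarrow> v \<in> d)" by (intro bexI[of _ c]) simp_all
  qed
  then show ?case using agree_step[OF _ IH(2) e(1)] ST(4) by simp
qed

lemma regraft_move:
  assumes A: "A \<in> BT {0..n}" and Y: "Y \<in> class_clusters n A" and D: "D \<in> class_clusters n A" "\<not> D \<subseteq> Y"
  shows "\<exists>B\<in>BT {0..n}. class_clusters n B = regraft (class_clusters n A) Y D \<and> (B = A \<or> (A, B) \<in> move_rel \<kappa> {0..n})"
proof -
  obtain T where T: "T \<in> A" using BT_cl(2)[OF A] by blast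
  obtain G l where TG: "T = (G, l)" by (cases T)
  have b: "binary_ltree {0..n} (G, l)" and cA: "clusters {0..n} (G, l) = class_clusters n A" using BT_member[OF A T] TG by auto
  obtain par Dn where R: "binary_rtree G (l 0) par Dn {0..n} l" using binary_ltree_binary_rtree[OF b] by auto
  show ?thesis
  proof (cases "regraft (class_clusters n A) Y D = class_clusters n A")
    case True
    then show ?thesis using A by auto
  next
    case False
    then obtain x y a bb c d where cfg: "spr_config G (l 0) par Dn {0..n} l x y a bb c d"
      and YD: "Y = binary_rtree.lab Dn {0..n} l y" "D = binary_rtree.lab Dn {0..n} l d"
      using binary_rtree.regraft_cases[OF R, of Y D] Y D unfolding cA by blast
    interpret spr_config G "l 0" par Dn "{0..n}" l x y a bb c d by (rule cfg)
    obtain B where B: "B \<in> BT {0..n}" "(G', l) \<in> B" "class_clusters n B = clusters {0..n} (G', l)" using BT_of_tree[OF binary'] by blast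
    have "class_clusters n B = regraft (class_clusters n A) Y D" using B(3) clusters' cA YD by simp
    moreover have "(A, B) \<in> move_rel \<kappa> {0..n}" unfolding move_rel_def using A B T TG config_move by blast
    ultimately show ?thesis using B(1) by blast
  qed
qed

lemma move_chain:
  assumes A: "A \<in> BT {0..n}" and B: "B \<in> BT {0..n}" and K: "pairing K" "\<Union>K \<subseteq> {1..n}"
    and cm: "compatible (class_clusters n A) K" "compatible (class_clusters n B) K"
  shows "\<exists>k\<le>n - card K. (A, B) \<in> move_rel \<kappa> {0..n} ^^ k"
proof -
  define M where "M = {(class_clusters n A, class_clusters n B) |A B. (A, B) \<in> move_rel \<kappa> {0..n}}"
  define \<K> where "\<K> = K \<union> (\<lambda>x. {x}) ` ({1..n} - \<Union>K)"
  have finU: "finite (\<Union>K)" using K(2) finite_subset by blast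
  have finK: "finite K" by (rule finite_UnionD[OF finU])
  have card2: "card p = 2" if "p \<in> K" for p using K(1) that unfolding pairing_def by blast
  have djK: "disjoint K" using K(1) unfolding pairing_def by blast
  have "card (\<Union>K) = (\<Sum>p\<in>K. card p)"
    using djK card2 by (intro card_Union_disjoint) (auto simp: disjoint_def pairwise_def disjnt_def intro: card_ge_0_finite)
  then have cU: "card (\<Union>K) = 2 * card K" using card2 by simp
  have c\<K>: "card \<K> \<le> n - card K"
  proof -
    have "card \<K> \<le> card K + card ((\<lambda>x. {x}) ` ({1..n} - \<Union>K))" unfolding \<K>_def by (rule card_Un_le)
    also have "card ((\<lambda>x. {x}) ` ({1..n} - \<Union>K)) \<le> card ({1..n} - \<Union>K)" by (rule card_image_le) simp
    also have "card ({1..n} - \<Union>K) = n - 2 * card K" using card_Diff_subset[OF finU K(2)] cU by simp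
    finally have "card \<K> \<le> card K + (n - 2 * card K)" by simp
    moreover have "2 * card K \<le> n" using card_mono[OF _ K(2)] cU by simp
    ultimately show ?thesis by simp
  qed
  have nsing: "\<not> splits c {x}" for c and x :: nat unfolding splits_def by auto
  have cmp: "anchored {} \<K> C" if "compatible C K" for C
  proof -
    have "compatible C \<K>" unfolding compatible_def
    proof (intro ballI impI)
      fix c p q assume h: "c \<in> C" "p \<in> \<K>" "q \<in> \<K>" "splits c p" "splits c q"
      then have "p \<in> K" "q \<in> K" unfolding \<K>_def using nsing by auto
      then show "p = q" using that h unfolding compatible_def by blast
    qed
    then show ?thesis unfolding anchored_def by simp
  qed
  have H: "binary_hierarchy {1..n} C" if "C \<in> class_clusters n ` BT {0..n}" for C using that hierarchy_cl by blast
  have mv: "regraft C Y D \<in> class_clusters n ` BT {0..n} \<and> (regraft C Y D = C \<or> (C, regraft C Y D) \<in> M)"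
    if C: "C \<in> class_clusters n ` BT {0..n}" and YD: "Y \<in> C" "D \<in> C" "\<not> D \<subseteq> Y" for C Y D
  proof -
    obtain A where A: "A \<in> BT {0..n}" "C = class_clusters n A" using C by blast
    obtain B where B: "B \<in> BT {0..n}" "class_clusters n B = regraft (class_clusters n A) Y D" "B = A \<or> (A, B) \<in> move_rel \<kappa> {0..n}"
      using regraft_move[OF A(1), of Y D \<kappa>] YD A(2) by blast
    have "class_clusters n B \<in> class_clusters n ` BT {0..n}" using B(1) by (rule imageI)
    moreover have "class_clusters n B = class_clusters n A \<or> (class_clusters n A, class_clusters n B) \<in> M" using B(3) unfolding M_def by blast
    ultimately show ?thesis using B(2) A(2) by simp
  qed
  have AB: "class_clusters n B \<in> class_clusters n ` BT {0..n}" "class_clusters n A \<in> class_clusters n ` BT {0..n}" using A B by auto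
  have fin\<K>: "finite \<K>" unfolding \<K>_def using finK by simp
  have dj\<K>: "disjoint \<K>" unfolding disjoint_def
  proof (intro ballI impI)
    fix p q assume h: "p \<in> \<K>" "q \<in> \<K>" "p \<noteq> q"
    have sing: "p \<in> K \<or> (\<exists>x. p = {x} \<and> x \<notin> \<Union>K)" if "p \<in> \<K>" for p using that unfolding \<K>_def by auto
    consider "p \<in> K" "q \<in> K" | x where "q = {x}" "x \<notin> \<Union>K" "p \<in> K" | x where "p = {x}" "x \<notin> \<Union>K" "q \<in> K"
      | x z where "p = {x}" "q = {z}" using sing[OF h(1)] sing[OF h(2)] by metis
    then show "p \<inter> q = {}"
    proof cases
      case 1
      then show ?thesis using djK h(3) unfolding disjoint_def by metis
    next
      case 2 then show ?thesis by auto
    next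
      case 3 then show ?thesis by auto
    next
      case 4 then show ?thesis using h(3) by auto
    qed
  qed
  have sz\<K>: "p \<noteq> {} \<and> card p \<le> 2" if "p \<in> \<K>" for p
  proof (cases "p \<in> K")
    case True
    then show ?thesis using card2[OF True] by auto
  next
    case False
    then show ?thesis using that unfolding \<K>_def by auto
  qed
  have un\<K>: "{} \<inter> \<Union>\<K> = {}" "{} \<union> \<Union>\<K> = {1..n}" unfolding \<K>_def using K(2) by auto
  have an\<K>: "anchored {} \<K> (class_clusters n A)" "anchored {} \<K> (class_clusters n B)" using cmp cm by auto
  have tr: "traces {} (class_clusters n A) = traces {} (class_clusters n B)" unfolding traces_def by auto
  have ex: "\<exists>k\<le>card \<K>. (class_clusters n A, class_clusters n B) \<in> M ^^ k"
    by (rule regraft_chain[OF H mv AB fin\<K> dj\<K> sz\<K> un\<K> an\<K> tr])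
  obtain k where k: "k \<le> card \<K>" "(class_clusters n A, class_clusters n B) \<in> M ^^ k" using ex by blast
  have "(A, B) \<in> move_rel \<kappa> {0..n} ^^ k" using k(2) B
  proof (induction k arbitrary: B)
    case 0
    then show ?case using A class_clusters_inj unfolding inj_on_def by auto
  next
    case (Suc k)
    then obtain c where c: "(class_clusters n A, c) \<in> M ^^ k" "(c, class_clusters n B) \<in> M" by auto
    then obtain C B' where CB: "c = class_clusters n C" "class_clusters n B = class_clusters n B'" "(C, B') \<in> move_rel \<kappa> {0..n}" unfolding M_def by auto
    then have CB': "C \<in> BT {0..n}" "B' \<in> BT {0..n}" unfolding move_rel_def by auto
    then have "B' = B" using CB(2) Suc.prems(2) class_clusters_inj unfolding inj_on_def by auto
    then show ?case using Suc.IH[of C] c(1) CB CB' by auto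
  qed
  then show ?thesis using k(1) c\<K> le_trans by blast
qed

lemma move_dist_le:
  assumes "A \<in> BT {0..n}" "B \<in> BT {0..n}" "pairing K" "\<Union>K \<subseteq> {1..n}"
    "compatible (class_clusters n A) K" "compatible (class_clusters n B) K"
  shows "move_dist \<kappa> {0..n} A B \<le> n - card K"
proof -
  obtain k where k: "k \<le> n - card K" "(A, B) \<in> move_rel \<kappa> {0..n} ^^ k" using move_chain[OF assms] by blast
  have "move_dist \<kappa> {0..n} A B \<le> k" unfolding move_dist_def using k(2) by (intro Least_le)
  then show ?thesis using k(1) by simp
qed

lemma empty_pairing: "pairing {}" "compatible C {}"
  unfolding pairing_def compatible_def disjoint_def by auto

lemma common_pairing:
  assumes "A \<in> BT {0..n}" "B \<in> BT {0..n}" "move_dist \<kappa> {0..n} A B + 4 * m + 1 \<le> n"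
  shows "\<exists>P. pairing P \<and> \<Union>P \<subseteq> {1..n} \<and> card P = m \<and> compatible (class_clusters n A) P \<and> compatible (class_clusters n B) P"
proof -
  obtain k where k: "(A, B) \<in> move_rel \<kappa> {0..n} ^^ k"
    using move_chain[OF assms(1,2) empty_pairing(1) _ empty_pairing(2) empty_pairing(2)] by auto
  then have "(A, B) \<in> move_rel \<kappa> {0..n} ^^ move_dist \<kappa> {0..n} A B" unfolding move_dist_def by (rule LeastI)
  then have "agree {1..n} (move_dist \<kappa> {0..n} A B) (class_clusters n A) (class_clusters n B)" using agree_moves[OF assms(1)] by blast
  then show ?thesis by (rule agree_common_pairing[rotated]) (use assms(3) in simp_all)
qed

lemma relabel_exists:
  assumes A: "A \<in> BT {0..n}" and \<sigma>: "\<sigma> permutes {1..n}"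
  shows "\<exists>B\<in>BT {0..n}. class_clusters n B = (`) \<sigma> ` class_clusters n A"
proof -
  obtain T where T: "T \<in> A" using BT_cl(2)[OF A] by blast
  obtain G l where TG: "T = (G, l)" by (cases T)
  have b: "binary_ltree {0..n} (G, l)" and cA: "clusters {0..n} (G, l) = class_clusters n A" using BT_member[OF A T] TG by auto
  let ?X = "{0..n}"
  let ?\<tau> = "inv \<sigma>"
  have \<tau>: "?\<tau> permutes {1..n}" by (rule permutes_inv[OF \<sigma>])
  then have \<tau>X: "?\<tau> permutes ?X" by (rule permutes_subset) auto
  have \<tau>0: "?\<tau> 0 = 0" using \<tau> by (simp add: permutes_def)
  have "bij_betw (l \<circ> ?\<tau>) ?X {v \<in> verts G. deg G v = 1}"
    by (rule bij_betw_trans[OF permutes_imp_bij[OF \<tau>X]]) (use b in \<open>simp add: binary_ltree_def\<close>)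
  then have b': "binary_ltree ?X (G, l \<circ> ?\<tau>)" using b unfolding binary_ltree_def by simp
  have "{x \<in> ?X. \<not> joined (delete_edge e G) (l 0) (l (?\<tau> x))} = \<sigma> ` {x \<in> ?X. \<not> joined (delete_edge e G) (l 0) (l x)}" for e
  proof
    show "{x \<in> ?X. \<not> joined (delete_edge e G) (l 0) (l (?\<tau> x))} \<subseteq> \<sigma> ` {x \<in> ?X. \<not> joined (delete_edge e G) (l 0) (l x)}"
    proof
      fix x assume "x \<in> {x \<in> ?X. \<not> joined (delete_edge e G) (l 0) (l (?\<tau> x))}"
      then have "?\<tau> x \<in> {x \<in> ?X. \<not> joined (delete_edge e G) (l 0) (l x)}" using permutes_in_image[OF \<tau>X, of x] by simp
      moreover have "x = \<sigma> (?\<tau> x)" using permutes_inverses(1)[OF \<sigma>] by simp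
      ultimately show "x \<in> \<sigma> ` {x \<in> ?X. \<not> joined (delete_edge e G) (l 0) (l x)}" by (rule image_eqI[rotated])
    qed
    show "\<sigma> ` {x \<in> ?X. \<not> joined (delete_edge e G) (l 0) (l x)} \<subseteq> {x \<in> ?X. \<not> joined (delete_edge e G) (l 0) (l (?\<tau> x))}"
    proof (rule image_subsetI)
      fix x assume x: "x \<in> {x \<in> ?X. \<not> joined (delete_edge e G) (l 0) (l x)}"
      have \<sigma>X: "\<sigma> permutes ?X" using \<sigma> by (rule permutes_subset) auto
      then have "\<sigma> x \<in> ?X" using x permutes_in_image[OF \<sigma>X, of x] by simp
      then show "\<sigma> x \<in> {x \<in> ?X. \<not> joined (delete_edge e G) (l 0) (l (?\<tau> x))}" using x permutes_inverses(2)[OF \<sigma>, of x] by simp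
    qed
  qed
  then have "clusters ?X (G, l \<circ> ?\<tau>) = (`) \<sigma> ` clusters ?X (G, l)" unfolding clusters_def using \<tau>0 by (simp add: image_image)
  then show ?thesis using BT_of_tree[OF b'] cA by metis
qed

definition relabel :: "nat \<Rightarrow> (nat \<Rightarrow> nat) \<Rightarrow> ltree set \<Rightarrow> ltree set" where
  "relabel n \<sigma> A = (SOME B. B \<in> BT {0..n} \<and> class_clusters n B = (`) \<sigma> ` class_clusters n A)"

lemma relabel:
  assumes "A \<in> BT {0..n}" "\<sigma> permutes {1..n}"
  shows "relabel n \<sigma> A \<in> BT {0..n}" "class_clusters n (relabel n \<sigma> A) = (`) \<sigma> ` class_clusters n A"
proof -
  have "\<exists>B. B \<in> BT {0..n} \<and> class_clusters n B = (`) \<sigma> ` class_clusters n A" using relabel_exists[OF assms] by blast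
  from someI_ex[OF this] show "relabel n \<sigma> A \<in> BT {0..n}" "class_clusters n (relabel n \<sigma> A) = (`) \<sigma> ` class_clusters n A"
    unfolding relabel_def by auto
qed

lemma relabel_bij: assumes \<sigma>: "\<sigma> permutes {1..n}" shows "bij_betw (relabel n \<sigma>) (BT {0..n}) (BT {0..n})"
proof -
  have "inj_on (relabel n \<sigma>) (BT {0..n})"
  proof (rule inj_onI)
    fix A B assume h: "A \<in> BT {0..n}" "B \<in> BT {0..n}" "relabel n \<sigma> A = relabel n \<sigma> B"
    then have eq: "(`) \<sigma> ` class_clusters n A = (`) \<sigma> ` class_clusters n B" using relabel(2)[OF _ \<sigma>] by metis
    have "inj ((`) \<sigma>)" using permutes_inj[OF \<sigma>] by (meson inj_image_eq_iff injI)
    then have "class_clusters n A = class_clusters n B" using iffD1[OF inj_image_eq_iff eq] by simp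
    then show "A = B" using class_clusters_inj h unfolding inj_on_def by blast
  qed
  moreover have "relabel n \<sigma> ` BT {0..n} \<subseteq> BT {0..n}" using relabel(1)[OF _ \<sigma>] by blast
  ultimately show ?thesis using endo_inj_surj[OF finite_BT] unfolding bij_betw_def by blast
qed

lemma sum_relabel:
  fixes F :: "ltree set \<Rightarrow> ltree set \<Rightarrow> real"
  shows "fact n * (\<Sum>A\<in>BT {0..n}. \<Sum>B\<in>BT {0..n}. F A B) =
    (\<Sum>A\<in>BT {0..n}. \<Sum>B\<in>BT {0..n}. \<Sum>\<sigma> | \<sigma> permutes {1..n}. F A (relabel n \<sigma> B))"
proof -
  let ?S = "{\<sigma>. \<sigma> permutes {1..n}}"
  have "(\<Sum>A\<in>BT {0..n}. \<Sum>B\<in>BT {0..n}. \<Sum>\<sigma>\<in>?S. F A (relabel n \<sigma> B)) =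
      (\<Sum>A\<in>BT {0..n}. \<Sum>\<sigma>\<in>?S. \<Sum>B\<in>BT {0..n}. F A (relabel n \<sigma> B))"
    by (intro sum.cong refl sum.swap)
  also have "\<dots> = (\<Sum>A\<in>BT {0..n}. \<Sum>\<sigma>\<in>?S. \<Sum>B\<in>BT {0..n}. F A B)"
    by (intro sum.cong refl sum.reindex_bij_betw relabel_bij) simp
  also have "\<dots> = (\<Sum>A\<in>BT {0..n}. fact n * (\<Sum>B\<in>BT {0..n}. F A B))"
  proof -
    have "card ?S = fact n" using card_permutations[of "{1..n}" n] by simp
    then show ?thesis by simp
  qed
  also have "\<dots> = fact n * (\<Sum>A\<in>BT {0..n}. \<Sum>B\<in>BT {0..n}. F A B)" by (simp add: sum_distrib_left)
  finally show ?thesis by simp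
qed

lemma splits_image:
  assumes "\<sigma> permutes L" shows "splits (\<sigma> ` c) k \<longleftrightarrow> splits c (inv \<sigma> ` k)"
proof -
  have i: "\<sigma> (inv \<sigma> x) = x" "inv \<sigma> (\<sigma> x) = x" for x using permutes_inverses[OF assms] by auto
  have m: "x \<in> \<sigma> ` c \<longleftrightarrow> inv \<sigma> x \<in> c" for x using i by (metis imageE imageI)
  have "\<sigma> ` c \<inter> k \<noteq> {} \<longleftrightarrow> (\<exists>x\<in>k. inv \<sigma> x \<in> c)" using m by blast
  also have "\<dots> \<longleftrightarrow> c \<inter> inv \<sigma> ` k \<noteq> {}" by blast
  finally have "\<sigma> ` c \<inter> k \<noteq> {} \<longleftrightarrow> c \<inter> inv \<sigma> ` k \<noteq> {}" .
  moreover have "k \<subseteq> \<sigma> ` c \<longleftrightarrow> inv \<sigma> ` k \<subseteq> c" unfolding subset_iff m by blast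
  ultimately show ?thesis unfolding splits_def by simp
qed

lemma compatible_image:
  assumes "\<sigma> permutes L" shows "compatible ((`) \<sigma> ` C) K \<longleftrightarrow> compatible C ((`) (inv \<sigma>) ` K)"
proof -
  have "inj (inv \<sigma>)" using permutes_inj[OF permutes_inv[OF assms]] .
  then have inj: "inv \<sigma> ` p = inv \<sigma> ` q \<longleftrightarrow> p = q" for p q by (rule inj_image_eq_iff)
  show ?thesis unfolding compatible_def by (simp add: splits_image[OF assms] inj)
qed

lemma pairing_image:
  assumes "\<sigma> permutes L" "pairing P" shows "pairing ((`) \<sigma> ` P)" "card ((`) \<sigma> ` P) = card P"
proof -
  have i: "inj \<sigma>" by (rule permutes_inj[OF assms(1)])
  have "card (\<sigma> ` p) = card p" for p using card_image[OF inj_on_subset[OF i subset_UNIV]] .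
  moreover have "\<sigma> ` p \<inter> \<sigma> ` q = \<sigma> ` (p \<inter> q)" for p q by (rule image_Int[OF i, symmetric])
  ultimately have "\<forall>a\<in>P. \<forall>b\<in>P. \<sigma> ` a \<noteq> \<sigma> ` b \<longrightarrow> \<sigma> ` a \<inter> \<sigma> ` b = {}" "\<forall>a\<in>P. card (\<sigma> ` a) = 2"
    using assms(2) unfolding pairing_def disjoint_def by (metis image_empty)+
  then show "pairing ((`) \<sigma> ` P)" unfolding pairing_def disjoint_def by simp
  have "inj ((`) \<sigma>)" using i by (meson inj_image_eq_iff injI)
  then show "card ((`) \<sigma> ` P) = card P" using card_image inj_on_subset subset_UNIV by metis
qed

section \<open>Expected distance\<close>

lemma sum_move_dist_relabel_le:
  assumes A: "A \<in> BT {0..n}" and B: "B \<in> BT {0..n}" and r: "4 \<le> r" "1024 * r ^ 3 \<le> n"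
  shows "(\<Sum>\<sigma> | \<sigma> permutes {1..n}. real (move_dist \<kappa> {0..n} A (relabel n \<sigma> B))) \<le> fact n * (real n - real r ^ 2 / 128)"
proof -
  let ?L = "{1..n}"
  let ?S = "{\<sigma>. \<sigma> permutes ?L}"
  have r2: "2 \<le> r" using r(1) by simp
  obtain \<P> where P: "disjoint \<P>" "\<Union>\<P> \<subseteq> ?L" "\<forall>p\<in>\<P>. card p = r" "compatible (class_clusters n A) \<P>" "card ?L \<le> 2 * r * card \<P> + r"
    using pieces_exist[OF hierarchy_cl[OF A] r2] by blast
  obtain \<Q> where Q: "disjoint \<Q>" "\<Union>\<Q> \<subseteq> ?L" "\<forall>p\<in>\<Q>. card p = r" "compatible (class_clusters n B) \<Q>" "card ?L \<le> 2 * r * card \<Q> + r"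
    using pieces_exist[OF hierarchy_cl[OF B] r2] by blast
  have "r * 1 \<le> r * r ^ 2" using r(1) by (intro mult_le_mono2) simp
  then have "r \<le> r ^ 3" by (simp add: power3_eq_cube power2_eq_square)
  then have rn: "2 * r \<le> n" using r(2) by linarith
  have e: "2 * r * card \<P> = 2 * (card \<P> * r)" "2 * r * card \<Q> = 2 * (card \<Q> * r)" "card ?L = n" by simp_all
  have q: "card ?L \<le> 4 * (card \<P> * r)" "card ?L \<le> 4 * (card \<Q> * r)" using P(5) Q(5) rn unfolding e by linarith+
  have rL: "1024 * r ^ 3 \<le> card ?L" using r(2) by simp
  have G: "fact n * (real r ^ 2 / 128) \<le> real (\<Sum>\<sigma>\<in>?S. card (isolated \<P> \<Q> \<sigma>))"
    using sum_card_isolated_ge[OF _ P(1) _ P(2) Q(1) _ Q(2) r(1) rL q] P(3) Q(3) by simp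
  have le: "real (move_dist \<kappa> {0..n} A (relabel n (inv \<tau>) B)) \<le> real n - real (card (isolated \<P> \<Q> \<tau>))" if \<tau>: "\<tau> \<in> ?S" for \<tau>
  proof -
    have \<tau>': "\<tau> permutes ?L" and i: "inv \<tau> permutes ?L" using \<tau> permutes_inv by auto
    let ?K = "upair ` isolated \<P> \<Q> \<tau>"
    note gp = isolated_pairs[OF P(1,2,4) Q(1,4), of \<tau>]
    have ii: "inv (inv \<tau>) = \<tau>" by (rule permutes_inv_inv[OF \<tau>'])
    have cmp: "compatible (class_clusters n (relabel n (inv \<tau>) B)) ?K"
      unfolding relabel(2)[OF B i] compatible_image[OF i] ii using gp(4) by simp
    have "move_dist \<kappa> {0..n} A (relabel n (inv \<tau>) B) \<le> n - card ?K"
      using gp by (intro move_dist_le[OF A relabel(1)[OF B i]] cmp) simp_all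
    moreover have "card ?K \<le> n"
    proof -
      have "card ?K \<le> card (\<Union>?K)"
      proof -
        have c2: "\<And>p. p \<in> ?K \<Longrightarrow> card p = 2" and dj: "disjoint ?K" using gp(1) unfolding pairing_def by auto
        have "card (\<Union>?K) = (\<Sum>p\<in>?K. card p)"
          using c2 dj by (intro card_Union_disjoint) (auto simp: disjoint_def pairwise_def disjnt_def intro: card_ge_0_finite)
        then show ?thesis using c2 by simp
      qed
      also have "\<dots> \<le> card ?L" using gp(2) by (intro card_mono) simp_all
      finally show ?thesis by simp
    qed
    ultimately show ?thesis using gp(5) by simp
  qed
  have "(\<Sum>\<sigma>\<in>?S. real (move_dist \<kappa> {0..n} A (relabel n \<sigma> B))) = (\<Sum>\<tau>\<in>?S. real (move_dist \<kappa> {0..n} A (relabel n (inv \<tau>) B)))"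
    by (rule sum_permutations_inverse)
  also have "\<dots> \<le> (\<Sum>\<tau>\<in>?S. real n - real (card (isolated \<P> \<Q> \<tau>)))" by (rule sum_mono[OF le])
  also have "\<dots> = real (card ?S) * real n - real (\<Sum>\<tau>\<in>?S. card (isolated \<P> \<Q> \<tau>))" by (simp add: sum_subtractf)
  also have "\<dots> \<le> fact n * real n - fact n * (real r ^ 2 / 128)"
    using G card_permutations[of ?L n] by simp
  finally show ?thesis by (simp add: right_diff_distrib)
qed

lemma sum_move_dist_le:
  assumes "4 \<le> r" "1024 * r ^ 3 \<le> n"
  shows "(\<Sum>A\<in>BT {0..n}. \<Sum>B\<in>BT {0..n}. real (move_dist \<kappa> {0..n} A B)) \<le>
    real (card (BT {0..n})) ^ 2 * (real n - real r ^ 2 / 128)"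
proof -
  let ?T = "BT {0..n}"
  have "fact n * (\<Sum>A\<in>?T. \<Sum>B\<in>?T. real (move_dist \<kappa> {0..n} A B)) =
     (\<Sum>A\<in>?T. \<Sum>B\<in>?T. \<Sum>\<sigma> | \<sigma> permutes {1..n}. real (move_dist \<kappa> {0..n} A (relabel n \<sigma> B)))" by (rule sum_relabel)
  also have "\<dots> \<le> (\<Sum>A\<in>?T. \<Sum>B\<in>?T. fact n * (real n - real r ^ 2 / 128))"
    by (intro sum_mono sum_move_dist_relabel_le assms)
  also have "\<dots> = fact n * (real (card ?T) ^ 2 * (real n - real r ^ 2 / 128))"
    by (simp add: power2_eq_square)
  finally show ?thesis by (rule mult_left_le_imp_le) simp
qed

definition pairings :: "nat \<Rightarrow> nat \<Rightarrow> ltree set \<Rightarrow> nat set set set" where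
  "pairings n m A = {P. pairing P \<and> \<Union>P \<subseteq> {1..n} \<and> card P = m \<and> compatible (class_clusters n A) P}"

lemma card_pairings_le:
  assumes A: "A \<in> BT {0..n}" and m: "0 < m"
  shows "finite (pairings n m A)" "card (pairings n m A) \<le> n choose (2 * m)"
proof -
  let ?S = "{S. S \<subseteq> {1..n} \<and> card S = 2 * m}"
  have fS: "finite ?S" by (rule finite_subset[of _ "Pow {1..n}"]) auto
  have inj: "inj_on Union (pairings n m A)"
  proof (rule inj_onI)
    fix P Q assume "P \<in> pairings n m A" "Q \<in> pairings n m A" "\<Union>P = \<Union>Q"
    then show "P = Q" using pairing_unique[OF hierarchy_cl[OF A], of P Q] unfolding pairings_def by simp
  qed
  have sub: "Union ` pairings n m A \<subseteq> ?S"
  proof (rule image_subsetI)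
    fix P assume "P \<in> pairings n m A"
    then have P: "pairing P" "\<Union>P \<subseteq> {1..n}" "card P = m" unfolding pairings_def by auto
    have c2: "\<And>p. p \<in> P \<Longrightarrow> card p = 2" and dj: "disjoint P" using P(1) unfolding pairing_def by auto
    have "card (\<Union>P) = (\<Sum>p\<in>P. card p)"
      using c2 dj by (intro card_Union_disjoint) (auto simp: disjoint_def pairwise_def disjnt_def intro: card_ge_0_finite)
    then show "\<Union>P \<in> ?S" using c2 P by simp
  qed
  show "finite (pairings n m A)" using inj sub fS by (meson finite_imageD finite_subset)
  have "card (pairings n m A) \<le> card ?S" by (rule card_inj_on_le[OF inj sub fS])
  also have "\<dots> = n choose (2 * m)" using n_subsets[of "{1..n}" "2 * m"] by simp
  finally show "card (pairings n m A) \<le> n choose (2 * m)" .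
qed

lemma card_close_relabel_le:
  assumes A: "A \<in> BT {0..n}" and B: "B \<in> BT {0..n}" and m: "0 < m"
  shows "card {\<sigma>. \<sigma> permutes {1..n} \<and> move_dist \<kappa> {0..n} A (relabel n \<sigma> B) + 4 * m + 1 \<le> n}
    \<le> (n choose (2 * m)) ^ 2 * (2 ^ m * fact m * fact (n - 2 * m))"
proof -
  let ?L = "{1..n}"
  let ?I = "pairings n m A \<times> pairings n m B"
  let ?F = "\<lambda>(P, Q). {\<sigma>. \<sigma> permutes ?L \<and> (`) \<sigma> ` Q = P}"
  have fI: "finite ?I" using card_pairings_le(1)[OF A m] card_pairings_le(1)[OF B m] by simp
  have fS: "finite {\<sigma>. \<sigma> permutes ?L}" by (rule finite_permutations) simp
  have "{\<sigma>. \<sigma> permutes ?L \<and> move_dist \<kappa> {0..n} A (relabel n \<sigma> B) + 4 * m + 1 \<le> n} \<subseteq> (\<Union>i\<in>?I. ?F i)"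
  proof
    fix \<sigma> assume "\<sigma> \<in> {\<sigma>. \<sigma> permutes ?L \<and> move_dist \<kappa> {0..n} A (relabel n \<sigma> B) + 4 * m + 1 \<le> n}"
    then have \<sigma>: "\<sigma> permutes ?L" "move_dist \<kappa> {0..n} A (relabel n \<sigma> B) + 4 * m + 1 \<le> n" by auto
    have i: "inv \<sigma> permutes ?L" by (rule permutes_inv[OF \<sigma>(1)])
    obtain P where P: "pairing P" "\<Union>P \<subseteq> ?L" "card P = m" "compatible (class_clusters n A) P" "compatible (class_clusters n (relabel n \<sigma> B)) P"
      using common_pairing[OF A relabel(1)[OF B \<sigma>(1)] \<sigma>(2)] by blast
    let ?Q = "(`) (inv \<sigma>) ` P"
    have c: "compatible (class_clusters n B) ?Q" using P(5) unfolding relabel(2)[OF B \<sigma>(1)] compatible_image[OF \<sigma>(1)] .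
    have "\<Union>?Q \<subseteq> ?L" using P(2) permutes_in_image[OF i] by blast
    then have "?Q \<in> pairings n m B" using pairing_image[OF i P(1)] P(3) c unfolding pairings_def by simp
    moreover have "P \<in> pairings n m A" using P unfolding pairings_def by simp
    moreover have "(`) \<sigma> ` ?Q = P"
    proof -
      have "\<sigma> ` inv \<sigma> ` p = p" for p using permutes_inverses(1)[OF \<sigma>(1)] by (simp add: image_image)
      then show ?thesis by (simp add: image_image)
    qed
    ultimately have "(P, ?Q) \<in> ?I" "\<sigma> \<in> ?F (P, ?Q)" using \<sigma>(1) by auto
    then show "\<sigma> \<in> (\<Union>i\<in>?I. ?F i)" by (rule UN_I)
  qed
  moreover have fU: "finite (\<Union>i\<in>?I. ?F i)" by (rule finite_subset[OF _ fS]) auto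
  ultimately have "card {\<sigma>. \<sigma> permutes ?L \<and> move_dist \<kappa> {0..n} A (relabel n \<sigma> B) + 4 * m + 1 \<le> n} \<le> card (\<Union>i\<in>?I. ?F i)"
    by (intro card_mono)
  also have "\<dots> \<le> (\<Sum>i\<in>?I. card (?F i))" by (rule card_UN_le[OF fI])
  also have "\<dots> \<le> (\<Sum>i\<in>?I. 2 ^ m * fact m * fact (n - 2 * m))"
  proof (rule sum_mono)
    fix i assume i: "i \<in> ?I"
    obtain P Q where PQ: "i = (P, Q)" by (cases i)
    have 1: "pairing P" "card P = m" "pairing Q" "\<Union>Q \<subseteq> ?L" "card Q = m" using i PQ unfolding pairings_def by auto
    have "finite P" "finite Q" using 1(2,5) m card_ge_0_finite by metis+
    then show "card (?F i) \<le> 2 ^ m * fact m * fact (n - 2 * m)"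
      using card_permutes_pairing_le[of ?L P Q] 1 PQ by simp
  qed
  also have "\<dots> = card ?I * (2 ^ m * fact m * fact (n - 2 * m))" by simp
  also have "card ?I \<le> (n choose (2 * m)) ^ 2"
    unfolding card_cartesian_product power2_eq_square
    by (intro mult_le_mono card_pairings_le(2)[OF A m] card_pairings_le(2)[OF B m])
  finally show ?thesis by simp
qed

lemma power_self_le_fact: "real m ^ m \<le> 3 ^ m * fact m"
proof (induction m)
  case (Suc m)
  show ?case
  proof (cases "m = 0")
    case False
    then have m0: "0 < real m" by simp
    have "1 + 1 / real m \<le> exp (1 / real m)" by (rule exp_ge_add_one_self)
    then have "(1 + 1 / real m) ^ m \<le> exp (1 / real m) ^ m" using m0 by (intro power_mono) auto
    also have "\<dots> = exp 1" using m0 by (simp flip: exp_of_nat_mult)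
    also have "\<dots> \<le> 3" by (rule exp_le)
    finally have a: "(1 + 1 / real m) ^ m \<le> 3" .
    have "real (Suc m) = real m * (1 + 1 / real m)" using m0 by (simp add: field_simps)
    then have "real (Suc m) ^ m = real m ^ m * (1 + 1 / real m) ^ m" by (metis power_mult_distrib)
    also have "\<dots> \<le> (3 ^ m * fact m) * 3" using a Suc.IH m0 by (intro mult_mono) auto
    finally have "real (Suc m) ^ m * real (Suc m) \<le> (3 ^ m * fact m) * 3 * real (Suc m)" by (intro mult_right_mono) auto
    then show ?thesis by (simp add: mult.commute mult.left_commute)
  qed simp
qed simp

lemma fact_double_ge: "fact m * real m ^ m \<le> fact (2 * m)"
proof -
  have "fact m * real m ^ k \<le> fact (m + k)" for k
  proof (induction k)
    case (Suc k)
    have "fact m * real m ^ Suc k = (fact m * real m ^ k) * real m" by simp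
    also have "\<dots> \<le> fact (m + k) * real (Suc (m + k))" using Suc.IH by (intro mult_mono) auto
    finally show ?case by (simp add: mult.commute)
  qed simp
  from this[of m] show ?thesis by (simp add: mult_2)
qed

lemma binomial_bound:
  assumes m: "0 < m" "2 * m \<le> n" and big: "12 * n ^ 2 \<le> m ^ 3"
  shows "real ((n choose (2 * m)) ^ 2 * (2 ^ m * fact m * fact (n - 2 * m))) \<le> fact n / 2 ^ m"
proof -
  have c: "real (n choose (2 * m)) * (fact (2 * m) * fact (n - 2 * m)) = fact n"
    using arg_cong[OF binomial_fact_lemma[OF m(2)], of real] by (simp add: mult.commute mult.left_commute)
  have m0: "0 < real m" using m(1) by simp
  define f where "f = (fact m :: real)"
  have f0: "0 < f" unfolding f_def by simp
  have "real ((n choose (2 * m)) * fact (2 * m)) \<le> real (n ^ (2 * m))" by (intro of_nat_mono binomial_fact_pow)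
  then have ch: "real (n choose (2 * m)) * fact (2 * m) \<le> real n ^ (2 * m)" by simp
  have d: "f * real m ^ m \<le> fact (2 * m)" unfolding f_def by (rule fact_double_ge)
  have "real m ^ m * real m ^ m * real m ^ m \<le> (real m ^ m) ^ 2 * (3 ^ m * f)"
    unfolding power2_eq_square f_def using power_self_le_fact[of m] by (intro mult_left_mono) auto
  then have e1: "real (m ^ 3) ^ m \<le> (real m ^ m) ^ 2 * (3 ^ m * f)"
    by (simp add: power3_eq_cube power_mult_distrib)
  have "real (12 * n ^ 2) ^ m \<le> real (m ^ 3) ^ m" using big by (intro power_mono of_nat_mono) auto
  then have e2: "12 ^ m * real n ^ (2 * m) \<le> (real m ^ m) ^ 2 * (3 ^ m * f)"
    using e1 by (simp add: power_mult_distrib power_mult)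
  have "real n ^ (2 * m) * (2 ^ m * f) * 2 ^ m * 3 ^ m = (12 ^ m * real n ^ (2 * m)) * f"
    by (simp add: power_mult_distrib[symmetric])
  also have "\<dots> \<le> ((real m ^ m) ^ 2 * (3 ^ m * f)) * f" using e2 f0 by (intro mult_right_mono) auto
  also have "\<dots> = (f * real m ^ m) ^ 2 * 3 ^ m" by (simp add: power2_eq_square)
  also have "\<dots> \<le> fact (2 * m) ^ 2 * 3 ^ m" using d f0 by (intro mult_right_mono power_mono) auto
  finally have e3: "real n ^ (2 * m) * (2 ^ m * f) * 2 ^ m \<le> fact (2 * m) ^ 2" by simp
  have "real (n choose (2 * m)) * fact (2 * m) * ((2 ^ m * f) * 2 ^ m) \<le> real n ^ (2 * m) * ((2 ^ m * f) * 2 ^ m)"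
    using ch f0 by (intro mult_right_mono) auto
  also have "\<dots> \<le> fact (2 * m) * fact (2 * m)" using e3 by (simp add: power2_eq_square mult.assoc)
  finally have "(real (n choose (2 * m)) * ((2 ^ m * f) * 2 ^ m)) * fact (2 * m) \<le> fact (2 * m) * fact (2 * m)"
    by (simp add: mult.assoc mult.left_commute mult.commute)
  then have e4: "real (n choose (2 * m)) * ((2 ^ m * f) * 2 ^ m) \<le> fact (2 * m)"
    by (rule mult_right_le_imp_le) simp
  have "real ((n choose (2 * m)) ^ 2 * (2 ^ m * fact m * fact (n - 2 * m))) * 2 ^ m
      = (real (n choose (2 * m)) * ((2 ^ m * f) * 2 ^ m)) * (real (n choose (2 * m)) * fact (n - 2 * m))"
    unfolding f_def by (simp add: power2_eq_square)
  also have "\<dots> \<le> fact (2 * m) * (real (n choose (2 * m)) * fact (n - 2 * m))"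
    using e4 by (intro mult_right_mono) auto
  also have "\<dots> = fact n" using c by (simp add: mult.left_commute)
  finally show ?thesis by (simp add: pos_le_divide_eq)
qed

lemma sum_move_dist_ge:
  assumes m: "0 < m" and big: "12 * n ^ 2 \<le> m ^ 3"
  shows "real (card (BT {0..n})) ^ 2 * (real n - 4 * real m - real n / 2 ^ m) \<le>
    (\<Sum>A\<in>BT {0..n}. \<Sum>B\<in>BT {0..n}. real (move_dist \<kappa> {0..n} A B))"
proof -
  let ?T = "BT {0..n}"
  let ?S = "{\<sigma>. \<sigma> permutes {1..n}}"
  have fS: "finite ?S" by (rule finite_permutations) simp
  have cS: "card ?S = fact n" using card_permutations[of "{1..n}" n] by simp
  have one: "fact n * (real n - 4 * real m - real n / 2 ^ m) \<le> (\<Sum>\<sigma>\<in>?S. real (move_dist \<kappa> {0..n} A (relabel n \<sigma> B)))"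
    if A: "A \<in> ?T" and B: "B \<in> ?T" for A B
  proof -
    let ?bad = "{\<sigma>. \<sigma> permutes {1..n} \<and> move_dist \<kappa> {0..n} A (relabel n \<sigma> B) + 4 * m + 1 \<le> n}"
    have fbad: "finite ?bad" by (rule finite_subset[OF _ fS]) auto
    have bad: "real (card ?bad) \<le> fact n / 2 ^ m"
    proof (cases "2 * m \<le> n")
      case True
      have "real (card ?bad) \<le> real ((n choose (2 * m)) ^ 2 * (2 ^ m * fact m * fact (n - 2 * m)))"
        by (intro of_nat_mono card_close_relabel_le A B m)
      also have "\<dots> \<le> fact n / 2 ^ m" by (rule binomial_bound[OF m True big])
      finally show ?thesis .
    next
      case False
      then have "?bad = {}" by auto
      then show ?thesis by (simp only: card.empty) simp
    qed
    have pt: "real n - 4 * real m - real n * (if \<sigma> \<in> ?bad then 1 else 0) \<le> real (move_dist \<kappa> {0..n} A (relabel n \<sigma> B))"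
      if "\<sigma> \<in> ?S" for \<sigma> using that by (cases "\<sigma> \<in> ?bad") auto
    have "fact n * (real n - 4 * real m - real n / 2 ^ m) = fact n * (real n - 4 * real m) - real n * (fact n / 2 ^ m)"
      by (simp add: algebra_simps)
    also have "\<dots> \<le> fact n * (real n - 4 * real m) - real n * real (card ?bad)"
      using bad by (intro diff_left_mono mult_left_mono) auto
    also have "\<dots> = (\<Sum>\<sigma>\<in>?S. real n - 4 * real m - real n * (if \<sigma> \<in> ?bad then 1 else 0))"
    proof -
      have gen: "(\<Sum>\<sigma>\<in>S. real n - 4 * real m - real n * (if \<sigma> \<in> U then 1 else 0)) = real (card S) * (real n - 4 * real m) - real n * real (card U)"
        if "finite S" "U \<subseteq> S" for S U :: "(nat \<Rightarrow> nat) set"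
      proof -
        have "(\<Sum>\<sigma>\<in>S. (if \<sigma> \<in> U then 1 else 0)) = real (card U)" using that by (simp add: sum.If_cases Int_absorb1)
        then show ?thesis by (simp only: sum_subtractf sum_distrib_left[symmetric] sum_constant of_nat_mult) (simp add: algebra_simps)
      qed
      have "?bad \<subseteq> ?S" by blast
      from gen[OF fS this] show ?thesis unfolding cS by simp
    qed
    also have "\<dots> \<le> (\<Sum>\<sigma>\<in>?S. real (move_dist \<kappa> {0..n} A (relabel n \<sigma> B)))" by (rule sum_mono[OF pt])
    finally show ?thesis .
  qed
  have "fact n * (real (card ?T) ^ 2 * (real n - 4 * real m - real n / 2 ^ m)) =
      (\<Sum>A\<in>?T. \<Sum>B\<in>?T. fact n * (real n - 4 * real m - real n / 2 ^ m))" by (simp add: power2_eq_square)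
  also have "\<dots> \<le> (\<Sum>A\<in>?T. \<Sum>B\<in>?T. \<Sum>\<sigma>\<in>?S. real (move_dist \<kappa> {0..n} A (relabel n \<sigma> B)))"
    by (intro sum_mono one)
  also have "\<dots> = fact n * (\<Sum>A\<in>?T. \<Sum>B\<in>?T. real (move_dist \<kappa> {0..n} A B))" by (rule sum_relabel[symmetric])
  finally show ?thesis by (rule mult_left_le_imp_le) simp
qed

lemma expectation_pair_of_set:
  fixes g :: "'a \<Rightarrow> 'a \<Rightarrow> real"
  assumes "finite S" "S \<noteq> {}"
  shows "measure_pmf.expectation (pair_pmf (pmf_of_set S) (pmf_of_set S)) (\<lambda>(A, B). g A B) =
    (\<Sum>A\<in>S. \<Sum>B\<in>S. g A B) / real (card S) ^ 2"
proof -
  have "pair_pmf (pmf_of_set S) (pmf_of_set S) = pmf_of_set (S \<times> S)"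
  proof (rule pmf_eqI)
    fix p
    show "pmf (pair_pmf (pmf_of_set S) (pmf_of_set S)) p = pmf (pmf_of_set (S \<times> S)) p"
      using assms by (cases p) (auto simp: pmf_pair card_cartesian_product indicator_def)
  qed
  then show ?thesis using assms
    by (simp add: integral_pmf_of_set sum.cartesian_product card_cartesian_product power2_eq_square)
qed

theorem theorem1p11:
  fixes \<kappa> :: move_kind
  shows "\<exists>f :: nat \<Rightarrow> real. f \<in> \<Theta>[at_top](\<lambda>n. real n powr (2 / 3)) \<and> (\<forall>n. 0 \<le> f n) \<and>
    (\<forall>\<^sub>F n in at_top.
       measure_pmf.expectation (pair_pmf (pmf_of_set (BT {0..n})) (pmf_of_set (BT {0..n})))
         (\<lambda>(A, B). real (move_dist \<kappa> {0..n} A B)) = real n - f n)"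
proof -
  define E where "E n = measure_pmf.expectation (pair_pmf (pmf_of_set (BT {0..n})) (pmf_of_set (BT {0..n})))
         (\<lambda>(A, B). real (move_dist \<kappa> {0..n} A B))" for n
  define f where "f n = max 0 (real n - E n)" for n
  have Eq: "E n = (\<Sum>A\<in>BT {0..n}. \<Sum>B\<in>BT {0..n}. real (move_dist \<kappa> {0..n} A B)) / real (card (BT {0..n})) ^ 2"
    and pos: "0 < real (card (BT {0..n})) ^ 2" if "2 \<le> n" for n
    using expectation_pair_of_set[OF finite_BT BT_nonempty[OF that], of "\<lambda>A B. real (move_dist \<kappa> {0..n} A B)"]
      BT_nonempty[OF that] finite_BT unfolding E_def by (auto simp: card_gt_0_iff)
  have upper: "E n \<le> real n - real r ^ 2 / 128" if "2 \<le> n" "4 \<le> r" "1024 * r ^ 3 \<le> n" for n r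
    using sum_move_dist_le[OF that(2,3), of \<kappa>] pos[OF that(1)] unfolding Eq[OF that(1)]
    by (simp add: pos_divide_le_eq mult.commute)
  have lower: "real n - 4 * real m - real n / 2 ^ m \<le> E n" if "2 \<le> n" "0 < m" "12 * n ^ 2 \<le> m ^ 3" for n m
    using sum_move_dist_ge[OF that(2,3), of \<kappa>] pos[OF that(1)] unfolding Eq[OF that(1)]
    by (simp add: pos_le_divide_eq mult.commute)
  have big: "\<forall>\<^sub>F n in at_top. (8192 :: nat) ^ 3 \<le> n" by (rule eventually_ge_at_top)
  have main: "real n powr (2 / 3) / (128 * 1024) \<le> real n - E n \<and> real n - E n \<le> 21 * real n powr (2 / 3)"
    if n: "8192 ^ 3 \<le> n" for n
  proof -
    define t where "t = real n powr (1 / 3)"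
    have n0: "0 < real n" using n by (cases n) auto
    have t3: "t ^ 3 = real n" unfolding t_def using n0 by (simp add: powr_powr flip: powr_realpow)
    have t2: "t ^ 2 = real n powr (2 / 3)" unfolding t_def using n0 by (simp add: powr_powr flip: powr_realpow)
    have t0: "0 < t" unfolding t_def using n0 by simp
    have "real (8192 ^ 3) \<le> real n" using n by (simp only: of_nat_le_iff)
    then have "8192 ^ 3 \<le> t ^ 3" using t3 by simp
    then have t4: "8192 \<le> t" using t0 power_mono_iff[of 8192 t 3] by simp
    have n2: "2 \<le> n" using n by simp
    define r where "r = nat \<lfloor>t / 16\<rfloor>"
    have fl: "real r = of_int \<lfloor>t / 16\<rfloor>" unfolding r_def using t0 by simp
    have r1: "real r \<le> t / 16" "t / 16 - 1 \<le> real r" unfolding fl by linarith+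
    have r4: "4 \<le> r"
    proof -
      have "4 \<le> real r" using r1(2) t4 by linarith
      then show ?thesis by simp
    qed
    have "real r ^ 3 \<le> (t / 16) ^ 3" using r1(1) by (intro power_mono) auto
    also have "\<dots> = real n / 4096" using t3 by (simp add: power_divide)
    finally have "real (1024 * r ^ 3) \<le> real n" using n0 by simp
    then have r3: "1024 * r ^ 3 \<le> n" by (simp only: of_nat_le_iff)
    have "t / 32 \<le> real r" using r1(2) t4 by linarith
    then have "(t / 32) ^ 2 \<le> real r ^ 2" using t0 by (intro power_mono) auto
    then have "t ^ 2 / 1024 \<le> real r ^ 2" by (simp add: power_divide)
    then have a: "t ^ 2 / (128 * 1024) \<le> real n - E n" using upper[OF n2 r4 r3] by simp
    define m where "m = nat \<lceil>4 * t ^ 2\<rceil>"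
    have cl: "real m = of_int \<lceil>4 * t ^ 2\<rceil>" unfolding m_def using t0 by simp
    have m1: "4 * t ^ 2 \<le> real m" "real m \<le> 4 * t ^ 2 + 1" unfolding cl by linarith+
    have m0: "0 < m" using m1(1) t0 by (cases m) auto
    have "12 * (t ^ 3) ^ 2 \<le> 64 * (t ^ 3) ^ 2" by simp
    also have "\<dots> = (4 * t ^ 2) ^ 3" by (simp add: power_mult_distrib flip: power_mult)
    also have "\<dots> \<le> real m ^ 3" using m1(1) t0 by (intro power_mono) auto
    finally have "real (12 * n ^ 2) \<le> real (m ^ 3)" unfolding t3 by simp
    then have m3: "12 * n ^ 2 \<le> m ^ 3" by (simp only: of_nat_le_iff)
    have "real m \<le> 2 ^ m" by (rule of_nat_less_two_power[THEN less_imp_le])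
    then have "t ^ 2 \<le> 2 ^ m" using m1(1) t0 by (smt (verit) zero_le_power)
    moreover have "t ^ 3 \<le> t ^ 2 * t ^ 2" using t4 t0 by (simp add: power3_eq_cube power2_eq_square)
    ultimately have "real n \<le> t ^ 2 * 2 ^ m" using t3 t0 by (smt (verit) mult_left_mono zero_le_power)
    then have "real n / 2 ^ m \<le> t ^ 2" by (simp add: pos_divide_le_eq)
    then have b: "real n - E n \<le> 17 * t ^ 2 + 4" using lower[OF n2 m0 m3] m1(2) by linarith
    have "1 \<le> t ^ 2" using t4 by (simp add: one_le_power)
    then have "real n - E n \<le> 21 * t ^ 2" using b by linarith
    then show ?thesis using a unfolding t2 by simp
  qed
  have fE: "f n = real n - E n" if "8192 ^ 3 \<le> n" for n
  proof -
    have "0 \<le> real n powr (2 / 3) / (128 * 1024)" by simp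
    then have "0 \<le> real n - E n" using main[OF that] by linarith
    then show ?thesis unfolding f_def by simp
  qed
  have "f \<in> \<Theta>[at_top](\<lambda>n. real n powr (2 / 3))"
  proof (rule bigthetaI)
    show "f \<in> O[at_top](\<lambda>n. real n powr (2 / 3))"
    proof (rule bigoI[of _ 21], rule eventually_mono[OF big])
      fix n :: nat assume n: "8192 ^ 3 \<le> n"
      have "0 \<le> f n" unfolding f_def by simp
      then show "norm (f n) \<le> 21 * norm (real n powr (2 / 3))" using main[OF n] fE[OF n] by simp
    qed
    show "f \<in> \<Omega>[at_top](\<lambda>n. real n powr (2 / 3))"
    proof (rule landau_omega.bigI[of "1 / (128 * 1024)"])
      show "\<forall>\<^sub>F n in at_top. 1 / (128 * 1024) * norm (real n powr (2 / 3)) \<le> norm (f n)"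
      proof (rule eventually_mono[OF big])
        fix n :: nat assume n: "8192 ^ 3 \<le> n"
        have "0 \<le> f n" unfolding f_def by simp
        then show "1 / (128 * 1024) * norm (real n powr (2 / 3)) \<le> norm (f n)" using main[OF n] fE[OF n] by simp
      qed
    qed simp
  qed
  moreover have "\<forall>n. 0 \<le> f n" unfolding f_def by simp
  moreover have "\<forall>\<^sub>F n in at_top. E n = real n - f n"
  proof (rule eventually_mono[OF big])
    fix n :: nat assume "8192 ^ 3 \<le> n"
    then show "E n = real n - f n" using fE by simp
  qed
  ultimately show ?thesis unfolding E_def by blast
qed

end
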